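(* Let $\mathbb P_{\rho,n}$ be the law of $\frac{X_n-X_0}{\sqrt n}$ under $\mathbb P_\rho$, where $(X_n)_{n\ge 0}$ is the position process of a homogeneous open quantum random walk with finite-dimensional local space $\mathfrak h$, local channel $\mathfrak L$ and arbitrary diagonal initial state $\rho$. Let $\mathcal R=\bigoplus_{\alpha\in A}\chi_\alpha$ be the canonical decomposition of the fast recurrent space of $\mathfrak L$, let $a_\alpha(\rho)=\mathbb E_\rho[\mathrm{Tr}(A(\chi_\alpha)\rho_0)]=\sum_{\underline k\in V}\mathrm{Tr}(A(\chi_\alpha)\rho(\underline k))$, and let $m_\alpha\in\mathbb R^d$ and $D_\alpha$ be the mean vector and covariance matrix associated with $\chi_\alpha$ (defined in the context). Then $$\lim_{n\to+\infty}\mathrm{dist}\Big(\mathbb P_{\rho,n},\ \sum_{\alpha\in A}a_\alpha(\rho)\,\mathcal N(\sqrt n\,m_\alpha,D_\alpha)\Big)=0,$$ where $\mathrm{dist}$ is the Fortet–Mourier distance and $\mathcal N(\sqrt n\,m_\alpha,D_\alpha)$ is the (possibly degenerate) Gaussian measure on $\mathbb R^d$ with mean $\sqrt n\, m_\alpha$ and covariance matrix $D_\alpha$.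
   Context: **Walk.** $V\subset\mathbb R^d$ is a locally finite lattice containing $0$, positively generated by a finite set $S=\{s_1,\dots,s_v\}\neq\{0\}$. $\mathfrak h$ is a finite-dimensional complex Hilbert space, $B(\mathfrak h)$ its bounded operators, $L^1(\mathfrak h)$ its trace-class operators. $L_1,\dots,L_v\in B(\mathfrak h)$ satisfy $\sum_i L_i^*L_i=1_{\mathfrak h}$. The local channel is $\mathfrak L(\sigma)=\sum_{i=1}^v L_i\sigma L_i^*$ on $L^1(\mathfrak h)$, with dual $\mathfrak L^*(x)=\sum_i L_i^*xL_i$ on $B(\mathfrak h)$. The initial state is $\rho=\sum_{\underline k\in V}\rho(\underline k)\otimes|\underline k\rangle\langle\underline k|$ with $\rho(\underline k)\ge 0$ in $L^1(\mathfrak h)$ and $\sum_{\underline k}\mathrm{Tr}\,\rho(\underline k)=1$. **Position process.** Let $J=\{1,\dots,v\}$, $\Omega=V\times J^{\mathbb N}$ with the $\sigma$-algebra $\mathcal F$ generated by cylinder sets. $\mathbb P_\rho$ is the unique probability on $(\Omega,\mathcal F)$ with $\mathbb P_\rho(\{\underline k\}\times J^{\mathbb N})=\mathrm{Tr}\,\rho(\underline k)$ and $\mathbb P_\rho(\{(\underline k,j_1,\dots,j_n)\}\times J^{\mathbb N})=\mathrm{Tr}(L_{j_n}\cdots L_{j_1}\rho(\underline k)L_{j_1}^*\cdots L_{j_n}^* )$; $\mathbb E_\rho$ is its expectation. For $\omega=(\underline k,j_1,j_2,\dots)$: $X_0=\underline k$, $X_{n+1}=X_n+s_{j_{n+1}}$,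 and ($\mathbb P_\rho$-a.s.) $\rho_0=\rho(\underline k)/\mathrm{Tr}\,\rho(\underline k)$, $\rho_{n+1}=L_{j_{n+1}}\rho_nL_{j_{n+1}}^*/\mathrm{Tr}(L_{j_{n+1}}\rho_nL_{j_{n+1}}^* )$. **Enclosures.** A subspace $\mathcal V\subset\mathfrak h$ is an enclosure for $\mathfrak L$ if for every positive $\omega\in L^1(\mathfrak h)$, $\mathrm{supp}(\omega)\subset\mathcal V$ implies $\mathrm{supp}(\mathfrak L(\omega))\subset\mathcal V$ (support of a positive operator $=\ker^\perp$). A minimal enclosure is a nonzero enclosure containing no enclosures other than $\{0\}$ and itself; it is the support of a unique invariant state $\tau_0^{\mathcal V}$ of $\mathfrak L$. With $p_{\mathcal V}$ the orthogonal projection onto $\mathcal V$, the absorption operator is $A(\mathcal V)=\lim_{n\to\infty}\mathfrak L^{*n}(p_{\mathcal V})$. **Decomposition.** The fast recurrent space $\mathcal R$ is the supremum (span) of the supports of all invariant states of $\mathfrak L$; $\mathfrak h=\mathcal R\oplus\mathcal T$ with $\mathcal T=\mathcal R^\perp$ the transient space. There is a unique decomposition $\mathcal R=\bigoplus_{\alpha\in A}\chi_\alpha$ into finitely many mutually orthogonal nonzero enclosures, each minimal among nonzero enclosures $\chi$ with the property: every minimal enclosure $\mathcal W$ satisfies $\mathcal W\perp\chi$ or $\mathcal W\subset\chi$. **Parameters.** For any minimal enclosure $\mathcal V\subset\chi_\alpha$ let $m_\alpha=\sum_{i=1}^v\mathrm{Tr}(L_i\tau_0^{\mathcal V}L_i^*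 )\,s_i$. For $u\in\mathbb R^d$ let $\lambda_u$ be the spectral radius of $\sigma\mapsto\sum_i e^{u\cdot s_i}L_i\sigma L_i^*$ acting on $L^1(\mathcal V)\simeq p_{\mathcal V}L^1(\mathfrak h)p_{\mathcal V}$, and $\lambda'_u=\frac{d}{dt}\lambda_{tu}|_{t=0}$, $\lambda''_u=\frac{d^2}{dt^2}\lambda_{tu}|_{t=0}$. $D_\alpha$ is the symmetric matrix with $\langle u,D_\alpha u\rangle=\lambda''_u-(\lambda'_u)^2$ for all $u\in\mathbb R^d$. These do not depend on the choice of $\mathcal V\subset\chi_\alpha$. **Distance.** For probability measures $P,Q$ on $\mathbb R^d$, $\mathrm{dist}(P,Q)=\sup\{|\int f\,dP-\int f\,dQ|: \|f\|_{BL}\le1\}$, where $\|f\|_{BL}=\sup_x|f(x)|+\sup_{x\ne y}\frac{|f(x)-f(y)|}{|x-y|}$. *)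

theory Defs
  imports "HOL-Probability.Probability"
begin

text \<open>
  The local space is \<open>complex^'h\<close> with its Hilbert structure, and operators on it are the
  matrices \<open>complex^'h^'h\<close>; in finite dimension these are at once the bounded and the
  trace-class operators. Subspaces are complex ones (\<open>vec.subspace\<close>, \<open>vec.span\<close>). The library
  inner product on \<open>complex^'h\<close> is only the real part of the sesquilinear product \<open>cinner\<close>.
  The steps \<open>s\<close> and the Kraus operators \<open>L\<close> are indexed by a finite type \<open>'j\<close>, whose
  universe plays the role of \<open>J = {1,\<dots>,v}\<close>.
\<close>

section \<open>Operators on the local space\<close>

definition cinner :: "complex^'h \<Rightarrow> complex^'h \<Rightarrow> complex" where
  "cinner x y = (\<Sum>i\<in>UNIV. cnj (x $ i) * y $ i)"

definition adj :: "complex^'h^'h \<Rightarrow> complex^'h^'h" where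
  "adj M = (\<chi> i j. cnj (M $ j $ i))"

definition psd :: "complex^'h^'h \<Rightarrow> bool" where
  "psd M \<longleftrightarrow> (\<forall>x. cinner x (M *v x) \<in> \<real>\<^sub>\<ge>\<^sub>0)"

definition corthogonal :: "(complex^'h) set \<Rightarrow> (complex^'h) set \<Rightarrow> bool" where
  "corthogonal U W \<longleftrightarrow> (\<forall>x\<in>U. \<forall>y\<in>W. cinner x y = 0)"

definition ortho_compl :: "(complex^'h) set \<Rightarrow> (complex^'h) set" where
  "ortho_compl U = {y. \<forall>x\<in>U. cinner x y = 0}"

definition supp :: "complex^'h^'h \<Rightarrow> (complex^'h) set" where
  "supp M = ortho_compl {x. M *v x = 0}"

definition ortho_proj :: "(complex^'h) set \<Rightarrow> complex^'h^'h" where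
  "ortho_proj U = (THE p. p ** p = p \<and> adj p = p \<and> range ((*v) p) = U)"


section \<open>Local channel, enclosures, decomposition\<close>

definition channel :: "('j::finite \<Rightarrow> complex^'h^'h) \<Rightarrow> complex^'h^'h \<Rightarrow> complex^'h^'h" where
  "channel L \<sigma> = (\<Sum>i\<in>UNIV. L i ** \<sigma> ** adj (L i))"

definition dual_channel :: "('j::finite \<Rightarrow> complex^'h^'h) \<Rightarrow> complex^'h^'h \<Rightarrow> complex^'h^'h" where
  "dual_channel L x = (\<Sum>i\<in>UNIV. adj (L i) ** x ** L i)"

definition invariant_state :: "('j::finite \<Rightarrow> complex^'h^'h) \<Rightarrow> complex^'h^'h \<Rightarrow> bool" where
  "invariant_state L \<tau> \<longleftrightarrow> psd \<tau> \<and> trace \<tau> = 1 \<and> channel L \<tau> = \<tau>"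

definition enclosure :: "('j::finite \<Rightarrow> complex^'h^'h) \<Rightarrow> (complex^'h) set \<Rightarrow> bool" where
  "enclosure L U \<longleftrightarrow> vec.subspace U \<and>
     (\<forall>\<omega>. psd \<omega> \<longrightarrow> supp \<omega> \<subseteq> U \<longrightarrow> supp (channel L \<omega>) \<subseteq> U)"

definition minimal_enclosure :: "('j::finite \<Rightarrow> complex^'h^'h) \<Rightarrow> (complex^'h) set \<Rightarrow> bool" where
  "minimal_enclosure L U \<longleftrightarrow> enclosure L U \<and> U \<noteq> {0} \<and>
     (\<forall>W. enclosure L W \<longrightarrow> W \<subseteq> U \<longrightarrow> W = {0} \<or> W = U)"

definition enclosure_state :: "('j::finite \<Rightarrow> complex^'h^'h) \<Rightarrow> (complex^'h) set \<Rightarrow> complex^'h^'h" where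
  "enclosure_state L U = (THE \<tau>. invariant_state L \<tau> \<and> supp \<tau> = U)"

definition absorption :: "('j::finite \<Rightarrow> complex^'h^'h) \<Rightarrow> (complex^'h) set \<Rightarrow> complex^'h^'h" where
  "absorption L U = lim (\<lambda>n. (dual_channel L ^^ n) (ortho_proj U))"

definition fast_recurrent_space :: "('j::finite \<Rightarrow> complex^'h^'h) \<Rightarrow> (complex^'h) set" where
  "fast_recurrent_space L = vec.span (\<Union>{supp \<tau> |\<tau>. invariant_state L \<tau>})"

definition absorbs_or_orthogonal :: "('j::finite \<Rightarrow> complex^'h^'h) \<Rightarrow> (complex^'h) set \<Rightarrow> bool" where
  "absorbs_or_orthogonal L U \<longleftrightarrow>
     (\<forall>W. minimal_enclosure L W \<longrightarrow> corthogonal W U \<or> W \<subseteq> U)"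

definition chi_component :: "('j::finite \<Rightarrow> complex^'h^'h) \<Rightarrow> (complex^'h) set \<Rightarrow> bool" where
  "chi_component L U \<longleftrightarrow> enclosure L U \<and> U \<noteq> {0} \<and> absorbs_or_orthogonal L U \<and>
     (\<forall>W. enclosure L W \<and> W \<noteq> {0} \<and> absorbs_or_orthogonal L W \<and> W \<subseteq> U \<longrightarrow> W = U)"

text \<open>The set of subspaces \<open>\<chi>\<^sub>\<alpha>\<close>; the subspaces themselves serve as the indices \<open>\<alpha>\<close>.\<close>

definition canonical_decomposition :: "('j::finite \<Rightarrow> complex^'h^'h) \<Rightarrow> (complex^'h) set set" where
  "canonical_decomposition L = (THE C. finite C \<and> (\<forall>U\<in>C. chi_component L U) \<and>
     pairwise corthogonal C \<and> vec.span (\<Union>C) = fast_recurrent_space L)"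


section \<open>Mean vector and covariance matrix\<close>

definition enclosure_mean ::
    "('j::finite \<Rightarrow> real^'d) \<Rightarrow> ('j \<Rightarrow> complex^'h^'h) \<Rightarrow> (complex^'h) set \<Rightarrow> real^'d" where
  "enclosure_mean s L U =
     (\<Sum>i\<in>UNIV. Re (trace (L i ** enclosure_state L U ** adj (L i))) *\<^sub>R s i)"

definition tilted_channel ::
    "('j::finite \<Rightarrow> real^'d) \<Rightarrow> ('j \<Rightarrow> complex^'h^'h) \<Rightarrow> real^'d \<Rightarrow> complex^'h^'h \<Rightarrow> complex^'h^'h" where
  "tilted_channel s L u \<sigma> = (\<Sum>i\<in>UNIV. exp (u \<bullet> s i) *\<^sub>R (L i ** \<sigma> ** adj (L i)))"

definition compressed_ops :: "(complex^'h) set \<Rightarrow> (complex^'h^'h) set" where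
  "compressed_ops U = range (\<lambda>\<sigma>. ortho_proj U ** \<sigma> ** ortho_proj U)"

text \<open>Spectrum and spectral radius of a linear map \<open>T\<close> on a finite-dimensional space \<open>S\<close> of
  matrices; \<open>mat z ** \<sigma>\<close> is the scalar multiple \<open>z \<sigma>\<close>.\<close>

definition spectrum_on :: "(complex^'h^'h) set \<Rightarrow> (complex^'h^'h \<Rightarrow> complex^'h^'h) \<Rightarrow> complex set" where
  "spectrum_on S T = {z. \<not> bij_betw (\<lambda>\<sigma>. T \<sigma> - mat z ** \<sigma>) S S}"

definition spectral_radius_on :: "(complex^'h^'h) set \<Rightarrow> (complex^'h^'h \<Rightarrow> complex^'h^'h) \<Rightarrow> real" where
  "spectral_radius_on S T = Sup (cmod ` spectrum_on S T)"

definition tilted_radius ::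
    "('j::finite \<Rightarrow> real^'d) \<Rightarrow> ('j \<Rightarrow> complex^'h^'h) \<Rightarrow> (complex^'h) set \<Rightarrow> real^'d \<Rightarrow> real" where
  "tilted_radius s L U u = spectral_radius_on (compressed_ops U) (tilted_channel s L u)"

text \<open>The mean and covariance of \<open>\<chi>\<close> are the common values over all minimal enclosures
  \<open>U \<subseteq> \<chi>\<close>.\<close>

definition chi_mean ::
    "('j::finite \<Rightarrow> real^'d) \<Rightarrow> ('j \<Rightarrow> complex^'h^'h) \<Rightarrow> (complex^'h) set \<Rightarrow> real^'d" where
  "chi_mean s L X =
     (THE m. \<forall>U. minimal_enclosure L U \<and> U \<subseteq> X \<longrightarrow> m = enclosure_mean s L U)"

definition chi_cov ::
    "('j::finite \<Rightarrow> real^'d) \<Rightarrow> ('j \<Rightarrow> complex^'h^'h) \<Rightarrow> (complex^'h) set \<Rightarrow> real^'d^'d" where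
  "chi_cov s L X = (THE D. transpose D = D \<and>
     (\<forall>U. minimal_enclosure L U \<and> U \<subseteq> X \<longrightarrow>
       (\<forall>u. u \<bullet> (D *v u) =
          deriv (deriv (\<lambda>t. tilted_radius s L U (t *\<^sub>R u))) 0
          - (deriv (\<lambda>t. tilted_radius s L U (t *\<^sub>R u)) 0)\<^sup>2)))"


section \<open>Position process\<close>

text \<open>\<open>V\<close> is a locally finite additive subgroup, and consists exactly of the finite sums of
  elements of \<open>S\<close>.\<close>

definition generated_lattice :: "(real^'d) set \<Rightarrow> (real^'d) set \<Rightarrow> bool" where
  "generated_lattice V S \<longleftrightarrow> 0 \<in> V \<and> (\<forall>x\<in>V. \<forall>y\<in>V. x - y \<in> V) \<and>
     (\<forall>B. bounded B \<longrightarrow> finite (V \<inter> B)) \<and> V = {sum_list xs |xs. set xs \<subseteq> S}"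

text \<open>The block \<open>\<rho> k\<close> of the diagonal state is only relevant for \<open>k \<in> V\<close>.\<close>

definition diagonal_state :: "(real^'d) set \<Rightarrow> (real^'d \<Rightarrow> complex^'h^'h) \<Rightarrow> bool" where
  "diagonal_state V \<rho> \<longleftrightarrow> (\<forall>k\<in>V. psd (\<rho> k)) \<and> ((\<lambda>k. Re (trace (\<rho> k))) has_sum 1) V"

text \<open>\<open>\<Omega> = V \<times> J\<^sup>\<nat>\<close> with the cylinder \<open>\<sigma>\<close>-algebra; the step \<open>j\<^sub>n\<^sub>+\<^sub>1\<close> of a path
  \<open>\<omega> = (k, j\<^sub>1, j\<^sub>2, \<dots>)\<close> is \<open>snd \<omega> n\<close>.\<close>

definition path_space :: "(real^'d) set \<Rightarrow> ((real^'d) \<times> (nat \<Rightarrow> 'j::finite)) measure" where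
  "path_space V = count_space V \<Otimes>\<^sub>M (\<Pi>\<^sub>M n\<in>UNIV. count_space UNIV)"

text \<open>\<open>word_op L [j\<^sub>1, \<dots>, j\<^sub>n] = L\<^bsub>j\<^sub>n\<^esub> \<cdots> L\<^bsub>j\<^sub>1\<^esub>\<close>\<close>

definition word_op :: "('j \<Rightarrow> complex^'h^'h) \<Rightarrow> 'j list \<Rightarrow> complex^'h^'h" where
  "word_op L js = foldl (\<lambda>M j. L j ** M) (mat 1) js"

text \<open>The empty word gives the prescribed law of \<open>X\<^sub>0\<close>.\<close>

definition walk_measure ::
    "(real^'d) set \<Rightarrow> ('j::finite \<Rightarrow> complex^'h^'h) \<Rightarrow> (real^'d \<Rightarrow> complex^'h^'h)
      \<Rightarrow> ((real^'d) \<times> (nat \<Rightarrow> 'j)) measure" where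
  "walk_measure V L \<rho> = (THE P. prob_space P \<and> sets P = sets (path_space V) \<and>
     (\<forall>k\<in>V. \<forall>js.
        measure P {\<omega> \<in> space (path_space V). fst \<omega> = k \<and> (\<forall>i<length js. snd \<omega> i = js ! i)}
        = Re (trace (word_op L js ** \<rho> k ** adj (word_op L js)))))"

primrec position :: "('j \<Rightarrow> real^'d) \<Rightarrow> nat \<Rightarrow> (real^'d) \<times> (nat \<Rightarrow> 'j) \<Rightarrow> real^'d" where
  "position s 0 \<omega> = fst \<omega>"
| "position s (Suc n) \<omega> = position s n \<omega> + s (snd \<omega> n)"

definition initial_local_state ::
    "(real^'d \<Rightarrow> complex^'h^'h) \<Rightarrow> (real^'d) \<times> (nat \<Rightarrow> 'j) \<Rightarrow> complex^'h^'h" where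
  "initial_local_state \<rho> \<omega> = (1 / Re (trace (\<rho> (fst \<omega>)))) *\<^sub>R \<rho> (fst \<omega>)"

definition absorption_weight ::
    "(real^'d) set \<Rightarrow> ('j::finite \<Rightarrow> complex^'h^'h) \<Rightarrow> (real^'d \<Rightarrow> complex^'h^'h)
      \<Rightarrow> (complex^'h) set \<Rightarrow> real" where
  "absorption_weight V L \<rho> U =
     (\<integral>\<omega>. Re (trace (absorption L U ** initial_local_state \<rho> \<omega>)) \<partial>walk_measure V L \<rho>)"


section \<open>Gaussian mixtures and the Fortet--Mourier distance\<close>

definition std_gaussian :: "(real^'d) measure" where
  "std_gaussian = density lborel (\<lambda>x. ennreal (\<Prod>i\<in>UNIV. std_normal_density (x $ i)))"

text \<open>Possibly degenerate: the law of \<open>m + B Z\<close> with \<open>Z\<close> standard Gaussian and \<open>B B\<^sup>T = D\<close>,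
  which does not depend on the choice of \<open>B\<close>.\<close>

definition gaussian :: "real^'d \<Rightarrow> real^'d^'d \<Rightarrow> (real^'d) measure" where
  "gaussian m D =
     distr std_gaussian borel (\<lambda>x. m + (SOME B :: real^'d^'d. B ** transpose B = D) *v x)"

definition mixture :: "'i set \<Rightarrow> ('i \<Rightarrow> real) \<Rightarrow> ('i \<Rightarrow> (real^'d) measure) \<Rightarrow> (real^'d) measure" where
  "mixture I a N = measure_of UNIV (sets borel) (\<lambda>B. \<Sum>i\<in>I. ennreal (a i) * emeasure (N i) B)"

definition bl_norm :: "(real^'d \<Rightarrow> real) \<Rightarrow> ennreal" where
  "bl_norm f = (SUP x. ennreal \<bar>f x\<bar>) +
     (SUP (x, y) \<in> {(x, y). x \<noteq> y}. ennreal (\<bar>f x - f y\<bar> / norm (x - y)))"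

definition fortet_mourier :: "(real^'d) measure \<Rightarrow> (real^'d) measure \<Rightarrow> real" where
  "fortet_mourier P Q = (SUP f \<in> {f. bl_norm f \<le> 1}. \<bar>(\<integral>x. f x \<partial>P) - (\<integral>x. f x \<partial>Q)\<bar>)"

definition rescaled_law ::
    "(real^'d) set \<Rightarrow> ('j::finite \<Rightarrow> real^'d) \<Rightarrow> ('j \<Rightarrow> complex^'h^'h) \<Rightarrow> (real^'d \<Rightarrow> complex^'h^'h)
      \<Rightarrow> nat \<Rightarrow> (real^'d) measure" where
  "rescaled_law V s L \<rho> n =
     distr (walk_measure V L \<rho>) borel
       (\<lambda>\<omega>. (1 / sqrt (real n)) *\<^sub>R (position s n \<omega> - position s 0 \<omega>))"

end

theory Submission
  imports Defs
begin

text \<open>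
  Conditioning on absorption in \<open>\<chi>\<close> amounts to inserting \<open>A(\<chi>)\<close> under the trace, and
  \<open>\<Sum>\<^sub>\<alpha> A(\<chi>\<^sub>\<alpha>) = 1\<close>; so it suffices to study, for each \<open>\<chi>\<close>, the finite measure giving the word
  \<open>w\<close> the mass \<open>Tr(L\<^sub>w \<rho> L\<^sub>w\<^sup>* A(\<chi>))\<close>, where \<open>\<rho>\<close> is the sum of the blocks of the initial state.
  Its characteristic function is an iterate of the phase-tilted dual channel applied to \<open>A(\<chi>)\<close>.
  The Poisson equations \<open>B - \<LL>\<^sup>*(B) = \<dots>\<close> and \<open>C - \<LL>\<^sup>*(C) = \<dots>\<close> are solvable because all minimal
  enclosures inside \<open>\<chi>\<close> are unitarily equivalent and hence share mean and variance; they correct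
  \<open>A(\<chi>)\<close> to an approximate eigenvector \<open>A + i\<epsilon>B + \<epsilon>\<^sup>2C\<close> of that tilted channel with eigenvalue
  \<open>1 - q\<epsilon>\<^sup>2/2\<close>, which at \<open>\<epsilon> = n\<^sup>-\<^sup>1\<^sup>/\<^sup>2\<close> gives the Gaussian limit. Perturbation of the
  Perron--Frobenius eigenvector identifies \<open>q\<close> with \<open>\<lambda>'' - \<lambda>'\<^sup>2\<close>. As the centring
  \<open>\<surd>n m\<close> moves with \<open>n\<close>, pointwise convergence of characteristic functions is upgraded to
  convergence uniformly over the bounded Lipschitz ball, which is translation invariant.
\<close>

text \<open>The channel may be periodic, so its powers need not converge and there is no spectral
  gap. The substitute is \<open>fixed_point_decomposition\<close>: a linear map with bounded orbits
  splits the space into its fixed points and the range of \<open>1 - T\<close>. Hence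
  \<open>B - T' B = Y\<close> is solvable as soon as all invariant states annihilate
  \<open>Y\<close>, and by \<open>psd_fixed_induct\<close> only the states of minimal enclosures
  have to be tested. The equation for \<open>C\<close> must also be tested on minimal enclosures
  outside \<chi>; it passes because \<open>B\<close> is normalised to be annihilated by the
  invariant states, which makes its compression to such an enclosure vanish. Several objects are
  definite descriptions, so existence is part of the work: the walk measure comes from the
  Ionescu-Tulcea theorem, and a covariance matrix from solving the Poisson equation coordinate by
  coordinate. Its positivity follows from characteristic functions being bounded by 1. The initial
  state enters only through the sum of its blocks because X_n - X_0 does not see the starting
  site.\<close>

section \<open>Matrices as operators\<close>

lemmas scaleR_complex = scaleR_conv_of_real[where 'a = complex]

lemma bounded_bilinear_matrix_mult:
  "bounded_bilinear ((**) :: complex^'h^'h \<Rightarrow> complex^'h^'h \<Rightarrow> complex^'h^'h)"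
  unfolding bilinear_conv_bounded_bilinear[symmetric] bilinear_def
  by (auto simp: linear_iff scaleR_complex vec_eq_iff
      matrix_matrix_mult_def sum.distrib sum_distrib_left algebra_simps)

interpretation mm: bounded_bilinear "(**) :: complex^'h^'h \<Rightarrow> complex^'h^'h \<Rightarrow> complex^'h^'h"
  by (rule bounded_bilinear_matrix_mult)

lemma bounded_bilinear_matrix_vector_mult:
  "bounded_bilinear ((*v) :: complex^'h^'h \<Rightarrow> complex^'h \<Rightarrow> complex^'h)"
  unfolding bilinear_conv_bounded_bilinear[symmetric] bilinear_def
  by (auto simp: linear_iff scaleR_complex vec_eq_iff sum.distrib
      matrix_vector_mult_def sum_distrib_left algebra_simps)

interpretation mv: bounded_bilinear "(*v) :: complex^'h^'h \<Rightarrow> complex^'h \<Rightarrow> complex^'h"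
  by (rule bounded_bilinear_matrix_vector_mult)

lemma bounded_bilinear_cinner: "bounded_bilinear (cinner :: complex^'h \<Rightarrow> complex^'h \<Rightarrow> complex)"
  unfolding bilinear_conv_bounded_bilinear[symmetric] bilinear_def
  by (auto simp: linear_iff cinner_def sum.distrib scaleR_complex sum_distrib_left algebra_simps)

interpretation ci: bounded_bilinear "cinner :: complex^'h \<Rightarrow> complex^'h \<Rightarrow> complex"
  by (rule bounded_bilinear_cinner)

lemma linear_adj: "linear (adj :: complex^'h^'h \<Rightarrow> complex^'h^'h)"
  unfolding linear_iff by (auto simp: adj_def vec_eq_iff)

lemmas adj_sum = linear_sum[OF linear_adj] and adj_add = linear_add[OF linear_adj]
  and adj_diff = linear_diff[OF linear_adj] and adj_scaleR = linear_scale[OF linear_adj]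
  and adj_zero = linear_0[OF linear_adj]

lemma linear_trace: "linear (trace :: complex^'h^'h \<Rightarrow> complex)"
  unfolding linear_iff by (auto simp: trace_def sum.distrib scaleR_sum_right)

lemmas tr_sum = linear_sum[OF linear_trace] and tr_add = linear_add[OF linear_trace]
  and tr_diff = linear_diff[OF linear_trace] and tr_scaleR = linear_scale[OF linear_trace]
  and tr_zero = linear_0[OF linear_trace]

lemma adj_adj [simp]: "adj (adj M) = M"
  by (simp add: adj_def vec_eq_iff)

lemma adj_mult: "adj (A ** B) = adj B ** adj A"
  by (simp add: adj_def vec_eq_iff matrix_matrix_mult_def mult.commute)

lemma adj_mat [simp]: "adj (mat c) = mat (cnj c)"
  by (simp add: adj_def vec_eq_iff mat_def)

lemma trace_adj: "trace (adj A) = cnj (trace A)"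
  by (simp add: trace_def adj_def)

lemma cinner_commute: "cinner y x = cnj (cinner x y)"
  by (simp add: cinner_def mult.commute)

lemma cinner_smult_left: "cinner (c *s x) y = cnj c * cinner x y"
  by (simp add: cinner_def sum_distrib_left algebra_simps)

lemma cinner_smult_right: "cinner x (c *s y) = c * cinner x y"
  by (simp add: cinner_def sum_distrib_left algebra_simps)

lemma Re_cinner: "Re (cinner x y) = x \<bullet> y"
  by (simp add: cinner_def inner_vec_def inner_complex_def)

lemma cinner_self: "cinner x x = of_real ((norm x)\<^sup>2)"
  by (rule complex_eqI)
    (simp_all add: Re_cinner power2_norm_eq_inner, simp add: cinner_def algebra_simps)

lemma cinner_self_eq_0: "cinner x x = 0 \<longleftrightarrow> x = 0"
  by (simp add: cinner_self)

lemma cinner_adj: "cinner (A *v x) y = cinner x (adj A *v y)"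
proof -
  have "cinner (A *v x) y = (\<Sum>i\<in>UNIV. \<Sum>j\<in>UNIV. cnj (A $ i $ j) * cnj (x $ j) * y $ i)"
    by (simp add: cinner_def matrix_vector_mult_def sum_distrib_right)
  also have "\<dots> = (\<Sum>j\<in>UNIV. \<Sum>i\<in>UNIV. cnj (A $ i $ j) * cnj (x $ j) * y $ i)"
    by (rule sum.swap)
  also have "\<dots> = cinner x (adj A *v y)"
    by (simp add: cinner_def matrix_vector_mult_def adj_def sum_distrib_left mult_ac)
  finally show ?thesis .
qed

lemma cinner_adj': "cinner (adj A *v x) y = cinner x (A *v y)"
  using cinner_adj[of "adj A"] by simp

lemma cinner_ext: "(\<And>y. cinner y x = cinner y z) \<Longrightarrow> x = z"
  using cinner_self_eq_0[of "x - z"] by (simp add: ci.diff_right)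

lemma matrix_ext: "(\<And>x. A *v x = B *v x) \<Longrightarrow> A = B"
  by (simp add: matrix_eq)

lemma mat_mult_left: "mat c ** (A :: complex^'h^'h) = (\<chi> i j. c * A $ i $ j)"
  by (simp add: vec_eq_iff matrix_matrix_mult_def mat_def if_distrib[of "\<lambda>z. z * _"] cong: if_cong)

lemma mat_mult_commute: "(A :: complex^'h^'h) ** mat c = mat c ** A"
  by (simp add: mat_mult_left)
    (simp add: vec_eq_iff matrix_matrix_mult_def mat_def if_distrib[of "\<lambda>z. _ * z"] mult.commute
      cong: if_cong)

lemma mat_of_real_mult: "mat (of_real r) ** (A :: complex^'h^'h) = r *\<^sub>R A"
  by (simp add: mat_mult_left vec_eq_iff scaleR_complex)

lemma trace_mat_mult: "trace (mat c ** (A :: complex^'h^'h)) = c * trace A"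
  by (simp add: mat_mult_left trace_def sum_distrib_left)

lemma inner_matrix_eq: "(X :: complex^'h^'h) \<bullet> Y = Re (trace (adj X ** Y))"
proof -
  have "Re (trace (adj X ** Y)) = (\<Sum>i\<in>UNIV. \<Sum>j\<in>UNIV. Re (cnj (X $ j $ i) * Y $ j $ i))"
    by (simp add: trace_def adj_def matrix_matrix_mult_def)
  also have "\<dots> = (\<Sum>j\<in>UNIV. \<Sum>i\<in>UNIV. Re (cnj (X $ j $ i) * Y $ j $ i))"
    by (rule sum.swap)
  finally show ?thesis
    by (simp add: inner_vec_def inner_complex_def)
qed

text \<open>The rank-one operator |x><y|. It is antilinear in \<open>y\<close>, so that
  \<open>outer x x\<close> is positive.\<close>

definition outer :: "complex^'h \<Rightarrow> complex^'h \<Rightarrow> complex^'h^'h" where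
  "outer x y = (\<chi> i j. x $ i * cnj (y $ j))"

lemma outer_mult_vec: "outer x y *v z = cinner y z *s x"
  by (simp add: vec_eq_iff outer_def matrix_vector_mult_def cinner_def sum_distrib_left sum_distrib_right mult_ac)

lemma adj_outer: "adj (outer x y) = outer y x"
  by (simp add: vec_eq_iff outer_def adj_def)

lemma mult_outer: "A ** outer x y = outer (A *v x) y"
  by (rule matrix_ext) (simp add: matrix_vector_mul_assoc[symmetric] outer_mult_vec vector_scalar_commute)

lemma outer_mult: "outer x y ** A = outer x (adj A *v y)"
  by (rule matrix_ext) (simp add: matrix_vector_mul_assoc[symmetric] outer_mult_vec cinner_adj')

lemma trace_outer: "trace (outer x y) = cinner y x"
  by (simp add: trace_def outer_def cinner_def mult.commute)

lemma trace_outer_mult: "trace (outer x y ** A) = cinner y (A *v x)"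
  by (simp add: outer_mult trace_outer cinner_adj')

section \<open>Positive semidefinite matrices\<close>

lemma psd_iff: "psd M \<longleftrightarrow> (\<forall>x. Im (cinner x (M *v x)) = 0 \<and> 0 \<le> Re (cinner x (M *v x)))"
  by (auto simp: psd_def complex_nonneg_Reals_iff)

lemma psd_Im: "psd M \<Longrightarrow> Im (cinner x (M *v x)) = 0"
  and psd_Re: "psd M \<Longrightarrow> 0 \<le> Re (cinner x (M *v x))"
  by (auto simp: psd_iff)

text \<open>Over the complex field polarisation recovers the whole sesquilinear form: testing at
  \<open>x + y\<close> gives the sum of the two cross terms, and replacing \<open>y\<close> by
  \<open>i y\<close> gives their difference.\<close>

lemma quadratic_form_zero:
  assumes "\<And>x. cinner x (N *v x) = 0"
  shows "N = 0"
proof (rule matrix_ext, rule cinner_ext)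
  fix y x
  have 1: "cinner x (N *v y) + cinner y (N *v x) = 0" for x y
    using assms[of "x + y"] assms[of x] assms[of y]
    by (simp add: mv.add_right ci.add_left ci.add_right add.commute)
  have "cinner x (N *v (\<i> *s y)) + cinner (\<i> *s y) (N *v x) = 0" for x y
    by (rule 1)
  then have 2: "cinner x (N *v y) - cinner y (N *v x) = 0" for x y
    by (simp add: vector_scalar_commute cinner_smult_left cinner_smult_right flip: right_diff_distrib)
  have "cinner x (N *v y) = 0" for x y
  proof -
    have "2 * cinner x (N *v y) = 0" using 1[of x y] 2[of x y] by simp
    then show ?thesis by simp
  qed
  then show "cinner y (N *v x) = cinner y (0 *v x)"
    by (simp add: ci.zero_right)
qed

lemma hermitian_iff: "adj M = M \<longleftrightarrow> (\<forall>x. Im (cinner x (M *v x)) = 0)"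
proof
  assume "adj M = M"
  then have "cinner x (M *v x) = cnj (cinner x (M *v x))" for x
    using cinner_adj[of M x x] cinner_commute[of "M *v x" x] by simp
  then show "\<forall>x. Im (cinner x (M *v x)) = 0"
    by (auto simp: complex_eq_iff)
next
  assume *: "\<forall>x. Im (cinner x (M *v x)) = 0"
  have "cinner x ((adj M - M) *v x) = 0" for x
  proof -
    have "cinner x (adj M *v x) = cnj (cinner x (M *v x))"
      using cinner_adj[of M x x] cinner_commute[of "M *v x" x] by simp
    also have "\<dots> = cinner x (M *v x)"
      using * by (simp add: complex_eq_iff)
    finally show ?thesis
      by (simp add: mv.diff_left ci.diff_right)
  qed
  then have "adj M - M = 0" by (rule quadratic_form_zero)
  then show "adj M = M" by simp
qed

lemma psd_adj: "psd M \<Longrightarrow> adj M = M"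
  by (simp add: hermitian_iff psd_iff)

lemma psd_iff_hermitian: "psd M \<longleftrightarrow> adj M = M \<and> (\<forall>x. 0 \<le> Re (cinner x (M *v x)))"
  by (auto simp: hermitian_iff psd_iff)

lemma psd_0 [simp]: "psd 0"
  by (simp add: psd_iff ci.zero_right)

lemma psd_add: "psd A \<Longrightarrow> psd B \<Longrightarrow> psd (A + B)"
  by (simp add: psd_iff mv.add_left ci.add_right)

lemma psd_scaleR: "psd A \<Longrightarrow> 0 \<le> c \<Longrightarrow> psd (c *\<^sub>R A)"
  by (simp add: psd_iff mv.scaleR_left ci.scaleR_right)

lemma psd_sum: "(\<And>i. i \<in> I \<Longrightarrow> psd (f i)) \<Longrightarrow> psd (\<Sum>i\<in>I. f i)"
  by (induction I rule: infinite_finite_induct) (auto intro: psd_add)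

lemma psd_conj: "psd M \<Longrightarrow> psd (A ** M ** adj A)"
  by (simp add: psd_iff matrix_vector_mul_assoc[symmetric] cinner_adj'[of A, symmetric])

lemma psd_mat_1 [simp]: "psd (mat 1)"
  by (simp add: psd_iff cinner_self)

lemma psd_outer: "psd (outer x x)"
proof -
  have "cinner y (outer x x *v y) = of_real ((cmod (cinner x y))\<^sup>2)" for y
    by (subst complex_norm_square) (simp add: outer_mult_vec cinner_smult_right cinner_commute[of y x])
  then show ?thesis by (simp add: psd_iff)
qed

lemma closed_psd: "closed {M. psd M}"
proof -
  have "closed {M :: complex^'a^'a. Im (cinner x (M *v x)) = 0 \<and> 0 \<le> Re (cinner x (M *v x))}" for x
  proof (rule closed_Collect_conj)
    have *: "continuous_on UNIV (\<lambda>M :: complex^'a^'a. cinner x (M *v x))"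
      by (intro continuous_intros ci.continuous_on mv.continuous_on)
    show "closed {M :: complex^'a^'a. Im (cinner x (M *v x)) = 0}"
      by (intro closed_Collect_eq continuous_intros *)
    show "closed {M :: complex^'a^'a. 0 \<le> Re (cinner x (M *v x))}"
      by (intro closed_Collect_le continuous_intros *)
  qed
  then have "closed (\<Inter>x. {M :: complex^'a^'a. Im (cinner x (M *v x)) = 0 \<and> 0 \<le> Re (cinner x (M *v x))})"
    by blast
  also have "\<dots> = {M. psd M}" by (auto simp: psd_iff)
  finally show ?thesis .
qed

lemma psd_limit: "(\<And>n. psd (f n)) \<Longrightarrow> f \<longlonglongrightarrow> M \<Longrightarrow> psd M"
  using closed_sequentially[OF closed_psd, of f M] by auto

text \<open>Moving from \<open>x\<close> by \<open>-e z\<close> with \<open>z = M x\<close> changes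
  the form by \<open>-2 e |z|^2 + O(e^2)\<close>, which would be negative for small
  \<open>e > 0\<close> unless \<open>z = 0\<close>.\<close>

lemma psd_kernel:
  assumes "psd M" "cinner x (M *v x) = 0"
  shows "M *v x = 0"
proof -
  define z where "z = M *v x"
  have adjM: "adj M = M" by (rule psd_adj[OF assms(1)])
  have zz: "cinner x (M *v z) = cinner z z"
    using cinner_adj[of M x z] by (simp add: adjM z_def)
  have *: "0 \<le> - 2 * e * (norm z)\<^sup>2 + e\<^sup>2 * Re (cinner z (M *v z))" for e :: real
  proof -
    have "cinner (x - e *\<^sub>R z) (M *v (x - e *\<^sub>R z)) =
        cinner x (M *v x) - e *\<^sub>R cinner x (M *v z) - e *\<^sub>R cinner z z + (e*e) *\<^sub>R cinner z (M *v z)"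
      by (simp add: mv.diff_right mv.scaleR_right ci.diff_left ci.diff_right ci.scaleR_left
          ci.scaleR_right z_def algebra_simps)
    also have "Re \<dots> = - 2 * e * (norm z)\<^sup>2 + e\<^sup>2 * Re (cinner z (M *v z))"
      by (simp add: zz assms cinner_self power2_eq_square)
    finally show ?thesis using psd_Re[OF assms(1)] by metis
  qed
  define c where "c = Re (cinner z (M *v z))"
  have c: "c \<ge> 0" unfolding c_def by (rule psd_Re[OF assms(1)])
  have "(norm z)\<^sup>2 \<le> 0"
  proof -
    have "0 \<le> - 2 * (1/(c+1)) * (norm z)\<^sup>2 + (1/(c+1))\<^sup>2 * ((norm z)\<^sup>2 * 0 + c)" 
      using *[of "1/(c+1)"] by (simp add: c_def)
    have "2 * (norm z)\<^sup>2 \<le> e * c" if "e > 0" for e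
    proof -
      have "e * (2 * (norm z)\<^sup>2) \<le> e * (e * c)"
        using *[of e] by (simp add: c_def power2_eq_square algebra_simps)
      with that show ?thesis by simp
    qed
    then have "2 * (norm z)\<^sup>2 \<le> 0 + d" if "d > 0" for d
    proof -
      assume *: "\<And>e. 0 < e \<Longrightarrow> 2 * (norm z)\<^sup>2 \<le> e * c"
      have "d / (c + 1) * c \<le> d" using that c by (simp add: field_simps)
      with *[of "d / (c+1)"] that c show ?thesis by simp
    qed
    then show ?thesis using field_le_epsilon[of "2 * (norm z)\<^sup>2" 0] by simp
  qed
  then show ?thesis by (simp add: z_def)
qed

lemma psd_kernel_iff: "psd M \<Longrightarrow> M *v x = 0 \<longleftrightarrow> Re (cinner x (M *v x)) = 0"
  using psd_kernel[of M x] psd_Im[of M x] by (auto simp: complex_eq_iff ci.zero_right)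

lemma mult_axis: "((M :: complex^'h^'h) *v axis i 1) $ j = M $ j $ i"
  by (simp add: matrix_vector_mult_def axis_def if_distrib[of "\<lambda>z. _ * z"] cong: if_cong)

lemma cinner_axis: "cinner (axis i 1) x = x $ i"
  by (simp add: cinner_def axis_def if_distrib[of "\<lambda>z. z * _"] if_distrib[of cnj] cong: if_cong)

lemma matrix_zeroI: "(\<And>i. (M :: complex^'h^'h) *v axis i 1 = 0) \<Longrightarrow> M = 0"
  by (simp add: vec_eq_iff mult_axis)

text \<open>Symmetric Gaussian elimination: subtracting \<open>v v\<^sup>*\<close> with \<open>v\<close> the normalised \<open>i\<close>-th column
  keeps the matrix positive and clears that column.\<close>
lemma psd_decomposition_aux:
  assumes "finite I" "psd M" "\<And>i. i \<notin> I \<Longrightarrow> M *v axis i 1 = 0"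
  shows "\<exists>v. M = (\<Sum>i\<in>I. outer (v i) (v i))"
  using assms
proof (induction I arbitrary: M)
  case empty
  then have "M = 0" by (intro matrix_zeroI) auto
  then show ?case by simp
next
  case (insert k I)
  show ?case
  proof (cases "M *v axis k 1 = 0")
    case True
    with insert.prems have "\<exists>v. M = (\<Sum>i\<in>I. outer (v i) (v i))"
      by (intro insert.IH) (auto, metis)
    then obtain v where v: "M = (\<Sum>i\<in>I. outer (v i) (v i))" ..
    have "outer 0 0 = (0 :: complex^'a^'a)" by (simp add: vec_eq_iff outer_def)
    then have "M = (\<Sum>i\<in>insert k I. outer ((v(k:=0)) i) ((v(k:=0)) i))"
      using insert.hyps by (simp add: v) (rule sum.cong, auto)
    then show ?thesis by blast
  next
    case False
    define e :: "complex^'a" where "e = axis k 1"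
    define a where "a = Re (cinner e (M *v e))"
    have adjM: "adj M = M" by (rule psd_adj[OF insert.prems(1)])
    have "a \<noteq> 0" using False psd_kernel_iff[OF insert.prems(1), of e] by (simp add: a_def e_def)
    then have a: "a > 0" using psd_Re[OF insert.prems(1), of e] by (simp add: a_def)
    have aM: "cinner e (M *v e) = of_real a"
      using psd_Im[OF insert.prems(1)] by (simp add: a_def complex_eq_iff)
    define w where "w = (1 / sqrt a) *\<^sub>R (M *v e)"
    have we: "cinner w x = (1 / sqrt a) *\<^sub>R cinner e (M *v x)" for x
      using cinner_adj[of M e x] by (simp add: w_def ci.scaleR_left adjM)
    define M' where "M' = M - outer w w"
    have M'v: "M' *v x = M *v x - ((1/a) *\<^sub>R cinner e (M *v x)) *s (M *v e)" for x
    proof -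
      have "cinner w x *s w = ((1/a) *\<^sub>R cinner e (M *v x)) *s (M *v e)"
        using a unfolding we by (simp add: w_def vec_eq_iff scaleR_complex field_simps flip: of_real_mult)
      then show ?thesis by (simp add: M'_def mv.diff_left outer_mult_vec)
    qed
    have "psd M'"
      unfolding psd_def
    proof
      fix x
      \<comment> \<open>With this \<open>c\<close> the vector \<open>z\<close> below is
        \<open>M\<close>-orthogonal to \<open>e\<close>, and the form of \<open>M'\<close> at
        \<open>x\<close> becomes the form of \<open>M\<close> at \<open>z\<close>: completing the
        square.\<close>
      define c where "c = (1/a) *\<^sub>R cinner e (M *v x)"
      define z where "z = x - c *s e"
      have ex: "cinner x (M *v e) = of_real a * cnj c"
        using a cinner_commute[of x "M *v e"] cinner_adj[of M e x] by (simp add: c_def adjM scaleR_complex)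
      have ex': "cinner e (M *v x) = of_real a * c"
        using a by (simp add: c_def scaleR_complex)
      have "cinner z (M *v z) = cinner x (M *v x) - c * cinner x (M *v e)
          - cnj c * cinner e (M *v x) + cnj c * c * cinner e (M *v e)"
        by (simp add: z_def mv.diff_right ci.diff_left ci.diff_right vector_scalar_commute
            cinner_smult_left cinner_smult_right algebra_simps)
      also have "\<dots> = cinner x (M *v x) - c * cinner x (M *v e)"
        by (simp add: ex ex' aM)
      also have "\<dots> = cinner x (M' *v x)"
        by (simp add: M'v c_def ci.diff_right cinner_smult_right)
      finally have zx: "cinner z (M *v z) = cinner x (M' *v x)" .
      show "cinner x (M' *v x) \<in> \<real>\<^sub>\<ge>\<^sub>0"
        using insert.prems(1)[unfolded psd_def, THEN spec, of z] unfolding zx .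
    qed
    moreover have "M' *v axis i 1 = 0" if "i \<notin> I" for i
    proof (cases "i = k")
      case True
      have "M' *v e = 0" using a by (simp add: M'v aM scaleR_complex)
      with True show ?thesis by (simp add: e_def)
    next
      case False
      with that insert.prems(2)[of i] have "M *v axis i 1 = 0" by simp
      then show ?thesis by (simp add: M'v ci.zero_right)
    qed
    ultimately obtain v where v: "M' = (\<Sum>i\<in>I. outer (v i) (v i))"
      using insert.IH by blast
    have "M = (\<Sum>i\<in>insert k I. outer ((v(k:=w)) i) ((v(k:=w)) i))"
    proof -
      have "(\<Sum>i\<in>insert k I. outer ((v(k:=w)) i) ((v(k:=w)) i)) =
          outer w w + (\<Sum>i\<in>I. outer ((v(k:=w)) i) ((v(k:=w)) i))"
        using insert.hyps by simp
      also have "(\<Sum>i\<in>I. outer ((v(k:=w)) i) ((v(k:=w)) i)) = (\<Sum>i\<in>I. outer (v i) (v i))"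
        using insert.hyps by (intro sum.cong) auto
      also have "outer w w + \<dots> = M" by (simp add: v[symmetric] M'_def)
      finally show ?thesis by simp
    qed
    then show ?thesis by blast
  qed
qed

lemma psd_decomposition:
  assumes "psd M"
  obtains v :: "'h \<Rightarrow> complex^'h" where "M = (\<Sum>i\<in>UNIV. outer (v i) (v i))"
proof -
  have "\<exists>v :: 'h \<Rightarrow> complex^'h. M = (\<Sum>i\<in>UNIV. outer (v i) (v i))"
    by (rule psd_decomposition_aux[OF finite assms]) simp
  then show ?thesis using that by blast
qed

section \<open>Trace inequalities for positive matrices\<close>

lemma trace_psd_mult:
  assumes "psd (M :: complex^'h^'h)" "psd N"
  shows "Im (trace (M ** N)) = 0" "0 \<le> Re (trace (M ** N))"
proof -
  obtain v :: "'h \<Rightarrow> complex^'h" where v: "M = (\<Sum>i\<in>UNIV. outer (v i) (v i))"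
    using psd_decomposition[OF assms(1)] by blast
  have "trace (M ** N) = (\<Sum>i\<in>UNIV. cinner (v i) (N *v v i))"
    by (simp add: v mm.sum_left tr_sum trace_outer_mult)
  then show "Im (trace (M ** N)) = 0" "0 \<le> Re (trace (M ** N))"
    using psd_Im[OF assms(2)] psd_Re[OF assms(2)] by (simp_all add: sum_nonneg)
qed

lemma trace_psd: 
  assumes "psd M"
  shows "Im (trace M) = 0" "0 \<le> Re (trace M)" "trace M = of_real (Re (trace M))"
  using trace_psd_mult[OF assms psd_mat_1] by (simp_all add: complex_eq_iff)

text \<open>Decomposing \<omega> into rank-one terms bounds the pairing by the sum of
  \<open>|v i|^2\<close>, which is the trace of \<omega>. A bound through the trace can be summed
  over all words of length \<open>n\<close>, because their blocks have a fixed total trace;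
  \<open>phase_sum_bound\<close> rests on this.\<close>

lemma trace_psd_mult_bound:
  "\<exists>K>0. \<forall>\<omega> X :: complex^'h^'h. psd \<omega> \<longrightarrow> cmod (trace (\<omega> ** X)) \<le> K * norm X * Re (trace \<omega>)"
proof -
  obtain K1 where K1: "K1 > 0" "\<And>X v. norm ((X :: complex^'h^'h) *v v) \<le> norm X * norm v * K1"
    using mv.pos_bounded by blast
  obtain K2 where K2: "K2 > 0" "\<And>x y. norm (cinner (x :: complex^'h) y) \<le> norm x * norm y * K2"
    using ci.pos_bounded by blast
  show ?thesis
  proof (intro exI[of _ "K1 * K2"] conjI allI impI)
    show "K1 * K2 > 0" using K1 K2 by simp
    fix \<omega> X :: "complex^'h^'h" assume "psd \<omega>"
    then obtain v :: "'h \<Rightarrow> complex^'h" where v: "\<omega> = (\<Sum>i\<in>UNIV. outer (v i) (v i))"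
      using psd_decomposition by blast
    have "cmod (trace (\<omega> ** X)) = cmod (\<Sum>i\<in>UNIV. cinner (v i) (X *v v i))"
      by (simp add: v mm.sum_left tr_sum trace_outer_mult)
    also have "\<dots> \<le> (\<Sum>i\<in>UNIV. K1 * K2 * norm X * (norm (v i))\<^sup>2)"
    proof (rule sum_norm_le)
      fix i
      have "norm (cinner (v i) (X *v v i)) \<le> norm (v i) * norm (X *v v i) * K2"
        by (rule K2)
      also have "\<dots> \<le> norm (v i) * (norm X * norm (v i) * K1) * K2"
        using K1 K2 by (intro mult_right_mono mult_left_mono) auto
      finally show "norm (cinner (v i) (X *v v i)) \<le> K1 * K2 * norm X * (norm (v i))\<^sup>2"
        by (simp add: power2_eq_square mult_ac)
    qed
    also have "\<dots> = K1 * K2 * norm X * Re (trace \<omega>)"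
      by (simp add: v tr_sum trace_outer cinner_self sum_distrib_left)
    finally show "cmod (trace (\<omega> ** X)) \<le> K1 * K2 * norm X * Re (trace \<omega>)" .
  qed
qed

text \<open>The squared norm is the trace of \<omega> times \<omega>; the previous bound with
  \<open>X = \<omega>\<close> gains one factor of the norm, which cancels. This makes the set of
  states compact and trace-preserving orbits bounded.\<close>

lemma norm_psd_le: "\<exists>K>0. \<forall>\<omega> :: complex^'h^'h. psd \<omega> \<longrightarrow> norm \<omega> \<le> K * Re (trace \<omega>)"
proof -
  obtain K where K: "K > 0"
    "\<And>\<omega> X :: complex^'h^'h. psd \<omega> \<Longrightarrow> cmod (trace (\<omega> ** X)) \<le> K * norm X * Re (trace \<omega>)"
    using trace_psd_mult_bound by blast
  have "norm \<omega> \<le> K * Re (trace \<omega>)" if "psd \<omega>" for \<omega> :: "complex^'h^'h"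
  proof -
    have "norm \<omega> * norm \<omega> = Re (trace (\<omega> ** \<omega>))"
      using inner_matrix_eq[of \<omega> \<omega>] psd_adj[OF that]
      by (simp flip: power2_eq_square add: power2_norm_eq_inner)
    also have "\<dots> \<le> cmod (trace (\<omega> ** \<omega>))" by (rule complex_Re_le_cmod)
    also have "\<dots> \<le> norm \<omega> * (K * Re (trace \<omega>))" using K(2)[OF that, of \<omega>] by (simp add: mult_ac)
    finally show ?thesis
      using K(1) trace_psd(2)[OF that] by (cases "norm \<omega> = 0") (simp_all add: mult_le_cancel_left)
  qed
  then show ?thesis using K(1) by blast
qed

lemma psd_trace_0: "psd (M :: complex^'h^'h) \<Longrightarrow> Re (trace M) = 0 \<Longrightarrow> M = 0"
proof -
  assume "psd M" "Re (trace M) = 0"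
  moreover obtain K where "\<And>\<omega> :: complex^'h^'h. psd \<omega> \<Longrightarrow> norm \<omega> \<le> K * Re (trace \<omega>)"
    using norm_psd_le by blast
  ultimately show ?thesis by fastforce
qed

lemma outer_polarization:
  "4 *\<^sub>R outer x y = outer (x + y) (x + y) - outer (x - y) (x - y)
     + mat \<i> ** outer (x + \<i> *s y) (x + \<i> *s y) - mat \<i> ** outer (x - \<i> *s y) (x - \<i> *s y)"
proof -
  have "4 * (a * cnj b) = (a + c) * cnj (d + b) - (a - c) * cnj (d - b)
      + \<i> * ((a + \<i> * c) * cnj (d + \<i> * b)) - \<i> * ((a - \<i> * c) * cnj (d - \<i> * b))" for a b c d
    by (rule complex_eqI; simp; algebra)
  then show ?thesis
    by (simp add: vec_eq_iff outer_def mat_mult_left scaleR_complex)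
qed

text \<open>By polarisation the operators \<open>outer x x\<close> span all matrices over the
  complex numbers, so a property stable under linear combinations needs checking on positive
  matrices only. There the trace controls the norm and monotonicity is available; boundedness of
  orbits, convergence of absorption operators and growth of tilted powers are all obtained this
  way.\<close>

lemma psd_induct [consumes 0, case_names psd add scale]:
  assumes psd: "\<And>X. psd X \<Longrightarrow> P X"
    and add: "\<And>X Y. P X \<Longrightarrow> P Y \<Longrightarrow> P (X + Y)"
    and scale: "\<And>c X. P X \<Longrightarrow> P (mat c ** X)"
  shows "P (X :: complex^'h^'h)"
proof -
  have neg: "P (- X)" if "P X" for X
    using scale[OF that, of "-1"] by (simp add: mat_mult_left) (simp add: vec_eq_iff uminus_vec_def)
  have diff: "P (X - Y)" if "P X" "P Y" for X Y
    using add[OF that(1) neg[OF that(2)]] by simp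
  have sum: "P (\<Sum>i\<in>I. f i)" if "\<And>i. P (f i)" for f :: "'h \<Rightarrow> _" and I
    by (induction I rule: infinite_finite_induct) (use add that psd[OF psd_0] in auto)
  have outer: "P (outer x y)" for x y
  proof -
    have "P (mat (1/4) ** (4 *\<^sub>R outer x y))"
      unfolding outer_polarization by (intro scale diff add psd psd_outer)
    also have "mat (1/4) ** (4 *\<^sub>R outer x y) = outer x y"
      using mat_of_real_mult[of "1/4" "4 *\<^sub>R outer x y"] by simp
    finally show ?thesis .
  qed
  have "X = (\<Sum>i\<in>UNIV. \<Sum>j\<in>UNIV. mat (X $ i $ j) ** outer (axis i 1) (axis j 1))"
  proof -
    have "X $ i $ j * ((axis i 1 :: complex^'h) $ a * cnj ((axis j 1 :: complex^'h) $ b)) =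
        (if j = b then if i = a then X $ i $ j else 0 else 0)" for i j a b
      by (simp add: axis_def)
    then show ?thesis
      by (simp add: vec_eq_iff outer_def mat_mult_left)
  qed
  moreover have "P \<dots>"
    by (intro sum scale outer)
  ultimately show ?thesis by simp
qed

section \<open>Orthogonal projections and supports\<close>

lemma csubspace_imp_subspace: "vec.subspace U \<Longrightarrow> subspace (U :: (complex^'h) set)"
proof -
  assume U: "vec.subspace U"
  have "c *\<^sub>R x = of_real c *s x" for c and x :: "complex^'h"
    by (simp add: vec_eq_iff scaleR_complex)
  with U show ?thesis by (simp add: vec.subspace_def subspace_def)
qed

lemma subspace_ortho_compl: "vec.subspace (ortho_compl U)"
  by (simp add: vec.subspace_def ortho_compl_def ci.zero_right ci.add_right cinner_smult_right)

lemma ortho_compl_Int: "x \<in> U \<Longrightarrow> x \<in> ortho_compl U \<Longrightarrow> x = 0"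
  by (auto simp: ortho_compl_def cinner_self_eq_0)

text \<open>The real orthogonal decomposition already gives the splitting: a complex subspace is
  stable under multiplication by \<open>i\<close>, so orthogonality for the real part of
  \<open>cinner\<close> kills the imaginary part as well.\<close>

lemma orthogonal_decomposition:
  assumes U: "vec.subspace (U :: (complex^'h) set)"
  shows "\<exists>y\<in>U. x - y \<in> ortho_compl U"
proof -
  have sU: "span U = U" using csubspace_imp_subspace[OF U] by (simp add: span_eq_iff)
  obtain y z where yz: "y \<in> U" "\<And>w. w \<in> U \<Longrightarrow> orthogonal z w" "x = y + z"
    using orthogonal_subspace_decomp_exists[of U x] unfolding sU by metis
  have "cinner w z = 0" if w: "w \<in> U" for w
  proof (rule complex_eqI)
    show "Re (cinner w z) = Re 0"
      using yz(2)[OF w] by (simp add: Re_cinner orthogonal_def inner_commute)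
    have "\<i> *s w \<in> U" using U w by (simp add: vec.subspace_def)
    from yz(2)[OF this] have "Re (cinner (\<i> *s w) z) = 0"
      by (simp add: Re_cinner orthogonal_def inner_commute)
    then show "Im (cinner w z) = Im 0" by (simp add: cinner_smult_left)
  qed
  then show ?thesis using yz by (intro bexI[of _ y]) (auto simp: ortho_compl_def)
qed

lemma ortho_compl_double:
  assumes U: "vec.subspace U"
  shows "ortho_compl (ortho_compl U) = U"
proof
  show "U \<subseteq> ortho_compl (ortho_compl U)"
  proof (auto simp: ortho_compl_def)
    fix x y assume "x \<in> U" "\<forall>z\<in>U. cinner z y = 0"
    then show "cinner y x = 0" using cinner_commute[of y x] by simp
  qed
  show "ortho_compl (ortho_compl U) \<subseteq> U"
  proof
    fix x assume x: "x \<in> ortho_compl (ortho_compl U)"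
    obtain y where y: "y \<in> U" "x - y \<in> ortho_compl U"
      using orthogonal_decomposition[OF U] by blast
    have "y \<in> ortho_compl (ortho_compl U)" using y(1) \<open>U \<subseteq> ortho_compl (ortho_compl U)\<close> by blast
    with x have "x - y \<in> ortho_compl (ortho_compl U)"
      using subspace_ortho_compl vec.subspace_diff by blast
    then have "x - y = 0" using ortho_compl_Int y(2) by blast
    then show "x \<in> U" using y(1) by simp
  qed
qed

lemma projection_exists:
  assumes U: "vec.subspace (U :: (complex^'h) set)"
  shows "\<exists>p. p ** p = p \<and> adj p = p \<and> range ((*v) p) = U"
proof -
  obtain f where f: "\<And>x. f x \<in> U" "\<And>x. x - f x \<in> ortho_compl U"
    using orthogonal_decomposition[OF U] by metis
  have f_unique: "y = f x" if "y \<in> U" "x - y \<in> ortho_compl U" for x y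
  proof -
    have "(x - f x) - (x - y) \<in> ortho_compl U"
      using that f subspace_ortho_compl vec.subspace_diff by blast
    moreover have "y - f x \<in> U" using that f U vec.subspace_diff by blast
    ultimately have "y - f x = 0" by (intro ortho_compl_Int) (auto simp: algebra_simps)
    then show ?thesis by simp
  qed
  have lin: "Vector_Spaces.linear (*s) (*s) f"
  proof unfold_locales
    fix x y :: "complex^'h" and r
    show "f (x + y) = f x + f y"
    proof (rule f_unique[symmetric])
      show "f x + f y \<in> U" using f U vec.subspace_add by blast
      have "(x - f x) + (y - f y) \<in> ortho_compl U"
        using f subspace_ortho_compl vec.subspace_add by blast
      then show "x + y - (f x + f y) \<in> ortho_compl U" by (simp add: algebra_simps)
    qed
    show "f (r *s x) = r *s f x"
    proof (rule f_unique[symmetric])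
      show "r *s f x \<in> U" using f U vec.subspace_scale by blast
      have "r *s (x - f x) \<in> ortho_compl U"
        using f subspace_ortho_compl vec.subspace_scale by blast
      then show "r *s x - r *s f x \<in> ortho_compl U" by (simp add: vec.scale_right_diff_distrib)
    qed
  qed
  define p where "p = matrix f"
  have p: "p *v x = f x" for x unfolding p_def by (rule matrix_works[OF lin])
  have ff: "f x = x" if "x \<in> U" for x
    using f_unique[of x x] that subspace_ortho_compl vec.subspace_0 by fastforce
  have "p ** p = p"
    by (rule matrix_ext) (simp add: matrix_vector_mul_assoc[symmetric] p ff f)
  moreover have "adj p = p"
  proof (rule matrix_ext, rule cinner_ext)
    fix x y
    have a: "cinner (f x) z = cinner (f x) (f z)" for x z
    proof -
      have "cinner (f x) (z - f z) = 0" using f by (simp add: ortho_compl_def)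
      then show ?thesis by (simp add: ci.diff_right)
    qed
    have "cinner y (adj p *v x) = cinner (f y) x" by (simp add: cinner_adj[symmetric] p)
    also have "\<dots> = cinner (f y) (f x)" by (rule a)
    also have "\<dots> = cnj (cinner (f x) (f y))" by (rule cinner_commute)
    also have "\<dots> = cnj (cinner (f x) y)" using a[of x y] by simp
    also have "\<dots> = cinner y (p *v x)" by (simp add: p cinner_commute[of y])
    finally show "cinner y (adj p *v x) = cinner y (p *v x)" .
  qed
  moreover have "range ((*v) p) = U"
  proof
    show "range ((*v) p) \<subseteq> U" using f p by auto
    show "U \<subseteq> range ((*v) p)"
    proof
      fix x assume "x \<in> U"
      then have "x = p *v x" by (simp add: p ff)
      then show "x \<in> range ((*v) p)" by (rule range_eqI)
    qed
  qed
  ultimately show ?thesis by blast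
qed

lemma ortho_proj_prop:
  assumes U: "vec.subspace (U :: (complex^'h) set)"
  shows "ortho_proj U ** ortho_proj U = ortho_proj U \<and> adj (ortho_proj U) = ortho_proj U
    \<and> range ((*v) (ortho_proj U)) = U"
  unfolding ortho_proj_def
proof (rule theI')
  show "\<exists>!p. p ** p = p \<and> adj p = p \<and> range ((*v) p) = U"
  proof (rule ex_ex1I[OF projection_exists[OF U]])
    fix p q assume p: "p ** p = p \<and> adj p = p \<and> range ((*v) p) = U"
      and q: "q ** q = q \<and> adj q = q \<and> range ((*v) q) = U"
    have fixq: "a ** b = b" if "a ** a = a" "range ((*v) a) = U" "range ((*v) b) = U" for a b :: "complex^'h^'h"
    proof (rule matrix_ext)
      fix x
      have "b *v x \<in> range ((*v) a)" using that by blast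
      then obtain y where "b *v x = a *v y" by blast
      then show "(a ** b) *v x = b *v x"
        by (metis matrix_vector_mul_assoc that(1))
    qed
    have "p = adj p" using p by simp
    also have "\<dots> = adj (q ** p)" using fixq[of q p] p q by simp
    also have "\<dots> = p ** q" using p q by (simp add: adj_mult)
    also have "\<dots> = q" using fixq[of p q] p q by simp
    finally show "p = q" .
  qed
qed

lemmas proj_idem = ortho_proj_prop[THEN conjunct1]
  and proj_adj = ortho_proj_prop[THEN conjunct2, THEN conjunct1]
  and proj_range = ortho_proj_prop[THEN conjunct2, THEN conjunct2]

lemma proj_in: "vec.subspace U \<Longrightarrow> ortho_proj U *v x \<in> U"
  using proj_range by blast

lemma proj_fix: "vec.subspace U \<Longrightarrow> x \<in> U \<longleftrightarrow> ortho_proj U *v x = x"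
  by (metis (no_types, lifting) matrix_vector_mul_assoc proj_idem proj_in proj_range rangeE)

lemma proj_ker: "vec.subspace U \<Longrightarrow> ortho_proj U *v x = 0 \<longleftrightarrow> x \<in> ortho_compl U"
proof
  assume U: "vec.subspace U" and 0: "ortho_proj U *v x = 0"
  have "cinner y x = 0" if "y \<in> U" for y
    using cinner_adj[of "ortho_proj U" y x] that U 0 by (simp add: proj_adj proj_fix ci.zero_right)
  then show "x \<in> ortho_compl U" by (simp add: ortho_compl_def)
next
  assume U: "vec.subspace U" and x: "x \<in> ortho_compl U"
  show "ortho_proj U *v x = 0"
  proof (rule cinner_ext)
    fix y
    have "cinner (ortho_proj U *v y) x = 0" using x proj_in[OF U] by (simp add: ortho_compl_def)
    then show "cinner y (ortho_proj U *v x) = cinner y 0"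
      using cinner_adj[of "ortho_proj U" y x] U by (simp add: proj_adj ci.zero_right)
  qed
qed

lemma proj_compl: "vec.subspace U \<Longrightarrow> x - ortho_proj U *v x \<in> ortho_compl U"
  by (simp add: proj_ker[symmetric] mv.diff_right matrix_vector_mul_assoc proj_idem)

lemma psd_proj: "vec.subspace U \<Longrightarrow> psd (ortho_proj U)"
  using psd_conj[OF psd_mat_1, of "ortho_proj U"] by (simp add: proj_adj proj_idem)

lemma psd_proj_compl: "vec.subspace U \<Longrightarrow> psd (mat 1 - ortho_proj U)"
  using psd_conj[OF psd_mat_1, of "mat 1 - ortho_proj U"]
  by (simp add: adj_diff mm.diff_left mm.diff_right proj_adj proj_idem)

lemma proj_UNIV [simp]: "ortho_proj UNIV = (mat 1 :: complex^'h^'h)"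
proof (rule matrix_ext)
  fix x :: "complex^'h"
  show "ortho_proj UNIV *v x = mat 1 *v x"
    using proj_fix[OF vec.subspace_UNIV, of x] by simp
qed

text \<open>The corner of the matrix algebra cut out by the projection onto \<open>U\<close>. For
  hermitian \<open>M\<close> it encodes \<open>supp M \<subseteq> U\<close>
  (\<open>supp_subset_iff_corner\<close>), but as a closed linear condition, so it passes to sums,
  multiples and limits.\<close>

definition corner :: "(complex^'h) set \<Rightarrow> complex^'h^'h \<Rightarrow> bool" where
  "corner U M \<longleftrightarrow> ortho_proj U ** M ** ortho_proj U = M"

lemma corner_UNIV [simp]: "corner UNIV M"
  by (simp add: corner_def)

lemma cornerD:
  assumes "vec.subspace U" "corner U M"
  shows "ortho_proj U ** M = M" "M ** ortho_proj U = M"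
  using assms unfolding corner_def by (metis matrix_mul_assoc proj_idem)+

lemma corner_iff:
  assumes "vec.subspace U"
  shows "corner U M \<longleftrightarrow> ortho_proj U ** M = M \<and> M ** ortho_proj U = M"
  using cornerD[OF assms] by (auto simp: corner_def)

lemma corner_compress: "vec.subspace U \<Longrightarrow> corner U (ortho_proj U ** M ** ortho_proj U)"
  unfolding corner_def by (metis matrix_mul_assoc proj_idem)

lemma corner_0 [simp]: "corner U 0"
  by (simp add: corner_def)

lemma corner_add: "corner U A \<Longrightarrow> corner U B \<Longrightarrow> corner U (A + B)"
  by (simp add: corner_def mm.add_left mm.add_right)

lemma corner_diff: "corner U A \<Longrightarrow> corner U B \<Longrightarrow> corner U (A - B)"
  by (simp add: corner_def mm.diff_left mm.diff_right)

lemma corner_scaleR: "corner U A \<Longrightarrow> corner U (c *\<^sub>R A)"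
  by (simp add: corner_def mm.scaleR_left mm.scaleR_right)

lemma corner_mat: "corner U A \<Longrightarrow> corner U (mat c ** A)"
  by (simp add: corner_def matrix_mul_assoc mat_mult_commute) (simp flip: matrix_mul_assoc)

lemma corner_sum: "(\<And>i. i \<in> I \<Longrightarrow> corner U (f i)) \<Longrightarrow> corner U (\<Sum>i\<in>I. f i)"
  by (induction I rule: infinite_finite_induct) (auto intro: corner_add)

lemma corner_outer: "vec.subspace U \<Longrightarrow> x \<in> U \<Longrightarrow> corner U (outer x x)"
  by (simp add: corner_def mult_outer outer_mult proj_adj proj_fix)

lemma corner_proj: "vec.subspace U \<Longrightarrow> corner U (ortho_proj U)"
  by (simp add: corner_def proj_idem)

lemma closed_corner: "closed {M. corner U M}"
  unfolding corner_def by (intro closed_Collect_eq mm.continuous_on continuous_intros)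

lemma corner_limit: "(\<And>n. corner U (f n)) \<Longrightarrow> f \<longlonglongrightarrow> M \<Longrightarrow> corner U M"
  using closed_sequentially[OF closed_corner, of f U M] by auto

section \<open>Supports\<close>

lemma subspace_supp: "vec.subspace (supp M)"
  unfolding supp_def by (rule subspace_ortho_compl)

lemma subspace_ker: "vec.subspace {x. (M :: complex^'h^'h) *v x = 0}"
  by (simp add: vec.subspace_def mv.zero_right mv.add_right vector_scalar_commute)

lemma ortho_compl_supp: "ortho_compl (supp M) = {x. M *v x = 0}"
  unfolding supp_def by (rule ortho_compl_double[OF subspace_ker])

lemma ortho_compl_antimono: "U \<subseteq> W \<Longrightarrow> ortho_compl W \<subseteq> ortho_compl U"
  by (auto simp: ortho_compl_def)

lemma range_in_supp: "adj M = M \<Longrightarrow> M *v x \<in> supp M"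
  unfolding supp_def ortho_compl_def
proof safe
  fix y assume "adj M = M" "M *v y = 0"
  then show "cinner y (M *v x) = 0" using cinner_adj[of M y x] by (simp add: ci.zero_left)
qed

lemma supp_subset_iff_corner:
  assumes "vec.subspace U" "adj M = M"
  shows "supp M \<subseteq> U \<longleftrightarrow> corner U M"
proof
  assume s: "supp M \<subseteq> U"
  have "ortho_proj U ** M = M"
  proof (rule matrix_ext)
    fix x
    have "M *v x \<in> U" using range_in_supp[OF assms(2)] s by blast
    then show "(ortho_proj U ** M) *v x = M *v x"
      using proj_fix[OF assms(1)] by (simp add: matrix_vector_mul_assoc[symmetric])
  qed
  moreover from this have "M ** ortho_proj U = M"
    by (metis adj_mult assms proj_adj)
  ultimately show "corner U M" using corner_iff[OF assms(1)] by blast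
next
  assume c: "corner U M"
  have "ortho_compl U \<subseteq> {x. M *v x = 0}"
  proof
    fix x assume "x \<in> ortho_compl U"
    then have "ortho_proj U *v x = 0" using proj_ker[OF assms(1)] by blast
    then have "(M ** ortho_proj U) *v x = 0"
      by (simp add: matrix_vector_mul_assoc[symmetric] mv.zero_right)
    then show "x \<in> {x. M *v x = 0}" using cornerD[OF assms(1) c] by simp
  qed
  then have "supp M \<subseteq> ortho_compl (ortho_compl U)"
    unfolding supp_def by (rule ortho_compl_antimono)
  then show "supp M \<subseteq> U" by (simp add: ortho_compl_double[OF assms(1)])
qed

lemma corner_supp: "adj M = M \<Longrightarrow> corner (supp M) M"
  using supp_subset_iff_corner[OF subspace_supp] by blast

lemma supp_eq_0: "adj M = M \<Longrightarrow> supp M = {0} \<longleftrightarrow> M = 0"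
proof
  assume "adj M = M" "supp M = {0}"
  then show "M = 0" using range_in_supp[of M] by (intro matrix_ext) (simp add: mv.zero_left)
next
  assume "M = 0"
  then show "supp M = {0}"
    using ortho_compl_Int[of _ UNIV] by (auto simp: supp_def mv.zero_left ortho_compl_def ci.zero_right)
qed

text \<open>The form attains its minimum on the compact unit sphere of the support. The minimum is
  not 0, because a zero of the form lies in the kernel, which is orthogonal to the support.\<close>

lemma psd_supp_lower:
  assumes Z: "psd (Z :: complex^'h^'h)"
  shows "\<exists>c>0. \<forall>x\<in>supp Z. c * (norm x)\<^sup>2 \<le> Re (cinner x (Z *v x))"
proof -
  define S where "S = supp Z \<inter> sphere 0 1"
  have sub: "subspace (supp Z)" by (rule csubspace_imp_subspace[OF subspace_supp])
  have compact: "compact S"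
    unfolding S_def by (intro closed_Int_compact closed_subspace sub compact_sphere)
  define f where "f x = Re (cinner x (Z *v x))" for x
  have cont: "continuous_on S f"
    unfolding f_def by (intro continuous_intros ci.continuous_on mv.continuous_on)
  have f_scale: "f (r *\<^sub>R x) = r\<^sup>2 * f x" for r x
    by (simp add: f_def mv.scaleR_right ci.scaleR_left ci.scaleR_right power2_eq_square)
  show ?thesis
  proof (cases "S = {}")
    case True
    have "x = 0" if "x \<in> supp Z" for x
    proof (rule ccontr)
      assume "x \<noteq> 0"
      then have "(1 / norm x) *\<^sub>R x \<in> S" using that sub by (simp add: S_def subspace_scale)
      with True show False by simp
    qed
    then have "1 * (norm x)\<^sup>2 \<le> Re (cinner x (Z *v x))" if "x \<in> supp Z" for x
      using that[THEN \<open>\<And>x. x \<in> supp Z \<Longrightarrow> x = 0\<close>] by (simp add: ci.zero_left)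
    then show ?thesis using zero_less_one by blast
  next
    case False
    obtain x0 where x0: "x0 \<in> S" "\<And>x. x \<in> S \<Longrightarrow> f x0 \<le> f x"
      using continuous_attains_inf[OF compact False cont] by blast
    have "f x0 \<noteq> 0"
    proof
      assume "f x0 = 0"
      then have "Z *v x0 = 0" using psd_kernel_iff[OF Z] by (simp add: f_def)
      then have "x0 \<in> ortho_compl (supp Z)" by (simp add: ortho_compl_supp)
      then have "x0 = 0" using x0(1) ortho_compl_Int by (auto simp: S_def)
      then show False using x0(1) by (simp add: S_def)
    qed
    then have pos: "f x0 > 0" using psd_Re[OF Z, of x0] by (simp add: f_def)
    have "f x0 * (norm x)\<^sup>2 \<le> f x" if "x \<in> supp Z" for x
    proof (cases "x = 0")
      case False
      then have "(1 / norm x) *\<^sub>R x \<in> S" using that sub by (simp add: S_def subspace_scale)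
      then have "f x0 \<le> (1 / norm x)\<^sup>2 * f x" using x0(2) f_scale by metis
      then show ?thesis using False by (simp add: field_simps)
    qed (simp add: f_def mv.zero_right ci.zero_right)
    with pos show ?thesis unfolding f_def by blast
  qed
qed

lemma quadratic_form_upper:
  "\<exists>C>0. \<forall>x. \<bar>Re (cinner x (N *v x))\<bar> \<le> C * (norm (x :: complex^'h))\<^sup>2"
proof -
  obtain K1 where K1: "K1 > 0" "\<And>X v. norm ((X :: complex^'h^'h) *v v) \<le> norm X * norm v * K1"
    using mv.pos_bounded by blast
  obtain K2 where K2: "K2 > 0" "\<And>x y. norm (cinner (x :: complex^'h) y) \<le> norm x * norm y * K2"
    using ci.pos_bounded by blast
  define C where "C = norm N * K1 * K2 + 1"
  have "\<bar>Re (cinner x (N *v x))\<bar> \<le> C * (norm x)\<^sup>2" for x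
  proof -
    have "\<bar>Re (cinner x (N *v x))\<bar> \<le> norm (cinner x (N *v x))" by (rule abs_Re_le_cmod)
    also have "\<dots> \<le> norm x * norm (N *v x) * K2" by (rule K2)
    also have "\<dots> \<le> norm x * (norm N * norm x * K1) * K2"
      using K1 K2 by (intro mult_right_mono mult_left_mono) auto
    also have "\<dots> \<le> C * (norm x)\<^sup>2" by (simp add: C_def power2_eq_square algebra_simps)
    finally show ?thesis .
  qed
  moreover have "C > 0" using K1 K2 by (simp add: C_def add_nonneg_pos)
  ultimately show ?thesis by blast
qed

text \<open>On its support \<open>Z\<close> is bounded below by some \<open>c > 0\<close> and
  \<open>N\<close> is bounded by some \<open>C\<close>, so a step of length \<open>c/C\<close> stays
  positive; on the orthogonal complement both vanish.\<close>

lemma psd_perturb: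
  assumes Z: "psd Z" and N: "adj N = N" "corner (supp Z) N"
  shows "\<exists>d>0. psd (Z - d *\<^sub>R N)"
proof -
  obtain c where c: "c > 0" "\<And>x. x \<in> supp Z \<Longrightarrow> c * (norm x)\<^sup>2 \<le> Re (cinner x (Z *v x))"
    using psd_supp_lower[OF Z] by blast
  obtain C where C: "C > 0" "\<And>x. \<bar>Re (cinner x (N *v x))\<bar> \<le> C * (norm x)\<^sup>2"
    using quadratic_form_upper by blast
  define p where "p = ortho_proj (supp Z)"
  note sub = subspace_supp[of Z]
  have red: "cinner x (M *v x) = cinner (p *v x) (M *v (p *v x))" if "corner (supp Z) M" for x M
  proof -
    have "M = p ** M ** p" using that by (simp add: corner_def p_def)
    then have "cinner x (M *v x) = cinner x ((p ** M ** p) *v x)" by simp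
    then show ?thesis
      by (simp add: matrix_vector_mul_assoc[symmetric] cinner_adj proj_adj[OF sub] p_def)
  qed
  have "psd (Z - (c/C) *\<^sub>R N)"
    unfolding psd_iff_hermitian
  proof (intro conjI allI)
    show "adj (Z - (c/C) *\<^sub>R N) = Z - (c/C) *\<^sub>R N"
      using N psd_adj[OF Z] by (simp add: adj_diff adj_scaleR)
    fix x
    define y where "y = p *v x"
    have y: "y \<in> supp Z" using proj_in[OF sub] by (simp add: y_def p_def)
    have "Re (cinner x ((Z - (c/C) *\<^sub>R N) *v x)) = Re (cinner y (Z *v y)) - (c/C) * Re (cinner y (N *v y))"
      using red[OF corner_supp[OF psd_adj[OF Z]], of x] red[OF N(2), of x]
      by (simp add: mv.diff_left ci.diff_right mv.scaleR_left ci.scaleR_right y_def)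
    moreover have "(c/C) * Re (cinner y (N *v y)) \<le> (c/C) * (C * (norm y)\<^sup>2)"
      using C(2)[of y] c C(1) by (intro mult_left_mono) auto
    ultimately show "0 \<le> Re (cinner x ((Z - (c/C) *\<^sub>R N) *v x))"
      using c(2)[OF y] C(1) by simp
  qed
  then show ?thesis using c(1) C(1) by (intro exI[of _ "c/C"]) simp
qed

text \<open>Take the largest \<open>t\<close> for which \<open>Z - t N\<close> is positive. If the
  support had not shrunk there, \<open>psd_perturb\<close> would allow a further step. Uniqueness of
  eigenvectors, the decomposition of invariant states and the Schur argument below all use this loss
  of support.\<close>

lemma psd_boundary:
  assumes Z: "psd Z" and N: "adj N = N" "corner (supp Z) N" and t0: "t0 \<ge> 0" "\<not> psd (Z - t0 *\<^sub>R N)"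
  obtains t where "t \<ge> 0" "psd (Z - t *\<^sub>R N)" "supp (Z - t *\<^sub>R N) \<subset> supp Z"
proof -
  define A where "A = {t. 0 \<le> t \<and> psd (Z - t *\<^sub>R N)}"
  have "A = {0..} \<inter> (\<lambda>t. Z - t *\<^sub>R N) -` {M. psd M}" by (auto simp: A_def)
  moreover have "closed ((\<lambda>t. Z - t *\<^sub>R N) -` {M. psd M})"
    by (intro closed_vimage closed_psd continuous_intros)
  ultimately have clA: "closed A" by (metis closed_Int closed_atLeast)
  have 0: "0 \<in> A" using Z by (simp add: A_def)
  have bd: "t \<le> t0" if "t \<in> A" for t
  proof (rule ccontr)
    assume "\<not> t \<le> t0"
    then have t: "t > t0" "t > 0" using t0 by auto
    \<comment> \<open>The point \<open>Z - t0 N\<close> lies on the segment from \<open>Z\<close> to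
      \<open>Z - t N\<close>, and the positive cone is convex.\<close>
    have "psd ((1 - t0/t) *\<^sub>R Z + (t0/t) *\<^sub>R (Z - t *\<^sub>R N))"
      using that t t0 Z by (intro psd_add psd_scaleR) (auto simp: A_def)
    also have "(1 - t0/t) *\<^sub>R Z + (t0/t) *\<^sub>R (Z - t *\<^sub>R N) = Z - t0 *\<^sub>R N"
      using t by (simp add: algebra_simps)
    finally show False using t0 by simp
  qed
  then have bdd: "bdd_above A" by (auto simp: bdd_above_def)
  define t where "t = Sup A"
  have tA: "t \<in> A" unfolding t_def using closed_contains_Sup[OF _ bdd clA] 0 by blast
  define Y where "Y = Z - t *\<^sub>R N"
  have Y: "psd Y" "t \<ge> 0" using tA by (auto simp: A_def Y_def)
  have "corner (supp Z) Y"
    unfolding Y_def by (intro corner_diff corner_scaleR N corner_supp psd_adj Z)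
  then have sub: "supp Y \<subseteq> supp Z" using supp_subset_iff_corner[OF subspace_supp psd_adj[OF Y(1)]] by blast
  have "supp Y \<noteq> supp Z"
  proof
    assume "supp Y = supp Z"
    then obtain d where d: "d > 0" "psd (Y - d *\<^sub>R N)" using psd_perturb[OF Y(1) N(1)] N(2) by metis
    have "Y - d *\<^sub>R N = Z - (t + d) *\<^sub>R N" by (simp add: Y_def algebra_simps)
    then have "t + d \<in> A" using d Y by (simp add: A_def)
    then have "t + d \<le> t" unfolding t_def by (rule cSup_upper[OF _ bdd])
    then show False using d by simp
  qed
  then show ?thesis using that Y sub unfolding Y_def by blast
qed

section \<open>Weighted Kraus maps\<close>

text \<open>Weights of either sign are allowed: weight 1 gives the channel, exponential weights the
  tilted channel, and weights such as \<open>a i\<close> or \<open>a i * a i\<close> its derivatives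
  at the origin. Passing to \<open>adj (K i)\<close> gives the duals of all of these.\<close>

definition kraus :: "('j::finite \<Rightarrow> real) \<Rightarrow> ('j \<Rightarrow> complex^'h^'h) \<Rightarrow> complex^'h^'h \<Rightarrow> complex^'h^'h" where
  "kraus c K X = (\<Sum>i\<in>UNIV. c i *\<^sub>R (K i ** X ** adj (K i)))"

lemma channel_kraus: "channel L = kraus (\<lambda>_. 1) L"
  by (simp add: fun_eq_iff channel_def kraus_def)

lemma dual_channel_kraus: "dual_channel L = kraus (\<lambda>_. 1) (\<lambda>i. adj (L i))"
  by (simp add: fun_eq_iff dual_channel_def kraus_def)

lemma tilted_channel_kraus: "tilted_channel s L u = kraus (\<lambda>i. exp (u \<bullet> s i)) L"
  by (simp add: fun_eq_iff tilted_channel_def kraus_def)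

lemma linear_kraus: "linear (kraus c K)"
  unfolding linear_iff kraus_def
  by (simp add: mm.add_left mm.add_right mm.scaleR_left mm.scaleR_right sum.distrib scaleR_sum_right
      scaleR_add_right mult.commute)

lemmas kraus_diff = linear_diff[OF linear_kraus]
  and kraus_scaleR = linear_scale[OF linear_kraus] and kraus_sum = linear_sum[OF linear_kraus]
  and kraus_0 = linear_0[OF linear_kraus]

lemma continuous_on_kraus: "continuous_on S (kraus c K)"
  by (intro linear_continuous_on linear_conv_bounded_linear[THEN iffD1] linear_kraus)

lemma psd_kraus: "psd X \<Longrightarrow> (\<And>i. c i \<ge> 0) \<Longrightarrow> psd (kraus c K X)"
  unfolding kraus_def by (intro psd_sum psd_scaleR psd_conj)

lemma adj_kraus: "adj (kraus c K X) = kraus c K (adj X)"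
  by (simp add: kraus_def adj_sum adj_scaleR adj_mult matrix_mul_assoc)

lemma kraus_mat: "kraus c K (mat z ** X) = mat z ** kraus c K X"
proof -
  have "K i ** (mat z ** X) ** adj (K i) = mat z ** (K i ** X ** adj (K i))" for i
    by (simp add: mat_mult_commute matrix_mul_assoc)
  then show ?thesis by (simp add: kraus_def mm.sum_right mm.scaleR_right)
qed

lemma trace_kraus_dual:
  "trace (kraus c K X ** Y) = trace (X ** kraus c (\<lambda>i. adj (K i)) Y)"
proof -
  have "trace (K i ** X ** adj (K i) ** Y) = trace (X ** (adj (K i) ** Y ** K i))" for i
    using trace_mul_sym[of "K i" "X ** adj (K i) ** Y"] by (simp add: matrix_mul_assoc)
  then show ?thesis
    by (simp add: kraus_def mm.sum_left mm.sum_right mm.scaleR_left mm.scaleR_right tr_sum tr_scaleR)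
qed

section \<open>Jointly invariant subspaces and enclosures\<close>

definition invsub :: "('j \<Rightarrow> complex^'h^'h) \<Rightarrow> (complex^'h) set \<Rightarrow> bool" where
  "invsub K U \<longleftrightarrow> vec.subspace U \<and> (\<forall>i. \<forall>x\<in>U. K i *v x \<in> U)"

lemma invsub_subspace: "invsub K U \<Longrightarrow> vec.subspace U"
  by (simp add: invsub_def)

lemma invsub_proj: "invsub K U \<Longrightarrow> ortho_proj U ** K i ** ortho_proj U = K i ** ortho_proj U"
  by (rule matrix_ext)
    (simp add: matrix_vector_mul_assoc[symmetric] proj_fix[symmetric] invsub_def proj_in)

lemma invsub_corner:
  assumes "invsub K U" "corner U X"
  shows "corner U (kraus c K X)"
proof -
  define p where "p = ortho_proj U"
  note sub = invsub_subspace[OF assms(1)]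
  have X: "X = p ** X ** p" using assms(2) by (simp add: corner_def p_def)
  have pK: "p ** (K i ** p) = K i ** p" for i
    using invsub_proj[OF assms(1)] by (simp add: p_def matrix_mul_assoc)
  have Kp: "p ** adj (K i) ** p = p ** adj (K i)" for i
    using arg_cong[OF pK[of i], of adj] by (simp add: adj_mult p_def proj_adj[OF sub] matrix_mul_assoc)
  have "K i ** X ** adj (K i) = p ** (K i ** X ** adj (K i)) ** p" for i
  proof -
    have "K i ** X ** adj (K i) = (K i ** p) ** X ** (p ** adj (K i))"
      by (subst X) (simp add: matrix_mul_assoc)
    also have "\<dots> = (p ** (K i ** p)) ** X ** (p ** adj (K i) ** p)" by (simp add: pK Kp)
    also have "\<dots> = p ** (K i ** (p ** X ** p) ** adj (K i)) ** p" by (simp add: matrix_mul_assoc)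
    also have "\<dots> = p ** (K i ** X ** adj (K i)) ** p" using X by simp
    finally show ?thesis .
  qed
  then have "corner U (K i ** X ** adj (K i))" for i by (simp add: corner_def p_def)
  then show ?thesis unfolding kraus_def by (intro corner_sum corner_scaleR)
qed

text \<open>The form of \<open>kraus c K X\<close> at \<open>y\<close> is the sum of the nonnegative
  numbers \<open>c i\<close> times the form of \<open>X\<close> at \<open>adj (K i) *v y\<close>; if
  the sum vanishes, every term does.\<close>

lemma kraus_kernel:
  assumes "psd X" "\<And>i. c i > 0" "kraus c K X *v y = 0"
  shows "X *v (adj (K i) *v y) = 0"
proof -
  have "0 = Re (cinner y (kraus c K X *v y))" using assms(3) by (simp add: ci.zero_right)
  also have "\<dots> = (\<Sum>i\<in>UNIV. c i * Re (cinner (adj (K i) *v y) (X *v (adj (K i) *v y))))"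
    by (simp add: kraus_def mv.sum_left ci.sum_right mv.scaleR_left ci.scaleR_right
        matrix_vector_mul_assoc[symmetric] cinner_adj')
  finally have *: "(\<Sum>i\<in>UNIV. c i * Re (cinner (adj (K i) *v y) (X *v (adj (K i) *v y)))) = 0" by simp
  have "c i * Re (cinner (adj (K i) *v y) (X *v (adj (K i) *v y))) = 0"
    using * assms(2) psd_Re[OF assms(1)]
    by (subst (asm) sum_nonneg_eq_0_iff) (auto intro: mult_nonneg_nonneg less_imp_le)
  then show ?thesis using assms(2)[of i] psd_kernel_iff[OF assms(1)] by simp
qed

text \<open>Testing an enclosure on the rank-one operator of \<open>x\<close> and on
  \<open>y\<close> orthogonal to \<open>U\<close>, \<open>kraus_kernel\<close> yields that
  \<open>x\<close> is orthogonal to \<open>adj (L i) *v y\<close>, that is, \<open>L i *v x\<close>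
  is orthogonal to \<open>y\<close>. Joint invariance then replaces the condition on supports
  everywhere.\<close>

lemma enclosure_iff_invsub: "enclosure L U \<longleftrightarrow> invsub L U"
proof
  assume inv: "invsub L U"
  show "enclosure L U"
    unfolding enclosure_def
  proof (intro conjI allI impI)
    show sub: "vec.subspace U" by (rule invsub_subspace[OF inv])
    fix \<omega> assume w: "psd \<omega>" "supp \<omega> \<subseteq> U"
    then have "corner U \<omega>" using supp_subset_iff_corner[OF sub psd_adj] by blast
    then have "corner U (channel L \<omega>)" unfolding channel_kraus by (rule invsub_corner[OF inv])
    moreover have "adj (channel L \<omega>) = channel L \<omega>" by (simp add: channel_kraus adj_kraus psd_adj w(1))
    ultimately show "supp (channel L \<omega>) \<subseteq> U" using supp_subset_iff_corner[OF sub] by blast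
  qed
next
  assume enc: "enclosure L U"
  then have sub: "vec.subspace U" by (simp add: enclosure_def)
  have "L i *v x \<in> U" if x: "x \<in> U" for i x
  proof (cases "x = 0")
    case True
    then show ?thesis using vec.subspace_0[OF sub] by (simp add: mv.zero_right)
  next
    case False
    have "supp (outer x x) \<subseteq> U"
      using corner_outer[OF sub x] supp_subset_iff_corner[OF sub psd_adj[OF psd_outer]] by blast
    then have "supp (channel L (outer x x)) \<subseteq> U" using enc psd_outer[of x] unfolding enclosure_def by blast
    moreover have "adj (channel L (outer x x)) = channel L (outer x x)"
      by (simp add: channel_kraus adj_kraus adj_outer)
    ultimately have "corner U (channel L (outer x x))" using supp_subset_iff_corner[OF sub] by blast
    then have c: "channel L (outer x x) ** ortho_proj U = channel L (outer x x)"
      by (rule cornerD[OF sub])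
    have "cinner y (L i *v x) = 0" if y: "y \<in> ortho_compl U" for y
    proof -
      have "channel L (outer x x) *v y = 0"
        using y proj_ker[OF sub] by (metis c matrix_vector_mul_assoc mv.zero_right)
      then have "outer x x *v (adj (L i) *v y) = 0"
        unfolding channel_kraus by (intro kraus_kernel[OF psd_outer]) auto
      then have "cinner x (adj (L i) *v y) = 0" using False by (simp add: outer_mult_vec)
      then show ?thesis using cinner_adj[of "L i" x y] cinner_commute[of y "L i *v x"] by simp
    qed
    then show ?thesis using ortho_compl_double[OF sub] by (auto simp: ortho_compl_def)
  qed
  then show "invsub L U" using sub by (simp add: invsub_def)
qed

text \<open>Minimality is stated for an arbitrary family \<open>K\<close> because it is applied not
  only to the Kraus operators but also to their compressions to an enclosure and to the adjoints of
  these.\<close>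

definition irred :: "('j \<Rightarrow> complex^'h^'h) \<Rightarrow> (complex^'h) set \<Rightarrow> bool" where
  "irred K U \<longleftrightarrow> invsub K U \<and> U \<noteq> {0} \<and> (\<forall>W. invsub K W \<longrightarrow> W \<subseteq> U \<longrightarrow> W = {0} \<or> W = U)"

lemma minimal_enclosure_iff_irred: "minimal_enclosure L U \<longleftrightarrow> irred L U"
  by (simp add: minimal_enclosure_def irred_def enclosure_iff_invsub)

text \<open>By \<open>kraus_kernel\<close> the kernel of \<open>X\<close> is invariant under all
  \<open>adj (K i)\<close>, so its orthogonal complement is invariant under all \<open>K i\<close>.
  The case \<open>r = 0\<close> occurs in \<open>kraus_trace_pos\<close>.\<close>

lemma invsub_supp_eigen:
  assumes "psd X" "\<And>i. c i > 0" "kraus c K X = r *\<^sub>R X"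
  shows "invsub K (supp X)"
  unfolding invsub_def
proof (intro conjI allI ballI subspace_supp)
  fix i x assume x: "x \<in> supp X"
  have "cinner y (K i *v x) = 0" if y: "X *v y = 0" for y
  proof -
    have "kraus c K X *v y = 0" using assms(3) y by (simp add: mv.scaleR_left)
    then have "X *v (adj (K i) *v y) = 0" by (intro kraus_kernel[OF assms(1,2)])
    then have "cinner (adj (K i) *v y) x = 0" using x by (simp add: supp_def ortho_compl_def)
    then show ?thesis by (simp add: cinner_adj')
  qed
  then show "K i *v x \<in> supp X" by (simp add: supp_def ortho_compl_def)
qed

lemma irred_supp:
  assumes "irred K U" "psd X" "corner U X" "X \<noteq> 0" "\<And>i. c i > 0" "kraus c K X = r *\<^sub>R X"
  shows "supp X = U"
proof -
  have "invsub K (supp X)" by (rule invsub_supp_eigen[OF assms(2,5,6)])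
  moreover have "supp X \<subseteq> U"
    using assms(1,3) supp_subset_iff_corner[of U X] psd_adj[OF assms(2)] by (simp add: irred_def invsub_def)
  moreover have "supp X \<noteq> {0}" using assms supp_eq_0 psd_adj by blast
  ultimately show ?thesis using assms(1) by (auto simp: irred_def)
qed

section \<open>Perron--Frobenius theory on a minimal invariant subspace\<close>

text \<open>If the image were 0, then \<open>X\<close> would be an eigenvector for the eigenvalue 0
  and hence have support \<open>U\<close>; every \<open>K i\<close> would then vanish on
  \<open>U\<close>. Positivity of this trace permits the normalisation in the Brouwer map.\<close>

lemma kraus_trace_pos:
  assumes irr: "irred K U" and c: "\<And>i. c i > 0" and nz: "\<exists>i. K i ** ortho_proj U \<noteq> 0"
    and X: "psd X" "corner U X" "X \<noteq> 0"
  shows "0 < Re (trace (kraus c K X))"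
proof (rule ccontr)
  assume "\<not> 0 < Re (trace (kraus c K X))"
  moreover have psdk: "psd (kraus c K X)" using X c less_imp_le by (intro psd_kraus) blast+
  ultimately have "Re (trace (kraus c K X)) = 0" using trace_psd(2) by fastforce
  then have 0: "kraus c K X = 0" using psd_trace_0[OF psdk] by blast
  have sub: "vec.subspace U" using irr by (simp add: irred_def invsub_def)
  have "supp X = U" using irred_supp[OF irr X c, where r = 0] 0 by simp
  have "K i *v x = 0" if "x \<in> U" for i x
  proof (rule cinner_ext)
    fix y
    have "X *v (adj (K i) *v y) = 0"
      using 0 by (intro kraus_kernel[where c = c and K = K and X = X] X c) (simp add: mv.zero_left)
    then have "cinner (adj (K i) *v y) x = 0"
      using that \<open>supp X = U\<close> unfolding supp_def ortho_compl_def by blast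
    then show "cinner y (K i *v x) = cinner y 0" by (simp add: cinner_adj' ci.zero_right)
  qed
  then have "K i ** ortho_proj U = 0" for i
    by (intro matrix_ext) (simp add: matrix_vector_mul_assoc[symmetric] proj_in[OF sub] mv.zero_left)
  with nz show False by blast
qed

lemma compact_states: "compact {X. psd X \<and> corner U X \<and> trace X = 1}"
proof -
  have "closed ({X. psd X} \<inter> {X. corner U X} \<inter> {X. trace X = 1})"
    by (intro closed_Int closed_psd closed_corner closed_Collect_eq continuous_intros
        linear_continuous_on linear_conv_bounded_linear[THEN iffD1] linear_trace)
  moreover have "{X. psd X} \<inter> {X. corner U X} \<inter> {X. trace X = 1} = {X. psd X \<and> corner U X \<and> trace X = 1}"
    by auto
  moreover obtain K where "\<And>\<omega> :: complex^'a^'a. psd \<omega> \<Longrightarrow> norm \<omega> \<le> K * Re (trace \<omega>)"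
    using norm_psd_le by blast
  then have "bounded {X :: complex^'a^'a. psd X \<and> corner U X \<and> trace X = 1}"
    unfolding bounded_iff by (intro exI[of _ K]) fastforce
  ultimately show ?thesis by (simp add: compact_eq_bounded_closed)
qed

text \<open>Brouwer's theorem applies to the Kraus map followed by division by the trace, on the
  compact convex set of states of the corner. Minimality of \<open>U\<close> forces the eigenvector
  to be faithful on \<open>U\<close>.\<close>

theorem perron_frobenius_exists:
  assumes irr: "irred K U" and c: "\<And>i. c i > 0" and nz: "\<exists>i. K i ** ortho_proj U \<noteq> 0"
  obtains X r where "psd X" "corner U X" "trace X = 1" "r > 0" "kraus c K X = r *\<^sub>R X" "supp X = U"
proof -
  define S where "S = {X. psd X \<and> corner U X \<and> trace X = 1}"
  have inv: "invsub K U" and sub: "vec.subspace U" and U0: "U \<noteq> {0}"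
    using irr by (auto simp: irred_def invsub_def)
  have convex: "convex S"
    unfolding convex_def S_def
    by (auto intro!: psd_add psd_scaleR corner_add corner_scaleR simp: tr_add tr_scaleR scaleR_complex
        simp flip: of_real_add)
  obtain x where x: "x \<in> U" "x \<noteq> 0" using U0 vec.subspace_0[OF sub] by blast
  have "(1 / (norm x)\<^sup>2) *\<^sub>R outer x x \<in> S"
    using x by (auto simp: S_def intro!: psd_scaleR psd_outer corner_scaleR corner_outer[OF sub])
      (simp add: tr_scaleR trace_outer cinner_self scaleR_complex flip: of_real_mult of_real_power)
  then have ne: "S \<noteq> {}" by blast
  define g where "g X = Re (trace (kraus c K X))" for X
  have pos: "g X > 0" if "X \<in> S" for X
    unfolding g_def using that by (intro kraus_trace_pos[OF irr c nz]) (auto simp: S_def tr_zero)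
  have cg: "continuous_on S g"
    unfolding g_def
    by (intro continuous_intros linear_continuous_on linear_conv_bounded_linear[THEN iffD1]
        linear_compose[OF linear_kraus linear_trace, unfolded o_def])
  obtain X where X: "X \<in> S" "(1 / g X) *\<^sub>R kraus c K X = X"
  proof (rule brouwer[of S "\<lambda>X. (1 / g X) *\<^sub>R kraus c K X"])
    show "compact S" unfolding S_def by (rule compact_states)
    show "convex S" "S \<noteq> {}" by fact+
    show "continuous_on S (\<lambda>X. (1 / g X) *\<^sub>R kraus c K X)"
      using pos by (intro continuous_intros cg continuous_on_kraus) force
    show "(\<lambda>X. (1 / g X) *\<^sub>R kraus c K X) \<in> S \<rightarrow> S"
    proof
      fix X assume XS: "X \<in> S"
      have psdk: "psd (kraus c K X)" using XS c less_imp_le by (intro psd_kraus) (auto simp: S_def)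
      have "trace (kraus c K X) = of_real (g X)" unfolding g_def by (rule trace_psd(3)[OF psdk])
      then have "trace ((1 / g X) *\<^sub>R kraus c K X) = 1"
        using pos[OF XS] by (simp add: tr_scaleR scaleR_complex flip: of_real_mult)
      then show "(1 / g X) *\<^sub>R kraus c K X \<in> S"
        using XS pos[OF XS] psdk by (auto simp: S_def intro!: psd_scaleR corner_scaleR invsub_corner[OF inv])
    qed
  qed
  have eig: "kraus c K X = g X *\<^sub>R X"
  proof -
    have "g X *\<^sub>R ((1 / g X) *\<^sub>R kraus c K X) = g X *\<^sub>R X" using X(2) by simp
    then show ?thesis using pos[OF X(1)] by simp
  qed
  have XS: "psd X" "corner U X" "trace X = 1" using X(1) by (auto simp: S_def)
  have "X \<noteq> 0" using XS(3) by (auto simp: tr_zero)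
  have "supp X = U" by (rule irred_supp[OF irr XS(1,2) \<open>X \<noteq> 0\<close> c eig])
  then show ?thesis using that[OF XS pos[OF X(1)] eig] by blast
qed

text \<open>Move from \<open>X\<close> along \<open>-N\<close> to the boundary of the positive cone.
  The point reached is an eigenvector with support smaller than \<open>U\<close>, so it is 0 by
  minimality; but it has the trace of \<open>X\<close>, since \<open>N\<close> has trace 0.\<close>

theorem perron_frobenius_unique:
  assumes irr: "irred K U" and c: "\<And>i. c i > 0"
    and X: "psd X" "corner U X" "X \<noteq> 0" "kraus c K X = r *\<^sub>R X"
    and N: "adj N = N" "corner U N" "Re (trace N) = 0" "kraus c K N = r *\<^sub>R N"
  shows "N = 0"
proof (rule ccontr)
  assume N0: "N \<noteq> 0"
  have suppX: "supp X = U" by (rule irred_supp[OF irr X(1,2,3) c X(4)])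
  \<comment> \<open>If the ray never left the cone, \<open>-N\<close> would be positive with trace
    0, hence 0.\<close>
  have "\<exists>t\<ge>0. \<not> psd (X - t *\<^sub>R N)"
  proof (rule ccontr)
    assume "\<not> ?thesis"
    then have *: "psd (X - t *\<^sub>R N)" if "t \<ge> 0" for t using that by blast
    have "psd (- N)"
      unfolding psd_iff_hermitian
    proof (intro conjI allI)
      show "adj (- N) = - N" using N(1) linear_neg[OF linear_adj, of N] by simp
      fix x
      define a b where "a = Re (cinner x (X *v x))" and "b = Re (cinner x (N *v x))"
      have le: "t * b \<le> a" if "t \<ge> 0" for t
        using psd_Re[OF *[OF that], of x]
        by (simp add: mv.diff_left ci.diff_right mv.scaleR_left ci.scaleR_right a_def b_def)
      have "b \<le> 0"
      proof (rule ccontr)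
        assume "\<not> b \<le> 0"
        moreover have "a \<ge> 0" using le[of 0] by simp
        ultimately have "((a + 1) / b) * b \<le> a" by (intro le) simp
        then show False using \<open>\<not> b \<le> 0\<close> by simp
      qed
      then show "0 \<le> Re (cinner x (- N *v x))"
        by (simp add: mv.minus_left ci.minus_right b_def)
    qed
    moreover have "Re (trace (- N)) = 0" using N(3) linear_neg[OF linear_trace, of N] by simp
    ultimately have "- N = 0" by (rule psd_trace_0)
    with N0 show False by simp
  qed
  then obtain t0 where "t0 \<ge> 0" "\<not> psd (X - t0 *\<^sub>R N)" by blast
  then obtain t where t: "t \<ge> 0" "psd (X - t *\<^sub>R N)" "supp (X - t *\<^sub>R N) \<subset> supp X"
    using psd_boundary[OF X(1) N(1), of t0] N(2) suppX by metis
  have "X - t *\<^sub>R N = 0"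
  proof (rule ccontr)
    assume "X - t *\<^sub>R N \<noteq> 0"
    moreover have "kraus c K (X - t *\<^sub>R N) = r *\<^sub>R (X - t *\<^sub>R N)"
      by (simp add: kraus_diff kraus_scaleR X(4) N(4) algebra_simps)
    ultimately have "supp (X - t *\<^sub>R N) = U"
      by (intro irred_supp[OF irr t(2) corner_diff[OF X(2) corner_scaleR[OF N(2)]]]) (use c in auto)
    with t(3) suppX show False by blast
  qed
  then have "Re (trace X) = t * Re (trace N)" by (simp add: tr_scaleR scaleR_complex)
  then show False using N(3) X(3) psd_trace_0[OF X(1)] by simp
qed

section \<open>Ergodic decomposition\<close>

text \<open>Bounded orbits exclude a Jordan block at the eigenvalue 1: if \<open>f (f x) = 0\<close>
  then the \<open>n\<close>-th iterate of \<open>x\<close> is \<open>x - n f x\<close>. So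
  \<open>f = 1 - T\<close> is injective on its range, in finite dimension it maps the range onto
  itself, and the space is the sum of kernel and range.\<close>

lemma fixed_point_decomposition:
  fixes T :: "'a::euclidean_space \<Rightarrow> 'a"
  assumes lin: "linear T" and bd: "\<And>x. \<exists>C. \<forall>n. norm ((T ^^ n) x) \<le> C"
  obtains k z where "T k = k" "x = k + (z - T z)"
proof -
  define f where "f x = x - T x" for x
  have linf: "linear f" unfolding f_def by (intro linear_compose_sub lin linear_ident)
  have ker: "f x = 0" if "f (f x) = 0" for x
  proof (rule ccontr)
    define y where "y = f x"
    assume "f x \<noteq> 0"
    then have y0: "norm y > 0" by (simp add: y_def)
    have Ty: "T y = y" using that by (simp add: y_def f_def)
    have "(T ^^ n) x = x - real n *\<^sub>R y" for n
    proof (induction n)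
      case (Suc n)
      have Tx: "T x = x - y" by (simp add: y_def f_def)
      have "(T ^^ Suc n) x = T (x - real n *\<^sub>R y)" using Suc by simp
      also have "\<dots> = x - real (Suc n) *\<^sub>R y"
        by (simp add: linear_diff[OF lin] linear_scale[OF lin] Ty Tx algebra_simps)
      finally show ?case .
    qed simp
    moreover obtain C where C: "\<And>n. norm ((T ^^ n) x) \<le> C" using bd by blast
    ultimately have "norm (real n *\<^sub>R y) \<le> C + norm x" for n
    proof -
      assume *: "\<And>n. (T ^^ n) x = x - real n *\<^sub>R y" and C: "\<And>n. norm ((T ^^ n) x) \<le> C"
      have "real n *\<^sub>R y = x - (T ^^ n) x" using *[of n] by simp
      then show ?thesis using norm_triangle_ineq4[of x "(T ^^ n) x"] C[of n] by simp
    qed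
    then have le: "real n * norm y \<le> C + norm x" for n by simp
    obtain n :: nat where "real n > (C + norm x) / norm y" using reals_Archimedean2 by blast
    then show False using le[of n] y0 by (simp add: field_simps)
  qed
  have "f ` range f = range f"
  proof (rule subspace_dim_equal)
    show "subspace (f ` range f)" "subspace (range f)"
      by (auto intro!: linear_subspace_image linf)
    show "f ` range f \<subseteq> range f" by blast
    have "inj_on f (range f)"
    proof (rule inj_onI)
      fix a b assume ab: "a \<in> range f" "b \<in> range f" "f a = f b"
      then obtain x y where xy: "a = f x" "b = f y" by blast
      have "f (f (x - y)) = 0" using ab xy by (simp add: linear_diff[OF linf])
      then have "f (x - y) = 0" by (rule ker)
      then show "a = b" by (simp add: xy linear_diff[OF linf])
    qed
    moreover have sp: "span (range f) = range f"
      using linear_subspace_image[OF linf subspace_UNIV] by (simp add: span_eq_iff)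
    ultimately show "dim (f ` range f) \<ge> dim (range f)" using dim_image_eq[OF linf, of "range f", unfolded sp] by simp
  qed
  then have "f x \<in> f ` range f" by blast
  then obtain z where z: "f x = f (f z)" by auto
  then have "f (x - f z) = 0" by (simp add: linear_diff[OF linf])
  then have "T (x - f z) = x - f z" by (simp add: f_def)
  then show ?thesis using that[of "x - f z" z] by (simp add: f_def)
qed

text \<open>The coboundary \<open>z - T z\<close> telescopes to the bounded term
  \<open>z - T^n z\<close>, which disappears after division by \<open>n\<close>.\<close>

lemma cesaro_limit:
  fixes T :: "'a::real_normed_vector \<Rightarrow> 'a"
  assumes lin: "linear T" and bd: "\<exists>C. \<forall>n. norm ((T ^^ n) z) \<le> C" and k: "T k = k"
  shows "(\<lambda>n. (1 / real n) *\<^sub>R (\<Sum>j<n. (T ^^ j) (k + (z - T z)))) \<longlonglongrightarrow> k"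
proof -
  have linn: "linear (T ^^ n)" for n
  proof (induction n)
    case 0
    show ?case by (simp add: linear_iff)
  next
    case (Suc n)
    from linear_compose[OF this lin] show ?case by (simp add: o_def)
  qed
  have kk: "(T ^^ n) k = k" for n by (induction n) (simp_all add: k)
  have sum: "(\<Sum>j<n. (T ^^ j) (k + (z - T z))) = real n *\<^sub>R k + (z - (T ^^ n) z)" for n
    by (induction n)
      (simp_all add: linear_add[OF linn] linear_diff[OF linn] kk algebra_simps funpow_swap1)
  obtain C where C: "\<And>n. norm ((T ^^ n) z) \<le> C" using bd by blast
  have lim: "(\<lambda>n. (1 / real n) *\<^sub>R (z - (T ^^ n) z)) \<longlonglongrightarrow> 0"
  proof (rule tendsto_0_le[where K = "norm z + C"])
    show "(\<lambda>n. 1 / real n) \<longlonglongrightarrow> 0" by (rule lim_1_over_n)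
    show "\<forall>\<^sub>F n in sequentially. norm ((1 / real n) *\<^sub>R (z - (T ^^ n) z)) \<le> norm (1 / real n) * (norm z + C)"
    proof (intro always_eventually allI)
      fix n
      have "norm (z - (T ^^ n) z) \<le> norm z + C"
        using norm_triangle_ineq4[of z "(T ^^ n) z"] C[of n] by linarith
      then show "norm ((1 / real n) *\<^sub>R (z - (T ^^ n) z)) \<le> norm (1 / real n) * (norm z + C)"
        by (simp add: divide_right_mono)
    qed
  qed
  have "\<forall>\<^sub>F n in sequentially. k + (1 / real n) *\<^sub>R (z - (T ^^ n) z)
      = (1 / real n) *\<^sub>R (\<Sum>j<n. (T ^^ j) (k + (z - T z)))"
    using eventually_gt_at_top[of 0]
    by eventually_elim (simp add: sum scaleR_add_right)
  moreover have "(\<lambda>n. k + (1 / real n) *\<^sub>R (z - (T ^^ n) z)) \<longlonglongrightarrow> k + 0"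
    by (intro tendsto_intros lim)
  ultimately show ?thesis by (simp add: tendsto_cong)
qed

lemma psd_trace_mult_0:
  assumes A: "psd (A :: complex^'h^'h)" and B: "psd B" and 0: "Re (trace (A ** B)) = 0"
  shows "A ** B = 0"
proof -
  obtain v :: "'h \<Rightarrow> complex^'h" where v: "A = (\<Sum>i\<in>UNIV. outer (v i) (v i))"
    using psd_decomposition[OF A] by blast
  have "Re (trace (A ** B)) = (\<Sum>i\<in>UNIV. Re (cinner (v i) (B *v v i)))"
    by (simp add: v mm.sum_left tr_sum trace_outer_mult)
  with 0 have "(\<Sum>i\<in>UNIV. Re (cinner (v i) (B *v v i))) = 0" by simp
  then have "Re (cinner (v i) (B *v v i)) = 0" for i
    using psd_Re[OF B] by (subst (asm) sum_nonneg_eq_0_iff) auto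
  then have Bv: "B *v v i = 0" for i using psd_kernel_iff[OF B] by simp
  have "outer (v i) (v i) ** B = 0" for i
    by (simp add: outer_mult psd_adj[OF B] Bv) (simp add: outer_def vec_eq_iff)
  then show ?thesis by (simp add: v mm.sum_left)
qed

lemma corner_trace: 
  assumes "vec.subspace U" "corner U X"
  shows "trace (X ** (ortho_proj U ** Y ** ortho_proj U)) = trace (X ** Y)"
proof -
  have "trace (X ** (ortho_proj U ** Y ** ortho_proj U)) = trace ((X ** ortho_proj U ** Y) ** ortho_proj U)"
    by (simp add: matrix_mul_assoc)
  also have "\<dots> = trace (ortho_proj U ** (X ** ortho_proj U ** Y))" by (rule trace_mul_sym)
  also have "\<dots> = trace (X ** Y)" using cornerD[OF assms] by (simp add: matrix_mul_assoc)
  finally show ?thesis .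
qed

lemma irredD:
  assumes "irred K U"
  shows "invsub K U" "vec.subspace U" "U \<noteq> {0}"
  using assms by (auto simp: irred_def invsub_def)

text \<open>A nonzero invariant subspace of least dimension inside \<open>U\<close> is minimal; the
  real dimension serves, since nested subspaces of equal real dimension coincide.\<close>

lemma irred_exists:
  assumes U: "invsub K U" "U \<noteq> {0}"
  shows "\<exists>W\<subseteq>U. irred K W"
proof -
  define P where "P W \<longleftrightarrow> invsub K W \<and> W \<noteq> {0} \<and> W \<subseteq> U" for W
  have "P U" using U by (simp add: P_def)
  then obtain W where W: "P W" "\<And>Y. P Y \<Longrightarrow> dim W \<le> dim Y"
    using ex_has_least_nat[of P U dim] by blast
  have "Y = {0} \<or> Y = W" if Y: "invsub K Y" "Y \<subseteq> W" for Y
  proof (rule ccontr)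
    assume n: "\<not> ?thesis"
    then have "P Y" using Y W by (auto simp: P_def)
    then have "dim W \<le> dim Y" by (rule W)
    then have "Y = W"
      using Y W by (intro subspace_dim_equal csubspace_imp_subspace) (auto simp: P_def invsub_def)
    with n show False by simp
  qed
  then show ?thesis using W(1) by (auto simp: P_def irred_def)
qed

section \<open>Orthogonality, spans and intertwiners\<close>

lemma corthogonal_iff: "corthogonal U W \<longleftrightarrow> W \<subseteq> ortho_compl U"
  by (auto simp: corthogonal_def ortho_compl_def)

lemma corthogonal_sym: "corthogonal U W \<Longrightarrow> corthogonal W U"
proof -
  assume *: "corthogonal U W"
  have "cinner x y = 0" if "x \<in> W" "y \<in> U" for x y
    using * that cinner_commute[of x y] by (simp add: corthogonal_def)
  then show ?thesis by (simp add: corthogonal_def)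
qed

lemma corthogonal_proj:
  assumes "vec.subspace U" "vec.subspace W"
  shows "corthogonal U W \<longleftrightarrow> ortho_proj U ** ortho_proj W = 0"
proof
  assume "corthogonal U W"
  then have "ortho_proj W *v x \<in> ortho_compl U" for x
    using proj_in[OF assms(2)] by (auto simp: corthogonal_iff)
  then have "ortho_proj U *v (ortho_proj W *v x) = 0" for x using proj_ker[OF assms(1)] by blast
  then show "ortho_proj U ** ortho_proj W = 0"
    by (intro matrix_ext) (simp add: matrix_vector_mul_assoc[symmetric] mv.zero_left)
next
  assume 0: "ortho_proj U ** ortho_proj W = 0"
  show "corthogonal U W"
    unfolding corthogonal_iff
  proof
    fix x assume "x \<in> W"
    then have "ortho_proj U *v x = (ortho_proj U ** ortho_proj W) *v x"
      using proj_fix[OF assms(2)] by (simp add: matrix_vector_mul_assoc[symmetric])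
    then show "x \<in> ortho_compl U" using 0 proj_ker[OF assms(1)] by (simp add: mv.zero_left)
  qed
qed

lemma corthogonal_span:
  assumes "\<And>U. U \<in> S \<Longrightarrow> corthogonal W U"
  shows "corthogonal W (vec.span (\<Union>S))"
  unfolding corthogonal_iff
  using assms by (intro vec.span_minimal subspace_ortho_compl) (auto simp: corthogonal_iff)

lemma invsub_span:
  assumes "\<And>U. U \<in> S \<Longrightarrow> invsub K U"
  shows "invsub K (vec.span (\<Union>S))"
  unfolding invsub_def
proof (intro conjI allI)
  show "vec.subspace (vec.span (\<Union>S))" by (rule vec.subspace_span)
  fix i
  have "vec.span (\<Union>S) \<subseteq> {x. K i *v x \<in> vec.span (\<Union>S)}"
  proof (rule vec.span_minimal)
    show "\<Union>S \<subseteq> {x. K i *v x \<in> vec.span (\<Union>S)}"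
    proof safe
      fix x U assume "x \<in> U" "U \<in> S"
      then have "K i *v x \<in> \<Union>S" using assms[of U] by (auto simp: invsub_def)
      then show "K i *v x \<in> vec.span (\<Union>S)" by (rule vec.span_base)
    qed
    show "vec.subspace {x. K i *v x \<in> vec.span (\<Union>S)}"
      by (auto simp: vec.subspace_def mv.zero_right mv.add_right vector_scalar_commute
          intro: vec.span_zero vec.span_add vec.span_scale)
  qed
  then show "\<forall>x\<in>vec.span (\<Union>S). K i *v x \<in> vec.span (\<Union>S)" by blast
qed

text \<open>The weights do not interact with the intertwining relation, so the same conjugation
  transports invariant states, means and tilted eigenvectors from one enclosure to another.\<close>

lemma kraus_intertwine:
  assumes LQ: "\<And>i. L i ** Q = Q ** L i ** P" and X: "P ** X = X" "X ** P = X" and P: "adj P = P"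
  shows "kraus c L (Q ** X ** adj Q) = Q ** kraus c L X ** adj Q"
proof -
  have *: "adj Q ** adj (L i) = P ** adj (L i) ** adj Q" for i
    using arg_cong[OF LQ[of i], of adj] by (simp add: adj_mult P matrix_mul_assoc)
  have "L i ** (Q ** X ** adj Q) ** adj (L i) = Q ** (L i ** X ** adj (L i)) ** adj Q" for i
  proof -
    have "L i ** (Q ** X ** adj Q) ** adj (L i) = (L i ** Q) ** X ** (adj Q ** adj (L i))"
      by (simp add: matrix_mul_assoc)
    also have "\<dots> = Q ** L i ** (P ** X ** P) ** adj (L i) ** adj Q"
      by (simp add: LQ * matrix_mul_assoc)
    also have "\<dots> = Q ** (L i ** X ** adj (L i)) ** adj Q" by (simp add: X matrix_mul_assoc)
    finally show ?thesis .
  qed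
  then show ?thesis
    by (simp add: kraus_def mm.sum_left mm.sum_right mm.scaleR_left mm.scaleR_right)
qed

lemma matrix_mult_norm_bound:
  obtains K where "K > 0" "\<And>A B. norm ((A :: complex^'h^'h) ** (B :: complex^'h^'h)) \<le> norm A * norm B * K"
proof -
  have "\<exists>K>0. \<forall>A B. norm ((A :: complex^'h^'h) ** (B :: complex^'h^'h)) \<le> norm A * norm B * K"
    by (rule mm.pos_bounded)
  then show ?thesis using that by (elim exE conjE) metis
qed

lemma trace_norm_bound:
  obtains K where "K > 0" "\<And>A. norm (trace (A :: complex^'h^'h)) \<le> norm A * K"
proof -
  have "\<exists>K>0. \<forall>A. norm (trace (A :: complex^'h^'h)) \<le> norm A * K"
    by (rule bounded_linear.pos_bounded[OF linear_trace[unfolded linear_conv_bounded_linear]])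
  then show ?thesis using that by (elim exE conjE) metis
qed

section \<open>The local channel and its dual\<close>

locale kraus_channel =
  fixes L :: "'j::finite \<Rightarrow> complex^'h^'h"
  assumes kraus: "(\<Sum>i\<in>UNIV. adj (L i) ** L i) = mat 1"
begin

abbreviation "T \<equiv> channel L"
abbreviation "T' \<equiv> dual_channel L"

lemma linear_T: "linear T" and linear_T': "linear T'"
  by (simp_all add: channel_kraus dual_channel_kraus linear_kraus)

lemma dual_1: "T' (mat 1) = mat 1"
  using kraus by (simp add: dual_channel_def)

lemma trace_T_mult: "trace (T X ** Y) = trace (X ** T' Y)"
  unfolding channel_kraus dual_channel_kraus by (rule trace_kraus_dual)

lemma trace_T: "trace (T X) = trace X"
  using trace_T_mult[of X "mat 1"] by (simp add: dual_1)

lemma psd_T: "psd X \<Longrightarrow> psd (T X)" and psd_T': "psd X \<Longrightarrow> psd (T' X)"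
  by (simp_all add: channel_kraus dual_channel_kraus psd_kraus)

lemma linear_T_pow: "linear (T ^^ n)"
proof (induction n)
  case (Suc n)
  from linear_compose[OF this linear_T] show ?case by (simp add: o_def)
qed (simp add: linear_iff)

lemma linear_T'_pow: "linear (T' ^^ n)"
proof (induction n)
  case (Suc n)
  from linear_compose[OF this linear_T'] show ?case by (simp add: o_def)
qed (simp add: linear_iff)

lemma trace_T_pow: "trace ((T ^^ n) X) = trace X"
  by (induction n) (simp_all add: trace_T)

lemma psd_T_pow: "psd X \<Longrightarrow> psd ((T ^^ n) X)" and psd_T'_pow: "psd X \<Longrightarrow> psd ((T' ^^ n) X)"
  by (induction n) (simp_all add: psd_T psd_T')

lemma trace_T_pow_mult: "trace ((T ^^ n) X ** Y) = trace (X ** (T' ^^ n) Y)"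
proof (induction n arbitrary: Y)
  case (Suc n)
  then show ?case using funpow_swap1[of T' n Y] by (simp add: trace_T_mult)
qed simp

lemma T_pow_mat: "(T ^^ n) (mat c ** X) = mat c ** (T ^^ n) X"
  by (induction n) (simp_all add: channel_kraus kraus_mat)

lemma corner_T_pow: "invsub L U \<Longrightarrow> corner U X \<Longrightarrow> corner U ((T ^^ n) X)"
  by (induction n) (simp_all add: channel_kraus invsub_corner)

text \<open>For positive \<open>X\<close> the norm is controlled by the trace, which the channel
  preserves; \<open>psd_induct\<close> extends this to all matrices.\<close>

lemma bounded_orbit_T: "\<exists>C. \<forall>n. norm ((T ^^ n) X) \<le> C"
proof (induction X rule: psd_induct)
  case (psd X)
  obtain K where K: "\<And>\<omega> :: complex^'h^'h. psd \<omega> \<Longrightarrow> norm \<omega> \<le> K * Re (trace \<omega>)"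
    using norm_psd_le by blast
  have "norm ((T ^^ n) X) \<le> K * Re (trace X)" for n
    using K[OF psd_T_pow[OF psd, of n]] by (simp add: trace_T_pow)
  then show ?case by blast
next
  case (add X Y)
  then obtain C D where "\<And>n. norm ((T ^^ n) X) \<le> C" "\<And>n. norm ((T ^^ n) Y) \<le> D" by blast
  then have "norm ((T ^^ n) (X + Y)) \<le> C + D" for n
    unfolding linear_add[OF linear_T_pow] by (rule norm_triangle_mono)
  then show ?case by blast
next
  case (scale c X)
  then obtain C where C: "\<And>n. norm ((T ^^ n) X) \<le> C" by blast
  obtain K where K: "K > 0" "\<And>A B. norm ((A :: complex^'h^'h) ** (B :: complex^'h^'h)) \<le> norm A * norm B * K"
    using matrix_mult_norm_bound by blast
  have "norm ((T ^^ n) (mat c ** X)) \<le> norm (mat c :: complex^'h^'h) * C * K" for n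
  proof -
    have "norm ((T ^^ n) (mat c ** X)) \<le> norm (mat c :: complex^'h^'h) * norm ((T ^^ n) X) * K"
      unfolding T_pow_mat by (rule K)
    also have "\<dots> \<le> norm (mat c :: complex^'h^'h) * C * K"
      using C K(1) by (intro mult_right_mono mult_left_mono) auto
    finally show ?thesis .
  qed
  then show ?case by blast
qed

text \<open>Every coordinate of the dual orbit of \<open>Y\<close> is a pairing of \<open>Y\<close>
  with an orbit of the channel, so boundedness is inherited by duality.\<close>

lemma bounded_orbit_T': "\<exists>C. \<forall>n. norm ((T' ^^ n) Y) \<le> C"
proof -
  have "\<exists>C. \<forall>n. \<bar>(T' ^^ n) Y \<bullet> b\<bar> \<le> C" for b
  proof -
    obtain C where C: "\<And>n. norm ((T ^^ n) (adj b)) \<le> C" using bounded_orbit_T by blast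
    obtain K where K: "K > 0" "\<And>A B. norm ((A :: complex^'h^'h) ** (B :: complex^'h^'h)) \<le> norm A * norm B * K"
      using matrix_mult_norm_bound by blast
    obtain K' where K': "K' > 0" "\<And>A. norm (trace (A :: complex^'h^'h)) \<le> norm A * K'"
      using trace_norm_bound by blast
    have "\<bar>(T' ^^ n) Y \<bullet> b\<bar> \<le> C * norm Y * K * K'" for n
    proof -
      have "\<bar>(T' ^^ n) Y \<bullet> b\<bar> = \<bar>Re (trace (adj b ** (T' ^^ n) Y))\<bar>"
        by (subst inner_commute) (simp add: inner_matrix_eq)
      also have "\<dots> \<le> cmod (trace ((T ^^ n) (adj b) ** Y))"
        unfolding trace_T_pow_mult by (rule abs_Re_le_cmod)
      also have "\<dots> \<le> norm ((T ^^ n) (adj b) ** Y) * K'" by (rule K')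
      also have "\<dots> \<le> norm ((T ^^ n) (adj b)) * norm Y * K * K'"
        using K K' by (intro mult_right_mono) auto
      also have "\<dots> \<le> C * norm Y * K * K'"
        using C K K' by (intro mult_right_mono) auto
      finally show ?thesis .
    qed
    then show ?thesis by (intro exI allI)
  qed
  then have "\<forall>b. \<exists>C. \<forall>n. \<bar>(T' ^^ n) Y \<bullet> b\<bar> \<le> C" ..
  from choice[OF this] obtain C where C: "\<And>b n. \<bar>(T' ^^ n) Y \<bullet> b\<bar> \<le> C b" by blast
  have "norm ((T' ^^ n) Y) \<le> (\<Sum>b\<in>Basis. C b)" for n
    by (rule order_trans[OF norm_le_l1 sum_mono]) (rule C)
  then show ?thesis by blast
qed

lemma invariant_stateI: "psd \<tau> \<Longrightarrow> T \<tau> = \<tau> \<Longrightarrow> \<tau> \<noteq> 0 \<Longrightarrow> invariant_state L ((1 / Re (trace \<tau>)) *\<^sub>R \<tau>)"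
proof -
  assume \<tau>: "psd \<tau>" "T \<tau> = \<tau>" "\<tau> \<noteq> 0"
  define r where "r = Re (trace \<tau>)"
  have "r \<noteq> 0" using psd_trace_0 \<tau> unfolding r_def by blast
  moreover have "trace \<tau> = of_real r" unfolding r_def by (rule trace_psd(3)[OF \<tau>(1)])
  moreover have "r \<ge> 0" unfolding r_def by (rule trace_psd(2)[OF \<tau>(1)])
  ultimately have "invariant_state L ((1 / r) *\<^sub>R \<tau>)"
    using \<tau>(1,2) by (simp add: invariant_state_def psd_scaleR linear_scale[OF linear_T] tr_scaleR
        scaleR_complex)
  then show ?thesis by (simp add: r_def)
qed

text \<open>A state supported in \<open>U\<close> has an invariant state supported in \<open>U\<close> as the limit of its
  Cesaro means, and a fixed point of the compressed dual takes the same value at both.\<close>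
lemma fixed_dual_zero:
  assumes U: "invsub L U" and Y: "corner U Y" "ortho_proj U ** T' Y ** ortho_proj U = Y"
    and 0: "\<And>\<tau>. invariant_state L \<tau> \<Longrightarrow> corner U \<tau> \<Longrightarrow> trace (\<tau> ** Y) = 0"
  shows "Y = 0"
proof -
  note sub = invsub_subspace[OF U]
  have zero: "trace (\<omega> ** Y) = 0" if \<omega>: "psd \<omega>" "corner U \<omega>" for \<omega>
  proof -
    obtain k z where kz: "T k = k" "\<omega> = k + (z - T z)"
      using fixed_point_decomposition[OF linear_T bounded_orbit_T] by metis
    define M where "M n = (1 / real n) *\<^sub>R (\<Sum>j<n. (T ^^ j) \<omega>)" for n
    have lim: "M \<longlonglongrightarrow> k"
      unfolding M_def kz(2) by (rule cesaro_limit[OF linear_T bounded_orbit_T kz(1)])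
    have "psd (M n)" for n
      unfolding M_def by (intro psd_scaleR psd_sum psd_T_pow \<omega>) simp
    then have pk: "psd k" by (rule psd_limit[OF _ lim])
    have "corner U (M n)" for n
      unfolding M_def by (intro corner_scaleR corner_sum corner_T_pow U \<omega>)
    then have ck: "corner U k" by (rule corner_limit[OF _ lim])
    have k0: "trace (k ** Y) = 0"
    proof (cases "k = 0")
      case False
      define r where "r = 1 / Re (trace k)"
      have "Re (trace k) \<noteq> 0" using psd_trace_0 pk False by blast
      then have r: "r \<noteq> 0" by (simp add: r_def)
      have "trace ((r *\<^sub>R k) ** Y) = 0"
        unfolding r_def by (intro 0 invariant_stateI pk kz False corner_scaleR ck)
      then show ?thesis using r by (simp add: mm.scaleR_left tr_scaleR)
    qed (simp add: mm.zero_left tr_zero)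
    \<comment> \<open>The orbit of \<omega> stays in the corner, where a pairing sees only the
      compression of \<open>T' Y\<close>, that is \<open>Y\<close> itself.\<close>
    have step: "trace ((T ^^ j) \<omega> ** Y) = trace (\<omega> ** Y)" for j
    proof (induction j)
      case (Suc j)
      have "trace ((T ^^ Suc j) \<omega> ** Y) = trace ((T ^^ j) \<omega> ** T' Y)" by (simp add: trace_T_mult)
      also have "\<dots> = trace ((T ^^ j) \<omega> ** (ortho_proj U ** T' Y ** ortho_proj U))"
        by (rule corner_trace[OF sub corner_T_pow[OF U \<omega>(2)], symmetric])
      finally show ?case using Suc Y(2) by simp
    qed simp
    have "trace (M n ** Y) = trace (\<omega> ** Y)" if "n > 0" for n
      using that by (simp add: M_def mm.scaleR_left mm.sum_left tr_scaleR tr_sum step scaleR_complex)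
    then have "\<forall>\<^sub>F n in sequentially. trace (M n ** Y) = trace (\<omega> ** Y)"
      by (intro eventually_mono[OF eventually_gt_at_top[of 0]])
    moreover have "(\<lambda>n. trace (M n ** Y)) \<longlonglongrightarrow> trace (k ** Y)"
      by (intro bounded_linear.tendsto[OF linear_trace[unfolded linear_conv_bounded_linear]]
          mm.tendsto lim tendsto_const)
    ultimately have "(\<lambda>n. trace (\<omega> ** Y)) \<longlonglongrightarrow> trace (k ** Y)"
      by (simp cong: tendsto_cong)
    then show ?thesis using k0 LIMSEQ_unique tendsto_const by metis
  qed
  show ?thesis
  proof (rule quadratic_form_zero)
    fix x
    let ?y = "ortho_proj U *v x"
    have "cinner ?y (Y *v ?y) = 0"
      using zero[OF psd_outer corner_outer[OF sub proj_in[OF sub]], of x] by (simp add: trace_outer_mult)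
    then have "cinner x ((ortho_proj U ** Y ** ortho_proj U) *v x) = 0"
      by (simp add: cinner_adj proj_adj[OF sub] matrix_vector_mul_assoc[symmetric])
    then show "cinner x (Y *v x) = 0" using Y(1) by (simp add: corner_def)
  qed
qed

lemma invsub_UNIV: "invsub L UNIV"
  by (simp add: invsub_def)

text \<open>Decompose \<open>Y\<close> into a fixed point of the dual and a coboundary. Invariant
  states annihilate coboundaries, hence also the fixed part, which is then 0 by
  \<open>fixed_dual_zero\<close>. The normalisation of \<open>B\<close> is what makes the second
  corrector equation solvable later.\<close>

lemma dual_solve:
  assumes "\<And>\<tau>. invariant_state L \<tau> \<Longrightarrow> trace (\<tau> ** Y) = 0"
  obtains B where "B - T' B = Y" "\<And>\<tau>. invariant_state L \<tau> \<Longrightarrow> trace (\<tau> ** B) = 0"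
proof -
  have inv: "trace (\<tau> ** (z - T' z)) = 0" if "invariant_state L \<tau>" for \<tau> z
    using that trace_T_mult[of \<tau> z] by (simp add: invariant_state_def mm.diff_right tr_diff)
  obtain k z where kz: "T' k = k" "Y = k + (z - T' z)"
    using fixed_point_decomposition[OF linear_T' bounded_orbit_T'] by metis
  have "k = 0"
  proof (rule fixed_dual_zero[OF invsub_UNIV])
    fix \<tau> assume \<tau>: "invariant_state L \<tau>"
    have "k = Y - (z - T' z)" using kz(2) by simp
    then show "trace (\<tau> ** k) = 0"
      using assms[OF \<tau>] inv[OF \<tau>, of z] by (simp only: mm.diff_right[of \<tau> Y] tr_diff) simp
  qed (simp_all add: kz)
  \<comment> \<open>The preimage \<open>z\<close> may contain a fixed part; dropping it leaves the
    coboundary \<open>w - T' w\<close>, which still solves the equation and is annihilated by the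
    invariant states.\<close>
  obtain k' w where w: "T' k' = k'" "z = k' + (w - T' w)"
    using fixed_point_decomposition[OF linear_T' bounded_orbit_T'] by metis
  have "(w - T' w) - T' (w - T' w) = Y"
    using w kz \<open>k = 0\<close> by (simp add: linear_add[OF linear_T'] linear_diff[OF linear_T'])
  then show ?thesis using that inv by blast
qed

section \<open>Invariant states of minimal enclosures\<close>

lemma enclosure_nonzero: "invsub L U \<Longrightarrow> U \<noteq> {0} \<Longrightarrow> \<exists>i. L i ** ortho_proj U \<noteq> 0"
proof (rule ccontr)
  assume U: "invsub L U" "U \<noteq> {0}" "\<not> (\<exists>i. L i ** ortho_proj U \<noteq> 0)"
  have "ortho_proj U = (\<Sum>i\<in>UNIV. adj (L i) ** (L i ** ortho_proj U))"
    using arg_cong[OF kraus, of "\<lambda>x. x ** ortho_proj U"] by (simp add: mm.sum_left matrix_mul_assoc)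
  also have "\<dots> = 0" using U by (simp add: mm.zero_right)
  finally have "x = 0" if "x \<in> U" for x
    using that proj_fix[OF invsub_subspace[OF U(1)]] by (metis mv.zero_left)
  then show False using U(2) vec.subspace_0[OF invsub_subspace[OF U(1)]] by auto
qed

text \<open>The Perron-Frobenius eigenvector for unit weights is the state sought: the channel
  preserves the trace, which forces the eigenvalue to be 1.\<close>

lemma irred_state_exists:
  assumes "irred L U"
  shows "\<exists>\<tau>. invariant_state L \<tau> \<and> supp \<tau> = U"
proof -
  obtain X r where X: "psd X" "corner U X" "trace X = 1" "r > 0" "kraus (\<lambda>_. 1) L X = r *\<^sub>R X" "supp X = U"
    using perron_frobenius_exists[OF assms, of "\<lambda>_. 1"] enclosure_nonzero irredD[OF assms] by auto
  have "trace (T X) = r *\<^sub>R trace X" using X(5) by (simp add: channel_kraus tr_scaleR)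
  then have "r = 1" using X(3) by (simp add: trace_T scaleR_complex)
  then show ?thesis using X by (auto simp: invariant_state_def channel_kraus)
qed

lemma irred_state_unique:
  assumes U: "irred L U" and "invariant_state L \<tau>" "corner U \<tau>" "invariant_state L \<tau>'" "corner U \<tau>'"
  shows "\<tau> = \<tau>'"
proof -
  have "\<tau> - \<tau>' = 0"
  proof (rule perron_frobenius_unique[OF U, of "\<lambda>_. 1" \<tau> 1])
    show "\<tau> \<noteq> 0" using assms(2) by (auto simp: invariant_state_def tr_zero)
    show "adj (\<tau> - \<tau>') = \<tau> - \<tau>'" using assms by (simp add: invariant_state_def psd_adj adj_diff)
  qed (use assms in \<open>auto simp: invariant_state_def channel_kraus tr_diff kraus_diff corner_diff\<close>)
  then show ?thesis by simp
qed

abbreviation "\<tau> \<equiv> enclosure_state L"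

lemma invariant_state_corner:
  "invariant_state L \<sigma> \<Longrightarrow> vec.subspace U \<Longrightarrow> supp \<sigma> \<subseteq> U \<longleftrightarrow> corner U \<sigma>"
  by (rule supp_subset_iff_corner) (auto simp: invariant_state_def psd_adj)

lemma enclosure_state:
  assumes U: "irred L U"
  shows "invariant_state L (\<tau> U)" "supp (\<tau> U) = U" "corner U (\<tau> U)"
proof -
  have "\<exists>!\<sigma>. invariant_state L \<sigma> \<and> supp \<sigma> = U"
  proof (rule ex_ex1I[OF irred_state_exists[OF U]])
    fix \<sigma> \<sigma>' assume s: "invariant_state L \<sigma> \<and> supp \<sigma> = U" "invariant_state L \<sigma>' \<and> supp \<sigma>' = U"
    then have "corner U \<sigma>" "corner U \<sigma>'" using invariant_state_corner irredD(2)[OF U] by blast+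
    with s show "\<sigma> = \<sigma>'" using irred_state_unique[OF U] by blast
  qed
  then have "invariant_state L (\<tau> U) \<and> supp (\<tau> U) = U"
    unfolding enclosure_state_def by (rule theI')
  then show "invariant_state L (\<tau> U)" "supp (\<tau> U) = U" by auto
  then show "corner U (\<tau> U)" using invariant_state_corner irredD(2)[OF U] by blast
qed

lemma enclosure_stateD:
  assumes U: "irred L U"
  shows "psd (\<tau> U)" "trace (\<tau> U) = 1" "T (\<tau> U) = \<tau> U"
  using enclosure_state[OF U] by (auto simp: invariant_state_def)

lemma enclosure_state_eq: "irred L U \<Longrightarrow> invariant_state L \<sigma> \<Longrightarrow> corner U \<sigma> \<Longrightarrow> \<sigma> = \<tau> U"
  using irred_state_unique enclosure_state by blast

text \<open>Subtracting the largest possible multiple of a minimal invariant state lowers the dimension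
  of the support.\<close>
lemma psd_fixed_induct [consumes 2, case_names zero step]:
  assumes "psd \<sigma>" "T \<sigma> = \<sigma>"
    and zero: "P 0"
    and step: "\<And>W t Z. irred L W \<Longrightarrow> t \<ge> 0 \<Longrightarrow> P Z \<Longrightarrow> P (Z + t *\<^sub>R \<tau> W)"
  shows "P \<sigma>"
  using assms(1,2)
proof (induction "dim (supp \<sigma>)" arbitrary: \<sigma> rule: less_induct)
  case less
  show ?case
  proof (cases "\<sigma> = 0")
    case False
    note \<sigma> = less.prems
    have inv: "invsub L (supp \<sigma>)"
      using \<sigma> by (intro invsub_supp_eigen[where c = "\<lambda>_. 1" and r = 1]) (auto simp: channel_kraus)
    have "supp \<sigma> \<noteq> {0}" using False supp_eq_0 psd_adj \<sigma> by blast
    then obtain W where W: "W \<subseteq> supp \<sigma>" "irred L W" using irred_exists[OF inv] by blast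
    note \<tau>W = enclosure_stateD[OF W(2)]
    \<comment> \<open>Since \<open>\<tau> W\<close> has trace 1, the trace of
      \<open>\<sigma> - t0 *\<^sub>R \<tau> W\<close> is -1, so this point lies outside the positive
      cone.\<close>
    define t0 where "t0 = Re (trace \<sigma>) + 1"
    have t0: "t0 \<ge> 0" using trace_psd(2)[OF \<sigma>(1)] by (simp add: t0_def)
    have "Re (trace (\<sigma> - t0 *\<^sub>R \<tau> W)) < 0"
      using \<tau>W(2) by (simp add: tr_diff tr_scaleR t0_def)
    then have "\<not> psd (\<sigma> - t0 *\<^sub>R \<tau> W)" using trace_psd(2) by fastforce
    moreover have "corner (supp \<sigma>) (\<tau> W)"
      using W(1) enclosure_state[OF W(2)] invariant_state_corner[OF _ subspace_supp] by blast
    ultimately obtain t where t: "t \<ge> 0" "psd (\<sigma> - t *\<^sub>R \<tau> W)" "supp (\<sigma> - t *\<^sub>R \<tau> W) \<subset> supp \<sigma>"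
      using psd_boundary[OF \<sigma>(1) psd_adj[OF \<tau>W(1)] _ t0] by blast
    define Z where "Z = \<sigma> - t *\<^sub>R \<tau> W"
    have fixZ: "T Z = Z"
      by (simp add: Z_def linear_diff[OF linear_T] linear_scale[OF linear_T] \<sigma> \<tau>W)
    have "dim (supp Z) < dim (supp \<sigma>)"
    proof (rule ccontr)
      assume "\<not> dim (supp Z) < dim (supp \<sigma>)"
      then have "supp Z = supp \<sigma>"
        using t(3) by (intro subspace_dim_equal csubspace_imp_subspace subspace_supp) (auto simp: Z_def)
      with t(3) show False by (simp add: Z_def)
    qed
    then have "P Z" using less.hyps t(2) fixZ by (simp add: Z_def)
    then have "P (Z + t *\<^sub>R \<tau> W)" by (rule step[OF W(2) t(1)])
    then show ?thesis by (simp add: Z_def)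
  qed (simp add: zero)
qed

text \<open>By \<open>psd_fixed_induct\<close> an invariant state is a nonnegative combination of
  states of minimal enclosures, so these suffice as test states.\<close>

lemma trace_invariant_zeroI:
  assumes "\<And>W. irred L W \<Longrightarrow> trace (\<tau> W ** Y) = 0" "invariant_state L \<sigma>"
  shows "trace (\<sigma> ** Y) = 0"
proof -
  have "psd \<sigma>" "T \<sigma> = \<sigma>" using assms(2) by (auto simp: invariant_state_def)
  then show ?thesis
    by (induction \<sigma> rule: psd_fixed_induct)
      (simp_all add: mm.zero_left tr_zero mm.add_left mm.scaleR_left tr_add tr_scaleR assms(1))
qed

section \<open>Non-orthogonal minimal enclosures\<close>

text \<open>Write \<open>p\<close> for the projection. Invariance says that \<open>1 - p\<close>
  kills \<open>L i ** p\<close>, so the dual of \<open>1 - p\<close> vanishes on \<open>U\<close>.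
  Hence the dual of \<open>p\<close> has \<open>p\<close> as its diagonal block on \<open>U\<close>
  and no off-diagonal part; the increment lives on the complement, where it is visibly
  positive.\<close>

lemma dual_proj:
  assumes U: "invsub L U"
  shows "T' (ortho_proj U) - ortho_proj U
    = (mat 1 - ortho_proj U) ** T' (ortho_proj U) ** (mat 1 - ortho_proj U)"
proof -
  define p q where "p = ortho_proj U" and "q = mat 1 - p"
  note sub = invsub_subspace[OF U]
  have pp: "p ** p = p" "adj p = p" unfolding p_def by (rule proj_idem[OF sub], rule proj_adj[OF sub])
  have qL: "q ** L i ** p = 0" for i
    using invsub_proj[OF U, of i] by (simp add: q_def p_def mm.diff_left)
  have "T' q ** p = (\<Sum>i\<in>UNIV. adj (L i) ** (q ** L i ** p))"
    by (simp add: dual_channel_def mm.sum_left matrix_mul_assoc)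
  then have Tqp: "T' q ** p = 0" by (simp add: qL mm.zero_right)
  have Tq: "T' q = mat 1 - T' p" by (simp add: q_def linear_diff[OF linear_T'] dual_1)
  then have Tpp: "T' p ** p = p" using Tqp by (simp add: mm.diff_left)
  have adjT: "adj (T' p) = T' p" by (simp add: dual_channel_kraus adj_kraus pp)
  then have pTp: "p ** T' p = p" using arg_cong[OF Tpp, of adj] by (simp add: adj_mult pp)
  have "q ** T' p ** q = T' p - p"
    by (simp add: q_def mm.diff_left mm.diff_right pTp Tpp pp)
  then show ?thesis by (simp add: q_def p_def)
qed

lemma psd_dual_proj_diff:
  assumes U: "invsub L U"
  shows "psd (T' (ortho_proj U) - ortho_proj U)"
proof -
  note sub = invsub_subspace[OF U]
  show ?thesis
    unfolding dual_proj[OF U]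
    using psd_conj[OF psd_T'[OF psd_proj[OF sub]], of "mat 1 - ortho_proj U"]
    by (simp add: adj_diff proj_adj[OF sub])
qed

text \<open>Recurrent mass does not flow into \<open>U\<close> from outside: the increment
  \<open>T' p - p\<close> is positive and, by invariance of \<sigma>, has trace 0 against \<sigma>,
  so it vanishes on the support of \<sigma>. For \<open>x\<close> orthogonal to \<open>U\<close>
  this leaves no component of \<open>L i *v x\<close> in \<open>U\<close>.\<close>

lemma orthocomplement_invariant:
  assumes U: "invsub L U" and \<sigma>: "psd \<sigma>" "T \<sigma> = \<sigma>" and x: "x \<in> supp \<sigma>" "x \<in> ortho_compl U"
  shows "L i *v x \<in> ortho_compl U"
proof -
  define p D where "p = ortho_proj U" and "D = T' p - p"
  note sub = invsub_subspace[OF U]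
  have D: "psd D" unfolding D_def p_def by (rule psd_dual_proj_diff[OF U])
  have "trace (\<sigma> ** D) = 0"
    using trace_T_mult[of \<sigma> p] \<sigma>(2) by (simp add: D_def mm.diff_right tr_diff)
  then have "\<sigma> ** D = 0" using psd_trace_mult_0[OF \<sigma>(1) D] by simp
  then have "\<sigma> *v (D *v y) = 0" for y by (simp add: matrix_vector_mul_assoc mv.zero_left)
  then have "cinner (D *v y) x = 0" for y using x(1) by (simp add: supp_def ortho_compl_def)
  then have "cinner y (D *v x) = 0" for y using cinner_adj[of D y x] psd_adj[OF D] by simp
  then have "D *v x = 0" by (intro cinner_ext) (simp add: ci.zero_right)
  moreover have "p *v x = 0" using x(2) proj_ker[OF sub] by (simp add: p_def)
  ultimately have "T' p *v x = 0" by (simp add: D_def mv.diff_left)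
  then have "p *v (adj (adj (L i)) *v x) = 0"
    unfolding dual_channel_kraus by (intro kraus_kernel) (auto simp: p_def psd_proj[OF sub])
  then show ?thesis using proj_ker[OF sub] by (simp add: p_def)
qed

text \<open>The support of the invariant operator \<open>\<tau> W + \<tau> W'\<close> contains both
  enclosures. For \<open>x\<close> in \<open>W'\<close>, the part of \<open>x\<close> in
  \<open>W\<close> stays in \<open>W\<close>, and the rest stays orthogonal to \<open>W\<close> by
  \<open>orthocomplement_invariant\<close>; so the projection onto \<open>W\<close> commutes with
  \<open>L i\<close> on \<open>W'\<close>.\<close>

lemma intertwine:
  assumes W: "irred L W" and W': "irred L W'"
  shows "ortho_proj W ** L i ** ortho_proj W' = L i ** ortho_proj W ** ortho_proj W'"
proof (rule matrix_ext)
  fix y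
  define p x where "p = ortho_proj W" and "x = ortho_proj W' *v y"
  note sub = irredD(2)[OF W]
  define \<sigma> where "\<sigma> = \<tau> W + \<tau> W'"
  note s = enclosure_stateD[OF W] enclosure_stateD[OF W']
  have \<sigma>: "psd \<sigma>" "T \<sigma> = \<sigma>"
    using s by (simp_all add: \<sigma>_def psd_add linear_add[OF linear_T])
  have "{z. \<sigma> *v z = 0} \<subseteq> {z. \<tau> W *v z = 0} \<inter> {z. \<tau> W' *v z = 0}"
  proof safe
    fix z assume "\<sigma> *v z = 0"
    then have "Re (cinner z (\<tau> W *v z)) + Re (cinner z (\<tau> W' *v z)) = 0"
      by (simp add: \<sigma>_def ci.zero_right mv.add_left flip: ci.add_right plus_complex.sel(1))
    then have "Re (cinner z (\<tau> W *v z)) = 0" "Re (cinner z (\<tau> W' *v z)) = 0"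
      using psd_Re[OF s(1), of z] psd_Re[OF s(4), of z] by linarith+
    then show "\<tau> W *v z = 0" "\<tau> W' *v z = 0"
      using psd_kernel_iff[OF s(1)] psd_kernel_iff[OF s(4)] by auto
  qed
  then have sup: "W \<subseteq> supp \<sigma>" "W' \<subseteq> supp \<sigma>"
    using enclosure_state(2)[OF W] enclosure_state(2)[OF W'] ortho_compl_antimono
    unfolding supp_def by blast+
  have "x \<in> supp \<sigma>" "p *v x \<in> supp \<sigma>"
    using sup proj_in[OF sub] proj_in[OF irredD(2)[OF W']] by (auto simp: x_def p_def)
  then have "x - p *v x \<in> supp \<sigma>" using vec.subspace_diff[OF subspace_supp] by blast
  moreover have "x - p *v x \<in> ortho_compl W" unfolding p_def by (rule proj_compl[OF sub])
  ultimately have "L i *v (x - p *v x) \<in> ortho_compl W"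
    by (rule orthocomplement_invariant[OF irredD(1)[OF W] \<sigma>])
  then have "p *v (L i *v x) = p *v (L i *v (p *v x))"
    using proj_ker[OF sub, of "L i *v (x - p *v x)"] by (simp add: p_def mv.diff_right)
  also have "\<dots> = L i *v (p *v x)"
    using arg_cong[OF invsub_proj[OF irredD(1)[OF W], of i], of "\<lambda>A. A *v x"]
    by (simp add: p_def matrix_vector_mul_assoc[symmetric])
  finally show "(ortho_proj W ** L i ** ortho_proj W') *v y = (L i ** ortho_proj W ** ortho_proj W') *v y"
    by (simp add: p_def x_def matrix_vector_mul_assoc[symmetric])
qed

text \<open>A Schur lemma. The operator \<open>S = p p' p\<close> commutes with the
  \<open>L i\<close> on \<open>W\<close> by \<open>intertwine\<close> used twice. Instead of an
  eigenvalue, the boundary point \<open>Y = p - t S\<close> of the positive cone is used: its kernel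
  in \<open>W\<close> is a nonzero invariant subspace, hence all of \<open>W\<close>, so
  \<open>p = t S\<close>.\<close>

lemma compressed_proj_scalar:
  assumes W: "irred L W" and W': "irred L W'" and no: "\<not> corthogonal W W'"
  shows "\<exists>c>0. ortho_proj W ** ortho_proj W' ** ortho_proj W = c *\<^sub>R ortho_proj W"
proof -
  define p p' S where "p = ortho_proj W" and "p' = ortho_proj W'" and "S = p ** p' ** p"
  note sub = irredD(2)[OF W] and sub' = irredD(2)[OF W']
  have pp: "p ** p = p" "adj p = p" "p' ** p' = p'" "adj p' = p'"
    unfolding p_def p'_def by (rule proj_idem[OF sub] proj_adj[OF sub] proj_idem[OF sub'] proj_adj[OF sub'])+
  have psdS: "psd S" using psd_conj[OF psd_proj[OF sub'], of p] by (simp add: S_def p'_def pp)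
  have cS: "corner W S" unfolding S_def p_def by (rule corner_compress[OF sub])
  have LS: "L i ** S = S ** L i ** p" for i
  proof -
    have "L i ** S = (L i ** p ** p') ** p" by (simp add: S_def matrix_mul_assoc)
    also have "\<dots> = p ** L i ** p' ** p" using intertwine[OF W W', of i] by (simp add: p_def p'_def)
    also have "\<dots> = p ** (L i ** p' ** p)" by (simp add: matrix_mul_assoc)
    also have "\<dots> = p ** (p' ** L i ** p)" using intertwine[OF W' W, of i] by (simp add: p_def p'_def)
    also have "\<dots> = p ** p' ** (L i ** p)" by (simp add: matrix_mul_assoc)
    also have "\<dots> = p ** p' ** (p ** L i ** p)" using invsub_proj[OF irredD(1)[OF W], of i] by (simp add: p_def)
    finally show ?thesis by (simp add: S_def matrix_mul_assoc)
  qed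
  have "S \<noteq> 0"
  proof
    assume "S = 0"
    have "p' ** p = 0"
    proof (rule matrix_ext, rule cinner_self_eq_0[THEN iffD1, THEN trans[OF _ mv.zero_left[symmetric]]])
      fix x
      have "cinner ((p' ** p) *v x) ((p' ** p) *v x) = cinner x ((adj (p' ** p) ** (p' ** p)) *v x)"
        by (simp add: cinner_adj matrix_vector_mul_assoc)
      also have "adj (p' ** p) ** (p' ** p) = p ** (p' ** p') ** p"
        by (simp add: adj_mult pp(2,4) matrix_mul_assoc)
      also have "\<dots> = 0" using \<open>S = 0\<close> by (simp add: pp S_def)
      finally show "cinner ((p' ** p) *v x) ((p' ** p) *v x) = 0" by (simp add: mv.zero_left ci.zero_right)
    qed
    then have "corthogonal W' W" using corthogonal_proj[OF sub' sub] by (simp add: p_def p'_def)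
    with no show False using corthogonal_sym by blast
  qed
  then have trS: "Re (trace S) > 0"
    using psd_trace_0[OF psdS] trace_psd(2)[OF psdS] by fastforce
  define t0 where "t0 = (Re (trace p) + 1) / Re (trace S)"
  have psdp: "psd p" unfolding p_def by (rule psd_proj[OF sub])
  have t0: "t0 \<ge> 0" using trS trace_psd(2)[OF psdp] by (simp add: t0_def)
  have "Re (trace (p - t0 *\<^sub>R S)) < 0" using trS by (simp add: tr_diff tr_scaleR t0_def)
  then have "\<not> psd (p - t0 *\<^sub>R S)" using trace_psd(2) by fastforce
  moreover have suppp: "supp p = W"
  proof -
    have "{x. p *v x = 0} = ortho_compl W" using proj_ker[OF sub] by (auto simp: p_def)
    then show ?thesis by (simp add: supp_def ortho_compl_double[OF sub])
  qed
  ultimately obtain t where t: "t \<ge> 0" "psd (p - t *\<^sub>R S)" "supp (p - t *\<^sub>R S) \<subset> W"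
    using psd_boundary[OF psdp psd_adj[OF psdS] _ t0] cS by auto
  define Y where "Y = p - t *\<^sub>R S"
  have LY: "L i ** Y = Y ** L i ** p" for i
    using LS[of i] invsub_proj[OF irredD(1)[OF W], of i]
    by (simp add: Y_def p_def mm.diff_left mm.diff_right mm.scaleR_left mm.scaleR_right)
  define V where "V = {x. Y *v x = 0} \<inter> W"
  have "invsub L V"
    unfolding invsub_def
  proof (intro conjI allI ballI)
    show "vec.subspace V" unfolding V_def by (intro vec.subspace_inter subspace_ker sub)
    fix i x assume x: "x \<in> V"
    then have xW: "x \<in> W" "p *v x = x" using proj_fix[OF sub] by (auto simp: V_def p_def)
    have "Y *v (L i *v x) = (Y ** L i ** p) *v x" using xW by (simp add: matrix_vector_mul_assoc[symmetric])
    also have "\<dots> = L i *v (Y *v x)" by (simp add: LY[symmetric] matrix_vector_mul_assoc)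
    also have "\<dots> = 0" using x by (simp add: V_def mv.zero_right)
    finally show "L i *v x \<in> V" using xW irredD(1)[OF W] by (simp add: V_def invsub_def)
  qed
  \<comment> \<open>The support of \<open>Y\<close> is strictly smaller than \<open>W\<close>;
    removing from a vector of \<open>W\<close> its projection onto that support gives a nonzero
    kernel vector inside \<open>W\<close>.\<close>
  moreover have "V \<noteq> {0}"
  proof -
    obtain w0 where w0: "w0 \<in> W" "w0 \<notin> supp Y" using t(3) by (auto simp: Y_def)
    define w where "w = w0 - ortho_proj (supp Y) *v w0"
    have "w \<in> ortho_compl (supp Y)" unfolding w_def by (rule proj_compl[OF subspace_supp])
    then have "Y *v w = 0" by (simp add: ortho_compl_supp)
    moreover have "w \<in> W"
      using w0 proj_in[OF subspace_supp, of Y] t(3) vec.subspace_diff[OF sub] by (auto simp: w_def Y_def)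
    moreover have "w \<noteq> 0"
      using w0 proj_in[OF subspace_supp, of Y w0] by (auto simp: w_def)
    ultimately show ?thesis by (auto simp: V_def)
  qed
  moreover have "V \<subseteq> W" by (simp add: V_def)
  ultimately have "V = W" using W by (auto simp: irred_def)
  have "Y = 0"
  proof (rule matrix_ext)
    fix x
    have "p *v x \<in> V" using \<open>V = W\<close> proj_in[OF sub] by (simp add: p_def)
    moreover have "Y ** p = Y"
      using cornerD(2)[OF sub cS] pp by (simp add: Y_def p_def mm.diff_left mm.scaleR_left)
    moreover have "Y *v x = Y *v (p *v x)" using \<open>Y ** p = Y\<close> by (simp add: matrix_vector_mul_assoc)
    ultimately show "Y *v x = 0 *v x" by (simp add: V_def mv.zero_left)
  qed
  then have pS: "p = t *\<^sub>R S" by (simp add: Y_def)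
  have "p \<noteq> 0" using irredD(3)[OF W] suppp supp_eq_0[of p] pp by auto
  then have "t \<noteq> 0" using pS by auto
  then have "S = (1/t) *\<^sub>R p" using pS by simp
  then show ?thesis using t(1) \<open>t \<noteq> 0\<close> by (intro exI[of _ "1/t"]) (simp add: S_def p_def p'_def)
qed

text \<open>Polar decomposition of \<open>p' p\<close>: its absolute value is a scalar on \<open>W\<close>.\<close>
lemma partial_isometry_exists:
  assumes W: "irred L W" and W': "irred L W'" and no: "\<not> corthogonal W W'"
  obtains Q where "adj Q ** Q = ortho_proj W" "Q ** adj Q = ortho_proj W'"
    "\<And>i. L i ** Q = Q ** L i ** ortho_proj W"
    "ortho_proj W' ** Q = Q" "Q ** ortho_proj W = Q"
proof -
  define p p' where "p = ortho_proj W" and "p' = ortho_proj W'"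
  note sub = irredD(2)[OF W] and sub' = irredD(2)[OF W']
  have pp: "p ** p = p" "adj p = p" "p' ** p' = p'" "adj p' = p'"
    unfolding p_def p'_def by (rule proj_idem[OF sub] proj_adj[OF sub] proj_idem[OF sub'] proj_adj[OF sub'])+
  obtain c where c: "c > 0" "p ** p' ** p = c *\<^sub>R p"
    using compressed_proj_scalar[OF W W' no] by (auto simp: p_def p'_def)
  have no': "\<not> corthogonal W' W" using no corthogonal_sym by blast
  obtain c' where c': "c' > 0" "p' ** p ** p' = c' *\<^sub>R p'"
    using compressed_proj_scalar[OF W' W no'] by (auto simp: p_def p'_def)
  have nz: "p ** p' \<noteq> 0" using no corthogonal_proj[OF sub sub'] by (simp add: p_def p'_def)
  \<comment> \<open>Evaluating \<open>p p' p p'\<close> in two ways identifies the two scalars, so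
    one normalisation makes both products of \<open>Q\<close> with its adjoint projections.\<close>
  have "c *\<^sub>R (p ** p') = (p ** p' ** p) ** p'" by (simp add: c mm.scaleR_left)
  also have "\<dots> = p ** (p' ** p ** p')" by (simp add: matrix_mul_assoc)
  also have "\<dots> = c' *\<^sub>R (p ** p')" by (simp add: c' mm.scaleR_right)
  finally have cc: "c' = c" using nz by simp
  define Q where "Q = (1 / sqrt c) *\<^sub>R (p' ** p)"
  have adjQ: "adj Q = (1 / sqrt c) *\<^sub>R (p ** p')" by (simp add: Q_def adj_scaleR adj_mult pp)
  have cs: "1 / (sqrt c * sqrt c) * c = 1" using c(1) by simp
  have "adj Q ** Q = (1 / (sqrt c * sqrt c)) *\<^sub>R (p ** (p' ** p') ** p)"
    unfolding adjQ by (simp add: Q_def mm.scaleR_left mm.scaleR_right matrix_mul_assoc)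
  also have "\<dots> = p" using cs by (simp add: pp c)
  finally have 1: "adj Q ** Q = p" .
  have "Q ** adj Q = (1 / (sqrt c * sqrt c)) *\<^sub>R (p' ** (p ** p) ** p')"
    unfolding adjQ by (simp add: Q_def mm.scaleR_left mm.scaleR_right matrix_mul_assoc)
  also have "\<dots> = p'" using cs by (simp add: pp c' cc)
  finally have 2: "Q ** adj Q = p'" .
  have "L i ** Q = Q ** L i ** p" for i
  proof -
    have "L i ** p' ** p = p' ** (L i ** p)"
      using intertwine[OF W' W, of i] by (simp add: p_def p'_def matrix_mul_assoc)
    also have "\<dots> = p' ** (p ** L i ** p)"
      using invsub_proj[OF irredD(1)[OF W], of i] by (simp add: p_def)
    finally show ?thesis
      by (simp add: Q_def mm.scaleR_left mm.scaleR_right matrix_mul_assoc)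
  qed
  moreover have "p' ** Q = Q" "Q ** p = Q"
    by (simp_all add: Q_def mm.scaleR_left mm.scaleR_right matrix_mul_assoc pp)
      (simp_all add: pp flip: matrix_mul_assoc)
  ultimately show ?thesis using that 1 2 by (simp add: p_def p'_def)
qed

end

context kraus_channel
begin

section \<open>The canonical decomposition\<close>

text \<open>Overlap of minimal enclosures need not be transitive, so classes are taken for its
  reflexive transitive closure \<open>conn\<close>. Irreducibility is built into the relation to
  keep chains among minimal enclosures.\<close>

definition linked :: "(complex^'h) set \<Rightarrow> (complex^'h) set \<Rightarrow> bool" where
  "linked U W \<longleftrightarrow> irred L U \<and> irred L W \<and> \<not> corthogonal U W"

abbreviation "conn \<equiv> linked\<^sup>*\<^sup>*"

definition chi :: "(complex^'h) set \<Rightarrow> (complex^'h) set" where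
  "chi W = vec.span (\<Union>{U. conn W U})"

lemma linked_sym: "linked U W \<Longrightarrow> linked W U"
  unfolding linked_def using corthogonal_sym by blast

lemma conn_sym: "conn U W \<Longrightarrow> conn W U"
  by (induction rule: rtranclp_induct) (auto intro: converse_rtranclp_into_rtranclp linked_sym)

lemma conn_irred: "conn W U \<Longrightarrow> irred L W \<Longrightarrow> irred L U"
  by (induction rule: rtranclp_induct) (auto simp: linked_def)

lemma not_corthogonal_self: "irred L U \<Longrightarrow> U \<subseteq> X \<Longrightarrow> \<not> corthogonal U X"
proof
  assume U: "irred L U" "U \<subseteq> X" "corthogonal U X"
  then have "x = 0" if "x \<in> U" for x
    using that ortho_compl_Int[of x U] by (auto simp: corthogonal_iff)
  then show False using irredD(2,3)[OF U(1)] vec.subspace_0 by blast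
qed

lemma invsub_chi: "irred L W \<Longrightarrow> invsub L (chi W)"
  unfolding chi_def by (rule invsub_span) (auto dest: conn_irred irredD(1))

lemma conn_subset_chi: "conn W U \<Longrightarrow> U \<subseteq> chi W"
  unfolding chi_def using vec.span_superset by fastforce

text \<open>Being orthogonal to every generator means being orthogonal to the span; otherwise
  \<open>U\<close> overlaps some member of the class and extends the chain by one link.\<close>

lemma chi_dichotomy:
  assumes W: "irred L W" and U: "irred L U"
  shows "conn W U \<or> corthogonal U (chi W)"
proof (rule disjCI)
  assume "\<not> corthogonal U (chi W)"
  then obtain X where X: "conn W X" "\<not> corthogonal U X"
    unfolding chi_def using corthogonal_span[of "{U. conn W U}" U] by auto
  then have "linked X U"
    using conn_irred[OF X(1) W] U corthogonal_sym by (auto simp: linked_def)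
  with X show "conn W U" by simp
qed

lemma subset_chi_iff: "irred L W \<Longrightarrow> irred L U \<Longrightarrow> U \<subseteq> chi W \<longleftrightarrow> conn W U"
  using chi_dichotomy not_corthogonal_self conn_subset_chi by blast

lemma chi_cong: "conn W W' \<Longrightarrow> chi W = chi W'"
proof -
  assume c: "conn W W'"
  then have "conn W U \<longleftrightarrow> conn W' U" for U using conn_sym by (meson rtranclp_trans)
  then show ?thesis by (simp add: chi_def)
qed

text \<open>Follow a chain starting in \<open>X\<close>: the next enclosure overlaps the previous
  one, which lies in \<open>X\<close>, so it is not orthogonal to \<open>X\<close> and must be
  contained in it.\<close>

lemma absorbing_contains_class:
  assumes W: "irred L W" "W \<subseteq> X" and X: "absorbs_or_orthogonal L X" and sub: "vec.subspace X"
  shows "chi W \<subseteq> X"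
proof -
  have "U \<subseteq> X" if "conn W U" for U
    using that
  proof (induction rule: rtranclp_induct)
    case (step Y Z)
    have "\<not> corthogonal Z X"
    proof
      assume "corthogonal Z X"
      then have "corthogonal Z Y" using step.IH by (auto simp: corthogonal_def)
      with step.hyps(2) show False using corthogonal_sym by (auto simp: linked_def)
    qed
    then show ?case
      using X step.hyps(2) by (auto simp: absorbs_or_orthogonal_def linked_def minimal_enclosure_iff_irred)
  qed (rule W(2))
  then show ?thesis unfolding chi_def by (intro vec.span_minimal sub) auto
qed

lemma absorbs_chi: "irred L W \<Longrightarrow> absorbs_or_orthogonal L (chi W)"
  unfolding absorbs_or_orthogonal_def minimal_enclosure_iff_irred
  using chi_dichotomy conn_subset_chi by blast

lemma chi_nonzero: "irred L W \<Longrightarrow> chi W \<noteq> {0}"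
  using conn_subset_chi[of W W] irredD(2,3)[of L W] vec.subspace_0[of W] by blast

text \<open>Any nonzero enclosure contains a minimal one, and an absorbing enclosure then contains
  its whole class; so the minimal absorbing enclosures are spans of single classes.\<close>

lemma chi_component_iff: "chi_component L X \<longleftrightarrow> (\<exists>W. irred L W \<and> X = chi W)"
proof
  assume X: "chi_component L X"
  then have inv: "invsub L X" "X \<noteq> {0}" by (auto simp: chi_component_def enclosure_iff_invsub)
  then obtain W where W: "W \<subseteq> X" "irred L W" using irred_exists by blast
  have "chi W \<subseteq> X"
    using absorbing_contains_class[OF W(2,1)] X invsub_subspace[OF inv(1)] by (simp add: chi_component_def)
  then have "chi W = X"
    using X invsub_chi[OF W(2)] chi_nonzero[OF W(2)] absorbs_chi[OF W(2)]
    by (simp add: chi_component_def enclosure_iff_invsub)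
  then show "\<exists>W. irred L W \<and> X = chi W" using W(2) by blast
next
  assume "\<exists>W. irred L W \<and> X = chi W"
  then obtain W where W: "irred L W" "X = chi W" by blast
  have "Y = chi W" if Y: "invsub L Y" "Y \<noteq> {0}" "absorbs_or_orthogonal L Y" "Y \<subseteq> chi W" for Y
  proof -
    obtain U where U: "U \<subseteq> Y" "irred L U" using irred_exists[OF Y(1,2)] by blast
    then have "conn W U" using subset_chi_iff[OF W(1) U(2)] Y(4) by blast
    then have "chi W = chi U" by (rule chi_cong)
    moreover have "chi U \<subseteq> Y"
      by (rule absorbing_contains_class[OF U(2,1) Y(3) invsub_subspace[OF Y(1)]])
    ultimately show ?thesis using Y(4) by blast
  qed
  then show "chi_component L X"
    using W invsub_chi[OF W(1)] chi_nonzero[OF W(1)] absorbs_chi[OF W(1)]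
    by (auto simp: chi_component_def enclosure_iff_invsub)
qed

lemma chi_orthogonal:
  assumes W: "irred L W" "irred L W'" "chi W \<noteq> chi W'"
  shows "corthogonal (chi W) (chi W')"
proof -
  have "corthogonal (chi W) U" if "conn W' U" for U
  proof -
    have U: "irred L U" by (rule conn_irred[OF that W(2)])
    have "\<not> conn W U" using chi_cong[OF that] chi_cong[of W U] W(3) by metis
    then show ?thesis using chi_dichotomy[OF W(1) U] corthogonal_sym by blast
  qed
  then show ?thesis unfolding chi_def[of W'] by (intro corthogonal_span) auto
qed

definition components :: "(complex^'h) set set" where
  "components = {X. chi_component L X}"

lemma components_eq: "components = chi ` {W. irred L W}"
  by (auto simp: components_def chi_component_iff)

lemma pairwise_components: "pairwise corthogonal components"
  unfolding components_eq pairwise_def using chi_orthogonal by auto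

text \<open>One nonzero vector chosen from each component gives a pairwise orthogonal family, which
  is finite in finite dimension.\<close>

lemma finite_components: "finite components"
proof -
  have "\<forall>X\<in>components. \<exists>x. x \<in> X \<and> x \<noteq> 0"
  proof
    fix X assume "X \<in> components"
    then have "vec.subspace X" "X \<noteq> {0}" by (auto simp: components_def chi_component_def enclosure_def)
    then show "\<exists>x. x \<in> X \<and> x \<noteq> 0" using vec.subspace_0[of X] by blast
  qed
  from bchoice[OF this] obtain f where f: "\<And>X. X \<in> components \<Longrightarrow> f X \<in> X \<and> f X \<noteq> 0" by blast
  have orth: "f X \<bullet> f Y = 0" if "X \<in> components" "Y \<in> components" "X \<noteq> Y" for X Y
  proof -
    have "cinner (f X) (f Y) = 0"
      using pairwise_components that f[of X] f[of Y] by (auto simp: pairwise_def corthogonal_def)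
    then show ?thesis using Re_cinner[of "f X" "f Y"] by simp
  qed
  have "inj_on f components"
  proof (rule inj_onI, rule ccontr)
    fix X Y assume XY: "X \<in> components" "Y \<in> components" "f X = f Y" "X \<noteq> Y"
    then show False using orth[of X Y] f[of Y] by simp
  qed
  moreover have "finite (f ` components)"
    by (rule pairwise_orthogonal_imp_finite) (auto simp: pairwise_def orthogonal_def intro!: orth)
  ultimately show ?thesis using finite_imageD by blast
qed

text \<open>Invariant states decompose into states of minimal enclosures by
  \<open>psd_fixed_induct\<close>, and each minimal enclosure is itself the support of an invariant
  state; this gives the two inclusions.\<close>

lemma span_components: "vec.span (\<Union>components) = fast_recurrent_space L"
proof
  define M where "M = vec.span (\<Union>components)"
  have subM: "vec.subspace M" unfolding M_def by (rule vec.subspace_span)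
  have irrM: "W \<subseteq> M" if "irred L W" for W
  proof -
    have "chi W \<in> components" using that by (auto simp: components_eq)
    then show ?thesis
      using conn_subset_chi[of W W] vec.span_superset[of "\<Union>components"] unfolding M_def by blast
  qed
  have "supp \<sigma> \<subseteq> M" if \<sigma>: "invariant_state L \<sigma>" for \<sigma>
  proof -
    have "psd \<sigma>" "T \<sigma> = \<sigma>" using \<sigma> by (auto simp: invariant_state_def)
    then have "corner M \<sigma>"
    proof (induction \<sigma> rule: psd_fixed_induct)
      case (step W t Z)
      have "corner M (\<tau> W)"
        using irrM[OF step(1)] enclosure_state[OF step(1)] invariant_state_corner[OF _ subM] by blast
      then show ?case by (intro corner_add step corner_scaleR)
    qed simp
    then show ?thesis using invariant_state_corner[OF \<sigma> subM] by blast
  qed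
  then show "fast_recurrent_space L \<subseteq> vec.span (\<Union>components)"
    unfolding fast_recurrent_space_def M_def[symmetric] by (intro vec.span_minimal subM) auto
  have "U \<subseteq> fast_recurrent_space L" if "irred L U" for U
    unfolding fast_recurrent_space_def
    using enclosure_state(1,2)[OF that] by (intro order_trans[OF _ vec.span_superset]) auto
  then have "chi W \<subseteq> fast_recurrent_space L" if "irred L W" for W
    unfolding chi_def using that conn_irred
    by (intro vec.span_minimal) (auto simp: fast_recurrent_space_def)
  then show "vec.span (\<Union>components) \<subseteq> fast_recurrent_space L"
    by (intro vec.span_minimal) (auto simp: components_eq fast_recurrent_space_def)
qed

text \<open>For uniqueness, a component missing from a competing family would be orthogonal to all
  its members, hence to the whole fast recurrent space, which contains it.\<close>

theorem canonical_decomposition_eq: "canonical_decomposition L = components"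
  unfolding canonical_decomposition_def
proof (rule the_equality)
  show "finite components \<and> (\<forall>U\<in>components. chi_component L U) \<and> pairwise corthogonal components
      \<and> vec.span (\<Union>components) = fast_recurrent_space L"
    by (intro conjI finite_components pairwise_components span_components) (simp add: components_def)
  fix C
  assume C: "finite C \<and> (\<forall>U\<in>C. chi_component L U) \<and> pairwise corthogonal C
      \<and> vec.span (\<Union>C) = fast_recurrent_space L"
  then have sub: "C \<subseteq> components" and spanC: "vec.span (\<Union>C) = fast_recurrent_space L"
    by (simp_all add: components_def subset_iff)
  have "X \<in> C" if X: "X \<in> components" for X
  proof (rule ccontr)
    assume "X \<notin> C"
    have "corthogonal X Y" if Y: "Y \<in> C" for Y
    proof (rule pairwiseD[OF pairwise_components X])
      show "Y \<in> components" using sub Y by (rule subsetD)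
      show "X \<noteq> Y" using Y \<open>X \<notin> C\<close> by metis
    qed
    then have "corthogonal X (vec.span (\<Union>C))" by (rule corthogonal_span)
    then have o: "corthogonal X (vec.span (\<Union>components))" by (simp only: spanC span_components)
    have "X \<subseteq> vec.span (\<Union>components)" by (rule order_trans[OF Union_upper[OF X] vec.span_superset])
    then have "X \<subseteq> ortho_compl X" using o unfolding corthogonal_iff by (rule order_trans)
    then have "x = 0" if "x \<in> X" for x using that ortho_compl_Int by blast
    moreover have "vec.subspace X" "X \<noteq> {0}" using X by (auto simp: components_def chi_component_def enclosure_def)
    ultimately show False using vec.subspace_0[of X] by blast
  qed
  then show "C = components" by (intro equalityI[OF sub] subsetI)
qed

lemma componentE:
  assumes "X \<in> components"
  obtains W where "irred L W" "W \<subseteq> X" "X = chi W"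
proof -
  obtain W where W: "irred L W" "X = chi W" using assms unfolding components_eq by blast
  have "W \<subseteq> X" unfolding W(2) by (rule conn_subset_chi) simp
  with W show ?thesis using that by blast
qed

lemma component_invsub: "X \<in> components \<Longrightarrow> invsub L X"
  by (auto simp: components_def chi_component_def enclosure_iff_invsub)

lemma irred_component: "irred L W \<Longrightarrow> \<exists>X\<in>components. W \<subseteq> X"
  using conn_subset_chi[of W W] by (auto simp: components_eq)

lemma component_conn: "X \<in> components \<Longrightarrow> irred L U \<Longrightarrow> irred L W \<Longrightarrow> U \<subseteq> X \<Longrightarrow> W \<subseteq> X \<Longrightarrow> conn U W"
proof -
  assume X: "X \<in> components" and U: "irred L U" and W: "irred L W" and sub: "U \<subseteq> X" "W \<subseteq> X"
  obtain Y where Y: "irred L Y" "X = chi Y" using componentE[OF X] by blast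
  have "conn Y U" "conn Y W" using subset_chi_iff[OF Y(1)] U W sub Y(2) by blast+
  then show ?thesis using rtranclp_trans[OF conn_sym] by blast
qed

text \<open>Transfers a quantity along a chain of overlaps; the mean vector and the tilted radius
  are shown in this way not to depend on the minimal enclosure chosen.\<close>

lemma component_induct:
  assumes "X \<in> components" "irred L U" "irred L W" "U \<subseteq> X" "W \<subseteq> X"
    and step: "\<And>U W. irred L U \<Longrightarrow> irred L W \<Longrightarrow> \<not> corthogonal U W \<Longrightarrow> f U = f W"
  shows "f U = f W"
proof -
  have "conn U W" by (rule component_conn[OF assms(1-5)])
  then show ?thesis
    by (induction rule: rtranclp_induct) (auto simp: linked_def step)
qed

section \<open>Absorption operators\<close>

lemma dual_pow_1: "(T' ^^ n) (mat 1) = mat 1"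
  by (induction n) (simp_all add: dual_1)

lemma dual_pow_proj_mono:
  assumes "invsub L U"
  shows "psd ((T' ^^ Suc n) (ortho_proj U) - (T' ^^ n) (ortho_proj U))"
  using psd_T'_pow[OF psd_dual_proj_diff[OF assms], of n]
  unfolding linear_diff[OF linear_T'_pow] funpow_Suc_right o_apply .

lemma dual_pow_proj_le_1:
  assumes "invsub L U"
  shows "psd (mat 1 - (T' ^^ n) (ortho_proj U))"
  using psd_T'_pow[OF psd_proj_compl[OF invsub_subspace[OF assms]], of n]
  unfolding linear_diff[OF linear_T'_pow] dual_pow_1 .

text \<open>The iterates increase and are bounded by 1, so their traces against a positive matrix
  converge; \<open>psd_induct\<close> extends this to all matrices, and the entries are such traces.
  Only now does \<open>lim\<close> in the definition denote a genuine limit.\<close>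

lemma absorption_limit:
  assumes U: "invsub L U"
  shows "(\<lambda>n. (T' ^^ n) (ortho_proj U)) \<longlonglongrightarrow> absorption L U"
proof -
  define P where "P n = (T' ^^ n) (ortho_proj U)" for n
  note sub = invsub_subspace[OF U]
  have up: "psd (P (Suc n) - P n)" for n unfolding P_def by (rule dual_pow_proj_mono[OF U])
  have ub: "psd (mat 1 - P n)" for n unfolding P_def by (rule dual_pow_proj_le_1[OF U])
  have conv: "convergent (\<lambda>n. trace (X ** P n))" for X
  proof (induction X rule: psd_induct)
    case (psd X)
    define a where "a n = Re (trace (X ** P n))" for n
    have "a n \<le> a (Suc n)" for n
      using trace_psd_mult(2)[OF psd up, of n] by (simp add: a_def mm.diff_right tr_diff)
    moreover have "a n \<le> Re (trace X)" for n
      using trace_psd_mult(2)[OF psd ub, of n] by (simp add: a_def mm.diff_right tr_diff)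
    ultimately obtain l where "a \<longlonglongrightarrow> l" using incseq_convergent[of a "Re (trace X)"] incseq_SucI by blast
    then have "convergent (\<lambda>n. complex_of_real (a n))" unfolding convergent_def using tendsto_of_real by blast
    moreover have "complex_of_real (a n) = trace (X ** P n)" for n
      using trace_psd_mult(1)[OF psd psd_T'_pow[OF psd_proj[OF sub]], of n]
      by (simp add: a_def complex_eq_iff P_def)
    ultimately show ?case by simp
  next
    case (add X Y)
    then show ?case by (simp add: mm.add_left tr_add convergent_add)
  next
    case (scale c X)
    then show ?case
      by (simp add: matrix_mul_assoc[symmetric] trace_mat_mult convergent_mult convergent_const)
  qed
  have "trace (outer (axis j 1) (axis i 1) ** P n) = P n $ i $ j" for i j n
    by (simp add: trace_outer_mult cinner_axis mult_axis)
  then have "convergent (\<lambda>n. P n $ i $ j)" for i j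
    using conv[of "outer (axis j 1) (axis i 1)"] by simp
  then have l: "(\<lambda>n. P n $ i $ j) \<longlonglongrightarrow> lim (\<lambda>n. P n $ i $ j)" for i j
    by (simp add: convergent_LIMSEQ_iff)
  have "P \<longlonglongrightarrow> (\<chi> i j. lim (\<lambda>n. P n $ i $ j))"
    by (intro vec_tendstoI) (simp add: l)
  then have "convergent P" by (auto simp: convergent_def)
  then show ?thesis unfolding absorption_def P_def[abs_def] by (simp add: convergent_LIMSEQ_iff)
qed

lemma absorption_fixed: "invsub L U \<Longrightarrow> T' (absorption L U) = absorption L U"
proof -
  assume U: "invsub L U"
  have "(\<lambda>n. T' ((T' ^^ n) (ortho_proj U))) \<longlonglongrightarrow> T' (absorption L U)"
    by (intro bounded_linear.tendsto[OF linear_T'[unfolded linear_conv_bounded_linear]] absorption_limit U)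
  moreover have "(\<lambda>n. T' ((T' ^^ n) (ortho_proj U))) \<longlonglongrightarrow> absorption L U"
    using LIMSEQ_Suc[OF absorption_limit[OF U]] by simp
  ultimately show ?thesis by (rule LIMSEQ_unique)
qed

lemma psd_absorption: "invsub L U \<Longrightarrow> psd (absorption L U)"
  by (rule psd_limit[OF _ absorption_limit]) (auto intro!: psd_T'_pow psd_proj invsub_subspace)

text \<open>The absorption operator lies between the projection onto \<open>U\<close> and the
  identity, and these two bounds agree in the form at a vector of \<open>U\<close>. The kernel lemma
  for positive operators turns equality of forms into equality of vectors.\<close>

lemma absorption_on:
  assumes U: "invsub L U"
  shows "absorption L U ** ortho_proj U = ortho_proj U"
proof (rule matrix_ext)
  fix y
  define x A where "x = ortho_proj U *v y" and "A = absorption L U"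
  note sub = invsub_subspace[OF U]
  have 1: "psd (mat 1 - A)"
    unfolding A_def
    by (rule psd_limit[OF dual_pow_proj_le_1[OF U] tendsto_diff[OF tendsto_const absorption_limit[OF U]]])
  have "psd ((T' ^^ n) (ortho_proj U) - ortho_proj U)" for n
  proof (induction n)
    case (Suc n)
    have "psd (((T' ^^ n) (ortho_proj U) - ortho_proj U)
        + ((T' ^^ Suc n) (ortho_proj U) - (T' ^^ n) (ortho_proj U)))"
      by (intro psd_add Suc dual_pow_proj_mono U)
    then show ?case by (simp del: funpow.simps)
  qed simp
  then have 2: "psd (A - ortho_proj U)"
    unfolding A_def by (rule psd_limit[OF _ tendsto_diff[OF absorption_limit[OF U] tendsto_const]])
  have px: "ortho_proj U *v x = x" unfolding x_def using proj_fix[OF sub] proj_in[OF sub] by blast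
  have "Re (cinner x ((mat 1 - A) *v x)) = - Re (cinner x ((A - ortho_proj U) *v x))"
    by (simp add: mv.diff_left ci.diff_right px)
  then have "Re (cinner x ((mat 1 - A) *v x)) = 0"
    using psd_Re[OF 1, of x] psd_Re[OF 2, of x] by linarith
  then have "(mat 1 - A) *v x = 0" using psd_kernel_iff[OF 1] by blast
  then have "A *v x = x" by (simp add: mv.diff_left)
  then show "(absorption L U ** ortho_proj U) *v y = ortho_proj U *v y"
    by (simp add: matrix_vector_mul_assoc[symmetric] x_def A_def)
qed

text \<open>Mass started in \<open>W\<close> never leaves \<open>W\<close>, so it never meets
  \<open>U\<close>: all approximants have zero form on \<open>W\<close>, and so has their positive
  limit.\<close>

lemma absorption_off:
  assumes U: "invsub L U" and W: "invsub L W" and o: "corthogonal W U"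
  shows "absorption L U ** ortho_proj W = 0"
proof (rule matrix_ext)
  fix y
  define x where "x = ortho_proj W *v y"
  note sub = invsub_subspace[OF U] and subW = invsub_subspace[OF W]
  have xW: "x \<in> W" using proj_in[OF subW] by (simp add: x_def)
  have "cinner x ((T' ^^ n) (ortho_proj U) *v x) = 0" for n
  proof -
    define \<omega> where "\<omega> = (T ^^ n) (outer x x)"
    have "corner W \<omega>" unfolding \<omega>_def by (intro corner_T_pow W corner_outer subW xW)
    then have "\<omega> ** ortho_proj U = \<omega> ** (ortho_proj W ** ortho_proj U)"
      using cornerD(2)[OF subW] by (simp add: matrix_mul_assoc)
    also have "\<dots> = 0" using o corthogonal_proj[OF subW sub] by (simp add: mm.zero_right)
    finally have "trace (\<omega> ** ortho_proj U) = 0" by (simp add: tr_zero)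
    then show ?thesis by (simp add: \<omega>_def trace_T_pow_mult trace_outer_mult)
  qed
  then have "(\<lambda>n. 0) \<longlonglongrightarrow> cinner x (absorption L U *v x)"
    using ci.tendsto[OF tendsto_const mv.tendsto[OF absorption_limit[OF U] tendsto_const], of x x] by simp
  then have "cinner x (absorption L U *v x) = 0" by (rule LIMSEQ_unique[OF _ tendsto_const])
  then have "absorption L U *v x = 0" by (rule psd_kernel[OF psd_absorption[OF U]])
  then show "(absorption L U ** ortho_proj W) *v y = 0 *v y"
    by (simp add: matrix_vector_mul_assoc[symmetric] x_def mv.zero_left)
qed

text \<open>In the applications \<open>M\<close> is mostly the state of a minimal enclosure or its
  image under a weighted Kraus map; under the trace the absorption operator can then be erased or
  makes the term vanish.\<close>

lemma absorption_mult_corner: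
  assumes X: "X \<in> components" "X' \<in> components" and W: "invsub L W" "W \<subseteq> X'" and M: "corner W M"
  shows "M ** absorption L X = (if X = X' then M else 0)"
proof -
  have subW: "vec.subspace W" by (rule invsub_subspace[OF W(1)])
  have A: "adj (absorption L X) = absorption L X"
    by (rule psd_adj[OF psd_absorption[OF component_invsub[OF X(1)]]])
  have "absorption L X ** ortho_proj W = (if X = X' then ortho_proj W else 0)"
  proof (cases "X = X'")
    case True
    have "absorption L X ** (ortho_proj X ** ortho_proj W) = ortho_proj X ** ortho_proj W"
      using absorption_on[OF component_invsub[OF X(1)]] by (simp add: matrix_mul_assoc)
    moreover have "ortho_proj X ** ortho_proj W = ortho_proj W"
      using W(2) True proj_in[OF subW] proj_fix[OF invsub_subspace[OF component_invsub[OF X(1)]]]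
      by (intro matrix_ext) (auto simp: matrix_vector_mul_assoc[symmetric])
    ultimately show ?thesis using True by simp
  next
    case False
    then have "corthogonal W X"
      using pairwise_components X W(2) by (auto simp: pairwise_def corthogonal_def)
    then show ?thesis using absorption_off[OF component_invsub[OF X(1)] W(1)] False by simp
  qed
  then have "adj (absorption L X ** ortho_proj W) = (if X = X' then ortho_proj W else 0)"
    by (simp add: proj_adj[OF subW] adj_zero)
  then have "ortho_proj W ** absorption L X = (if X = X' then ortho_proj W else 0)"
    by (simp add: adj_mult A proj_adj[OF subW])
  then have "M ** (ortho_proj W ** absorption L X) = (if X = X' then M ** ortho_proj W else 0)"
    by (simp add: mm.zero_right)
  then show ?thesis using cornerD(2)[OF subW M] by (simp add: matrix_mul_assoc)
qed

text \<open>Absorption into the recurrent space is certain: the difference to the identity is fixed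
  by the dual and annihilated by the states of all minimal enclosures, so
  \<open>fixed_dual_zero\<close> applies.\<close>

lemma sum_absorption: "(\<Sum>X\<in>components. absorption L X) = mat 1"
proof -
  define k where "k = (\<Sum>X\<in>components. absorption L X) - mat 1"
  have "k = 0"
  proof (rule fixed_dual_zero[OF invsub_UNIV])
    have "(\<Sum>X\<in>components. T' (absorption L X)) = (\<Sum>X\<in>components. absorption L X)"
      by (intro sum.cong refl absorption_fixed component_invsub)
    then have "T' k = k"
      unfolding k_def linear_diff[OF linear_T'] linear_sum[OF linear_T'] dual_1 by simp
    then show "ortho_proj UNIV ** T' k ** ortho_proj UNIV = k" by simp
    fix \<sigma> assume "invariant_state L \<sigma>"
    moreover have "trace (\<tau> W ** k) = 0" if W: "irred L W" for W
    proof -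
      obtain X where X: "X \<in> components" "W \<subseteq> X" using irred_component[OF W] by blast
      have "(\<Sum>Y\<in>components. \<tau> W ** absorption L Y) = (\<Sum>Y\<in>components. if Y = X then \<tau> W else 0)"
        by (rule sum.cong[OF refl],
            rule absorption_mult_corner[OF _ X(1) irredD(1)[OF W] X(2) enclosure_state(3)[OF W]])
      also have "\<dots> = \<tau> W" using X(1) finite_components by (simp add: sum.delta)
      finally have "\<tau> W ** k = 0" by (simp add: k_def mm.diff_right mm.sum_right)
      then show ?thesis by (simp add: tr_zero)
    qed
    ultimately show "trace (\<sigma> ** k) = 0" using trace_invariant_zeroI by blast
  qed simp
  then show ?thesis by (simp add: k_def)
qed

end

section \<open>Differentiability of Perron--Frobenius eigenvalues\<close>

lemma kraus_weights_diff: "kraus c K X - kraus d K X = kraus (\<lambda>i. c i - d i) K X"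
  by (simp add: kraus_def scaleR_diff_left sum_subtractf)

lemma kraus_weights_scaleR: "r *\<^sub>R kraus c K X = kraus (\<lambda>i. r * c i) K X"
  by (simp add: kraus_def scaleR_sum_right)

lemma kraus_weights_add: "kraus c K X + kraus d K X = kraus (\<lambda>i. c i + d i) K X"
  by (simp add: kraus_def scaleR_add_left sum.distrib)

lemma kraus_weights_sum: "(\<Sum>k\<in>I. kraus (c k) K X) = kraus (\<lambda>i. \<Sum>k\<in>I. c k i) K X"
  unfolding kraus_def by (subst sum.swap) (simp add: scaleR_sum_left)

lemma tendsto_kraus:
  assumes "\<And>i. (c i \<longlongrightarrow> d i) F" "(x \<longlongrightarrow> X) F"
  shows "((\<lambda>t. kraus (\<lambda>i. c i t) K (x t)) \<longlongrightarrow> kraus d K X) F"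
  unfolding kraus_def by (intro tendsto_intros mm.tendsto assms)

lemma inner_kraus: "Y \<bullet> kraus c K X = kraus c (\<lambda>i. adj (K i)) Y \<bullet> X"
proof -
  have "Y \<bullet> kraus c K X = Re (trace (kraus c K X ** adj Y))"
    by (simp add: inner_matrix_eq trace_mul_sym[of "adj Y"])
  also have "\<dots> = Re (trace (X ** adj (kraus c (\<lambda>i. adj (K i)) Y)))"
    by (simp add: trace_kraus_dual adj_kraus)
  also have "\<dots> = kraus c (\<lambda>i. adj (K i)) Y \<bullet> X"
    by (simp add: inner_matrix_eq trace_mul_sym[of X])
  finally show ?thesis .
qed

lemma kraus_norm_bound:
  "\<exists>C>0. \<forall>c X. norm (kraus c K X) \<le> C * (\<Sum>i\<in>UNIV. \<bar>c i\<bar>) * norm (X :: complex^'h^'h)"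
proof -
  obtain B where B: "B > 0" "\<And>X Y. norm ((X :: complex^'h^'h) ** (Y :: complex^'h^'h)) \<le> norm X * norm Y * B"
    using matrix_mult_norm_bound by blast
  define C where "C = (\<Sum>i\<in>UNIV. norm (K i) * norm (adj (K i)) * B * B) + 1"
  have C: "norm (K i) * norm (adj (K i)) * B * B \<le> C" for i
  proof -
    have "norm (K i) * norm (adj (K i)) * B * B \<le> (\<Sum>i\<in>UNIV. norm (K i) * norm (adj (K i)) * B * B)"
      using B(1) by (intro member_le_sum) auto
    then show ?thesis by (simp add: C_def)
  qed
  have C0: "C > 0" unfolding C_def using B(1) by (intro add_nonneg_pos sum_nonneg) auto
  have "norm (kraus c K X) \<le> C * (\<Sum>i\<in>UNIV. \<bar>c i\<bar>) * norm X" for c X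
  proof -
    have "norm (kraus c K X) \<le> (\<Sum>i\<in>UNIV. \<bar>c i\<bar> * (C * norm X))"
      unfolding kraus_def
    proof (rule sum_norm_le)
      fix i
      have "norm (K i ** X ** adj (K i)) \<le> norm (K i ** X) * norm (adj (K i)) * B" by (rule B)
      also have "\<dots> \<le> (norm (K i) * norm X * B) * norm (adj (K i)) * B"
        using B by (intro mult_right_mono) auto
      also have "\<dots> \<le> C * norm X"
        using mult_right_mono[OF C[of i] norm_ge_zero[of X]] by (simp add: mult_ac)
      finally show "norm (c i *\<^sub>R (K i ** X ** adj (K i))) \<le> \<bar>c i\<bar> * (C * norm X)"
        by (simp add: mult_left_mono)
    qed
    also have "\<dots> = C * (\<Sum>i\<in>UNIV. \<bar>c i\<bar>) * norm X" by (simp add: sum_distrib_left sum_distrib_right mult_ac)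
    finally show ?thesis .
  qed
  with C0 show ?thesis by blast
qed

lemma has_vector_derivativeI_quotient:
  assumes "((\<lambda>t. (1 / (t - s)) *\<^sub>R (f t - f s)) \<longlongrightarrow> D) (at (s :: real))"
  shows "(f has_vector_derivative D) (at s)"
  unfolding has_vector_derivative_def has_derivative_iff_norm
proof
  show "bounded_linear (\<lambda>h. h *\<^sub>R D)" by (rule bounded_linear_scaleR_left)
  have "((\<lambda>t. norm ((1 / (t - s)) *\<^sub>R (f t - f s) - D)) \<longlongrightarrow> 0) (at s)"
    using tendsto_norm[OF tendsto_diff[OF assms tendsto_const[of D]]] by simp
  moreover have "\<forall>\<^sub>F t in at s. norm ((1 / (t - s)) *\<^sub>R (f t - f s) - D)
      = norm (f t - f s - (t - s) *\<^sub>R D) / norm (t - s)"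
    unfolding eventually_at_filter
  proof (intro always_eventually allI impI)
    fix t assume "t \<noteq> s"
    then have "(1 / (t - s)) *\<^sub>R (f t - f s) - D = (1 / (t - s)) *\<^sub>R (f t - f s - (t - s) *\<^sub>R D)"
      by (simp add: scaleR_diff_right)
    then show "norm ((1 / (t - s)) *\<^sub>R (f t - f s) - D) = norm (f t - f s - (t - s) *\<^sub>R D) / norm (t - s)"
      by simp
  qed
  ultimately show "((\<lambda>t. norm (f t - f s - (t - s) *\<^sub>R D) / norm (t - s)) \<longlongrightarrow> 0) (at s)"
    by (rule Lim_transform_eventually)
qed

text \<open>The eigenvectors \<open>x t\<close> will come from a choice function, so not even
  continuity is given. Pairing with the left eigenvector at \<open>s\<close> controls the
  eigenvalue. The map \<open>B\<close>, the Kraus map at \<open>s\<close> minus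
  \<open>lam s\<close>, is injective on the directions of \<open>S\<close> with \<phi> equal to 0,
  hence bounded below there; this turns convergence of \<open>B\<close> applied to differences and
  to difference quotients into convergence of these themselves.\<close>

lemma eigen_curve:
  fixes M :: "'j::finite \<Rightarrow> complex^'h^'h" and a :: "'j \<Rightarrow> real" and x y :: "real \<Rightarrow> complex^'h^'h"
    and lam :: "real \<Rightarrow> real" and \<phi> :: "complex^'h^'h \<Rightarrow> real"
  assumes S: "subspace S" and \<phi>: "linear \<phi>"
    and x: "\<And>t. x t \<in> S" "\<And>t. \<phi> (x t) = 1" "\<And>t. norm (x t) \<le> C"
      "\<And>t. kraus (\<lambda>i. exp (t * a i)) M (x t) = lam t *\<^sub>R x t"
    and y: "kraus (\<lambda>i. exp (s * a i)) (\<lambda>i. adj (M i)) (y s) = lam s *\<^sub>R y s"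
    and pair: "c > 0" "\<And>t. c \<le> y s \<bullet> x t"
    and inj: "\<And>z. z \<in> S \<Longrightarrow> \<phi> z = 0 \<Longrightarrow> kraus (\<lambda>i. exp (s * a i)) M z = lam s *\<^sub>R z \<Longrightarrow> z = 0"
  defines "D \<equiv> (y s \<bullet> kraus (\<lambda>i. a i * exp (s * a i)) M (x s)) / (y s \<bullet> x s)"
  shows "(lam has_real_derivative D) (at s)"
    and "\<exists>x'. (x has_vector_derivative x') (at s) \<and> x' \<in> S \<and> \<phi> x' = 0 \<and>
      kraus (\<lambda>i. exp (s * a i)) M x' - lam s *\<^sub>R x'
        = D *\<^sub>R x s - kraus (\<lambda>i. a i * exp (s * a i)) M (x s)"
proof -
  define \<delta> where "\<delta> t i = exp (t * a i) - exp (s * a i)" for t i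
  define B where "B z = kraus (\<lambda>i. exp (s * a i)) M z - lam s *\<^sub>R z" for z
  have linB: "linear B"
    unfolding B_def by (intro linear_compose_sub linear_kraus linear_scale_self)
  have C0: "C \<ge> 0" using x(3)[of 0] norm_ge_zero order_trans by blast
  have \<delta>_lim: "((\<lambda>t. \<delta> t i) \<longlongrightarrow> 0) (at s)" for i
  proof -
    have "((\<lambda>t. \<delta> t i) \<longlongrightarrow> exp (s * a i) - exp (s * a i)) (at s)"
      unfolding \<delta>_def by (intro tendsto_intros)
    then show ?thesis by simp
  qed
  have q_lim: "((\<lambda>t. \<delta> t i / (t - s)) \<longlongrightarrow> a i * exp (s * a i)) (at s)" for i
  proof -
    have "((\<lambda>t. exp (t * a i)) has_field_derivative exp (s * a i) * a i) (at s)"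
      by (auto intro!: derivative_eq_intros)
    then show ?thesis by (simp add: has_field_derivative_iff \<delta>_def mult.commute)
  qed
  obtain Kc where Kc: "Kc > 0" "\<And>c X. norm (kraus c M X) \<le> Kc * (\<Sum>i\<in>UNIV. \<bar>c i\<bar>) * norm X"
    using kraus_norm_bound[of M] by blast
  have kd: "kraus (\<delta> t) M (x t) = lam t *\<^sub>R x t - kraus (\<lambda>i. exp (s * a i)) M (x t)" for t
    unfolding \<delta>_def kraus_weights_diff[symmetric] x(4) ..
  have kd_lim: "((\<lambda>t. kraus (\<delta> t) M (x t)) \<longlongrightarrow> 0) (at s)"
  proof (rule Lim_null_comparison)
    show "\<forall>\<^sub>F t in at s. norm (kraus (\<delta> t) M (x t)) \<le> Kc * (\<Sum>i\<in>UNIV. \<bar>\<delta> t i\<bar>) * C"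
    proof (intro always_eventually allI)
      fix t
      have "norm (kraus (\<delta> t) M (x t)) \<le> Kc * (\<Sum>i\<in>UNIV. \<bar>\<delta> t i\<bar>) * norm (x t)" by (rule Kc)
      also have "\<dots> \<le> Kc * (\<Sum>i\<in>UNIV. \<bar>\<delta> t i\<bar>) * C"
        using Kc(1) x(3) by (intro mult_left_mono mult_nonneg_nonneg sum_nonneg) auto
      finally show "norm (kraus (\<delta> t) M (x t)) \<le> Kc * (\<Sum>i\<in>UNIV. \<bar>\<delta> t i\<bar>) * C" .
    qed
    have "((\<lambda>t. Kc * (\<Sum>i\<in>UNIV. \<bar>\<delta> t i\<bar>) * C) \<longlongrightarrow> Kc * (\<Sum>i\<in>(UNIV :: 'j set). \<bar>0\<bar>) * C) (at s)"
      by (intro tendsto_intros \<delta>_lim)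
    then show "((\<lambda>t. Kc * (\<Sum>i\<in>UNIV. \<bar>\<delta> t i\<bar>) * C) \<longlongrightarrow> 0) (at s)" by simp
  qed
  have yx: "y s \<bullet> x t > 0" for t using pair by (meson less_le_trans)
  \<comment> \<open>Pairing with the left eigenvector at \<open>s\<close> eliminates the unknown
    change of \<open>x t\<close>; the denominator is bounded below by assumption.\<close>
  have key: "lam t - lam s = (y s \<bullet> kraus (\<delta> t) M (x t)) / (y s \<bullet> x t)" for t
  proof -
    have "y s \<bullet> kraus (\<lambda>i. exp (s * a i)) M (x t) = lam s * (y s \<bullet> x t)"
      by (simp add: inner_kraus y)
    then have "y s \<bullet> kraus (\<delta> t) M (x t) = (lam t - lam s) * (y s \<bullet> x t)"
      by (simp add: kd inner_diff_right algebra_simps)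
    then show ?thesis using yx[of t] by (simp add: field_simps)
  qed
  have lam_lim: "((\<lambda>t. lam t - lam s) \<longlongrightarrow> 0) (at s)"
  proof (rule Lim_null_comparison)
    show "\<forall>\<^sub>F t in at s. norm (lam t - lam s) \<le> \<bar>y s \<bullet> kraus (\<delta> t) M (x t)\<bar> / c"
    proof (intro always_eventually allI)
      fix t
      have "norm (lam t - lam s) = \<bar>y s \<bullet> kraus (\<delta> t) M (x t)\<bar> / (y s \<bullet> x t)"
        unfolding key using yx[of t] by simp
      also have "\<dots> \<le> \<bar>y s \<bullet> kraus (\<delta> t) M (x t)\<bar> / c"
        using pair(1) pair(2)[of t] by (intro divide_left_mono mult_pos_pos yx) auto
      finally show "norm (lam t - lam s) \<le> \<bar>y s \<bullet> kraus (\<delta> t) M (x t)\<bar> / c" .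
    qed
    have "((\<lambda>t. \<bar>y s \<bullet> kraus (\<delta> t) M (x t)\<bar> / c) \<longlongrightarrow> \<bar>y s \<bullet> 0\<bar> / c) (at s)"
      using pair(1) by (intro tendsto_intros kd_lim) simp
    then show "((\<lambda>t. \<bar>y s \<bullet> kraus (\<delta> t) M (x t)\<bar> / c) \<longlongrightarrow> 0) (at s)" by simp
  qed
  define S0 where "S0 = {z \<in> S. \<phi> z = 0}"
  have S0: "subspace S0"
    using S unfolding S0_def subspace_def
    by (auto simp: linear_0[OF \<phi>] linear_add[OF \<phi>] linear_scale[OF \<phi>])
  \<comment> \<open>An injective linear map on a finite-dimensional subspace is bounded
    below.\<close>
  obtain e where e: "e > 0" "\<And>z. z \<in> S0 \<Longrightarrow> e * norm z \<le> norm (B z)"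
  proof -
    have "\<exists>e>0. \<forall>z\<in>S0. e * norm z \<le> norm (B z)"
    proof (rule injective_imp_isometric)
      show "closed S0" by (rule closed_subspace[OF S0])
      show "bounded_linear B" using linB linear_conv_bounded_linear by blast
      show "\<forall>z\<in>S0. B z = 0 \<longrightarrow> z = 0" using inj by (simp add: S0_def B_def)
    qed (rule S0)
    then show ?thesis using that by blast
  qed
  have dS0: "x t - x s \<in> S0" for t
    using x(1,2) S by (simp add: S0_def subspace_diff linear_diff[OF \<phi>])
  have Bx: "B (x t - x s) = (lam t - lam s) *\<^sub>R x t - kraus (\<delta> t) M (x t)" for t
    unfolding kd B_def kraus_diff x(4) by (simp add: algebra_simps)
  have scaleR_lim: "((\<lambda>t. (lam t - lam s) *\<^sub>R x t) \<longlongrightarrow> 0) (at s)"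
  proof (rule Lim_null_comparison)
    show "\<forall>\<^sub>F t in at s. norm ((lam t - lam s) *\<^sub>R x t) \<le> \<bar>lam t - lam s\<bar> * C"
      using x(3) by (intro always_eventually allI) (simp add: mult_left_mono)
    have "((\<lambda>t. \<bar>lam t - lam s\<bar> * C) \<longlongrightarrow> \<bar>0\<bar> * C) (at s)" by (intro tendsto_intros lam_lim)
    then show "((\<lambda>t. \<bar>lam t - lam s\<bar> * C) \<longlongrightarrow> 0) (at s)" by simp
  qed
  have Bx_lim: "((\<lambda>t. B (x t - x s)) \<longlongrightarrow> 0) (at s)"
    using tendsto_diff[OF scaleR_lim kd_lim] by (simp add: Bx)
  have x_lim: "(x \<longlongrightarrow> x s) (at s)"
  proof (rule LIM_zero_cancel, rule Lim_null_comparison)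
    show "\<forall>\<^sub>F t in at s. norm (x t - x s) \<le> norm (B (x t - x s)) / e"
      using e dS0 by (intro always_eventually allI) (simp add: field_simps)
    have "((\<lambda>t. norm (B (x t - x s)) / e) \<longlongrightarrow> norm (0 :: complex^'h^'h) / e) (at s)"
      using e(1) by (intro tendsto_intros Bx_lim) simp
    then show "((\<lambda>t. norm (B (x t - x s)) / e) \<longlongrightarrow> 0) (at s)" by simp
  qed
  have kq: "(1 / (t - s)) *\<^sub>R kraus (\<delta> t) M (x t) = kraus (\<lambda>i. \<delta> t i / (t - s)) M (x t)" for t
    by (simp add: kraus_weights_scaleR)
  have kq_lim: "((\<lambda>t. kraus (\<lambda>i. \<delta> t i / (t - s)) M (x t)) \<longlongrightarrow> kraus (\<lambda>i. a i * exp (s * a i)) M (x s)) (at s)"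
    by (rule tendsto_kraus[OF q_lim x_lim])
  have lamq: "(lam t - lam s) / (t - s) = (y s \<bullet> kraus (\<lambda>i. \<delta> t i / (t - s)) M (x t)) / (y s \<bullet> x t)" for t
    unfolding kq[symmetric] by (subst key) simp
  have lamq_lim: "((\<lambda>t. (lam t - lam s) / (t - s)) \<longlongrightarrow> D) (at s)"
    unfolding lamq D_def using yx[of s] by (intro tendsto_intros kq_lim x_lim) simp
  then show "(lam has_real_derivative D) (at s)" by (simp add: has_field_derivative_iff)
  define v where "v = D *\<^sub>R x s - kraus (\<lambda>i. a i * exp (s * a i)) M (x s)"
  define z where "z t = (1 / (t - s)) *\<^sub>R (x t - x s)" for t
  have zS: "z t \<in> S0" for t unfolding z_def by (intro subspace_scale S0 dS0)
  have Bz: "B (z t) = ((lam t - lam s) / (t - s)) *\<^sub>R x t - kraus (\<lambda>i. \<delta> t i / (t - s)) M (x t)" for t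
    unfolding z_def linear_scale[OF linB] Bx by (simp add: scaleR_diff_right kq)
  have Bz_lim: "((\<lambda>t. B (z t)) \<longlongrightarrow> v) (at s)"
    unfolding Bz v_def by (intro tendsto_intros lamq_lim x_lim kq_lim)
  \<comment> \<open>The image of the finite-dimensional \<open>S0\<close> is closed, so the limit of
    \<open>B (z t)\<close> is attained; its preimage is the derivative.\<close>
  have "v \<in> B ` S0"
  proof (rule Lim_in_closed_set[OF _ _ _ Bz_lim])
    show "closed (B ` S0)" by (intro closed_subspace linear_subspace_image linB S0)
    show "\<forall>\<^sub>F t in at s. B (z t) \<in> B ` S0" using zS by (intro always_eventually) blast
  qed simp
  then obtain x' where x': "x' \<in> S0" "B x' = v" by auto
  have "(z \<longlongrightarrow> x') (at s)"
  proof (rule LIM_zero_cancel, rule Lim_null_comparison)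
    show "\<forall>\<^sub>F t in at s. norm (z t - x') \<le> norm (B (z t) - v) / e"
    proof (intro always_eventually allI)
      fix t
      have "e * norm (z t - x') \<le> norm (B (z t - x'))" by (intro e(2) subspace_diff S0 zS x')
      then show "norm (z t - x') \<le> norm (B (z t) - v) / e"
        using e(1) by (simp add: linear_diff[OF linB] x' field_simps)
    qed
    have "((\<lambda>t. norm (B (z t) - v) / e) \<longlongrightarrow> norm (v - v) / e) (at s)"
      using e(1) by (intro tendsto_intros Bz_lim) simp
    then show "((\<lambda>t. norm (B (z t) - v) / e) \<longlongrightarrow> 0) (at s)" by simp
  qed
  then have "(x has_vector_derivative x') (at s)"
    unfolding z_def by (rule has_vector_derivativeI_quotient)
  then show "\<exists>x'. (x has_vector_derivative x') (at s) \<and> x' \<in> S \<and> \<phi> x' = 0 \<and>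
      kraus (\<lambda>i. exp (s * a i)) M x' - lam s *\<^sub>R x'
        = D *\<^sub>R x s - kraus (\<lambda>i. a i * exp (s * a i)) M (x s)"
    using x' unfolding S0_def B_def v_def by blast
qed

lemma kraus_has_vector_derivative:
  assumes "(x has_vector_derivative x') (at s)"
  shows "((\<lambda>t. kraus (\<lambda>i. w i * exp (t * a i)) M (x t)) has_vector_derivative
    (kraus (\<lambda>i. w i * exp (s * a i)) M x' + kraus (\<lambda>i. w i * a i * exp (s * a i)) M (x s))) (at s)"
proof -
  have "((\<lambda>t. (w i * exp (t * a i)) *\<^sub>R (M i ** x t ** adj (M i))) has_vector_derivative
     ((w i * exp (s * a i)) *\<^sub>R (M i ** x' ** adj (M i)) + (w i * a i * exp (s * a i)) *\<^sub>R (M i ** x s ** adj (M i)))) (at s)"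
    for i
  proof (rule has_vector_derivative_scaleR)
    show "((\<lambda>t. w i * exp (t * a i)) has_field_derivative w i * a i * exp (s * a i)) (at s)"
      by (auto intro!: derivative_eq_intros)
    show "((\<lambda>t. M i ** x t ** adj (M i)) has_vector_derivative M i ** x' ** adj (M i)) (at s)"
      by (intro bounded_linear.has_vector_derivative[OF mm.bounded_linear_left]
          bounded_linear.has_vector_derivative[OF mm.bounded_linear_right] assms)
  qed
  from has_vector_derivative_sum[of UNIV, OF this] show ?thesis
    by (simp add: kraus_def sum.distrib)
qed

section \<open>Tilted channels on a minimal enclosure\<close>

lemma compressed_ops_eq: "vec.subspace U \<Longrightarrow> compressed_ops U = {X. corner U X}"
  by (auto simp: compressed_ops_def corner_compress) (auto simp: corner_def intro: rangeI sym image_eqI)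

lemma subspace_corner: "subspace {X. corner U X}"
  by (auto simp: subspace_def corner_add corner_scaleR)

lemma subspace_hermitian_corner: "subspace {X. adj X = X \<and> corner U X}"
  by (auto simp: subspace_def corner_add corner_scaleR adj_add adj_scaleR adj_zero)

text \<open>A positive operator with full support in \<open>U\<close> dominates a positive multiple
  of the projection onto \<open>U\<close>, by \<open>psd_perturb\<close>.\<close>

lemma psd_pairing_lower:
  assumes y: "psd y" "supp y = U"
  shows "\<exists>d>0. \<forall>X. psd X \<longrightarrow> corner U X \<longrightarrow> d * Re (trace X) \<le> y \<bullet> X"
proof -
  have sub: "vec.subspace U" using subspace_supp y(2) by blast
  obtain d where d: "d > 0" "psd (y - d *\<^sub>R ortho_proj U)"
    using psd_perturb[OF y(1) proj_adj[OF sub]] corner_proj[OF sub] y(2) by blast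
  have "d * Re (trace X) \<le> y \<bullet> X" if X: "psd X" "corner U X" for X
  proof -
    have "0 \<le> Re (trace ((y - d *\<^sub>R ortho_proj U) ** X))" by (rule trace_psd_mult(2)[OF d(2) X(1)])
    also have "\<dots> = y \<bullet> X - d * Re (trace X)"
      using cornerD(1)[OF sub X(2)]
      by (simp add: inner_matrix_eq psd_adj[OF y(1)] mm.diff_left mm.scaleR_left tr_diff tr_scaleR)
    finally show ?thesis by simp
  qed
  with d(1) show ?thesis by blast
qed

text \<open>The compressed operators \<open>L i p\<close> and their adjoints are both irreducible on \<open>U\<close>, so both the
  tilted channel and its dual have faithful Perron--Frobenius eigenvectors.\<close>

lemma irred_compress:
  assumes "irred L U"
  shows "irred (\<lambda>i. L i ** ortho_proj U) U"
proof -
  have *: "invsub (\<lambda>i. L i ** ortho_proj U) W \<longleftrightarrow> invsub L W" if "W \<subseteq> U" for W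
  proof -
    have "(L i ** ortho_proj U) *v x = L i *v x" if "x \<in> W" for i x
      using that \<open>W \<subseteq> U\<close> proj_fix[OF irredD(2)[OF assms], of x]
      by (auto simp: matrix_vector_mul_assoc[symmetric])
    then show ?thesis by (simp add: invsub_def)
  qed
  then show ?thesis using assms by (auto simp: irred_def)
qed

text \<open>Taking orthogonal complements inside \<open>U\<close> exchanges the invariant subspaces
  of the family with those of its adjoints. The assumption that \<open>M i\<close> lives in the
  corner makes the adjoints preserve \<open>U\<close>, which the adjoints of the uncompressed
  operators need not do.\<close>

lemma irred_adj:
  assumes U: "irred M U" and M: "\<And>i. ortho_proj U ** M i ** ortho_proj U = M i"
  shows "irred (\<lambda>i. adj (M i)) U"
proof -
  note sub = irredD(2)[OF U]
  define p where "p = ortho_proj U"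
  have padj: "p ** adj (M i) ** p = adj (M i)" for i
    using arg_cong[OF M[of i], of adj] by (simp add: adj_mult p_def proj_adj[OF sub] matrix_mul_assoc)
  have "p ** (p ** adj (M i) ** p) = p ** adj (M i) ** p" for i
    using proj_idem[OF sub] by (simp add: p_def matrix_mul_assoc)
  then have "p ** adj (M i) = adj (M i)" for i unfolding padj .
  then have in_U: "adj (M i) *v x \<in> U" for i x
    using proj_fix[OF sub] by (simp add: p_def matrix_vector_mul_assoc)
  have "W = {0} \<or> W = U" if W: "invsub (\<lambda>i. adj (M i)) W" "W \<subseteq> U" for W
  proof -
    define V where "V = U \<inter> ortho_compl W"
    have "invsub M V"
      unfolding invsub_def
    proof (intro conjI allI ballI)
      show "vec.subspace V" unfolding V_def by (intro vec.subspace_inter sub subspace_ortho_compl)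
      fix i x assume x: "x \<in> V"
      have "cinner w (M i *v x) = 0" if "w \<in> W" for w
      proof -
        have "adj (M i) *v w \<in> W" using W(1) that by (auto simp: invsub_def)
        then have "cinner (adj (M i) *v w) x = 0" using x by (auto simp: V_def ortho_compl_def)
        then show ?thesis by (simp add: cinner_adj')
      qed
      moreover have "M i *v x \<in> U" using x irredD(1)[OF U] by (auto simp: V_def invsub_def)
      ultimately show "M i *v x \<in> V" by (simp add: V_def ortho_compl_def)
    qed
    then have "V = {0} \<or> V = U" using U by (auto simp: irred_def V_def)
    then show ?thesis
    proof
      assume V: "V = U"
      have "x = 0" if "x \<in> W" for x
        using that V W(2) ortho_compl_Int[of x W] by (auto simp: V_def)
      then show ?thesis using vec.subspace_0[OF invsub_subspace[OF W(1)]] by blast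
    next
      assume V: "V = {0}"
      note subW = invsub_subspace[OF W(1)]
      have "x \<in> W" if "x \<in> U" for x
      proof -
        have "x - ortho_proj W *v x \<in> V"
          using that W(2) proj_in[OF subW, of x] proj_compl[OF subW, of x] vec.subspace_diff[OF sub]
          by (auto simp: V_def)
        then have "ortho_proj W *v x = x" using V by auto
        then show ?thesis using proj_in[OF subW, of x] by simp
      qed
      then show ?thesis using W(2) by blast
    qed
  qed
  then show ?thesis
    using sub irredD(3)[OF U] in_U by (auto simp: irred_def invsub_def)
qed

lemma kraus_compress:
  assumes U: "vec.subspace U" and X: "corner U X"
  shows "kraus c (\<lambda>i. L i ** ortho_proj U) X = kraus c L X"
proof -
  have "L i ** ortho_proj U ** X ** adj (L i ** ortho_proj U) = L i ** X ** adj (L i)" for i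
  proof -
    have "L i ** ortho_proj U ** X ** adj (L i ** ortho_proj U)
        = L i ** (ortho_proj U ** X ** ortho_proj U) ** adj (L i)"
      by (simp add: adj_mult proj_adj[OF U] matrix_mul_assoc)
    then show ?thesis using X by (simp add: corner_def)
  qed
  then show ?thesis by (simp add: kraus_def)
qed

text \<open>The eigenvector \<open>X\<close> puts \<open>r\<close> into the spectrum. Conversely,
  pairing with the left eigenvector \<open>y\<close> multiplies by \<open>r\<close> at each step,
  and \<open>y\<close> is faithful, so the powers of the map grow at most like \<open>r^n\<close> on
  the corner; an eigenvalue of larger modulus would contradict this.\<close>

lemma tilted_radius_eq:
  assumes U: "irred L U" and X: "psd X" "corner U X" "X \<noteq> 0" "kraus (\<lambda>i. exp (u \<bullet> s i)) L X = r *\<^sub>R X"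
    and r: "r > 0"
    and y: "psd y" "supp y = U"
      "kraus (\<lambda>i. exp (u \<bullet> s i)) (\<lambda>i. adj (L i ** ortho_proj U)) y = r *\<^sub>R y"
  shows "tilted_radius s L U u = r"
proof -
  define c where "c i = exp (u \<bullet> s i)" for i
  define A where "A = kraus c L"
  define S where "S = {X. corner U X}"
  note sub = irredD(2)[OF U] and inv = irredD(1)[OF U]
  have linA: "linear A" unfolding A_def by (rule linear_kraus)
  have AS: "A Y \<in> S" if "Y \<in> S" for Y using invsub_corner[OF inv] that by (simp add: S_def A_def)
  have AS_pow: "(A ^^ n) Y \<in> S" if "Y \<in> S" for n Y using that AS by (induction n) auto
  have c0: "c i \<ge> 0" for i by (simp add: c_def)
  have yA: "y \<bullet> A Y = r * (y \<bullet> Y)" if "Y \<in> S" for Y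
  proof -
    have "y \<bullet> A Y = y \<bullet> kraus c (\<lambda>i. L i ** ortho_proj U) Y"
      using that by (simp add: A_def S_def kraus_compress[OF sub])
    also have "\<dots> = r * (y \<bullet> Y)" using y(3)[folded c_def] by (simp add: inner_kraus)
    finally show ?thesis .
  qed
  have yA_pow: "y \<bullet> (A ^^ n) Y = r ^ n * (y \<bullet> Y)" if "Y \<in> S" for n Y
    by (induction n) (simp_all add: yA AS_pow that)
  obtain d where d: "d > 0" "\<And>X. psd X \<Longrightarrow> corner U X \<Longrightarrow> d * Re (trace X) \<le> y \<bullet> X"
    using psd_pairing_lower[OF y(1,2)] by blast
  obtain K where K: "K > 0" "\<And>\<omega> :: complex^'b^'b. psd \<omega> \<Longrightarrow> norm \<omega> \<le> K * Re (trace \<omega>)"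
    using norm_psd_le by blast
  have Amat: "A (mat z ** Y) = mat z ** A Y" for z Y unfolding A_def by (rule kraus_mat)
  have Amat_pow: "(A ^^ n) (mat z ** Y) = mat z ** (A ^^ n) Y" for n z Y
    by (induction n) (simp_all add: Amat)
  have linA_pow: "linear (A ^^ n)" for n
  proof (induction n)
    case (Suc n)
    from linear_compose[OF this linA] show ?case by (simp add: o_def)
  qed (simp add: linear_iff)
  define p where "p = ortho_proj U"
  \<comment> \<open>Stated for the compression of an arbitrary \<open>Y\<close> because
    \<open>psd_induct\<close> ranges over all matrices.\<close>
  have growth: "\<exists>C. \<forall>n. norm ((A ^^ n) (p ** Y ** p)) \<le> C * r ^ n" for Y
  proof (induction Y rule: psd_induct)
    case (psd Y)
    define \<omega> where "\<omega> = p ** Y ** p"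
    have \<omega>: "psd \<omega>" "\<omega> \<in> S"
      using psd_conj[OF psd, of p] corner_compress[OF sub, of Y]
      by (simp_all add: \<omega>_def p_def proj_adj[OF sub] S_def)
    have psd_pow: "psd ((A ^^ n) \<omega>)" for n
      by (induction n) (simp_all add: \<omega> A_def psd_kraus c0)
    have "norm ((A ^^ n) \<omega>) \<le> (K / d * (y \<bullet> \<omega>)) * r ^ n" for n
    proof -
      have "norm ((A ^^ n) \<omega>) \<le> K * Re (trace ((A ^^ n) \<omega>))" by (rule K(2)[OF psd_pow])
      also have "\<dots> \<le> K * ((y \<bullet> (A ^^ n) \<omega>) / d)"
        using d(2)[OF psd_pow[of n]] AS_pow[OF \<omega>(2), of n] d(1) K(1)
        by (intro mult_left_mono) (auto simp: S_def field_simps)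
      also have "\<dots> = (K / d * (y \<bullet> \<omega>)) * r ^ n" by (simp add: yA_pow[OF \<omega>(2)])
      finally show ?thesis .
    qed
    then show ?case unfolding \<omega>_def by blast
  next
    case (add X Y)
    then obtain C D where CD: "\<And>n. norm ((A ^^ n) (p ** X ** p)) \<le> C * r ^ n"
      "\<And>n. norm ((A ^^ n) (p ** Y ** p)) \<le> D * r ^ n" by blast
    have "norm ((A ^^ n) (p ** (X + Y) ** p)) \<le> (C + D) * r ^ n" for n
      unfolding mm.add_right mm.add_left linear_add[OF linA_pow] distrib_right
      by (intro norm_triangle_mono CD)
    then show ?case by blast
  next
    case (scale z X)
    then obtain C where C: "\<And>n. norm ((A ^^ n) (p ** X ** p)) \<le> C * r ^ n" by blast
    obtain K where K: "K > 0" "\<And>A B. norm ((A :: complex^'b^'b) ** (B :: complex^'b^'b)) \<le> norm A * norm B * K"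
      using matrix_mult_norm_bound by blast
    have eq: "p ** (mat z ** X) ** p = mat z ** (p ** X ** p)"
      by (simp add: matrix_mul_assoc mat_mult_commute)
    have "norm ((A ^^ n) (p ** (mat z ** X) ** p)) \<le> (norm (mat z :: complex^'b^'b) * C * K) * r ^ n" for n
    proof -
      have "norm ((A ^^ n) (p ** (mat z ** X) ** p))
          \<le> norm (mat z :: complex^'b^'b) * norm ((A ^^ n) (p ** X ** p)) * K"
        unfolding eq Amat_pow by (rule K)
      also have "\<dots> \<le> norm (mat z :: complex^'b^'b) * (C * r ^ n) * K"
        using K(1) by (intro mult_right_mono mult_left_mono C) auto
      finally show ?thesis by (simp add: mult_ac)
    qed
    then show ?case by blast
  qed
  have spec: "spectrum_on (compressed_ops U) (tilted_channel s L u)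
      = {z. \<not> bij_betw (\<lambda>\<sigma>. A \<sigma> - mat z ** \<sigma>) S S}"
    by (simp add: spectrum_on_def compressed_ops_eq[OF sub] S_def tilted_channel_kraus A_def c_def[abs_def])
  have r_in: "of_real r \<in> {z. \<not> bij_betw (\<lambda>\<sigma>. A \<sigma> - mat z ** \<sigma>) S S}"
  proof
    have "A X - mat (of_real r) ** X = A 0 - mat (of_real r) ** 0"
      using X(4) by (simp add: A_def c_def[abs_def] mat_of_real_mult kraus_0 mm.zero_right)
    then have "\<not> inj_on (\<lambda>\<sigma>. A \<sigma> - mat (of_real r) ** \<sigma>) S"
      using inj_onD[of "\<lambda>\<sigma>. A \<sigma> - mat (of_real r) ** \<sigma>" S X 0] X(2,3) by (auto simp: S_def)
    then show "\<not> bij_betw (\<lambda>\<sigma>. A \<sigma> - mat (of_real r) ** \<sigma>) S S" by (simp add: bij_betw_def)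
  qed
  have bound: "cmod z \<le> r" if z: "\<not> bij_betw (\<lambda>\<sigma>. A \<sigma> - mat z ** \<sigma>) S S" for z
  proof -
    define f where "f \<sigma> = A \<sigma> - mat z ** \<sigma>" for \<sigma>
    have linf: "linear f"
      unfolding f_def by (intro linear_compose_sub linA bounded_linear.linear mm.bounded_linear_right)
    have subS: "subspace S" unfolding S_def by (rule subspace_corner)
    have fS: "f ` S \<subseteq> S"
      using AS by (auto simp: f_def S_def intro!: corner_diff corner_mat)
    \<comment> \<open>In finite dimension an injective map of \<open>S\<close> into itself is onto,
      so a spectral value is an eigenvalue.\<close>
    have "\<not> inj_on f S"
    proof
      assume inj: "inj_on f S"
      have "f ` S = S"
      proof (rule subspace_dim_equal)
        have sp: "span S = S" using subS by (simp add: span_eq_iff)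
        show "dim (f ` S) \<ge> dim S" using dim_image_eq[OF linf, of S, unfolded sp, OF inj] by simp
      qed (use fS subS linear_subspace_image[OF linf subS] in auto)
      then show False using z inj by (simp add: bij_betw_def f_def[abs_def])
    qed
    then obtain v1 v2 where v12: "v1 \<in> S" "v2 \<in> S" "f v1 = f v2" "v1 \<noteq> v2" by (auto simp: inj_on_def)
    define v where "v = v1 - v2"
    have v: "v \<in> S" "v \<noteq> 0" "f v = 0"
      using v12 subS by (auto simp: v_def subspace_diff linear_diff[OF linf])
    have "A v = mat z ** v" using v(3) by (simp add: f_def)
    then have pow: "(A ^^ n) v = mat (z ^ n) ** v" for n
    proof (induction n)
      case (Suc n)
      have "A (mat (z ^ n) ** v) = mat (z ^ n) ** (mat z ** v)" using Suc(2) by (simp add: Amat)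
      also have "\<dots> = mat (z ^ Suc n) ** v" by (simp add: mat_mult_left vec_eq_iff mult_ac)
      finally show ?case using Suc by simp
    qed (simp add: mat_mult_left vec_eq_iff)
    have "p ** v ** p = v" using v(1) by (simp add: S_def corner_def p_def)
    then obtain C where C: "\<And>n. norm ((A ^^ n) v) \<le> C * r ^ n" using growth[of v] by auto
    obtain i j where ij: "v $ i $ j \<noteq> 0" using v(2) by (auto simp: vec_eq_iff)
    have le: "cmod z ^ n * cmod (v $ i $ j) \<le> C * r ^ n" for n
    proof -
      have "cmod z ^ n * cmod (v $ i $ j) = norm ((A ^^ n) v $ i $ j)"
        by (simp add: pow mat_mult_left norm_mult norm_power)
      also have "\<dots> \<le> norm ((A ^^ n) v $ i)" by (rule Finite_Cartesian_Product.norm_nth_le)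
      also have "\<dots> \<le> norm ((A ^^ n) v)" by (rule Finite_Cartesian_Product.norm_nth_le)
      finally show ?thesis using C[of n] by simp
    qed
    show "cmod z \<le> r"
    proof (rule ccontr)
      assume "\<not> cmod z \<le> r"
      then have gt: "cmod z / r > 1" using r by simp
      define B where "B = C / cmod (v $ i $ j)"
      have "(cmod z / r) ^ n \<le> B" for n
        using le[of n] r ij by (simp add: B_def power_divide field_simps)
      moreover obtain n where "B < (cmod z / r) ^ n" using real_arch_pow[OF gt] by blast
      ultimately show False by (meson not_le)
    qed
  qed
  show ?thesis
    unfolding tilted_radius_def spectral_radius_on_def spec
  proof (rule cSup_eq_maximum)
    show "r \<in> cmod ` {z. \<not> bij_betw (\<lambda>\<sigma>. A \<sigma> - mat z ** \<sigma>) S S}"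
      using r by (intro image_eqI[OF _ r_in]) simp
  qed (use bound in auto)
qed

lemma hermitian_trace: "adj X = X \<Longrightarrow> trace X = of_real (Re (trace X))"
  using trace_adj[of X] by (auto simp: complex_eq_iff)

lemma Re_trace_linear: "linear (\<lambda>X. Re (trace (X :: complex^'h^'h)))"
  by (simp add: linear_iff tr_add tr_scaleR)

lemma perron_frobenius_family:
  assumes irr: "irred K U" and c: "\<And>t i. c t i > 0" and nz: "\<exists>i. K i ** ortho_proj U \<noteq> 0"
  shows "\<exists>x r. \<forall>t. psd (x t) \<and> corner U (x t) \<and> trace (x t) = 1 \<and> r t > 0
    \<and> kraus (c t) K (x t) = r t *\<^sub>R x t \<and> supp (x t) = U"
proof -
  define P where "P t z \<longleftrightarrow> psd (fst z) \<and> corner U (fst z) \<and> trace (fst z) = 1 \<and> snd z > 0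
    \<and> kraus (c t) K (fst z) = snd z *\<^sub>R fst z \<and> supp (fst z) = U" for t and z :: "(complex^'b^'b) \<times> real"
  have "\<exists>z. P t z" for t
  proof (rule perron_frobenius_exists[of K U "c t", OF irr c nz])
    fix X r
    assume "psd X" "corner U X" "trace X = 1" "r > 0" "kraus (c t) K X = r *\<^sub>R X" "supp X = U"
    then show ?thesis by (intro exI[of _ "(X, r)"]) (simp add: P_def)
  qed
  then have "\<forall>t. \<exists>z. P t z" ..
  from choice[OF this] obtain z where z: "\<And>t. P t (z t)" by blast
  show ?thesis
    by (rule exI[of _ "\<lambda>t. fst (z t)"], rule exI[of _ "\<lambda>t. snd (z t)"]) (use z in \<open>simp add: P_def\<close>)
qed

context kraus_channel
begin

text \<open>The formula for the second derivative comes from differentiating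
  \<open>\<lambda>' = \<langle>y, T' x\<rangle> / \<langle>y, x\<rangle>\<close> along the left and right eigenvectors \<open>y\<close> and \<open>x\<close>, the left one at the
  origin being proportional to the projection.\<close>
lemma tilted_radius_derivatives:
  fixes s :: "'j \<Rightarrow> real^'d" and u :: "real^'d"
  assumes W: "irred L W"
  defines "a \<equiv> \<lambda>i. u \<bullet> s i" and "lam \<equiv> \<lambda>t. tilted_radius s L W (t *\<^sub>R u)"
  shows "deriv lam 0 = u \<bullet> enclosure_mean s L W"
    and "\<exists>x'. corner W x' \<and> adj x' = x' \<and> trace x' = 0
      \<and> T x' - x' = (u \<bullet> enclosure_mean s L W) *\<^sub>R \<tau> W - kraus a L (\<tau> W)
      \<and> deriv (deriv lam) 0 = Re (trace (kraus (\<lambda>i. a i * a i) L (\<tau> W))) + 2 * Re (trace (kraus a L x'))"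
proof -
  define p where "p = ortho_proj W"
  \<comment> \<open>Compression leaves the action on the corner unchanged and makes the adjoints
    preserve \<open>W\<close>, so that left eigenvectors exist inside the corner as well.\<close>
  define M where "M i = L i ** p" for i
  define c where "c t i = exp (t * a i)" for t i
  note sub = irredD(2)[OF W] and inv = irredD(1)[OF W]
  have pp: "p ** p = p" "adj p = p" unfolding p_def by (rule proj_idem[OF sub] proj_adj[OF sub])+
  have c0: "c t i > 0" for t i by (simp add: c_def)
  have irrM: "irred M W" unfolding M_def[abs_def] p_def by (rule irred_compress[OF W])
  have kM: "kraus w M X = kraus w L X" if "corner W X" for w X
    unfolding M_def[abs_def] p_def by (rule kraus_compress[OF sub that])
  have pMp: "p ** M i ** p = M i" for i
  proof -
    have "p ** M i ** p = p ** L i ** p ** p" by (simp add: M_def matrix_mul_assoc)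
    also have "\<dots> = L i ** p ** p" using invsub_proj[OF inv, of i] by (simp add: p_def)
    also have "\<dots> = L i ** (p ** p)" by (rule matrix_mul_assoc[symmetric])
    finally show ?thesis by (simp add: pp M_def)
  qed
  have irrA: "irred (\<lambda>i. adj (M i)) W" by (rule irred_adj[OF irrM]) (rule pMp[unfolded p_def])
  obtain i0 where i0: "L i0 ** p \<noteq> 0" using enclosure_nonzero[OF inv irredD(3)[OF W]] by (auto simp: p_def)
  have nzM: "\<exists>i. M i ** ortho_proj W \<noteq> 0"
    using i0 pp by (intro exI[of _ i0]) (simp add: M_def p_def[symmetric] matrix_mul_assoc[symmetric])
  have nzA: "\<exists>i. adj (M i) ** ortho_proj W \<noteq> 0"
  proof (intro exI[of _ i0] notI)
    assume "adj (M i0) ** ortho_proj W = 0"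
    then have "adj (adj (M i0) ** p) = 0" by (simp add: p_def adj_zero)
    then have "p ** M i0 = 0" by (simp add: adj_mult pp)
    then have "M i0 = 0" using pMp[of i0] by (simp add: mm.zero_left)
    with i0 show False by (simp add: M_def)
  qed
  obtain x r where xr: "\<forall>t. psd (x t) \<and> corner W (x t) \<and> trace (x t) = 1 \<and> r t > 0
    \<and> kraus (c t) M (x t) = r t *\<^sub>R x t \<and> supp (x t) = W"
    using perron_frobenius_family[of M W c, OF irrM c0 nzM] by (elim exE)
  then have x: "psd (x t)" "corner W (x t)" "trace (x t) = 1" "r t > 0"
    "kraus (c t) M (x t) = r t *\<^sub>R x t" "supp (x t) = W" for t by simp_all
  obtain y r' where yr: "\<forall>t. psd (y t) \<and> corner W (y t) \<and> trace (y t) = 1 \<and> r' t > 0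
    \<and> kraus (c t) (\<lambda>i. adj (M i)) (y t) = r' t *\<^sub>R y t \<and> supp (y t) = W"
    using perron_frobenius_family[of "\<lambda>i. adj (M i)" W c, OF irrA c0 nzA] by (elim exE)
  then have y: "psd (y t)" "corner W (y t)" "trace (y t) = 1" "r' t > 0"
    "kraus (c t) (\<lambda>i. adj (M i)) (y t) = r' t *\<^sub>R y t" "supp (y t) = W" for t by simp_all
  have c_fun: "c t = (\<lambda>i. exp (t * a i))" for t by (simp add: c_def fun_eq_iff)
  have pair_y: "\<exists>d>0. \<forall>t. d \<le> y t0 \<bullet> x t" for t0
  proof -
    obtain d where "d > 0" "\<And>X. psd X \<Longrightarrow> corner W X \<Longrightarrow> d * Re (trace X) \<le> y t0 \<bullet> X"
      using psd_pairing_lower[OF y(1,6)] by blast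
    from this(1) this(2)[OF x(1,2)] show ?thesis by (intro exI[of _ d]) (simp add: x(3))
  qed
  have pair_x: "\<exists>d>0. \<forall>t. d \<le> x t0 \<bullet> y t" for t0
  proof -
    obtain d where "d > 0" "\<And>X. psd X \<Longrightarrow> corner W X \<Longrightarrow> d * Re (trace X) \<le> x t0 \<bullet> X"
      using psd_pairing_lower[OF x(1,6)] by blast
    from this(1) this(2)[OF y(1,2)] show ?thesis by (intro exI[of _ d]) (simp add: y(3))
  qed
  have rr: "r' t = r t" for t
  proof -
    obtain d where d: "d > 0" "d \<le> y t \<bullet> x t" using pair_y[of t] by blast
    have "r t * (y t \<bullet> x t) = y t \<bullet> kraus (c t) M (x t)" by (simp add: x(5))
    also have "\<dots> = r' t * (y t \<bullet> x t)" by (simp add: inner_kraus y(5))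
    finally show ?thesis using d by simp
  qed
  have lam: "lam t = r t" for t
    unfolding lam_def
  proof (rule tilted_radius_eq[OF W x(1,2) _ _ x(4) y(1,6)])
    have ce: "(\<lambda>i. exp (t *\<^sub>R u \<bullet> s i)) = c t" by (simp add: c_def a_def fun_eq_iff)
    show "x t \<noteq> 0" using x(3)[of t] by (auto simp: tr_zero)
    show "kraus (\<lambda>i. exp (t *\<^sub>R u \<bullet> s i)) L (x t) = r t *\<^sub>R x t"
      unfolding ce kM[OF x(2), symmetric] by (rule x(5))
    show "kraus (\<lambda>i. exp (t *\<^sub>R u \<bullet> s i)) (\<lambda>i. adj (L i ** ortho_proj W)) (y t) = r t *\<^sub>R y t"
      unfolding ce using y(5)[of t] unfolding rr M_def[abs_def] p_def .
  qed
  obtain K where K: "\<And>\<omega> :: complex^'h^'h. psd \<omega> \<Longrightarrow> norm \<omega> \<le> K * Re (trace \<omega>)"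
    using norm_psd_le by blast
  define S where "S = {X. adj X = X \<and> corner W X}"
  define \<phi> where "\<phi> X = Re (trace X)" for X :: "complex^'h^'h"
  have S: "subspace S" unfolding S_def by (rule subspace_hermitian_corner)
  have lin\<phi>: "linear \<phi>" unfolding \<phi>_def by (rule Re_trace_linear)
  define D where "D t = (y t \<bullet> kraus (\<lambda>i. a i * exp (t * a i)) M (x t)) / (y t \<bullet> x t)" for t
  have curve_x: "(r has_real_derivative D t) (at t)"
    "\<exists>x'. (x has_vector_derivative x') (at t) \<and> x' \<in> S \<and> \<phi> x' = 0 \<and>
      kraus (\<lambda>i. exp (t * a i)) M x' - r t *\<^sub>R x' = D t *\<^sub>R x t - kraus (\<lambda>i. a i * exp (t * a i)) M (x t)" for t
  proof -
    obtain d where d: "d > 0" "\<And>t'. d \<le> y t \<bullet> x t'" using pair_y[of t] by blast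
    have a1: "x t \<in> S" for t using x(1,2) by (simp add: S_def psd_adj)
    have a2: "\<phi> (x t) = 1" for t by (simp add: \<phi>_def x(3))
    have a3: "norm (x t) \<le> K" for t using K[OF x(1)[of t]] by (simp add: x(3))
    have a4: "kraus (\<lambda>i. exp (t * a i)) M (x t) = r t *\<^sub>R x t" for t using x(5)[of t] by (simp add: c_fun)
    have a5: "kraus (\<lambda>i. exp (t * a i)) (\<lambda>i. adj (M i)) (y t) = r t *\<^sub>R y t"
      using y(5)[of t] rr by (simp add: c_fun)
    have a6: "z = 0" if "z \<in> S" "\<phi> z = 0" "kraus (\<lambda>i. exp (t * a i)) M z = r t *\<^sub>R z" for z
    proof (rule perron_frobenius_unique[OF irrM c0 x(1,2) _ x(5)])
      show "x t \<noteq> 0" using x(3)[of t] by (auto simp: tr_zero)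
    qed (use that in \<open>simp_all add: S_def \<phi>_def c_fun\<close>)
    show "(r has_real_derivative D t) (at t)"
      unfolding D_def by (rule eigen_curve(1)[where S = S and \<phi> = \<phi> and x = x and y = y and s = t and lam = r and a = a and M = M and C = K and c = d, OF S lin\<phi>
          a1 a2 a3 a4 a5 d a6])
    show "\<exists>x'. (x has_vector_derivative x') (at t) \<and> x' \<in> S \<and> \<phi> x' = 0 \<and>
      kraus (\<lambda>i. exp (t * a i)) M x' - r t *\<^sub>R x' = D t *\<^sub>R x t - kraus (\<lambda>i. a i * exp (t * a i)) M (x t)"
      unfolding D_def by (rule eigen_curve(2)[where S = S and \<phi> = \<phi> and x = x and y = y and s = t and lam = r and a = a and M = M and C = K and c = d, OF S lin\<phi>
          a1 a2 a3 a4 a5 d a6])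
  qed
  \<comment> \<open>The derivative of the eigenvalue as seen from the left eigenvectors; by duality
    it is the same number, so \<open>eigen_curve\<close> differentiates the curve \<open>y\<close>
    with the same \<open>D\<close>.\<close>
  define D' where "D' t = (x t \<bullet> kraus (\<lambda>i. a i * exp (t * a i)) (\<lambda>i. adj (M i)) (y t)) / (x t \<bullet> y t)" for t
  have D'D: "D' t = D t" for t
    unfolding D_def D'_def inner_commute[of "y t"] by (simp only: inner_kraus adj_adj)
  have curve_y: "\<exists>y'. (y has_vector_derivative y') (at t) \<and> y' \<in> S \<and> \<phi> y' = 0 \<and>
      kraus (\<lambda>i. exp (t * a i)) (\<lambda>i. adj (M i)) y' - r t *\<^sub>R y'
        = D t *\<^sub>R y t - kraus (\<lambda>i. a i * exp (t * a i)) (\<lambda>i. adj (M i)) (y t)" for t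
  proof -
    obtain d where d: "d > 0" "\<And>t'. d \<le> x t \<bullet> y t'" using pair_x[of t] by blast
    have a1: "y t \<in> S" for t using y(1,2) by (simp add: S_def psd_adj)
    have a2: "\<phi> (y t) = 1" for t by (simp add: \<phi>_def y(3))
    have a3: "norm (y t) \<le> K" for t using K[OF y(1)[of t]] by (simp add: y(3))
    have a4: "kraus (\<lambda>i. exp (t * a i)) (\<lambda>i. adj (M i)) (y t) = r t *\<^sub>R y t" for t
      using y(5)[of t] rr by (simp add: c_fun)
    have a5: "kraus (\<lambda>i. exp (t * a i)) (\<lambda>i. adj (adj (M i))) (x t) = r t *\<^sub>R x t"
      using x(5)[of t] by (simp add: c_fun)
    have a6: "z = 0" if "z \<in> S" "\<phi> z = 0" "kraus (\<lambda>i. exp (t * a i)) (\<lambda>i. adj (M i)) z = r t *\<^sub>R z" for z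
    proof (rule perron_frobenius_unique[OF irrA c0 y(1,2) _ y(5)])
      show "y t \<noteq> 0" using y(3)[of t] by (auto simp: tr_zero)
    qed (use that in \<open>simp_all add: S_def \<phi>_def c_fun rr\<close>)
    show ?thesis
      unfolding D'D[symmetric] D'_def by (rule eigen_curve(2)[where S = S and \<phi> = \<phi> and x = y and y = x and s = t and lam = r and a = a and M = "\<lambda>i. adj (M i)" and C = K and c = d, OF S lin\<phi>
          a1 a2 a3 a4 a5 d a6])
  qed
  obtain x' where x': "(x has_vector_derivative x') (at 0)" "x' \<in> S" "\<phi> x' = 0"
      "kraus (\<lambda>_. 1) M x' - r 0 *\<^sub>R x' = D 0 *\<^sub>R x 0 - kraus a M (x 0)"
    using curve_x(2)[of 0] by auto
  obtain y' where y': "(y has_vector_derivative y') (at 0)" "y' \<in> S" "\<phi> y' = 0"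
      "kraus (\<lambda>_. 1) (\<lambda>i. adj (M i)) y' - r 0 *\<^sub>R y' = D 0 *\<^sub>R y 0 - kraus a (\<lambda>i. adj (M i)) (y 0)"
    using curve_y[of 0] by auto
  have c00: "c 0 = (\<lambda>_. 1)" by (simp add: c_def fun_eq_iff)
  have Tx0: "T (x 0) = r 0 *\<^sub>R x 0" using x(5)[of 0] by (simp add: c00 kM[OF x(2)] channel_kraus)
  then have "trace (T (x 0)) = r 0 *\<^sub>R trace (x 0)" by (simp add: tr_scaleR)
  then have r0: "r 0 = 1" by (simp add: trace_T x(3) scaleR_complex)
  then have "invariant_state L (x 0)" using Tx0 x(1,3) by (simp add: invariant_state_def)
  then have x0: "x 0 = \<tau> W" by (rule enclosure_state_eq[OF W _ x(2)])
  define P where "P = Re (trace p)"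
  have psdp: "psd p" unfolding p_def by (rule psd_proj[OF sub])
  have "p \<noteq> 0"
    using i0 by (auto simp: mm.zero_right)
  then have P0: "P > 0" using psd_trace_0[OF psdp] trace_psd(2)[OF psdp] unfolding P_def by (metis less_eq_real_def)
  \<comment> \<open>The normalisation of the Kraus operators, compressed to \<open>W\<close>, says
    that \<open>p\<close> is fixed by the compressed dual; uniqueness leaves only the scalar that
    makes the trace 1.\<close>
  have y0: "y 0 = (1/P) *\<^sub>R p"
  proof -
    have "kraus (\<lambda>_. 1) (\<lambda>i. adj (M i)) p = p"
    proof -
      have "kraus (\<lambda>_. 1) (\<lambda>i. adj (M i)) p = (\<Sum>i\<in>UNIV. p ** (adj (L i) ** L i) ** p)"
      proof -
        have "adj (M i) ** p ** adj (adj (M i)) = p ** (adj (L i) ** L i) ** p" for i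
        proof -
          have "adj (M i) ** p ** adj (adj (M i)) = p ** adj (L i) ** (p ** L i ** p)"
            by (simp add: M_def adj_mult pp matrix_mul_assoc)
          also have "\<dots> = p ** adj (L i) ** (L i ** p)"
            using invsub_proj[OF inv, of i] by (simp add: p_def)
          finally show ?thesis by (simp add: matrix_mul_assoc)
        qed
        then show ?thesis by (simp add: kraus_def)
      qed
      also have "\<dots> = p ** (\<Sum>i\<in>UNIV. adj (L i) ** L i) ** p" by (simp add: mm.sum_left mm.sum_right)
      finally show ?thesis by (simp add: kraus pp)
    qed
    then have q: "kraus (c 0) (\<lambda>i. adj (M i)) ((1/P) *\<^sub>R p) = 1 *\<^sub>R ((1/P) *\<^sub>R p)"
      by (simp add: c00 kraus_scaleR)
    have "y 0 - (1/P) *\<^sub>R p = 0"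
    proof (rule perron_frobenius_unique[OF irrA c0 _ _ _ q])
      show "psd ((1/P) *\<^sub>R p)" "corner W ((1/P) *\<^sub>R p)" "(1/P) *\<^sub>R p \<noteq> 0"
        using P0 \<open>p \<noteq> 0\<close> psdp corner_proj[OF sub] by (auto simp: p_def psd_scaleR corner_scaleR)
      then show "corner W (y 0 - (1/P) *\<^sub>R p)" by (intro corner_diff y)
      show "adj (y 0 - (1/P) *\<^sub>R p) = y 0 - (1/P) *\<^sub>R p"
        by (simp add: adj_diff adj_scaleR pp psd_adj[OF y(1)])
      show "Re (trace (y 0 - (1/P) *\<^sub>R p)) = 0" using P0 by (simp add: tr_diff tr_scaleR y(3) P_def)
      show "kraus (c 0) (\<lambda>i. adj (M i)) (y 0 - (1/P) *\<^sub>R p) = 1 *\<^sub>R (y 0 - (1/P) *\<^sub>R p)"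
        using q by (simp add: kraus_diff y(5) rr r0)
    qed
    then show ?thesis by simp
  qed
  have y0z: "y 0 \<bullet> z = Re (trace z) / P" if "corner W z" for z
    using cornerD(1)[OF sub that] by (simp add: y0 inner_matrix_eq pp p_def[symmetric] adj_scaleR mm.scaleR_left tr_scaleR)
  have corner_k: "corner W (kraus w L z)" if "corner W z" for w z by (rule invsub_corner[OF inv that])
  have cx': "corner W x'" and ax': "adj x' = x'" using x'(2) by (auto simp: S_def)
  define m where "m = enclosure_mean s L W"
  have c\<tau>: "corner W (\<tau> W)" by (rule enclosure_state(3)[OF W])
  have tr\<tau>: "trace (\<tau> W) = 1" by (rule enclosure_stateD(2)[OF W])
  have mean: "Re (trace (kraus a L (\<tau> W))) = u \<bullet> m"
    by (simp add: kraus_def tr_sum tr_scaleR m_def enclosure_mean_def inner_sum_right a_def mult.commute)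
  have Dn0: "y 0 \<bullet> x 0 = 1 / P" by (simp add: x0 y0z[OF c\<tau>] tr\<tau>)
  have N0: "y 0 \<bullet> kraus a M (x 0) = (u \<bullet> m) / P"
    by (simp add: x0 kM[OF c\<tau>] y0z[OF corner_k[OF c\<tau>]] mean)
  have D0: "D 0 = u \<bullet> m"
    using P0 by (simp add: D_def Dn0 N0)
  have lam_fun: "lam = r" by (simp add: fun_eq_iff lam)
  have deriv_lam: "deriv lam = D"
    unfolding lam_fun using curve_x(1) by (auto simp: fun_eq_iff intro!: DERIV_imp_deriv)
  then show "deriv lam 0 = u \<bullet> enclosure_mean s L W" by (simp add: D0 m_def)
  define \<beta> where "\<beta> = y' \<bullet> x 0"
  have y0x': "y 0 \<bullet> x' = 0" using x'(3) by (simp add: y0z[OF cx'] \<phi>_def)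
  \<comment> \<open>Testing the two derivative equations against each other trades \<open>y'\<close>
    for \<open>x'\<close>. The remaining unknown \<beta> cancels in the quotient rule below, and the
    surviving cross term appears twice.\<close>
  have cross: "y' \<bullet> kraus a M (x 0) = (u \<bullet> m) * \<beta> + y 0 \<bullet> kraus a M x'"
  proof -
    have "kraus a M (x 0) = D 0 *\<^sub>R x 0 - (kraus (\<lambda>_. 1) M x' - x')" using x'(4) by (simp add: r0)
    then have "y' \<bullet> kraus a M (x 0) = D 0 * \<beta> - (y' \<bullet> kraus (\<lambda>_. 1) M x' - y' \<bullet> x')"
      by (simp add: inner_diff_right \<beta>_def)
    also have "y' \<bullet> kraus (\<lambda>_. 1) M x' - y' \<bullet> x' = (kraus (\<lambda>_. 1) (\<lambda>i. adj (M i)) y' - y') \<bullet> x'"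
      by (simp add: inner_kraus inner_diff_left)
    also have "\<dots> = D 0 * (y 0 \<bullet> x') - y 0 \<bullet> kraus a M x'"
      using y'(4) by (simp add: r0 inner_diff_left inner_kraus)
    finally show ?thesis by (simp add: y0x' D0)
  qed
  define N where "N t = y t \<bullet> kraus (\<lambda>i. a i * exp (t * a i)) M (x t)" for t
  define Q where "Q t = y t \<bullet> x t" for t
  have N': "(N has_real_derivative (y 0 \<bullet> (kraus a M x' + kraus (\<lambda>i. a i * a i) M (x 0)) + y' \<bullet> kraus a M (x 0))) (at 0)"
    unfolding has_real_derivative_iff_has_vector_derivative N_def
    using bounded_bilinear.has_vector_derivative[OF bounded_bilinear_inner y'(1)
        kraus_has_vector_derivative[OF x'(1), of a a M]] by simp
  have Q': "(Q has_real_derivative (y 0 \<bullet> x' + y' \<bullet> x 0)) (at 0)"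
    unfolding has_real_derivative_iff_has_vector_derivative Q_def
    by (rule bounded_bilinear.has_vector_derivative[OF bounded_bilinear_inner y'(1) x'(1)])
  have Q0: "Q 0 = 1 / P" "Q 0 \<noteq> 0" using Dn0 P0 by (simp_all add: Q_def)
  have N00: "N 0 = (u \<bullet> m) / P" using N0 by (simp add: N_def)
  have "D = (\<lambda>t. N t / Q t)" by (simp add: D_def N_def Q_def fun_eq_iff)
  then have "(D has_real_derivative
     ((y 0 \<bullet> (kraus a M x' + kraus (\<lambda>i. a i * a i) M (x 0)) + y' \<bullet> kraus a M (x 0)) * Q 0
       - N 0 * (y 0 \<bullet> x' + y' \<bullet> x 0)) / (Q 0 * Q 0)) (at 0)"
    using DERIV_divide[OF N' Q' Q0(2)] by simp
  also have "((y 0 \<bullet> (kraus a M x' + kraus (\<lambda>i. a i * a i) M (x 0)) + y' \<bullet> kraus a M (x 0)) * Q 0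
       - N 0 * (y 0 \<bullet> x' + y' \<bullet> x 0)) / (Q 0 * Q 0)
     = P * (2 * (y 0 \<bullet> kraus a M x') + y 0 \<bullet> kraus (\<lambda>i. a i * a i) M (x 0))"
    using P0 unfolding cross Q0 N00 y0x' \<beta>_def[symmetric] inner_add_right by (simp add: field_simps)
  also have "\<dots> = Re (trace (kraus (\<lambda>i. a i * a i) L (\<tau> W))) + 2 * Re (trace (kraus a L x'))"
    using P0 by (simp add: x0 kM[OF c\<tau>] kM[OF cx'] y0z[OF corner_k[OF c\<tau>]] y0z[OF corner_k[OF cx']] field_simps)
  finally have "deriv (deriv lam) 0 = Re (trace (kraus (\<lambda>i. a i * a i) L (\<tau> W))) + 2 * Re (trace (kraus a L x'))"
    unfolding deriv_lam by (rule DERIV_imp_deriv)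
  moreover have "T x' - x' = (u \<bullet> m) *\<^sub>R \<tau> W - kraus a L (\<tau> W)"
    using x'(4) by (simp add: r0 D0 x0 kM[OF c\<tau>] kM[OF cx'] channel_kraus)
  moreover have "trace x' = 0" using hermitian_trace[OF ax'] x'(3) by (simp add: \<phi>_def)
  ultimately show "\<exists>x'. corner W x' \<and> adj x' = x' \<and> trace x' = 0
      \<and> T x' - x' = (u \<bullet> enclosure_mean s L W) *\<^sub>R \<tau> W - kraus a L (\<tau> W)
      \<and> deriv (deriv lam) 0 = Re (trace (kraus (\<lambda>i. a i * a i) L (\<tau> W))) + 2 * Re (trace (kraus a L x'))"
    using cx' ax' by (intro exI[of _ x']) (simp add: m_def)
qed

end

lemma symmetric_form_unique:
  fixes D D' :: "real^'d^'d"
  assumes D: "transpose D = D" "transpose D' = D'" and eq: "\<And>u. u \<bullet> (D *v u) = u \<bullet> (D' *v u)"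
  shows "D = D'"
proof -
  define N where "N = D - D'"
  have sym: "x \<bullet> (N *v y) = y \<bullet> (N *v x)" for x y
  proof -
    have tN: "transpose N = N" using D by (simp add: N_def transpose_def vec_eq_iff)
    have "x \<bullet> (N *v y) = (x v* N) \<bullet> y" by (simp add: dot_lmul_matrix)
    also have "x v* N = N *v x" using transpose_matrix_vector[of N x] tN by simp
    finally show ?thesis by (simp add: inner_commute)
  qed
  have zero: "u \<bullet> (N *v u) = 0" for u
    using eq by (simp add: N_def matrix_vector_mult_diff_rdistrib inner_diff_right)
  have "x \<bullet> (N *v y) = 0" for x y
    using zero[of "x + y"] zero[of x] zero[of y] sym[of x y]
    by (simp add: matrix_vector_right_distrib inner_add_left inner_add_right)
  then have "N *v y = 0" for y using inner_eq_zero_iff by blast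
  then have "N = 0" by (simp add: matrix_eq)
  then show ?thesis by (simp add: N_def)
qed

context kraus_channel
begin

abbreviation "L' \<equiv> \<lambda>i. adj (L i)"

section \<open>Mean and covariance of a component\<close>

lemma inner_enclosure_mean:
  "u \<bullet> enclosure_mean s L W = Re (trace (kraus (\<lambda>i. u \<bullet> s i) L (\<tau> W)))"
  by (simp add: enclosure_mean_def kraus_def tr_sum tr_scaleR inner_sum_right mult.commute)

lemma conj_isometry_trace:
  assumes "adj Q ** Q = p" "X ** p = X"
  shows "trace (Q ** X ** adj Q) = trace (X :: complex^'h^'h)"
proof -
  have "trace (Q ** X ** adj Q) = trace (Q ** (X ** adj Q))" by (simp add: matrix_mul_assoc)
  also have "\<dots> = trace ((X ** adj Q) ** Q)" by (rule trace_mul_sym)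
  also have "\<dots> = trace (X ** (adj Q ** Q))" by (simp add: matrix_mul_assoc)
  finally show ?thesis by (simp add: assms)
qed

text \<open>The unitary equivalence of overlapping minimal enclosures, in the form used afterwards:
  conjugation by \<open>Q\<close> carries the corner of \<open>U\<close> into that of
  \<open>W\<close> and respects traces and all weighted Kraus maps.\<close>

lemma conj_isometry:
  assumes U: "irred L U" and W: "irred L W" and no: "\<not> corthogonal U W"
  obtains Q where "\<And>X c. corner U X \<Longrightarrow> kraus c L (Q ** X ** adj Q) = Q ** kraus c L X ** adj Q"
    "\<And>X. corner U X \<Longrightarrow> trace (Q ** X ** adj Q) = trace X"
    "\<And>X. corner W (Q ** X ** adj Q)"
proof -
  obtain Q where Q: "adj Q ** Q = ortho_proj U" "Q ** adj Q = ortho_proj W"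
    "\<And>i. L i ** Q = Q ** L i ** ortho_proj U" "ortho_proj W ** Q = Q" "Q ** ortho_proj U = Q"
    using partial_isometry_exists[OF U W no] by blast
  note sub = irredD(2)[OF U] and subW = irredD(2)[OF W]
  have 1: "kraus c L (Q ** X ** adj Q) = Q ** kraus c L X ** adj Q" if "corner U X" for X c
    by (rule kraus_intertwine[OF Q(3) cornerD[OF sub that] proj_adj[OF sub]])
  have 2: "trace (Q ** X ** adj Q) = trace X" if "corner U X" for X
    by (rule conj_isometry_trace[OF Q(1) cornerD(2)[OF sub that]])
  have aQ: "adj Q ** ortho_proj W = adj Q"
    using arg_cong[OF Q(4), of adj] by (simp add: adj_mult proj_adj[OF subW])
  have 3: "corner W (Q ** X ** adj Q)" for X
    unfolding corner_def
  proof -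
    have "ortho_proj W ** (Q ** X ** adj Q) ** ortho_proj W
        = (ortho_proj W ** Q) ** X ** (adj Q ** ortho_proj W)" by (simp add: matrix_mul_assoc)
    then show "ortho_proj W ** (Q ** X ** adj Q) ** ortho_proj W = Q ** X ** adj Q"
      by (simp only: Q(4) aQ)
  qed
  show ?thesis by (rule that[OF 1 2 3])
qed

lemma enclosure_mean_linked:
  assumes U: "irred L U" and W: "irred L W" and no: "\<not> corthogonal U W"
  shows "enclosure_mean s L U = enclosure_mean s L W"
proof (rule conj_isometry[OF U W no])
  fix Q
  assume Q: "\<And>X c. corner U X \<Longrightarrow> kraus c L (Q ** X ** adj Q) = Q ** kraus c L X ** adj Q"
    "\<And>X. corner U X \<Longrightarrow> trace (Q ** X ** adj Q) = trace X" "\<And>X. corner W (Q ** X ** adj Q)"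
  note c = enclosure_state(3)[OF U] and s = enclosure_stateD[OF U]
  have "invariant_state L (Q ** \<tau> U ** adj Q)"
    using Q(1)[OF c, of "\<lambda>_. 1"] Q(2)[OF c] s by (simp add: invariant_state_def psd_conj channel_kraus)
  then have "Q ** \<tau> U ** adj Q = \<tau> W" by (rule enclosure_state_eq[OF W _ Q(3)])
  then have "Re (trace (kraus w L (\<tau> W))) = Re (trace (kraus w L (\<tau> U)))" for w
    using Q(1)[OF c, of w] Q(2)[OF invsub_corner[OF irredD(1)[OF U] c, of w]] by metis
  then have "u \<bullet> enclosure_mean s L U = u \<bullet> enclosure_mean s L W" for u
    by (simp add: inner_enclosure_mean)
  then show ?thesis using vector_eq_ldot by blast
qed

text \<open>Right and left eigenvectors are obtained separately; evaluating their pairing on both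
  sides shows that the eigenvalues agree, since a faithful \<open>y\<close> pairs positively with
  the state \<open>X\<close>.\<close>

lemma tilted_eigen:
  assumes W: "irred L W" and c: "\<And>i. c i > 0"
  shows "\<exists>X y r. psd X \<and> corner W X \<and> trace X = 1 \<and> kraus c L X = r *\<^sub>R X \<and> r > 0 \<and> psd y \<and> supp y = W
    \<and> kraus c (\<lambda>i. adj (L i ** ortho_proj W)) y = r *\<^sub>R y"
proof -
  define p where "p = ortho_proj W"
  define M where "M i = L i ** p" for i
  note sub = irredD(2)[OF W] and inv = irredD(1)[OF W]
  have pp: "p ** p = p" "adj p = p" unfolding p_def by (rule proj_idem[OF sub] proj_adj[OF sub])+
  have kM: "kraus w M X = kraus w L X" if "corner W X" for w X
    unfolding M_def[abs_def] p_def by (rule kraus_compress[OF sub that])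
  have pMp: "p ** M i ** p = M i" for i
  proof -
    have "p ** M i ** p = p ** L i ** p ** p" by (simp add: M_def matrix_mul_assoc)
    also have "\<dots> = L i ** p ** p" using invsub_proj[OF inv, of i] by (simp add: p_def)
    also have "\<dots> = L i ** (p ** p)" by (rule matrix_mul_assoc[symmetric])
    finally show ?thesis by (simp add: pp M_def)
  qed
  have irrM: "irred M W" unfolding M_def[abs_def] p_def by (rule irred_compress[OF W])
  have irrA: "irred (\<lambda>i. adj (M i)) W" by (rule irred_adj[OF irrM]) (rule pMp[unfolded p_def])
  obtain i0 where i0: "L i0 ** p \<noteq> 0" using enclosure_nonzero[OF inv irredD(3)[OF W]] by (auto simp: p_def)
  have nzM: "\<exists>i. M i ** ortho_proj W \<noteq> 0"
    using i0 pp by (intro exI[of _ i0]) (simp add: M_def p_def[symmetric] matrix_mul_assoc[symmetric])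
  have nzA: "\<exists>i. adj (M i) ** ortho_proj W \<noteq> 0"
  proof (intro exI[of _ i0] notI)
    assume "adj (M i0) ** ortho_proj W = 0"
    then have "adj (adj (M i0) ** p) = 0" by (simp add: p_def adj_zero)
    then have "p ** M i0 = 0" by (simp add: adj_mult pp)
    then have "M i0 = 0" using pMp[of i0] by (simp add: mm.zero_left)
    with i0 show False by (simp add: M_def)
  qed
  show ?thesis
  proof (rule perron_frobenius_exists[of M W c, OF irrM c nzM])
    fix X r assume X: "psd X" "corner W X" "trace X = 1" "r > 0" "kraus c M X = r *\<^sub>R X" "supp X = W"
    show ?thesis
    proof (rule perron_frobenius_exists[of "\<lambda>i. adj (M i)" W c, OF irrA c nzA])
      fix y r' assume y: "psd y" "corner W y" "trace y = 1" "r' > 0"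
        "kraus c (\<lambda>i. adj (M i)) y = r' *\<^sub>R y" "supp y = W"
      obtain d where d: "d > 0" "\<And>X. psd X \<Longrightarrow> corner W X \<Longrightarrow> d * Re (trace X) \<le> y \<bullet> X"
        using psd_pairing_lower[OF y(1,6)] by blast
      then have pos: "y \<bullet> X > 0" using d(2)[OF X(1,2)] X(3) d(1) by simp
      have "r * (y \<bullet> X) = y \<bullet> kraus c M X" by (simp add: X(5))
      also have "\<dots> = r' * (y \<bullet> X)" by (simp add: inner_kraus y(5))
      finally have "r' = r" using pos by simp
      then show ?thesis
        using X y kM[OF X(2)] by (intro exI[of _ X] exI[of _ y] exI[of _ r]) (simp add: M_def[abs_def] p_def)
    qed
  qed
qed

text \<open>Conjugation moves the right eigenvector from \<open>U\<close> to \<open>W\<close> with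
  its eigenvalue; pairing it with the left eigenvector on \<open>W\<close> identifies the two
  eigenvalues.\<close>

lemma tilted_radius_linked:
  assumes U: "irred L U" and W: "irred L W" and no: "\<not> corthogonal U W"
  shows "tilted_radius s L U u = tilted_radius s L W u"
proof (rule conj_isometry[OF U W no])
  fix Q
  assume Q: "\<And>X c. corner U X \<Longrightarrow> kraus c L (Q ** X ** adj Q) = Q ** kraus c L X ** adj Q"
    "\<And>X. corner U X \<Longrightarrow> trace (Q ** X ** adj Q) = trace X" "\<And>X. corner W (Q ** X ** adj Q)"
  define c where "c i = exp (u \<bullet> s i)" for i
  have c0: "c i > 0" for i by (simp add: c_def)
  have ce: "(\<lambda>i. exp (u \<bullet> s i)) = c" by (simp add: c_def fun_eq_iff)
  have one: "X \<noteq> 0" if "trace X = 1" for X :: "complex^'h^'h" using that by (auto simp: tr_zero)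
  obtain X y r where X: "psd X" "corner U X" "trace X = 1" "kraus c L X = r *\<^sub>R X" "r > 0" "psd y" "supp y = U"
    "kraus c (\<lambda>i. adj (L i ** ortho_proj U)) y = r *\<^sub>R y"
    using tilted_eigen[of U c, OF U c0] by (elim exE conjE)
  obtain Z z t where Z: "psd Z" "corner W Z" "trace Z = 1" "kraus c L Z = t *\<^sub>R Z" "t > 0" "psd z" "supp z = W"
    "kraus c (\<lambda>i. adj (L i ** ortho_proj W)) z = t *\<^sub>R z"
    using tilted_eigen[of W c, OF W c0] by (elim exE conjE)
  have rU: "tilted_radius s L U u = r"
    by (rule tilted_radius_eq[OF U X(1,2) one[OF X(3)] _ X(5-7)]) (unfold ce, rule X(4), rule X(8))
  have rW: "tilted_radius s L W u = t"
    by (rule tilted_radius_eq[OF W Z(1,2) one[OF Z(3)] _ Z(5-7)]) (unfold ce, rule Z(4), rule Z(8))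
  define Y where "Y = Q ** X ** adj Q"
  have Y: "psd Y" "corner W Y" "trace Y = 1" "kraus c L Y = r *\<^sub>R Y"
    using psd_conj[OF X(1)] Q(3) Q(2)[OF X(2)] X(3) Q(1)[OF X(2), of c] X(4)
    by (simp_all add: Y_def mm.scaleR_left mm.scaleR_right)
  obtain d where d: "d > 0" "\<And>X. psd X \<Longrightarrow> corner W X \<Longrightarrow> d * Re (trace X) \<le> z \<bullet> X"
    using psd_pairing_lower[OF Z(6,7)] by blast
  then have pos: "z \<bullet> Y > 0" using d(2)[OF Y(1,2)] Y(3) d(1) by simp
  have "r * (z \<bullet> Y) = z \<bullet> kraus c L Y" by (simp add: Y(4))
  also have "kraus c L Y = kraus c (\<lambda>i. L i ** ortho_proj W) Y"
    by (rule kraus_compress[OF irredD(2)[OF W] Y(2), symmetric])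
  also have "z \<bullet> \<dots> = t * (z \<bullet> Y)" unfolding inner_kraus Z(8) by simp
  finally show ?thesis using pos rU rW by simp
qed

lemma component_minimal: "X \<in> components \<Longrightarrow> \<exists>W. irred L W \<and> W \<subseteq> X"
  by (erule componentE) blast

lemma chi_mean_eq:
  assumes X: "X \<in> components" and W: "irred L W" "W \<subseteq> X"
  shows "chi_mean s L X = enclosure_mean s L W"
  unfolding chi_mean_def minimal_enclosure_iff_irred
proof (rule the_equality)
  show "\<forall>U. irred L U \<and> U \<subseteq> X \<longrightarrow> enclosure_mean s L W = enclosure_mean s L U"
    using component_induct[OF X W(1) _ W(2), of _ "enclosure_mean s L"] enclosure_mean_linked by blast
qed (use W in blast)

definition radius_var :: "('j \<Rightarrow> real^'d) \<Rightarrow> (complex^'h) set \<Rightarrow> real^'d \<Rightarrow> real" where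
  "radius_var s W u = deriv (deriv (\<lambda>t. tilted_radius s L W (t *\<^sub>R u))) 0
    - (deriv (\<lambda>t. tilted_radius s L W (t *\<^sub>R u)) 0)\<^sup>2"

lemma radius_var_cong:
  assumes X: "X \<in> components" and U: "irred L U" "U \<subseteq> X" and W: "irred L W" "W \<subseteq> X"
  shows "radius_var s U u = radius_var s W u"
proof -
  have "tilted_radius s L U = tilted_radius s L W"
    using component_induct[OF X U(1) W(1) U(2) W(2), of "tilted_radius s L"] tilted_radius_linked
    by blast
  then show ?thesis by (simp add: radius_var_def)
qed

text \<open>With \<open>A\<close> an absorption operator and \<open>b\<close> the centred steps, \<open>B\<close> solves the Poisson equation of
  the martingale approximation; pairing with the eigenvector derivative \<open>x'\<close> identifies the
  resulting variance with that of the tilted radius.\<close>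
lemma radius_var_poisson:
  fixes s :: "'j \<Rightarrow> real^'d" and u :: "real^'d"
  assumes X: "X \<in> components" and W: "irred L W" "W \<subseteq> X"
  defines "b \<equiv> \<lambda>i. u \<bullet> (s i - chi_mean s L X)"
  assumes B: "B - T' B = kraus b L' (absorption L X)"
  shows "trace (\<tau> W ** kraus (\<lambda>i. b i * b i) L' (absorption L X)) + 2 * trace (\<tau> W ** kraus b L' B)
    = of_real (radius_var s W u)"
proof -
  define a where "a i = u \<bullet> s i" for i
  define \<mu> where "\<mu> = u \<bullet> enclosure_mean s L W"
  define A where "A = absorption L X"
  have b: "b i = a i - \<mu>" for i
    by (simp add: b_def a_def \<mu>_def chi_mean_eq[OF X W] inner_diff_right)
  have tr_adj_kraus: "trace (Y ** kraus w L' Z) = trace (kraus w L Y ** Z)" for w Y Z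
    by (rule trace_kraus_dual[symmetric])
  have mA: "Y ** A = Y" if "corner W Y" for Y
    unfolding A_def using absorption_mult_corner[OF X X irredD(1)[OF W(1)] W(2) that] by simp
  note inv = irredD(1)[OF W(1)] and c\<tau> = enclosure_state(3)[OF W(1)] and s\<tau> = enclosure_stateD[OF W(1)]
  have kb: "kraus b L Y = kraus a L Y - \<mu> *\<^sub>R T Y" for Y
  proof -
    have "kraus a L Y - \<mu> *\<^sub>R kraus (\<lambda>_. 1) L Y = kraus (\<lambda>i. a i - \<mu> * 1) L Y"
      by (simp only: kraus_weights_diff kraus_weights_scaleR)
    then show ?thesis by (simp add: channel_kraus b[abs_def])
  qed
  obtain x' where x': "corner W x'" "adj x' = x'" "trace x' = 0"
    "T x' - x' = \<mu> *\<^sub>R \<tau> W - kraus a L (\<tau> W)"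
    "deriv (deriv (\<lambda>t. tilted_radius s L W (t *\<^sub>R u))) 0
      = Re (trace (kraus (\<lambda>i. a i * a i) L (\<tau> W))) + 2 * Re (trace (kraus a L x'))"
    using tilted_radius_derivatives(2)[OF W(1), where u = u and s = s] unfolding \<mu>_def a_def by (elim exE conjE)
  have d1: "deriv (\<lambda>t. tilted_radius s L W (t *\<^sub>R u)) 0 = \<mu>"
    using tilted_radius_derivatives(1)[OF W(1), where u = u and s = s] by (simp add: \<mu>_def)
  have real: "trace (kraus w L Y) = of_real (Re (trace (kraus w L Y)))" if "adj Y = Y" for w Y
    by (rule hermitian_trace) (simp add: adj_kraus that)
  \<comment> \<open>The eigenvector derivative solves the Poisson equation on the side of the
    states. Moving \<open>1 - T\<close> across the trace then meets the equation for
    \<open>B\<close> and eliminates it.\<close>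
  have "kraus b L (\<tau> W) = x' - T x'" using x'(4) unfolding kb s\<tau>(3) by (simp add: algebra_simps)
  then have "trace (\<tau> W ** kraus b L' B) = trace (x' ** B) - trace (T x' ** B)"
    unfolding tr_adj_kraus by (simp add: mm.diff_left tr_diff)
  also have "\<dots> = trace (x' ** kraus b L' A)"
    using B by (simp add: trace_T_mult A_def flip: tr_diff mm.diff_right)
  also have "\<dots> = trace (kraus b L x')"
    unfolding tr_adj_kraus by (simp add: mA[OF invsub_corner[OF inv x'(1)]])
  also have "\<dots> = trace (kraus a L x')" by (simp add: kb tr_diff tr_scaleR trace_T x'(3))
  also have "\<dots> = of_real (Re (trace (kraus a L x')))" by (rule real[OF x'(2)])
  finally have 1: "trace (\<tau> W ** kraus b L' B) = of_real (Re (trace (kraus a L x')))" .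
  have h\<tau>: "adj (\<tau> W) = \<tau> W" by (rule psd_adj[OF s\<tau>(1)])
  have mean: "trace (kraus a L (\<tau> W)) = of_real \<mu>"
    by (subst real[OF h\<tau>]) (simp add: \<mu>_def inner_enclosure_mean a_def[abs_def])
  have "trace (\<tau> W ** kraus (\<lambda>i. b i * b i) L' A) = trace (kraus (\<lambda>i. b i * b i) L (\<tau> W))"
    unfolding tr_adj_kraus by (simp add: mA[OF invsub_corner[OF inv c\<tau>]])
  also have "kraus (\<lambda>i. b i * b i) L (\<tau> W)
      = kraus (\<lambda>i. a i * a i) L (\<tau> W) - (2 * \<mu>) *\<^sub>R kraus a L (\<tau> W) + (\<mu> * \<mu>) *\<^sub>R \<tau> W"
  proof -
    have "kraus (\<lambda>i. a i * a i) L (\<tau> W) - (2 * \<mu>) *\<^sub>R kraus a L (\<tau> W) + (\<mu> * \<mu>) *\<^sub>R kraus (\<lambda>_. 1) L (\<tau> W)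
        = kraus (\<lambda>i. a i * a i - 2 * \<mu> * a i + \<mu> * \<mu> * 1) L (\<tau> W)"
      by (simp only: kraus_weights_diff kraus_weights_scaleR kraus_weights_add)
    also have "(\<lambda>i. a i * a i - 2 * \<mu> * a i + \<mu> * \<mu> * 1) = (\<lambda>i. b i * b i)"
      by (simp add: b fun_eq_iff algebra_simps)
    finally show ?thesis using s\<tau>(3) by (simp add: channel_kraus)
  qed
  also have "trace \<dots> = of_real (Re (trace (kraus (\<lambda>i. a i * a i) L (\<tau> W))) - \<mu>\<^sup>2)"
    by (subst tr_add, subst tr_diff, subst real[OF h\<tau>])
      (simp add: tr_scaleR mean s\<tau>(2) scaleR_complex power2_eq_square)
  finally have 2: "trace (\<tau> W ** kraus (\<lambda>i. b i * b i) L' A)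
      = of_real (Re (trace (kraus (\<lambda>i. a i * a i) L (\<tau> W))) - \<mu>\<^sup>2)" .
  show ?thesis
    unfolding 1 2[unfolded A_def] radius_var_def d1 x'(5) by simp
qed

lemma trace_component_zeroI:
  assumes X: "X \<in> components"
    and on: "\<And>W. irred L W \<Longrightarrow> W \<subseteq> X \<Longrightarrow> trace (\<tau> W ** Y) = 0"
    and off: "\<And>W X'. irred L W \<Longrightarrow> X' \<in> components \<Longrightarrow> X' \<noteq> X \<Longrightarrow> W \<subseteq> X' \<Longrightarrow> trace (\<tau> W ** Y) = 0"
    and \<sigma>: "invariant_state L \<sigma>"
  shows "trace (\<sigma> ** Y) = 0"
proof (rule trace_invariant_zeroI[OF _ \<sigma>])
  fix W assume W: "irred L W"
  then obtain X' where "X' \<in> components" "W \<subseteq> X'" using irred_component by blast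
  then show "trace (\<tau> W ** Y) = 0" using on off W by (cases "X' = X") auto
qed

lemma trace_kraus_absorption_off:
  assumes X: "X \<in> components" "X' \<in> components" "X' \<noteq> X" and W: "irred L W" "W \<subseteq> X'"
  shows "trace (\<tau> W ** kraus w L' (absorption L X)) = 0"
proof -
  have "kraus w L (\<tau> W) ** absorption L X = 0"
    using absorption_mult_corner[OF X(1,2) irredD(1)[OF W(1)] W(2)
        invsub_corner[OF irredD(1)[OF W(1)] enclosure_state(3)[OF W(1)]], of w] X(3) by simp
  then show ?thesis by (simp add: trace_kraus_dual[symmetric] tr_zero)
qed

text \<open>Inside \<open>X\<close> the solvability condition says that the centred mean of each
  minimal enclosure vanishes, which holds because they all share \<open>chi_mean\<close>; on the
  other components the absorption operator contributes nothing.\<close>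

lemma poisson_solution:
  fixes s :: "'j \<Rightarrow> real^'d" and u :: "real^'d"
  assumes X: "X \<in> components"
  defines "b \<equiv> \<lambda>i. u \<bullet> (s i - chi_mean s L X)"
  shows "\<exists>B. B - T' B = kraus b L' (absorption L X) \<and> (\<forall>\<sigma>. invariant_state L \<sigma> \<longrightarrow> trace (\<sigma> ** B) = 0)"
proof -
  have "trace (\<sigma> ** kraus b L' (absorption L X)) = 0" if \<sigma>: "invariant_state L \<sigma>" for \<sigma>
  proof (rule trace_component_zeroI[OF X _ _ \<sigma>])
    fix W assume W: "irred L W" "W \<subseteq> X"
    note inv = irredD(1)[OF W(1)] and s\<tau> = enclosure_stateD[OF W(1)]
    have "trace (\<tau> W ** kraus b L' (absorption L X)) = trace (kraus b L (\<tau> W))"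
      using absorption_mult_corner[OF X X inv W(2) invsub_corner[OF inv enclosure_state(3)[OF W(1)]], of b]
      by (simp add: trace_kraus_dual[symmetric])
    also have "\<dots> = of_real (Re (trace (kraus b L (\<tau> W))))"
      by (rule hermitian_trace) (simp add: adj_kraus psd_adj[OF s\<tau>(1)])
    also have "kraus b L (\<tau> W) = kraus (\<lambda>i. u \<bullet> s i) L (\<tau> W) - (u \<bullet> chi_mean s L X) *\<^sub>R \<tau> W"
    proof -
      have "kraus (\<lambda>i. u \<bullet> s i) L (\<tau> W) - (u \<bullet> chi_mean s L X) *\<^sub>R kraus (\<lambda>_. 1) L (\<tau> W) = kraus b L (\<tau> W)"
        by (simp add: kraus_weights_diff kraus_weights_scaleR b_def inner_diff_right)
      then show ?thesis using s\<tau>(3) by (simp add: channel_kraus)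
    qed
    also have "Re (trace \<dots>) = 0"
      by (simp add: tr_diff tr_scaleR s\<tau>(2) chi_mean_eq[OF X W] inner_enclosure_mean)
    finally show "trace (\<tau> W ** kraus b L' (absorption L X)) = 0" by simp
  qed (rule trace_kraus_absorption_off[OF X])
  then show ?thesis using dual_solve[of "kraus b L' (absorption L X)"] by blast
qed

text \<open>Uniqueness is polarisation. For existence, a matrix with the required quadratic form has
  to be exhibited: solutions of the Poisson equation combine linearly in \<open>u\<close>, so
  solving it for the coordinate directions makes the variance formula a quadratic form with
  coefficients \<open>G\<close>.\<close>

theorem chi_cov_form:
  fixes s :: "'j \<Rightarrow> real^'d"
  assumes X: "X \<in> components"
  shows "transpose (chi_cov s L X) = chi_cov s L X"
    and "\<And>W u. irred L W \<Longrightarrow> W \<subseteq> X \<Longrightarrow> u \<bullet> (chi_cov s L X *v u) = radius_var s W u"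
proof -
  obtain W where W: "irred L W" "W \<subseteq> X" using component_minimal[OF X] by blast
  define A where "A = absorption L X"
  define m where "m = chi_mean s L X"
  define b where "b j i = (s i - m) $ j" for j i
  have "\<forall>j. \<exists>B. B - T' B = kraus (b j) L' A"
  proof
    fix j
    have "(\<lambda>i. axis j 1 \<bullet> (s i - m)) = b j" by (simp add: b_def inner_axis' fun_eq_iff)
    then show "\<exists>B. B - T' B = kraus (b j) L' A"
      using poisson_solution[OF X, where u = "axis j 1" and s = s] unfolding A_def m_def by metis
  qed
  from choice[OF this] obtain B where B: "\<And>j. B j - T' (B j) = kraus (b j) L' A" by blast
  \<comment> \<open>The second term is not symmetric in the two indices, since \<open>B k\<close>
    carries only one of them; \<open>D\<close> is the symmetrisation.\<close>
  define G where "G j k = Re (trace (\<tau> W ** kraus (\<lambda>i. b j i * b k i) L' A))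
    + 2 * Re (trace (\<tau> W ** kraus (b j) L' (B k)))" for j k
  define D :: "real^'d^'d" where "D = (\<chi> j k. (G j k + G k j) / 2)"
  have tD: "transpose D = D" by (simp add: D_def transpose_def vec_eq_iff add.commute)
  have form: "u \<bullet> (D *v u) = radius_var s W u" for u
  proof -
    define bu where "bu i = u \<bullet> (s i - m)" for i
    define Bu where "Bu = (\<Sum>k\<in>UNIV. u $ k *\<^sub>R B k)"
    have bu: "bu = (\<lambda>i. \<Sum>j\<in>UNIV. u $ j * b j i)"
      by (simp add: bu_def b_def inner_vec_def fun_eq_iff)
    have kbu: "kraus bu L' Y = (\<Sum>j\<in>UNIV. u $ j *\<^sub>R kraus (b j) L' Y)" for Y
      unfolding bu kraus_weights_scaleR kraus_weights_sum ..
    have "Bu - T' Bu = (\<Sum>k\<in>UNIV. u $ k *\<^sub>R (B k - T' (B k)))"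
      by (simp add: Bu_def linear_sum[OF linear_T'] linear_scale[OF linear_T'] sum_subtractf scaleR_diff_right)
    also have "\<dots> = kraus bu L' A" unfolding B kbu ..
    finally have eq: "Bu - T' Bu = kraus bu L' A" .
    have "of_real (radius_var s W u)
        = trace (\<tau> W ** kraus (\<lambda>i. bu i * bu i) L' A) + 2 * trace (\<tau> W ** kraus bu L' Bu)"
      using radius_var_poisson[OF X W, where B = Bu and u = u and s = s] eq unfolding A_def bu_def m_def by simp
    then have "radius_var s W u = Re (trace (\<tau> W ** kraus (\<lambda>i. bu i * bu i) L' A))
        + 2 * Re (trace (\<tau> W ** kraus bu L' Bu))"
      by (metis Re_complex_of_real plus_complex.sel(1) mult_2)
    also have "kraus (\<lambda>i. bu i * bu i) L' A
        = (\<Sum>j\<in>UNIV. \<Sum>k\<in>UNIV. (u $ j * u $ k) *\<^sub>R kraus (\<lambda>i. b j i * b k i) L' A)"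
      unfolding kraus_weights_scaleR kraus_weights_sum
      by (simp add: bu sum_product mult_ac)
    also have "kraus bu L' Bu = (\<Sum>j\<in>UNIV. \<Sum>k\<in>UNIV. (u $ j * u $ k) *\<^sub>R kraus (b j) L' (B k))"
      unfolding kbu by (simp add: Bu_def kraus_sum kraus_scaleR scaleR_sum_right)
    also have "Re (trace (\<tau> W ** (\<Sum>j\<in>UNIV. \<Sum>k\<in>UNIV. (u $ j * u $ k) *\<^sub>R kraus (\<lambda>i. b j i * b k i) L' A)))
        + 2 * Re (trace (\<tau> W ** (\<Sum>j\<in>UNIV. \<Sum>k\<in>UNIV. (u $ j * u $ k) *\<^sub>R kraus (b j) L' (B k))))
        = (\<Sum>j\<in>UNIV. \<Sum>k\<in>UNIV. u $ j * u $ k * G j k)"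
      by (simp add: mm.sum_right mm.scaleR_right tr_sum tr_scaleR G_def sum_distrib_left algebra_simps
          sum.distrib)
    finally have r: "radius_var s W u = (\<Sum>j\<in>UNIV. \<Sum>k\<in>UNIV. u $ j * u $ k * G j k)" .
    have "u \<bullet> (D *v u) = (\<Sum>j\<in>UNIV. \<Sum>k\<in>UNIV. (u $ j * u $ k * G j k + u $ k * u $ j * G k j) / 2)"
      by (simp add: inner_vec_def matrix_vector_mult_def D_def sum_distrib_left algebra_simps add_divide_distrib)
    also have "\<dots> = ((\<Sum>j\<in>UNIV. \<Sum>k\<in>UNIV. u $ j * u $ k * G j k)
        + (\<Sum>j\<in>UNIV. \<Sum>k\<in>UNIV. u $ k * u $ j * G k j)) / 2"
      by (simp add: sum.distrib add_divide_distrib sum_divide_distrib)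
    also have "(\<Sum>j\<in>UNIV. \<Sum>k\<in>UNIV. u $ k * u $ j * G k j) = (\<Sum>j\<in>UNIV. \<Sum>k\<in>UNIV. u $ j * u $ k * G j k)"
      by (rule sum.swap)
    finally show ?thesis by (simp add: r)
  qed
  have all: "u \<bullet> (D *v u) = radius_var s U u" if "irred L U" "U \<subseteq> X" for U u
    unfolding form by (rule radius_var_cong[OF X W that])
  have "chi_cov s L X = D"
    unfolding chi_cov_def minimal_enclosure_iff_irred radius_var_def[symmetric]
  proof (rule the_equality)
    show "transpose D = D \<and> (\<forall>U. irred L U \<and> U \<subseteq> X \<longrightarrow> (\<forall>u. u \<bullet> (D *v u) = radius_var s U u))"
      using tD all by blast
    fix D' assume D': "transpose D' = D' \<and> (\<forall>U. irred L U \<and> U \<subseteq> X \<longrightarrow> (\<forall>u. u \<bullet> (D' *v u) = radius_var s U u))"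
    show "D' = D"
      by (rule symmetric_form_unique) (use D' tD all W in auto)
  qed
  then show "transpose (chi_cov s L X) = chi_cov s L X"
    "\<And>W u. irred L W \<Longrightarrow> W \<subseteq> X \<Longrightarrow> u \<bullet> (chi_cov s L X *v u) = radius_var s W u"
    using tD all by auto
qed

text \<open>On a minimal enclosure in \<open>X\<close>, solvability of the second equation is
  \<open>radius_var_poisson\<close>. On one outside \<open>X\<close> the terms with the absorption
  operator vanish; the compression \<open>Z\<close> of \<open>B\<close> then satisfies the
  homogeneous compressed equation and has trace 0 against the state there, so it is 0.\<close>

theorem corrector_solutions:
  fixes s :: "'j \<Rightarrow> real^'d" and u :: "real^'d"
  assumes X: "X \<in> components"
  defines "b \<equiv> \<lambda>i. u \<bullet> (s i - chi_mean s L X)"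
  shows "\<exists>B C. B - T' B = kraus b L' (absorption L X) \<and>
    C - T' C = ((u \<bullet> (chi_cov s L X *v u)) / 2) *\<^sub>R absorption L X - kraus b L' B
      - (1/2) *\<^sub>R kraus (\<lambda>i. b i * b i) L' (absorption L X)"
proof -
  define A where "A = absorption L X"
  define q where "q = u \<bullet> (chi_cov s L X *v u)"
  obtain B where B: "B - T' B = kraus b L' A" "\<And>\<sigma>. invariant_state L \<sigma> \<Longrightarrow> trace (\<sigma> ** B) = 0"
    using poisson_solution[OF X, where u = u and s = s] unfolding A_def b_def by blast
  define Y where "Y = (q / 2) *\<^sub>R A - kraus b L' B - (1/2) *\<^sub>R kraus (\<lambda>i. b i * b i) L' A"
  have trY: "trace (\<sigma> ** Y) = of_real (q / 2) * trace (\<sigma> ** A) - trace (\<sigma> ** kraus b L' B)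
      - of_real (1/2) * trace (\<sigma> ** kraus (\<lambda>i. b i * b i) L' A)" for \<sigma>
    by (simp add: Y_def mm.diff_right tr_diff mm.scaleR_right tr_scaleR scaleR_complex)
  have "trace (\<sigma> ** Y) = 0" if \<sigma>: "invariant_state L \<sigma>" for \<sigma>
  proof (rule trace_component_zeroI[OF X _ _ \<sigma>])
    fix W assume W: "irred L W" "W \<subseteq> X"
    have "trace (\<tau> W ** kraus (\<lambda>i. b i * b i) L' A) + 2 * trace (\<tau> W ** kraus b L' B) = of_real q"
      using radius_var_poisson[OF X W, where B = B and u = u and s = s] B(1) chi_cov_form(2)[OF X W, where u = u and s = s]
      unfolding A_def b_def q_def by simp
    then have "trace (\<tau> W ** kraus (\<lambda>i. b i * b i) L' A) = of_real q - 2 * trace (\<tau> W ** kraus b L' B)"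
      by (simp add: algebra_simps)
    moreover have "\<tau> W ** A = \<tau> W"
      unfolding A_def using absorption_mult_corner[OF X X irredD(1)[OF W(1)] W(2) enclosure_state(3)[OF W(1)]] by simp
    ultimately show "trace (\<tau> W ** Y) = 0"
      by (simp add: trY enclosure_stateD(2)[OF W(1)] algebra_simps)
  next
    fix W X' assume W: "irred L W" and X': "X' \<in> components" "X' \<noteq> X" "W \<subseteq> X'"
    note inv = irredD(1)[OF W] and sub = irredD(2)[OF W] and c\<tau> = enclosure_state(3)[OF W]
    define p where "p = ortho_proj W"
    have pp: "p ** p = p" "adj p = p" unfolding p_def by (rule proj_idem[OF sub] proj_adj[OF sub])+
    have offA: "kraus w L Z ** A = 0" if "corner W Z" for w Z
      unfolding A_def using absorption_mult_corner[OF X X'(1) inv X'(3) invsub_corner[OF inv that], of w] X'(2) by simp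
    \<comment> \<open>Because \<open>W\<close> is invariant, the compressed dual map depends on its
      argument only through the compression of that argument.\<close>
    have comp: "p ** kraus w L' Z ** p = p ** kraus w L' (p ** Z ** p) ** p" for w Z
    proof -
      have 1: "p ** (adj (L i) ** Z ** L i) ** p = p ** (adj (L i) ** (p ** Z ** p) ** L i) ** p" for i
      proof -
        have Lp: "L i ** p = p ** L i ** p" using invsub_proj[OF inv, of i] by (simp add: p_def)
        have pL: "p ** adj (L i) = p ** adj (L i) ** p"
          using arg_cong[OF Lp, of adj] by (simp add: adj_mult pp matrix_mul_assoc)
        have "p ** (adj (L i) ** Z ** L i) ** p = (p ** adj (L i)) ** Z ** (L i ** p)"
          by (simp add: matrix_mul_assoc)
        also have "\<dots> = (p ** adj (L i) ** p) ** Z ** (p ** L i ** p)" using Lp pL by simp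
        finally show ?thesis by (simp add: matrix_mul_assoc)
      qed
      show ?thesis by (simp add: kraus_def mm.sum_left mm.sum_right mm.scaleR_left mm.scaleR_right 1)
    qed
    define Z where "Z = p ** B ** p"
    have "Z = 0"
    proof (rule fixed_dual_zero[OF inv])
      show cZ: "corner W Z" unfolding Z_def p_def by (rule corner_compress[OF sub])
      have pA: "p ** A ** p = 0"
      proof -
        have "p ** A = 0"
          unfolding A_def p_def
          using absorption_mult_corner[OF X X'(1) inv X'(3) corner_proj[OF sub]] X'(2) by simp
        then show ?thesis by (simp add: mm.zero_left)
      qed
      have "p ** T' Z ** p = p ** T' B ** p"
        unfolding Z_def dual_channel_kraus by (rule comp[symmetric])
      also have "T' B = B - kraus b L' A" using B(1) by (simp add: algebra_simps)
      also have "p ** (B - kraus b L' A) ** p = Z - p ** kraus b L' (p ** A ** p) ** p"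
        using comp[of b A] by (simp add: Z_def mm.diff_left mm.diff_right)
      also have "\<dots> = Z" by (simp add: pA kraus_0 mm.zero_left mm.zero_right)
      finally show "ortho_proj W ** T' Z ** ortho_proj W = Z" by (simp add: p_def)
      fix \<sigma> assume s: "invariant_state L \<sigma>" "corner W \<sigma>"
      show "trace (\<sigma> ** Z) = 0"
        unfolding Z_def p_def using corner_trace[OF sub s(2), of B] B(2)[OF s(1)] by simp
    qed
    moreover have "trace (\<tau> W ** kraus b L' B) = trace (kraus b L (\<tau> W) ** Z)"
      unfolding Z_def p_def corner_trace[OF sub invsub_corner[OF inv c\<tau>]] by (simp add: trace_kraus_dual)
    ultimately have "trace (\<tau> W ** kraus b L' B) = 0" by (simp add: mm.zero_right tr_zero)
    moreover have "\<tau> W ** A = 0"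
      unfolding A_def using absorption_mult_corner[OF X X'(1) inv X'(3) c\<tau>] X'(2) by simp
    moreover have "trace (\<tau> W ** kraus (\<lambda>i. b i * b i) L' A) = 0"
      unfolding A_def by (rule trace_kraus_absorption_off[OF X X'(1,2) W X'(3)])
    ultimately show "trace (\<tau> W ** Y) = 0" by (simp add: trY tr_zero)
  qed
  then obtain C where "C - T' C = Y" using dual_solve[of Y] by blast
  then show ?thesis using B(1) unfolding Y_def A_def q_def by blast
qed

end

section \<open>Convergence of the characteristic functions\<close>

definition words :: "nat \<Rightarrow> 'j list set" where
  "words n = {w. length w = n}"

lemma finite_words: "finite (words n :: 'j::finite list set)"
  unfolding words_def using finite_lists_length_eq[OF finite, of UNIV n] by simp

lemma words_0: "words 0 = {[]}"
  by (auto simp: words_def)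

lemma sum_words_Suc:
  "(\<Sum>w\<in>words (Suc n). f w) = (\<Sum>w\<in>words n. \<Sum>j\<in>(UNIV :: 'j::finite set). f (w @ [j]))"
proof -
  have "butlast w @ [last w] = w" if "length w = Suc n" for w :: "'j list"
    using that by (intro append_butlast_last_id) auto
  then show ?thesis
    unfolding sum.cartesian_product
    by (intro sum.reindex_bij_witness[where i = "\<lambda>(w, j). w @ [j]" and j = "\<lambda>w. (butlast w, last w)"])
      (auto simp: words_def)
qed

definition block :: "('j \<Rightarrow> complex^'h^'h) \<Rightarrow> complex^'h^'h \<Rightarrow> 'j list \<Rightarrow> complex^'h^'h" where
  "block L \<rho> w = word_op L w ** \<rho> ** adj (word_op L w)"

lemma block_Nil: "block L \<rho> [] = \<rho>"
  by (simp add: block_def word_op_def)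

lemma block_snoc: "block L \<rho> (w @ [j]) = L j ** block L \<rho> w ** adj (L j)"
  by (simp add: block_def word_op_def adj_mult matrix_mul_assoc)

lemma psd_block: "psd \<rho> \<Longrightarrow> psd (block L \<rho> w)"
  unfolding block_def by (rule psd_conj)

lemma sum_block: "(\<Sum>w\<in>words n. block L \<rho> w) = (channel L ^^ n) \<rho>"
proof (induction n)
  case (Suc n)
  have "(\<Sum>w\<in>words (Suc n). block L \<rho> w) = (\<Sum>w\<in>words n. channel L (block L \<rho> w))"
    by (simp add: sum_words_Suc block_snoc channel_def)
  also have "\<dots> = channel L (\<Sum>w\<in>words n. block L \<rho> w)"
    by (simp add: channel_kraus kraus_sum)
  finally show ?case by (simp add: Suc)
qed (simp add: words_0 block_Nil)

text \<open>The trace of \<rho> against the \<open>n\<close>-th power of the phase-tilted dual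
  channel applied to \<open>Y\<close>. It is written as a sum over words because
  \<open>kraus\<close> carries real weights only. With \<open>Y\<close> an absorption operator it is
  the characteristic function of the increments restricted to absorption in that component.\<close>

definition phase_sum :: "('j::finite \<Rightarrow> complex^'h^'h) \<Rightarrow> complex^'h^'h \<Rightarrow> ('j \<Rightarrow> real) \<Rightarrow> real \<Rightarrow> nat
    \<Rightarrow> complex^'h^'h \<Rightarrow> complex" where
  "phase_sum L \<rho> b e n Y = (\<Sum>w\<in>words n. iexp (e * sum_list (map b w)) * trace (block L \<rho> w ** Y))"

lemma phase_sum_0: "phase_sum L \<rho> b e 0 Y = trace (\<rho> ** Y)"
  by (simp add: phase_sum_def words_0 block_Nil)

lemma linear_phase_sum: "linear (phase_sum L \<rho> b e n)"
  unfolding linear_iff phase_sum_def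
  by (simp add: mm.add_right mm.scaleR_right tr_add tr_scaleR algebra_simps sum.distrib scaleR_sum_right)

lemmas phase_sum_diff = linear_diff[OF linear_phase_sum]
  and phase_sum_scaleR = linear_scale[OF linear_phase_sum] and phase_sum_sum = linear_sum[OF linear_phase_sum]

lemma phase_sum_Suc:
  "phase_sum L \<rho> b e (Suc n) Y = (\<Sum>j\<in>UNIV. iexp (e * b j) * phase_sum L \<rho> b e n (adj (L j) ** Y ** L j))"
proof -
  have tr: "trace (block L \<rho> (w @ [j]) ** Y) = trace (block L \<rho> w ** (adj (L j) ** Y ** L j))" for w j
    using trace_mul_sym[of "L j" "block L \<rho> w ** adj (L j) ** Y"] by (simp add: block_snoc matrix_mul_assoc)
  have "phase_sum L \<rho> b e (Suc n) Y = (\<Sum>w\<in>words n. \<Sum>j\<in>UNIV. iexp (e * b j) *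
      (iexp (e * sum_list (map b w)) * trace (block L \<rho> w ** (adj (L j) ** Y ** L j))))"
    unfolding phase_sum_def sum_words_Suc tr
    by (intro sum.cong refl) (simp add: distrib_left exp_add mult_ac)
  also have "\<dots> = (\<Sum>j\<in>UNIV. iexp (e * b j) * phase_sum L \<rho> b e n (adj (L j) ** Y ** L j))"
    unfolding phase_sum_def by (subst sum.swap) (simp add: sum_distrib_left)
  finally show ?thesis .
qed

lemma phase_sum_kraus:
  "phase_sum L \<rho> b e n (kraus c (\<lambda>i. adj (L i)) Y)
    = (\<Sum>j\<in>UNIV. of_real (c j) * phase_sum L \<rho> b e n (adj (L j) ** Y ** L j))"
  by (simp add: kraus_def phase_sum_sum phase_sum_scaleR scaleR_complex)

text \<open>Each of the \<open>n\<close> one-step errors is amplified by at most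
  \<open>1 + a\<close> in every later step.\<close>

lemma approximate_power:
  fixes h :: "nat \<Rightarrow> complex"
  assumes step: "\<And>n. cmod (h (Suc n) - z * h n) \<le> d" and z: "cmod z \<le> 1 + a" and a: "a \<ge> 0"
  shows "cmod (h n - z ^ n * h 0) \<le> real n * d * (1 + a) ^ n"
proof (induction n)
  case (Suc n)
  have d: "d \<ge> 0" using step[of 0] norm_ge_zero order_trans by blast
  have "cmod (h (Suc n) - z ^ Suc n * h 0) = cmod ((h (Suc n) - z * h n) + z * (h n - z ^ n * h 0))"
    by (simp add: algebra_simps)
  also have "\<dots> \<le> d + cmod z * cmod (h n - z ^ n * h 0)"
    using norm_triangle_mono[OF step order_refl] by (metis norm_mult)
  also have "\<dots> \<le> d + (1 + a) * (real n * d * (1 + a) ^ n)"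
    using z a by (intro add_left_mono mult_mono Suc) auto
  also have "\<dots> \<le> d * (1 + a) ^ Suc n + (1 + a) * (real n * d * (1 + a) ^ n)"
    using mult_left_mono[OF one_le_power[of "1 + a" "Suc n"] d] a by simp
  also have "\<dots> = real (Suc n) * d * (1 + a) ^ Suc n" by (simp add: algebra_simps)
  finally show ?case .
qed simp

context kraus_channel
begin

text \<open>The phases have modulus 1 and the traces of the blocks add up to the trace of \<rho>;
  this makes the bound uniform in \<open>b\<close>, \<open>e\<close> and \<open>n\<close>.\<close>

lemma phase_sum_bound:
  assumes \<rho>: "psd \<rho>"
  shows "\<exists>K\<ge>0. \<forall>b e n Y. cmod (phase_sum L \<rho> b e n Y) \<le> K * norm Y"
proof -
  obtain K where K: "K > 0" "\<And>\<omega> X :: complex^'h^'h. psd \<omega> \<Longrightarrow> cmod (trace (\<omega> ** X)) \<le> K * norm X * Re (trace \<omega>)"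
    using trace_psd_mult_bound by blast
  have "cmod (phase_sum L \<rho> b e n Y) \<le> (K * Re (trace \<rho>)) * norm Y" for b e n Y
  proof -
    have "cmod (phase_sum L \<rho> b e n Y) \<le> (\<Sum>w\<in>words n. K * norm Y * Re (trace (block L \<rho> w)))"
      unfolding phase_sum_def
      by (rule sum_norm_le) (simp add: norm_mult K(2)[OF psd_block[OF \<rho>]])
    also have "\<dots> = K * norm Y * Re (trace (\<Sum>w\<in>words n. block L \<rho> w))"
      by (simp add: tr_sum sum_distrib_left)
    finally show ?thesis by (simp add: sum_block trace_T_pow mult_ac)
  qed
  moreover have "K * Re (trace \<rho>) \<ge> 0" using K(1) trace_psd(2)[OF \<rho>] by simp
  ultimately show ?thesis by blast
qed

text \<open>Taylor expansion of the phase of the last letter, with a remainder uniform in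
  \<open>n\<close>. The order is a parameter because \<open>A\<close>, \<open>B\<close> and
  \<open>C\<close> are expanded to orders 2, 1 and 0, which gives a common error of third
  order.\<close>

lemma phase_sum_expand:
  assumes \<rho>: "psd \<rho>"
  shows "\<exists>M\<ge>0. \<forall>e n. cmod (phase_sum L \<rho> b e (Suc n) Y
    - (\<Sum>k\<le>m. (\<i> * of_real e) ^ k / fact k * phase_sum L \<rho> b e n (kraus (\<lambda>j. b j ^ k) L' Y)))
      \<le> M * \<bar>e\<bar> ^ Suc m"
proof -
  obtain K where K: "K \<ge> 0" "\<And>b e n Y. cmod (phase_sum L \<rho> b e n Y) \<le> K * norm Y"
    using phase_sum_bound[OF \<rho>] by blast
  define M where "M = (\<Sum>j\<in>UNIV. \<bar>b j\<bar> ^ Suc m * (K * norm (adj (L j) ** Y ** L j)))"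
  have "cmod (phase_sum L \<rho> b e (Suc n) Y
      - (\<Sum>k\<le>m. (\<i> * of_real e) ^ k / fact k * phase_sum L \<rho> b e n (kraus (\<lambda>j. b j ^ k) L' Y)))
        \<le> M * \<bar>e\<bar> ^ Suc m" for e n
  proof -
    define g where "g j = phase_sum L \<rho> b e n (adj (L j) ** Y ** L j)" for j
    have "(\<Sum>k\<le>m. (\<i> * of_real e) ^ k / fact k * phase_sum L \<rho> b e n (kraus (\<lambda>j. b j ^ k) L' Y))
        = (\<Sum>k\<le>m. \<Sum>j\<in>UNIV. (\<i> * of_real (e * b j)) ^ k / fact k * g j)"
      by (simp add: phase_sum_kraus g_def sum_distrib_left power_mult_distrib mult_ac)
    also have "\<dots> = (\<Sum>j\<in>UNIV. (\<Sum>k\<le>m. (\<i> * of_real (e * b j)) ^ k / fact k) * g j)"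
      by (subst sum.swap) (simp add: sum_distrib_right)
    finally have "phase_sum L \<rho> b e (Suc n) Y
      - (\<Sum>k\<le>m. (\<i> * of_real e) ^ k / fact k * phase_sum L \<rho> b e n (kraus (\<lambda>j. b j ^ k) L' Y))
      = (\<Sum>j\<in>UNIV. (iexp (e * b j) - (\<Sum>k\<le>m. (\<i> * of_real (e * b j)) ^ k / fact k)) * g j)"
      unfolding phase_sum_Suc g_def[symmetric] by (simp only: left_diff_distrib sum_subtractf)
    also have "cmod \<dots> \<le> (\<Sum>j\<in>UNIV. \<bar>b j\<bar> ^ Suc m * (K * norm (adj (L j) ** Y ** L j)) * \<bar>e\<bar> ^ Suc m)"
    proof (rule sum_norm_le)
      fix j
      have "cmod (iexp (e * b j) - (\<Sum>k\<le>m. (\<i> * of_real (e * b j)) ^ k / fact k))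
          \<le> \<bar>e * b j\<bar> ^ Suc m / fact (Suc m)" by (rule iexp_approx1)
      also have "\<dots> \<le> \<bar>e * b j\<bar> ^ Suc m / 1"
        by (intro divide_left_mono fact_ge_1) auto
      finally have "cmod ((iexp (e * b j) - (\<Sum>k\<le>m. (\<i> * of_real (e * b j)) ^ k / fact k)) * g j)
          \<le> \<bar>e * b j\<bar> ^ Suc m * (K * norm (adj (L j) ** Y ** L j))"
        unfolding norm_mult g_def using K by (intro mult_mono) auto
      then show "cmod ((iexp (e * b j) - (\<Sum>k\<le>m. (\<i> * of_real (e * b j)) ^ k / fact k)) * g j)
          \<le> \<bar>b j\<bar> ^ Suc m * (K * norm (adj (L j) ** Y ** L j)) * \<bar>e\<bar> ^ Suc m"
        by (simp add: abs_mult power_mult_distrib mult_ac)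
    qed
    also have "\<dots> = M * \<bar>e\<bar> ^ Suc m" by (simp add: M_def sum_distrib_right)
    finally show ?thesis .
  qed
  moreover have "M \<ge> 0" unfolding M_def using K(1) by (intro sum_nonneg) auto
  ultimately show ?thesis by blast
qed

text \<open>The corrected observable \<open>A + i\<epsilon>B + \<epsilon>\<^sup>2C\<close> is an eigenvector of the phase-tilted dual channel up to
  \<open>O(\<epsilon>\<^sup>3)\<close>, with eigenvalue \<open>1 - q\<epsilon>\<^sup>2/2\<close>.\<close>
lemma phase_sum_limit:
  assumes \<rho>: "psd \<rho>" and A: "T' A = A" and B: "B - T' B = kraus b L' A"
    and C: "C - T' C = (q / 2) *\<^sub>R A - kraus b L' B - (1/2) *\<^sub>R kraus (\<lambda>i. b i * b i) L' A"
  shows "(\<lambda>n. phase_sum L \<rho> b (1 / sqrt (real n)) n A) \<longlonglongrightarrow> of_real (exp (- q / 2)) * trace (\<rho> ** A)"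
proof -
  define G where "G = phase_sum L \<rho> b"
  obtain K where K: "K \<ge> 0" "\<And>e n Y. cmod (G e n Y) \<le> K * norm Y"
    using phase_sum_bound[OF \<rho>] unfolding G_def by blast
  obtain M1 where M1: "M1 \<ge> 0" "\<And>e n. cmod (G e (Suc n) A
     - (\<Sum>k\<le>2. (\<i> * of_real e) ^ k / fact k * G e n (kraus (\<lambda>j. b j ^ k) L' A))) \<le> M1 * \<bar>e\<bar> ^ 3"
    using phase_sum_expand[OF \<rho>, of b A 2] unfolding G_def by (auto simp: eval_nat_numeral)
  obtain M2 where M2: "M2 \<ge> 0" "\<And>e n. cmod (G e (Suc n) B
     - (\<Sum>k\<le>1. (\<i> * of_real e) ^ k / fact k * G e n (kraus (\<lambda>j. b j ^ k) L' B))) \<le> M2 * \<bar>e\<bar> ^ 2"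
    using phase_sum_expand[OF \<rho>, of b B 1] unfolding G_def by (auto simp: eval_nat_numeral)
  obtain M3 where M3: "M3 \<ge> 0" "\<And>e n. cmod (G e (Suc n) C
     - (\<Sum>k\<le>0. (\<i> * of_real e) ^ k / fact k * G e n (kraus (\<lambda>j. b j ^ k) L' C))) \<le> M3 * \<bar>e\<bar>"
    using phase_sum_expand[OF \<rho>, of b C 0] unfolding G_def by auto
  \<comment> \<open>The last summand pays for the part of the eigenvalue correction that falls on
    the correctors, of order at least 3 in \<open>e\<close>.\<close>
  define M where "M = M1 + M2 + M3 + \<bar>q\<bar> * (K * norm B + K * norm C)"
  have M0: "M \<ge> 0" unfolding M_def using M1(1) M2(1) M3(1) K(1) by simp
  define H where "H e n = G e n A + \<i> * of_real e * G e n B + (of_real e)\<^sup>2 * G e n C" for e n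
  have step: "cmod (H e (Suc n) - of_real (1 - q * e\<^sup>2 / 2) * H e n) \<le> M * \<bar>e\<bar> ^ 3" if e: "\<bar>e\<bar> \<le> 1" for e n
  proof -
    define E where "E = complex_of_real e"
    define q' where "q' = complex_of_real (q / 2)"
    define GA GB GC where "GA = G e n A" and "GB = G e n B" and "GC = G e n C"
    define TB KB K2 where "TB = G e n (T' B)" and "KB = G e n (kraus b L' B)"
      and "K2 = G e n (kraus (\<lambda>i. b i * b i) L' A) / 2"
    have gb: "G e n (kraus b L' A) = GB - TB"
      unfolding B[symmetric] GB_def TB_def G_def by (rule phase_sum_diff)
    have gc: "G e n (T' C) = GC - q' * GA + KB + K2"
    proof -
      have "G e n (C - T' C) = q' * GA - KB - K2"
        unfolding C G_def phase_sum_diff phase_sum_scaleR scaleR_complex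
        by (simp add: GA_def KB_def K2_def G_def q'_def)
      then show ?thesis by (simp add: G_def phase_sum_diff GC_def algebra_simps)
    qed
    define R1 R2 R3 where "R1 = G e (Suc n) A - (GA + \<i> * E * (GB - TB) - E\<^sup>2 * K2)"
      and "R2 = G e (Suc n) B - (TB + \<i> * E * KB)"
      and "R3 = G e (Suc n) C - (GC - q' * GA + KB + K2)"
    have T'0: "kraus (\<lambda>j. 1) L' = T'" by (simp add: dual_channel_kraus)
    have iE: "\<i> * E * (\<i> * E) = - (E * E)" by (simp add: algebra_simps)
    have r1: "cmod R1 \<le> M1 * \<bar>e\<bar> ^ 3"
    proof -
      have "(\<Sum>k\<le>2. (\<i> * of_real e) ^ k / fact k * G e n (kraus (\<lambda>j. b j ^ k) L' A))
          = GA + \<i> * E * (GB - TB) - E\<^sup>2 * K2"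
        by (simp add: eval_nat_numeral T'0 A gb GA_def[symmetric] K2_def iE flip: E_def)
      then show ?thesis using M1(2)[of e n] by (simp add: R1_def)
    qed
    have r2: "cmod R2 \<le> M2 * \<bar>e\<bar> ^ 2"
      using M2(2)[of e n] by (simp add: R2_def T'0 TB_def KB_def E_def)
    have r3: "cmod R3 \<le> M3 * \<bar>e\<bar>"
      using M3(2)[of e n] by (simp add: R3_def T'0 gc)
    have ii: "\<i> * \<i> = -1" by simp
    \<comment> \<open>The terms of first order cancel by the equation for \<open>B\<close> and those
      of second order by the equation for \<open>C\<close>; only remainders of third order or higher
      are left.\<close>
    have eq: "H e (Suc n) - of_real (1 - q * e\<^sup>2 / 2) * H e n
        = R1 + \<i> * E * R2 + E\<^sup>2 * R3 + q' * E\<^sup>2 * (\<i> * E * GB + E\<^sup>2 * GC)"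
    proof -
      have c: "complex_of_real (1 - q * e\<^sup>2 / 2) = 1 - q' * E\<^sup>2" by (simp add: q'_def E_def)
      have "G e (Suc n) A = R1 + (GA + \<i> * E * (GB - TB) - E\<^sup>2 * K2)"
        "G e (Suc n) B = R2 + (TB + \<i> * E * KB)" "G e (Suc n) C = R3 + (GC - q' * GA + KB + K2)"
        by (simp_all add: R1_def R2_def R3_def)
      then show ?thesis
        unfolding H_def c E_def[symmetric] GA_def[symmetric] GB_def[symmetric] GC_def[symmetric]
        using ii by algebra
    qed
    have "cmod (R1 + \<i> * E * R2 + E\<^sup>2 * R3 + q' * E\<^sup>2 * (\<i> * E * GB + E\<^sup>2 * GC))
        \<le> cmod R1 + cmod (\<i> * E * R2) + cmod (E\<^sup>2 * R3) + cmod (q' * E\<^sup>2 * (\<i> * E * GB + E\<^sup>2 * GC))"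
      by (intro norm_triangle_mono order_refl)
    also have "cmod (\<i> * E * R2) \<le> M2 * \<bar>e\<bar> ^ 3"
      using mult_left_mono[OF r2 abs_ge_zero[of e]] by (simp add: norm_mult E_def eval_nat_numeral mult_ac)
    also have "cmod (E\<^sup>2 * R3) \<le> M3 * \<bar>e\<bar> ^ 3"
      using mult_left_mono[OF r3, of "\<bar>e\<bar>\<^sup>2"] by (simp add: norm_mult norm_power E_def eval_nat_numeral mult_ac)
    also have "cmod (q' * E\<^sup>2 * (\<i> * E * GB + E\<^sup>2 * GC)) \<le> (\<bar>q\<bar> * (K * norm B + K * norm C)) * \<bar>e\<bar> ^ 3"
    proof -
      have "cmod (\<i> * E * GB + E\<^sup>2 * GC) \<le> \<bar>e\<bar> * (K * norm B) + \<bar>e\<bar>\<^sup>2 * (K * norm C)"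
        using K(2)[of e n B] K(2)[of e n C]
        by (intro norm_triangle_mono) (auto simp: norm_mult norm_power E_def GB_def GC_def intro!: mult_left_mono)
      also have "\<dots> \<le> \<bar>e\<bar> * (K * norm B) + \<bar>e\<bar> * (K * norm C)"
      proof (intro add_left_mono mult_right_mono)
        show "\<bar>e\<bar>\<^sup>2 \<le> \<bar>e\<bar>" using mult_left_le[OF e abs_ge_zero[of e]] by (simp only: power2_eq_square)
      qed (use K(1) in simp)
      finally have 1: "cmod (\<i> * E * GB + E\<^sup>2 * GC) \<le> \<bar>e\<bar> * (K * norm B + K * norm C)"
        by (simp add: distrib_left)
      have "cmod (q' * E\<^sup>2 * (\<i> * E * GB + E\<^sup>2 * GC)) = (\<bar>q\<bar> / 2 * \<bar>e\<bar>\<^sup>2) * cmod (\<i> * E * GB + E\<^sup>2 * GC)"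
        by (simp add: norm_mult norm_power q'_def E_def)
      also have "\<dots> \<le> (\<bar>q\<bar> * \<bar>e\<bar>\<^sup>2) * (\<bar>e\<bar> * (K * norm B + K * norm C))"
        using K(1) by (intro mult_mono 1) auto
      finally show ?thesis by (simp add: eval_nat_numeral mult_ac)
    qed
    also note r1
    finally show ?thesis unfolding eq M_def by (simp add: distrib_right add_ac)
  qed
  define e where "e n = 1 / sqrt (real n)" for n
  \<comment> \<open>With \<open>e n\<close> equal to \<open>n^(-1/2)\<close>, the \<open>n\<close>
    steps of error \<open>M (e n)^3\<close> add up to a multiple of \<open>e n\<close>.\<close>
  have dist: "cmod (H (e n) n - of_real (1 - q * (e n)\<^sup>2 / 2) ^ n * H (e n) 0) \<le> M * exp (\<bar>q\<bar> / 2) * e n"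
    if n: "n > 0" for n
  proof -
    have en: "(e n)\<^sup>2 = 1 / real n" "e n \<ge> 0" "\<bar>e n\<bar> \<le> 1" using n by (auto simp: e_def power_divide)
    \<comment> \<open>The modulus of the approximate eigenvalue exceeds 1 by at most
      \<open>a\<close>, so \<open>n\<close> steps amplify by at most
      \<open>exp (\<bar>q\<bar> / 2)\<close>.\<close>
    define a where "a = \<bar>q\<bar> / (2 * real n)"
    have a0: "a \<ge> 0" by (simp add: a_def)
    have z: "cmod (of_real (1 - q * (e n)\<^sup>2 / 2)) \<le> 1 + a"
    proof -
      have "\<bar>1 - q * (e n)\<^sup>2 / 2\<bar> \<le> 1 + \<bar>q * (e n)\<^sup>2 / 2\<bar>" by linarith
      also have "\<bar>q * (e n)\<^sup>2 / 2\<bar> = a" by (simp add: en a_def abs_mult)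
      finally show ?thesis by (simp only: norm_of_real)
    qed
    have "cmod (H (e n) n - of_real (1 - q * (e n)\<^sup>2 / 2) ^ n * H (e n) 0) \<le> real n * (M * \<bar>e n\<bar> ^ 3) * (1 + a) ^ n"
      by (rule approximate_power[where h = "H (e n)" and z = "of_real (1 - q * (e n)\<^sup>2 / 2)",
            OF step[OF en(3)] z a0])
    also have "\<dots> \<le> M * e n * exp (\<bar>q\<bar> / 2)"
    proof (rule mult_mono)
      show "(1 + a) ^ n \<le> exp (\<bar>q\<bar> / 2)"
    proof -
      have "(1 + a) ^ n \<le> exp a ^ n" using a0 by (intro power_mono) auto
      also have "\<dots> = exp (\<bar>q\<bar> / 2)" using n by (simp add: a_def flip: exp_of_nat_mult)
      finally show ?thesis .
    qed
      show "real n * (M * \<bar>e n\<bar> ^ 3) \<le> M * e n"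
    proof -
      have e3: "\<bar>e n\<bar> ^ 3 = (e n)\<^sup>2 * e n" using en(2) by (simp add: eval_nat_numeral)
      have "real n * (M * \<bar>e n\<bar> ^ 3) = M * (real n * (e n)\<^sup>2) * e n"
        unfolding e3 by (simp only: mult_ac)
      also have "real n * (e n)\<^sup>2 = 1" using n by (simp add: en)
      finally show ?thesis unfolding mult_1_right by (rule eq_refl)
    qed
    qed (use M0 en(2) a0 in auto)
    finally show ?thesis by (simp add: mult_ac)
  qed
  have e_lim: "e \<longlonglongrightarrow> 0"
    unfolding e_def by (intro real_tendsto_divide_at_top[OF tendsto_const] filterlim_compose[OF sqrt_at_top] filterlim_real_sequentially)
  have diff: "(\<lambda>n. H (e n) n - of_real (1 - q * (e n)\<^sup>2 / 2) ^ n * H (e n) 0) \<longlonglongrightarrow> 0"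
  proof (rule Lim_null_comparison)
    show "\<forall>\<^sub>F n in sequentially. cmod (H (e n) n - of_real (1 - q * (e n)\<^sup>2 / 2) ^ n * H (e n) 0)
        \<le> M * exp (\<bar>q\<bar> / 2) * e n"
      using dist by (intro eventually_mono[OF eventually_gt_at_top[of 0]])
    show "(\<lambda>n. M * exp (\<bar>q\<bar> / 2) * e n) \<longlonglongrightarrow> 0"
      by (rule tendsto_mult_right_zero[OF e_lim])
  qed
  have pow: "(\<lambda>n. complex_of_real (1 - q * (e n)\<^sup>2 / 2) ^ n) \<longlonglongrightarrow> of_real (exp (- q / 2))"
  proof -
    have "(\<lambda>n. (1 + (- q / 2) / real n) ^ n) \<longlonglongrightarrow> exp (- q / 2)" by (rule tendsto_exp_limit_sequentially)
    moreover have "\<forall>\<^sub>F n in sequentially. (1 + (- q / 2) / real n) ^ n = (1 - q * (e n)\<^sup>2 / 2) ^ n"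
      using eventually_gt_at_top[of 0] by eventually_elim (simp add: e_def power_divide mult.commute)
    ultimately have "(\<lambda>n. (1 - q * (e n)\<^sup>2 / 2) ^ n) \<longlonglongrightarrow> exp (- q / 2)"
      by (rule Lim_transform_eventually)
    from tendsto_of_real[where 'a = complex, OF this] show ?thesis by (simp only: of_real_power)
  qed
  have ec: "(\<lambda>n. complex_of_real (e n)) \<longlonglongrightarrow> 0" using tendsto_of_real[OF e_lim] by simp
  have H0: "(\<lambda>n. H (e n) 0) \<longlonglongrightarrow> trace (\<rho> ** A) + \<i> * 0 * trace (\<rho> ** B) + 0\<^sup>2 * trace (\<rho> ** C)"
    unfolding H_def G_def phase_sum_0 by (intro tendsto_intros ec)
  have rest: "(\<lambda>n. \<i> * of_real (e n) * G (e n) n B + (of_real (e n))\<^sup>2 * G (e n) n C) \<longlonglongrightarrow> 0"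
  proof (rule Lim_null_comparison)
    show "\<forall>\<^sub>F n in sequentially. cmod (\<i> * of_real (e n) * G (e n) n B + (of_real (e n))\<^sup>2 * G (e n) n C)
        \<le> \<bar>e n\<bar> * (K * norm B) + \<bar>e n\<bar>\<^sup>2 * (K * norm C)"
      using K by (intro always_eventually allI norm_triangle_mono)
        (auto simp: norm_mult norm_power intro!: mult_left_mono)
    have "(\<lambda>n. \<bar>e n\<bar> * (K * norm B) + \<bar>e n\<bar>\<^sup>2 * (K * norm C)) \<longlonglongrightarrow> \<bar>0\<bar> * (K * norm B) + \<bar>0\<bar>\<^sup>2 * (K * norm C)"
      by (intro tendsto_intros e_lim)
    then show "(\<lambda>n. \<bar>e n\<bar> * (K * norm B) + \<bar>e n\<bar>\<^sup>2 * (K * norm C)) \<longlonglongrightarrow> 0" by simp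
  qed
  have "(\<lambda>n. (H (e n) n - of_real (1 - q * (e n)\<^sup>2 / 2) ^ n * H (e n) 0)
      + of_real (1 - q * (e n)\<^sup>2 / 2) ^ n * H (e n) 0
      - (\<i> * of_real (e n) * G (e n) n B + (of_real (e n))\<^sup>2 * G (e n) n C))
    \<longlonglongrightarrow> 0 + of_real (exp (- q / 2)) * (trace (\<rho> ** A) + \<i> * 0 * trace (\<rho> ** B) + 0\<^sup>2 * trace (\<rho> ** C)) - 0"
    by (intro tendsto_intros diff pow H0 rest)
  then show ?thesis by (simp add: H_def G_def e_def)
qed

theorem component_phase_limit:
  fixes s :: "'j \<Rightarrow> real^'d" and u :: "real^'d"
  assumes X: "X \<in> components" and \<rho>: "psd \<rho>"
  shows "(\<lambda>n. phase_sum L \<rho> (\<lambda>i. u \<bullet> (s i - chi_mean s L X)) (1 / sqrt (real n)) n (absorption L X))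
    \<longlonglongrightarrow> of_real (exp (- (u \<bullet> (chi_cov s L X *v u)) / 2)) * trace (\<rho> ** absorption L X)"
proof -
  obtain B C where "B - T' B = kraus (\<lambda>i. u \<bullet> (s i - chi_mean s L X)) L' (absorption L X)"
    "C - T' C = ((u \<bullet> (chi_cov s L X *v u)) / 2) *\<^sub>R absorption L X - kraus (\<lambda>i. u \<bullet> (s i - chi_mean s L X)) L' B
      - (1/2) *\<^sub>R kraus (\<lambda>i. (u \<bullet> (s i - chi_mean s L X)) * (u \<bullet> (s i - chi_mean s L X))) L' (absorption L X)"
    using corrector_solutions[OF X, where u = u and s = s] by blast
  then show ?thesis by (rule phase_sum_limit[OF \<rho> absorption_fixed[OF component_invsub[OF X]]])
qed

text \<open>Start the walk in the state of a minimal enclosure inside \<open>X\<close>: the phase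
  sums are bounded by 1, hence so is their limit \<open>exp (-q/2)\<close>.\<close>

lemma chi_cov_nonneg:
  fixes s :: "'j \<Rightarrow> real^'d"
  assumes X: "X \<in> components"
  shows "0 \<le> u \<bullet> (chi_cov s L X *v u)"
proof -
  obtain W where W: "irred L W" "W \<subseteq> X" using component_minimal[OF X] by blast
  define A where "A = absorption L X"
  define b where "b i = u \<bullet> (s i - chi_mean s L X)" for i
  note s\<tau> = enclosure_stateD[OF W(1)]
  have psdA: "psd A" unfolding A_def by (rule psd_absorption[OF component_invsub[OF X]])
  have A\<tau>: "\<tau> W ** A = \<tau> W"
    unfolding A_def using absorption_mult_corner[OF X X irredD(1)[OF W(1)] W(2) enclosure_state(3)[OF W(1)]] by simp
  have "cmod (phase_sum L (\<tau> W) b e n A) \<le> 1" for e n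
  proof -
    have "cmod (phase_sum L (\<tau> W) b e n A) \<le> (\<Sum>w\<in>words n. Re (trace (block L (\<tau> W) w ** A)))"
      unfolding phase_sum_def
    proof (rule sum_norm_le)
      fix w
      have "Im (trace (block L (\<tau> W) w ** A)) = 0" "0 \<le> Re (trace (block L (\<tau> W) w ** A))"
        by (rule trace_psd_mult[OF psd_block[OF s\<tau>(1)] psdA])+
      then have "cmod (trace (block L (\<tau> W) w ** A)) = Re (trace (block L (\<tau> W) w ** A))"
        by (simp add: cmod_eq_Re)
      then show "cmod (iexp (e * sum_list (map b w)) * trace (block L (\<tau> W) w ** A))
          \<le> Re (trace (block L (\<tau> W) w ** A))" by (simp add: norm_mult)
    qed
    also have "\<dots> = Re (trace ((\<Sum>w\<in>words n. block L (\<tau> W) w) ** A))"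
      by (simp add: mm.sum_left tr_sum)
    also have "(\<Sum>w\<in>words n. block L (\<tau> W) w) = \<tau> W"
      unfolding sum_block by (induction n) (simp_all add: s\<tau>)
    finally show ?thesis by (simp add: A\<tau> s\<tau>(2))
  qed
  moreover have "(\<lambda>n. phase_sum L (\<tau> W) b (1 / sqrt (real n)) n A)
      \<longlonglongrightarrow> of_real (exp (- (u \<bullet> (chi_cov s L X *v u)) / 2)) * trace (\<tau> W ** A)"
    unfolding A_def b_def by (rule component_phase_limit[OF X s\<tau>(1)])
  ultimately have "cmod (of_real (exp (- (u \<bullet> (chi_cov s L X *v u)) / 2)) * trace (\<tau> W ** A)) \<le> 1"
    by (intro LIMSEQ_le_const2[OF tendsto_norm]) auto
  then show ?thesis by (simp add: A\<tau> s\<tau>(2))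
qed

end

section \<open>Gaussian measures\<close>

lemma axis_image_Basis: "(Basis :: (real^'d) set) = range (\<lambda>i. axis i 1)"
  by (auto simp: Basis_vec_def)

lemma prod_Basis_vec: "(\<Prod>b\<in>(Basis :: (real^'d) set). f (x \<bullet> b)) = (\<Prod>i\<in>UNIV. f (x $ i))"
  unfolding axis_image_Basis
  by (subst prod.reindex) (auto simp: inj_on_def axis_eq_axis inner_axis)

lemma std_gaussian_density:
  "std_gaussian = density lborel (\<lambda>x :: real^'d. ennreal (\<Prod>b\<in>Basis. std_normal_density (x \<bullet> b)))"
  by (simp add: std_gaussian_def prod_Basis_vec)

lemma sets_std_gaussian [measurable_cong, simp]: "sets std_gaussian = sets borel"
  and space_std_gaussian [simp]: "space std_gaussian = UNIV"
  by (simp_all add: std_gaussian_def)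

lemma prob_space_std_gaussian: "prob_space (std_gaussian :: (real^'d) measure)"
proof
  have "emeasure (std_gaussian :: (real^'d) measure) UNIV
      = (\<integral>\<^sup>+x. (\<Prod>b\<in>Basis. ennreal (std_normal_density (x \<bullet> b))) \<partial>(lborel :: (real^'d) measure))"
    by (simp add: std_gaussian_density emeasure_density prod_ennreal normal_density_nonneg)
  also have "\<dots> = (\<Prod>b\<in>(Basis :: (real^'d) set). \<integral>\<^sup>+x. ennreal (std_normal_density x) \<partial>lborel)"
    by (rule nn_integral_lborel_prod) auto
  also have "(\<integral>\<^sup>+x. ennreal (std_normal_density x) \<partial>lborel) = 1"
    using prob_space.emeasure_space_1[OF prob_space_normal_density[of 1 0]]
    by (simp add: emeasure_density)
  finally show "emeasure (std_gaussian :: (real^'d) measure) (space std_gaussian) = 1" by simp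
qed

lemma integral_lborel_prod:
  fixes f :: "'a::euclidean_space \<Rightarrow> real \<Rightarrow> complex"
  assumes f: "\<And>b. b \<in> Basis \<Longrightarrow> integrable lborel (f b)"
  shows "(\<integral>x. (\<Prod>b\<in>Basis. f b (x \<bullet> b)) \<partial>lborel) = (\<Prod>b\<in>Basis. \<integral>x. f b x \<partial>lborel)"
proof -
  interpret product_sigma_finite "\<lambda>b :: 'a. lborel :: real measure" by standard
  have m[measurable]: "f b \<in> borel_measurable borel" if "b \<in> Basis" for b
    using borel_measurable_integrable[OF f[OF that]] by simp
  have "(\<integral>x. (\<Prod>b\<in>Basis. f b (x \<bullet> b)) \<partial>lborel)
      = (\<integral>g. (\<Prod>b\<in>Basis. f b ((\<Sum>c\<in>Basis. g c *\<^sub>R c) \<bullet> b)) \<partial>(\<Pi>\<^sub>M b\<in>Basis. lborel))"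
    by (subst lborel_eq) (rule integral_distr, auto)
  also have "\<dots> = (\<integral>g. (\<Prod>b\<in>Basis. f b (g b)) \<partial>(\<Pi>\<^sub>M b\<in>Basis. lborel))"
    by (intro Bochner_Integration.integral_cong prod.cong refl) (simp add: inner_sum_left inner_Basis if_distrib cong: if_cong)
  also have "\<dots> = (\<Prod>b\<in>Basis. \<integral>x. f b x \<partial>lborel)"
    by (rule product_integral_prod) (auto intro: f)
  finally show ?thesis .
qed

lemma norm_sq_Basis: "(norm x)\<^sup>2 = (\<Sum>b\<in>Basis. (x \<bullet> b)\<^sup>2)"
  by (subst power2_norm_eq_inner, subst euclidean_inner) (simp add: power2_eq_square)

lemma std_gaussian_char:
  "(CLINT x|std_gaussian. iexp (u \<bullet> x)) = of_real (exp (- (norm (u :: real^'d))\<^sup>2 / 2))"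
proof -
  have int: "integrable lborel (\<lambda>x. std_normal_density x *\<^sub>R iexp (t * x))" for t
  proof -
    have "integrable std_normal_distribution (\<lambda>x. iexp (t * x))"
      by (rule finite_measure.integrable_const_bound[where B = 1])
        (auto simp: prob_space.finite_measure[OF prob_space_normal_density])
    then show ?thesis by (subst (asm) integrable_density) auto
  qed
  have one: "(\<integral>x. std_normal_density x *\<^sub>R iexp (t * x) \<partial>lborel) = of_real (exp (- t\<^sup>2 / 2))" for t
  proof -
    have "char std_normal_distribution t = (\<integral>x. std_normal_density x *\<^sub>R iexp (t * x) \<partial>lborel)"
      unfolding char_def by (rule integral_density) auto
    then show ?thesis by (simp add: char_std_normal_distribution)
  qed
  have "(CLINT x|std_gaussian. iexp (u \<bullet> x))
      = (\<integral>x. (\<Prod>b\<in>Basis. std_normal_density (x \<bullet> b)) *\<^sub>R iexp (u \<bullet> x) \<partial>lborel)"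
    unfolding std_gaussian_density by (rule integral_density) (auto intro!: prod_nonneg)
  also have "\<dots> = (\<integral>x. (\<Prod>b\<in>Basis. std_normal_density (x \<bullet> b) *\<^sub>R iexp ((u \<bullet> b) * (x \<bullet> b))) \<partial>lborel)"
  proof (intro Bochner_Integration.integral_cong refl)
    fix x :: "real^'d"
    have "iexp (u \<bullet> x) = (\<Prod>b\<in>Basis. iexp ((u \<bullet> b) * (x \<bullet> b)))"
      by (subst euclidean_inner) (simp add: sum_distrib_left exp_sum)
    then show "(\<Prod>b\<in>Basis. std_normal_density (x \<bullet> b)) *\<^sub>R iexp (u \<bullet> x)
        = (\<Prod>b\<in>Basis. std_normal_density (x \<bullet> b) *\<^sub>R iexp ((u \<bullet> b) * (x \<bullet> b)))"
      by (simp add: scaleR_conv_of_real prod.distrib)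
  qed
  also have "\<dots> = (\<Prod>b\<in>Basis. \<integral>x. std_normal_density x *\<^sub>R iexp ((u \<bullet> b) * x) \<partial>lborel)"
    by (rule integral_lborel_prod[of "\<lambda>b x. std_normal_density x *\<^sub>R iexp ((u \<bullet> b) * x)"]) (rule int)
  also have "\<dots> = of_real (\<Prod>b\<in>Basis. exp (- (u \<bullet> b)\<^sup>2 / 2))" by (simp only: one of_real_prod)
  also have "(\<Prod>b\<in>Basis. exp (- (u \<bullet> b)\<^sup>2 / 2)) = exp (- (norm u)\<^sup>2 / 2)"
    unfolding exp_sum[OF finite_Basis, symmetric] norm_sq_Basis
    by (simp add: sum_negf flip: sum_divide_distrib)
  finally show ?thesis .
qed

section \<open>Square roots of covariance matrices\<close>

lemma nonneg_quadratic_linear_term: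
  assumes "\<And>t :: real. 0 \<le> 2 * t * b + t\<^sup>2 * c"
  shows "b = 0"
proof (rule ccontr)
  assume b: "b \<noteq> 0"
  \<comment> \<open>For this \<open>t\<close> the quadratic term is at most \<open>-t b\<close>,
    half of what the linear term loses.\<close>
  define t where "t = - b / (\<bar>c\<bar> + 1)"
  have p: "\<bar>c\<bar> + 1 > 0" by simp
  have "t\<^sup>2 * c \<le> t\<^sup>2 * \<bar>c\<bar>" by (intro mult_left_mono) auto
  moreover have "t\<^sup>2 * \<bar>c\<bar> \<le> t\<^sup>2 * (\<bar>c\<bar> + 1)" by (intro mult_left_mono) auto
  moreover have "t\<^sup>2 * (\<bar>c\<bar> + 1) = - t * b" using p by (simp add: t_def power2_eq_square)
  moreover have "t * b < 0"
  proof -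
    have "b * b / (\<bar>c\<bar> + 1) > 0" using b p by (intro divide_pos_pos) (simp_all add: zero_less_mult_iff linorder_neq_iff disj_commute)
    then show ?thesis by (simp add: t_def)
  qed
  ultimately show False using assms[of t] by linarith
qed

text \<open>The elimination of \<open>psd_decomposition_aux\<close> over the reals, where symmetry
  has to be assumed because positivity of the form does not imply it.\<close>

lemma real_psd_decomposition:
  fixes M :: "real^'d^'d"
  assumes "finite I" "transpose M = M" "\<And>u. 0 \<le> u \<bullet> (M *v u)" "\<And>i. i \<notin> I \<Longrightarrow> M *v axis i 1 = 0"
  shows "\<exists>v :: 'd \<Rightarrow> real^'d. M = (\<chi> r s. \<Sum>i\<in>I. v i $ r * v i $ s)"
  using assms
proof (induction I arbitrary: M)
  case empty
  then have "M $ r $ s = 0" for r s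
    by (metis empty_iff matrix_vector_mul_component inner_axis mult.right_neutral inner_real_def zero_index)
  then show ?case by (simp add: vec_eq_iff)
next
  case (insert k I)
  have sym: "x \<bullet> (M *v y) = y \<bullet> (M *v x)" for x y
  proof -
    have "x \<bullet> (M *v y) = (x v* M) \<bullet> y" by (simp add: dot_lmul_matrix)
    also have "x v* M = M *v x" using transpose_matrix_vector[of M x] insert.prems(1) by simp
    finally show ?thesis by (simp add: inner_commute)
  qed
  have entry: "axis r 1 \<bullet> (M *v axis s 1) = M $ r $ s" for r s
    by (simp add: inner_axis' matrix_vector_mul_component inner_axis)
  define e :: "real^'d" where "e = axis k 1"
  show ?case
  proof (cases "M *v e = 0")
    case True
    then have "\<exists>v :: 'd \<Rightarrow> real^'d. M = (\<chi> r s. \<Sum>i\<in>I. v i $ r * v i $ s)"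
      using insert.prems by (intro insert.IH) (auto simp: e_def, metis insert_iff)
    then obtain v :: "'d \<Rightarrow> real^'d" where v: "M = (\<chi> r s. \<Sum>i\<in>I. v i $ r * v i $ s)" ..
    have "(\<Sum>i\<in>insert k I. (v(k := 0)) i $ r * (v(k := 0)) i $ s) = (\<Sum>i\<in>I. v i $ r * v i $ s)" for r s
      using insert.hyps by (simp add: sum.insert) (rule sum.cong, auto)
    then show ?thesis using v by (intro exI[of _ "v(k := 0)"]) simp
  next
    case False
    define a where "a = e \<bullet> (M *v e)"
    have "a \<noteq> 0"
    proof
      assume a0: "a = 0"
      have "y \<bullet> (M *v e) = 0" for y
      proof (rule nonneg_quadratic_linear_term[of _ "y \<bullet> (M *v y)"])
        fix t
        show "0 \<le> 2 * t * (y \<bullet> (M *v e)) + t\<^sup>2 * (y \<bullet> (M *v y))"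
          using insert.prems(2)[of "e + t *\<^sub>R y"] sym[of e y] a0
          by (simp add: matrix_vector_right_distrib matrix_vector_mult_scaleR inner_add_left inner_add_right
              a_def power2_eq_square algebra_simps)
      qed
      then have "M *v e = 0" using inner_eq_zero_iff by blast
      with False show False by simp
    qed
    then have a: "a > 0" using insert.prems(2)[of e] by (simp add: a_def)
    define w where "w = (1 / sqrt a) *\<^sub>R (M *v e)"
    define M' where "M' = M - (\<chi> r s. w $ r * w $ s)"
    have M'v: "M' *v x = M *v x - (w \<bullet> x) *\<^sub>R w" for x
      by (simp add: M'_def matrix_vector_mult_diff_rdistrib)
        (simp add: vec_eq_iff matrix_vector_mult_def inner_vec_def sum_distrib_left sum_distrib_right mult_ac)
    have we: "w \<bullet> x = (e \<bullet> (M *v x)) / sqrt a" for x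
      using sym[of x e] by (simp add: w_def inner_commute)
    have "\<exists>v :: 'd \<Rightarrow> real^'d. M' = (\<chi> r s. \<Sum>i\<in>I. v i $ r * v i $ s)"
    proof (rule insert.IH)
      show "transpose M' = M'"
        using insert.prems(1) by (simp add: M'_def transpose_def vec_eq_iff mult.commute)
      show "0 \<le> x \<bullet> (M' *v x)" for x
      proof -
        define c where "c = (e \<bullet> (M *v x)) / a"
        have ex: "e \<bullet> (M *v x) = c * a" using a by (simp add: c_def)
        have "0 \<le> (x - c *\<^sub>R e) \<bullet> (M *v (x - c *\<^sub>R e))" by (rule insert.prems)
        also have "\<dots> = x \<bullet> (M *v x) - c * c * a"
          using sym[of x e] ex a_def[symmetric]
          by (simp add: matrix_vector_mult_diff_distrib matrix_vector_mult_scaleR inner_diff_left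
              inner_diff_right algebra_simps)
        also have "\<dots> = x \<bullet> (M' *v x)"
        proof -
          have "(w \<bullet> x) * (x \<bullet> w) = c * c * a"
            using a unfolding inner_commute[of x w] we ex by (simp add: field_simps)
          then show ?thesis by (simp add: M'v inner_diff_right)
        qed
        finally show ?thesis .
      qed
      show "M' *v axis i 1 = 0" if "i \<notin> I" for i
      proof (cases "i = k")
        case True
        have "(w \<bullet> e) *\<^sub>R w = M *v e"
          using a by (simp add: we a_def[symmetric] real_div_sqrt) (simp add: w_def)
        then show ?thesis using True by (simp add: M'v e_def)
      next
        case False
        with that insert.prems(3)[of i] have "M *v axis i 1 = 0" by simp
        then show ?thesis by (simp add: M'v we)
      qed
    qed
    then obtain v :: "'d \<Rightarrow> real^'d" where v: "M' = (\<chi> r s. \<Sum>i\<in>I. v i $ r * v i $ s)" ..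
    have "M = (\<chi> r s. \<Sum>i\<in>insert k I. (v(k := w)) i $ r * (v(k := w)) i $ s)"
    proof -
      have "(\<Sum>i\<in>insert k I. (v(k := w)) i $ r * (v(k := w)) i $ s) = w $ r * w $ s + (\<Sum>i\<in>I. v i $ r * v i $ s)" for r s
        using insert.hyps by (simp add: sum.insert) (rule sum.cong, auto)
      moreover have "M = (\<chi> r s. w $ r * w $ s) + M'" by (simp add: M'_def)
      ultimately show ?thesis by (simp add: v vec_eq_iff)
    qed
    then show ?thesis by blast
  qed
qed

text \<open>Makes the choice in \<open>gaussian\<close> a genuine factorisation; the vectors of the
  decomposition are the columns of the root.\<close>

lemma real_psd_sqrt_exists:
  fixes D :: "real^'d^'d"
  assumes "transpose D = D" "\<And>u. 0 \<le> u \<bullet> (D *v u)"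
  shows "\<exists>B :: real^'d^'d. B ** transpose B = D"
proof -
  obtain v :: "'d \<Rightarrow> real^'d" where "D = (\<chi> r s. \<Sum>i\<in>UNIV. v i $ r * v i $ s)"
    using real_psd_decomposition[OF finite assms, of UNIV] by auto
  then show ?thesis
    by (intro exI[of _ "\<chi> r i. v i $ r"]) (simp add: matrix_matrix_mult_def transpose_def)
qed

lemma measurable_affine [measurable]: "(\<lambda>x. m + (B :: real^'d^'d) *v x) \<in> borel_measurable borel"
  by (intro borel_measurable_continuous_onI continuous_intros)

lemma measurable_affine_std_gaussian [simp]:
  "(\<lambda>x. m + (B :: real^'d^'d) *v x) \<in> borel_measurable std_gaussian"
  "(*v) (B :: real^'d^'d) \<in> borel_measurable std_gaussian"
  using measurable_affine[of m B] measurable_affine[of 0 B]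
  by (simp_all add: measurable_cong_sets[OF sets_std_gaussian refl])

lemma sets_gaussian [measurable_cong, simp]: "sets (gaussian m D) = sets borel"
  and space_gaussian [simp]: "space (gaussian m D) = UNIV"
  by (simp_all add: gaussian_def)

lemma prob_space_gaussian: "prob_space (gaussian m D)"
  unfolding gaussian_def by (rule prob_space.prob_space_distr[OF prob_space_std_gaussian]) simp

lemma integral_gaussian_shift:
  fixes f :: "real^'d \<Rightarrow> real"
  assumes [measurable]: "f \<in> borel_measurable borel"
  shows "(\<integral>x. f x \<partial>gaussian m D) = (\<integral>x. f (m + x) \<partial>gaussian 0 D)"
  unfolding gaussian_def by (simp add: integral_distr)

lemma gaussian_char:
  fixes D :: "real^'d^'d"
  assumes D: "transpose D = D" "\<And>u. 0 \<le> u \<bullet> (D *v u)"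
  shows "(CLINT x|gaussian 0 D. iexp (u \<bullet> x)) = of_real (exp (- (u \<bullet> (D *v u)) / 2))"
proof -
  define B :: "real^'d^'d" where "B = (SOME B. B ** transpose B = D)"
  have B: "B ** transpose B = D" unfolding B_def by (rule someI_ex[OF real_psd_sqrt_exists[OF D]])
  have "(CLINT x|gaussian 0 D. iexp (u \<bullet> x)) = (CLINT x|std_gaussian. iexp (u \<bullet> (0 + B *v x)))"
    unfolding gaussian_def B_def[symmetric] by (rule integral_distr) auto
  also have "\<dots> = (CLINT x|std_gaussian. iexp ((u v* B) \<bullet> x))" by (simp add: dot_lmul_matrix)
  also have "\<dots> = of_real (exp (- (norm (u v* B))\<^sup>2 / 2))" by (rule std_gaussian_char)
  also have "(norm (u v* B))\<^sup>2 = u \<bullet> (D *v u)"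
  proof -
    have "(norm (u v* B))\<^sup>2 = (u v* B) \<bullet> (transpose B *v u)"
      by (simp add: power2_norm_eq_inner transpose_matrix_vector)
    also have "\<dots> = u \<bullet> (B *v (transpose B *v u))" by (rule dot_lmul_matrix)
    finally show ?thesis by (simp only: matrix_vector_mul_assoc B)
  qed
  finally show ?thesis .
qed

section \<open>Gaussian smoothing\<close>

text \<open>The smoothed function is an integral of plane waves because the Gaussian density is, up to
  scaling, its own Fourier transform.\<close>

definition smooth :: "real \<Rightarrow> (real^'d \<Rightarrow> real) \<Rightarrow> real^'d \<Rightarrow> real" where
  "smooth \<delta> g x = (\<integral>z. g (x + \<delta> *\<^sub>R z) \<partial>std_gaussian)"

lemma bounded_integrable:
  fixes f :: "'a \<Rightarrow> 'b::{banach, second_countable_topology}"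
  assumes "finite_measure M" "f \<in> borel_measurable M" "\<And>x. norm (f x) \<le> B"
  shows "integrable M f"
  using assms by (intro finite_measure.integrable_const_bound[where B = B]) auto

lemma finite_measure_std_gaussian: "finite_measure std_gaussian"
  by (rule prob_space.finite_measure[OF prob_space_std_gaussian])

lemma smooth_integrand:
  fixes g :: "real^'d \<Rightarrow> real"
  assumes [measurable]: "g \<in> borel_measurable borel" and "\<And>x. \<bar>g x\<bar> \<le> B"
  shows "integrable std_gaussian (\<lambda>z. g (x + \<delta> *\<^sub>R z))"
  using assms(2) by (intro bounded_integrable[where B = B] finite_measure_std_gaussian) auto

lemma measurable_smooth:
  fixes g :: "real^'d \<Rightarrow> real"
  assumes [measurable]: "g \<in> borel_measurable borel"
  shows "smooth \<delta> g \<in> borel_measurable borel"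
proof -
  interpret prob_space "std_gaussian :: (real^'d) measure" by (rule prob_space_std_gaussian)
  show ?thesis unfolding smooth_def[abs_def] by measurable
qed

lemma smooth_add:
  assumes "g \<in> borel_measurable borel" "\<And>x. \<bar>g x\<bar> \<le> B" "h \<in> borel_measurable borel" "\<And>x. \<bar>h x\<bar> \<le> C"
  shows "smooth \<delta> (\<lambda>x. g x + h x) x = smooth \<delta> g x + smooth \<delta> h x"
  unfolding smooth_def
  by (intro Bochner_Integration.integral_add smooth_integrand[OF assms(1,2)] smooth_integrand[OF assms(3,4)])

lemma smooth_mono:
  assumes "g \<in> borel_measurable borel" "\<And>x. \<bar>g x\<bar> \<le> B" "h \<in> borel_measurable borel" "\<And>x. \<bar>h x\<bar> \<le> C"
    and "\<And>x. g x \<le> h x"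
  shows "smooth \<delta> g x \<le> smooth \<delta> h x"
  unfolding smooth_def
  by (intro integral_mono smooth_integrand[OF assms(1,2)] smooth_integrand[OF assms(3,4)] assms(5))

lemma smooth_const: "smooth \<delta> (\<lambda>_. c) x = c"
proof -
  interpret prob_space "std_gaussian :: (real^'d) measure" by (rule prob_space_std_gaussian)
  show ?thesis by (simp add: smooth_def prob_space[unfolded space_std_gaussian])
qed

lemma smooth_abs_le:
  assumes "g \<in> borel_measurable borel" "\<And>x. \<bar>g x\<bar> \<le> B"
  shows "\<bar>smooth \<delta> g x\<bar> \<le> B"
proof -
  have "smooth \<delta> g x \<le> smooth \<delta> (\<lambda>_. B) x"
    by (rule smooth_mono[OF assms, of "\<lambda>_. B" "\<bar>B\<bar>"]) (use assms(2) in \<open>auto simp: abs_le_iff smooth_const\<close>)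
  moreover have "smooth \<delta> (\<lambda>_. - B) x \<le> smooth \<delta> g x"
    by (rule smooth_mono[OF _ _ assms, of "\<lambda>_. - B" "\<bar>B\<bar>"]) (use assms(2) in \<open>auto simp: abs_le_iff minus_le_iff smooth_const\<close>)
  ultimately show ?thesis by (simp add: abs_le_iff smooth_const)
qed

text \<open>A bound for the change of a test function under smoothing, combining its Lipschitz
  estimate with the trivial oscillation bound 2. The truncation keeps the integrand bounded, so
  dominated convergence applies directly.\<close>

definition smoothing_error :: "'d::finite itself \<Rightarrow> real \<Rightarrow> real" where
  "smoothing_error _ \<delta> = (\<integral>z. min 2 (\<delta> * norm z) \<partial>(std_gaussian :: (real^'d) measure))"

lemma smooth_error:
  fixes f :: "real^'d \<Rightarrow> real"
  assumes f: "\<And>x. \<bar>f x\<bar> \<le> 1" "\<And>x y. \<bar>f x - f y\<bar> \<le> norm (x - y)" and m: "f \<in> borel_measurable borel" and \<delta>: "\<delta> \<ge> 0"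
  shows "\<bar>f x - smooth \<delta> f x\<bar> \<le> smoothing_error TYPE('d) \<delta>"
proof -
  interpret prob_space "std_gaussian :: (real^'d) measure" by (rule prob_space_std_gaussian)
  have "\<bar>f x - smooth \<delta> f x\<bar> = \<bar>\<integral>z. f x - f (x + \<delta> *\<^sub>R z) \<partial>std_gaussian\<bar>"
    unfolding smooth_def using smooth_integrand[OF m f(1)] by (simp add: prob_space[unfolded space_std_gaussian])
  also have "\<dots> \<le> (\<integral>z. \<bar>f x - f (x + \<delta> *\<^sub>R z)\<bar> \<partial>std_gaussian)" by (rule integral_abs_bound)
  also have "\<dots> \<le> smoothing_error TYPE('d) \<delta>"
    unfolding smoothing_error_def
  proof (rule integral_mono)
    show "integrable std_gaussian (\<lambda>z. \<bar>f x - f (x + \<delta> *\<^sub>R z)\<bar>)"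
      using smooth_integrand[OF m f(1)] by (intro Bochner_Integration.integrable_abs Bochner_Integration.integrable_diff integrable_const)
    show "integrable std_gaussian (\<lambda>z :: real^'d. min 2 (\<delta> * norm z))"
      using \<delta> by (intro bounded_integrable[where B = 2] finite_measure_std_gaussian) (auto simp: abs_of_nonneg)
    fix z
    have "\<bar>f x - f (x + \<delta> *\<^sub>R z)\<bar> \<le> \<delta> * norm z" using f(2)[of x "x + \<delta> *\<^sub>R z"] \<delta> by simp
    moreover have "\<bar>f x - f (x + \<delta> *\<^sub>R z)\<bar> \<le> 2" using f(1)[of x] f(1)[of "x + \<delta> *\<^sub>R z"] by linarith
    ultimately show "\<bar>f x - f (x + \<delta> *\<^sub>R z)\<bar> \<le> min 2 (\<delta> * norm z)" by simp
  qed
  finally show ?thesis .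
qed

lemma smoothing_error_lim: "(\<lambda>k. smoothing_error TYPE('d::finite) (1 / real (Suc k))) \<longlonglongrightarrow> 0"
proof -
  have "(\<lambda>k. \<integral>z. min 2 (1 / real (Suc k) * norm z) \<partial>(std_gaussian :: (real^'d) measure))
      \<longlonglongrightarrow> (\<integral>z. 0 \<partial>(std_gaussian :: (real^'d) measure))"
  proof (rule integral_dominated_convergence[where w = "\<lambda>_. 2"])
    show "integrable std_gaussian (\<lambda>_ :: real^'d. 2 :: real)"
      by (rule finite_measure.integrable_const[OF finite_measure_std_gaussian])
    have "(\<lambda>k. min 2 (1 / real (Suc k) * norm z)) \<longlonglongrightarrow> min 2 (0 * norm z)" for z :: "real^'d"
      by (intro tendsto_intros LIMSEQ_Suc[OF lim_1_over_n])
    then show "AE z in (std_gaussian :: (real^'d) measure). (\<lambda>k. min 2 (1 / real (Suc k) * norm z)) \<longlonglongrightarrow> 0"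
      by simp
    show "AE z in (std_gaussian :: (real^'d) measure). norm (min 2 (1 / real (Suc k) * norm z)) \<le> 2" for k
      by (intro AE_I2) (simp add: abs_of_nonneg)
  qed auto
  then show ?thesis by (simp add: smoothing_error_def)
qed

lemma smooth_kernel:
  fixes g :: "real^'d \<Rightarrow> real"
  assumes [measurable]: "g \<in> borel_measurable borel" and \<delta>: "\<delta> > 0"
  shows "smooth \<delta> g x = (1 / (\<delta> * sqrt (2 * pi))) ^ CARD('d)
    * (\<integral>z. g z * exp (- (norm (z - x))\<^sup>2 / (2 * \<delta>\<^sup>2)) \<partial>lborel)"
proof -
  define \<phi> where "\<phi> y = (\<Prod>b\<in>(Basis :: (real^'d) set). std_normal_density (y \<bullet> b))" for y
  have \<phi>: "\<phi> y = (1 / sqrt (2 * pi)) ^ CARD('d) * exp (- (norm y)\<^sup>2 / 2)" for y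
    unfolding \<phi>_def std_normal_density_def prod.distrib exp_sum[OF finite_Basis, symmetric] norm_sq_Basis
    by (simp add: sum_negf flip: sum_divide_distrib)
  have m\<phi>[measurable]: "\<phi> \<in> borel_measurable borel" unfolding \<phi>_def by measurable
  have "smooth \<delta> g x = (\<integral>y. \<phi> y * g (x + \<delta> *\<^sub>R y) \<partial>lborel)"
    unfolding smooth_def std_gaussian_density \<phi>_def[symmetric]
    by (subst integral_density) (auto simp: \<phi>_def intro!: prod_nonneg)
  also have "\<dots> = (\<integral>y. \<phi> ((1/\<delta>) *\<^sub>R ((x + \<delta> *\<^sub>R y) - x)) * g (x + \<delta> *\<^sub>R y) \<partial>lborel)"
    using \<delta> by simp
  also have "\<dots> = (\<integral>z. \<phi> ((1/\<delta>) *\<^sub>R (z - x)) * g z \<partial>distr lborel borel (\<lambda>y. x + \<delta> *\<^sub>R y))"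
    by (subst integral_distr) auto
  \<comment> \<open>Lebesgue measure is represented as a rescaled image of itself under the affine
    map; the Jacobian is introduced as a constant density and compensated in front.\<close>
  also have "\<dots> = (1 / \<delta> ^ CARD('d)) * (\<integral>z. \<phi> ((1/\<delta>) *\<^sub>R (z - x)) * g z
      \<partial>density (distr lborel borel (\<lambda>y. x + \<delta> *\<^sub>R y)) (\<lambda>_. \<bar>\<delta>\<bar> ^ DIM(real^'d)))"
    using \<delta> by (subst integral_density) (auto simp: ennreal_power)
  also have "density (distr lborel borel (\<lambda>y. x + \<delta> *\<^sub>R y)) (\<lambda>_. \<bar>\<delta>\<bar> ^ DIM(real^'d)) = lborel"
    using lborel_affine[of \<delta> x] \<delta> by simp
  also have "(\<integral>z. \<phi> ((1/\<delta>) *\<^sub>R (z - x)) * g z \<partial>lborel)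
      = (1 / sqrt (2 * pi)) ^ CARD('d) * (\<integral>z. g z * exp (- (norm (z - x))\<^sup>2 / (2 * \<delta>\<^sup>2)) \<partial>lborel)"
    unfolding \<phi> by (subst integral_mult_right_zero[symmetric])
      (simp add: power_divide mult_ac)
  finally show ?thesis using \<delta> by (simp add: power_mult_distrib power_divide)
qed

text \<open>The kernel is the characteristic function of the standard Gaussian at
  \<open>(z - x)/\<delta>\<close>. After Fubini the measure \<open>P\<close> occurs only through its
  own characteristic function.\<close>

lemma gaussian_kernel_char:
  fixes P :: "(real^'d) measure"
  assumes P: "finite_measure P" "sets P = sets borel" and \<delta>: "\<delta> > 0"
  shows "complex_of_real (\<integral>x. exp (- (norm (z - x))\<^sup>2 / (2 * \<delta>\<^sup>2)) \<partial>P)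
    = (CLINT w|std_gaussian. iexp (z \<bullet> ((1/\<delta>) *\<^sub>R w)) * (CLINT x|P. iexp ((- (1/\<delta>) *\<^sub>R w) \<bullet> x)))"
proof -
  note [measurable_cong] = P(2)
  interpret G: prob_space "std_gaussian :: (real^'d) measure" by (rule prob_space_std_gaussian)
  interpret P: finite_measure P by (rule P)
  interpret pair_sigma_finite P "std_gaussian :: (real^'d) measure" ..
  have spP: "space P = UNIV" using sets_eq_imp_space_eq[OF P(2)] by simp
  have int: "integrable (P \<Otimes>\<^sub>M std_gaussian) (\<lambda>(x, w). iexp (((1/\<delta>) *\<^sub>R (z - x)) \<bullet> w))"
  proof (rule bounded_integrable[where B = 1])
    show "finite_measure (P \<Otimes>\<^sub>M (std_gaussian :: (real^'d) measure))"
      by (intro finite_measure_pair_measure P finite_measure_std_gaussian)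
  qed (auto simp: split_beta')
  have "complex_of_real (\<integral>x. exp (- (norm (z - x))\<^sup>2 / (2 * \<delta>\<^sup>2)) \<partial>P)
      = (CLINT x|P. of_real (exp (- (norm ((1/\<delta>) *\<^sub>R (z - x)))\<^sup>2 / 2)))"
    using \<delta> by (simp add: power_divide power_mult_distrib mult.commute flip: integral_complex_of_real)
  also have "\<dots> = (CLINT x|P. CLINT w|std_gaussian. iexp (((1/\<delta>) *\<^sub>R (z - x)) \<bullet> w))"
    unfolding std_gaussian_char ..
  also have "\<dots> = (CLINT w|std_gaussian. CLINT x|P. iexp (((1/\<delta>) *\<^sub>R (z - x)) \<bullet> w))"
    by (rule Fubini_integral[OF int, symmetric])
  also have "\<dots> = (CLINT w|std_gaussian. iexp (z \<bullet> ((1/\<delta>) *\<^sub>R w)) * (CLINT x|P. iexp ((- (1/\<delta>) *\<^sub>R w) \<bullet> x)))"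
  proof (intro Bochner_Integration.integral_cong refl)
    fix w :: "real^'d"
    have "iexp (((1/\<delta>) *\<^sub>R (z - x)) \<bullet> w) = iexp (z \<bullet> ((1/\<delta>) *\<^sub>R w)) * iexp ((- (1/\<delta>) *\<^sub>R w) \<bullet> x)" for x
      unfolding exp_add[symmetric]
      by (rule arg_cong[of _ _ exp]) (simp add: inner_diff_left inner_commute[of w x] algebra_simps)
    then show "(CLINT x|P. iexp (((1/\<delta>) *\<^sub>R (z - x)) \<bullet> w))
        = iexp (z \<bullet> ((1/\<delta>) *\<^sub>R w)) * (CLINT x|P. iexp ((- (1/\<delta>) *\<^sub>R w) \<bullet> x))"
      by simp
  qed
  finally show ?thesis .
qed

section \<open>Convergence in the Fortet--Mourier distance\<close>

text \<open>The distance of the characteristic functions in L1 of a Gaussian of scale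
  \<open>1/\<delta>\<close>. No test function and no point \<open>z\<close> occurs in it, which is
  the source of uniformity.\<close>

definition char_gap :: "real \<Rightarrow> (real^'d) measure \<Rightarrow> (real^'d) measure \<Rightarrow> real" where
  "char_gap \<delta> P Q = (\<integral>w. cmod ((CLINT x|P. iexp ((- (1/\<delta>) *\<^sub>R w) \<bullet> x))
    - (CLINT x|Q. iexp ((- (1/\<delta>) *\<^sub>R w) \<bullet> x))) \<partial>std_gaussian)"

lemma measurable_char:
  fixes P :: "(real^'d) measure"
  assumes P: "finite_measure P" "sets P = sets borel"
  shows "(\<lambda>w. CLINT x|P. iexp ((c *\<^sub>R w) \<bullet> x)) \<in> borel_measurable borel"
proof -
  note [measurable_cong] = P(2)
  interpret finite_measure P by (rule P)
  show ?thesis by measurable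
qed

lemma char_norm_le:
  fixes P :: "(real^'d) measure"
  assumes P: "finite_measure P" "sets P = sets borel" "measure P UNIV = a"
  shows "cmod (CLINT x|P. iexp (u \<bullet> x)) \<le> a"
proof -
  have "cmod (CLINT x|P. iexp (u \<bullet> x)) \<le> (\<integral>x. cmod (iexp (u \<bullet> x)) \<partial>P)" by (rule integral_norm_bound)
  also have "\<dots> = a" using P(3) sets_eq_imp_space_eq[OF P(2)] by simp
  finally show ?thesis .
qed

lemma gaussian_kernel_gap:
  fixes P Q :: "(real^'d) measure"
  assumes P: "finite_measure P" "sets P = sets borel" and Q: "finite_measure Q" "sets Q = sets borel" and \<delta>: "\<delta> > 0"
  shows "\<bar>(\<integral>x. exp (- (norm (z - x))\<^sup>2 / (2 * \<delta>\<^sup>2)) \<partial>P) - (\<integral>x. exp (- (norm (z - x))\<^sup>2 / (2 * \<delta>\<^sup>2)) \<partial>Q)\<bar>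
    \<le> char_gap \<delta> P Q"
proof -
  define f where "f M w = (CLINT x|M. iexp ((- (1/\<delta>) *\<^sub>R w) \<bullet> x))" for M and w :: "real^'d"
  define h where "h w = iexp (z \<bullet> ((1/\<delta>) *\<^sub>R w))" for w
  have int: "integrable std_gaussian (\<lambda>w. h w * f M w)" if M: "finite_measure M" "sets M = sets borel" for M
  proof (rule bounded_integrable[OF finite_measure_std_gaussian, where B = "measure M UNIV"])
    have [measurable]: "f M \<in> borel_measurable borel" unfolding f_def[abs_def] by (rule measurable_char[OF M])
    show "(\<lambda>w. h w * f M w) \<in> borel_measurable std_gaussian" unfolding h_def by measurable
    show "norm (h w * f M w) \<le> measure M UNIV" for w
    proof -
      have "cmod (h w) = 1" unfolding h_def by (rule norm_exp_i_times)
      moreover have "cmod (f M w) \<le> measure M UNIV" unfolding f_def by (rule char_norm_le[OF M refl])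
      ultimately show ?thesis by (simp only: norm_mult mult_1)
    qed
  qed
  have "\<bar>(\<integral>x. exp (- (norm (z - x))\<^sup>2 / (2 * \<delta>\<^sup>2)) \<partial>P) - (\<integral>x. exp (- (norm (z - x))\<^sup>2 / (2 * \<delta>\<^sup>2)) \<partial>Q)\<bar>
      = cmod (complex_of_real (\<integral>x. exp (- (norm (z - x))\<^sup>2 / (2 * \<delta>\<^sup>2)) \<partial>P)
        - complex_of_real (\<integral>x. exp (- (norm (z - x))\<^sup>2 / (2 * \<delta>\<^sup>2)) \<partial>Q))"
    by (simp only: of_real_diff[symmetric] norm_of_real real_norm_def)
  also have "\<dots> = cmod (CLINT w|std_gaussian. h w * f P w - h w * f Q w)"
    unfolding gaussian_kernel_char[OF P \<delta>] gaussian_kernel_char[OF Q \<delta>]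
    using int[OF P] int[OF Q] by (simp add: h_def f_def)
  also have "\<dots> \<le> (\<integral>w. cmod (h w * f P w - h w * f Q w) \<partial>std_gaussian)" by (rule integral_norm_bound)
  also have "(\<lambda>w. cmod (h w * f P w - h w * f Q w)) = (\<lambda>w. cmod (f P w - f Q w))"
    by (simp add: h_def norm_mult flip: right_diff_distrib)
  finally show ?thesis by (simp add: char_gap_def f_def)
qed

lemma smooth_integral_kernel:
  fixes P :: "(real^'d) measure" and g :: "real^'d \<Rightarrow> real"
  assumes P: "finite_measure P" "sets P = sets borel" and g: "integrable lborel g" and \<delta>: "\<delta> > 0"
  shows "(\<integral>x. smooth \<delta> g x \<partial>P) = (1 / (\<delta> * sqrt (2 * pi))) ^ CARD('d)
    * (\<integral>z. g z * (\<integral>x. exp (- (norm (z - x))\<^sup>2 / (2 * \<delta>\<^sup>2)) \<partial>P) \<partial>lborel)"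
    and "integrable lborel (\<lambda>z. g z * (\<integral>x. exp (- (norm (z - x))\<^sup>2 / (2 * \<delta>\<^sup>2)) \<partial>P))"
proof -
  note [measurable_cong] = P(2)
  interpret P: finite_measure P by (rule P)
  interpret pair_sigma_finite P "lborel :: (real^'d) measure" ..
  have [measurable]: "g \<in> borel_measurable borel" using borel_measurable_integrable[OF g] by simp
  have one: "integrable lborel (\<lambda>z. g z * exp (- (norm (z - x))\<^sup>2 / (2 * \<delta>\<^sup>2)))" for x
    by (rule Bochner_Integration.integrable_bound[OF g]) (auto simp: abs_mult mult_left_le)
  have int: "integrable (P \<Otimes>\<^sub>M lborel) (\<lambda>(x, z). g z * exp (- (norm (z - x))\<^sup>2 / (2 * \<delta>\<^sup>2)))"
  proof (rule Fubini_integrable)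
    show "integrable P (\<lambda>x. \<integral>z. norm (case (x, z) of (x, z) \<Rightarrow> g z * exp (- (norm (z - x))\<^sup>2 / (2 * \<delta>\<^sup>2))) \<partial>lborel)"
    proof (rule bounded_integrable[OF P(1), where B = "\<integral>z. \<bar>g z\<bar> \<partial>lborel"])
      fix x
      have "(\<integral>z. \<bar>g z * exp (- (norm (z - x))\<^sup>2 / (2 * \<delta>\<^sup>2))\<bar> \<partial>lborel) \<le> (\<integral>z. \<bar>g z\<bar> \<partial>lborel)"
      proof (rule integral_mono)
        show "integrable lborel (\<lambda>z. \<bar>g z * exp (- (norm (z - x))\<^sup>2 / (2 * \<delta>\<^sup>2))\<bar>)"
          by (rule Bochner_Integration.integrable_abs[OF one])
      qed (use g in \<open>auto simp: abs_mult mult_left_le\<close>)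
      then show "norm (\<integral>z. norm (case (x, z) of (x, z) \<Rightarrow> g z * exp (- (norm (z - x))\<^sup>2 / (2 * \<delta>\<^sup>2))) \<partial>lborel)
          \<le> (\<integral>z. \<bar>g z\<bar> \<partial>lborel)" by simp
    qed measurable
  qed (use one in auto)
  have "(\<integral>x. smooth \<delta> g x \<partial>P) = (1 / (\<delta> * sqrt (2 * pi))) ^ CARD('d)
      * (\<integral>x. (\<integral>z. g z * exp (- (norm (z - x))\<^sup>2 / (2 * \<delta>\<^sup>2)) \<partial>lborel) \<partial>P)"
    using \<delta> by (simp add: smooth_kernel)
  also have "(\<integral>x. (\<integral>z. g z * exp (- (norm (z - x))\<^sup>2 / (2 * \<delta>\<^sup>2)) \<partial>lborel) \<partial>P)
      = (\<integral>z. (\<integral>x. g z * exp (- (norm (z - x))\<^sup>2 / (2 * \<delta>\<^sup>2)) \<partial>P) \<partial>lborel)"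
    by (rule Fubini_integral[OF int, symmetric])
  finally show "(\<integral>x. smooth \<delta> g x \<partial>P) = (1 / (\<delta> * sqrt (2 * pi))) ^ CARD('d)
    * (\<integral>z. g z * (\<integral>x. exp (- (norm (z - x))\<^sup>2 / (2 * \<delta>\<^sup>2)) \<partial>P) \<partial>lborel)" by simp
  show "integrable lborel (\<lambda>z. g z * (\<integral>x. exp (- (norm (z - x))\<^sup>2 / (2 * \<delta>\<^sup>2)) \<partial>P))"
    using integrable_snd[OF int] by simp
qed

text \<open>The estimate depends on \<open>g\<close> only through its L1 norm, so it is uniform over
  bounded functions living on a fixed ball.\<close>

lemma smooth_gap:
  fixes P Q :: "(real^'d) measure" and g :: "real^'d \<Rightarrow> real"
  assumes P: "finite_measure P" "sets P = sets borel" and Q: "finite_measure Q" "sets Q = sets borel" and \<delta>: "\<delta> > 0"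
    and g: "integrable lborel g"
  shows "\<bar>(\<integral>x. smooth \<delta> g x \<partial>P) - (\<integral>x. smooth \<delta> g x \<partial>Q)\<bar>
    \<le> (1 / (\<delta> * sqrt (2 * pi))) ^ CARD('d) * ((\<integral>z. \<bar>g z\<bar> \<partial>lborel) * char_gap \<delta> P Q)"
proof -
  define k where "k M z = (\<integral>x. exp (- (norm (z - x))\<^sup>2 / (2 * \<delta>\<^sup>2)) \<partial>M)" for M and z :: "real^'d"
  define c where "c = (1 / (\<delta> * sqrt (2 * pi))) ^ CARD('d)"
  have c: "c \<ge> 0" using \<delta> by (simp add: c_def)
  note iP = smooth_integral_kernel[OF P g \<delta>, folded k_def c_def]
    and iQ = smooth_integral_kernel[OF Q g \<delta>, folded k_def c_def]
  have "(\<integral>x. smooth \<delta> g x \<partial>P) - (\<integral>x. smooth \<delta> g x \<partial>Q) = c * (\<integral>z. g z * k P z - g z * k Q z \<partial>lborel)"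
    unfolding iP(1) iQ(1) using iP(2) iQ(2) by (simp add: right_diff_distrib)
  also have "\<bar>\<dots>\<bar> = c * \<bar>\<integral>z. g z * k P z - g z * k Q z \<partial>lborel\<bar>" using c by (simp add: abs_mult)
  also have "\<dots> \<le> c * (\<integral>z. \<bar>g z\<bar> * char_gap \<delta> P Q \<partial>lborel)"
  proof (intro mult_left_mono c)
    have "\<bar>\<integral>z. g z * k P z - g z * k Q z \<partial>lborel\<bar> \<le> (\<integral>z. \<bar>g z * k P z - g z * k Q z\<bar> \<partial>lborel)"
      by (rule integral_abs_bound)
    also have "\<dots> \<le> (\<integral>z. \<bar>g z\<bar> * char_gap \<delta> P Q \<partial>lborel)"
    proof (rule integral_mono)
      show "integrable lborel (\<lambda>z. \<bar>g z * k P z - g z * k Q z\<bar>)" using iP(2) iQ(2) by auto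
      show "integrable lborel (\<lambda>z. \<bar>g z\<bar> * char_gap \<delta> P Q)" using g by auto
      show "\<bar>g z * k P z - g z * k Q z\<bar> \<le> \<bar>g z\<bar> * char_gap \<delta> P Q" for z
        using gaussian_kernel_gap[OF P Q \<delta>, of z]
        by (simp add: abs_mult mult_left_mono k_def flip: right_diff_distrib)
    qed
    finally show "\<bar>\<integral>z. g z * k P z - g z * k Q z \<partial>lborel\<bar> \<le> (\<integral>z. \<bar>g z\<bar> * char_gap \<delta> P Q \<partial>lborel)" .
  qed
  finally show ?thesis using g by (simp add: c_def)
qed

text \<open>A bounded test function need not be Lebesgue integrable, as \<open>smooth_gap\<close>
  requires; multiplying by a cutoff makes it so, at the price of a tail term.\<close>

definition cutoff :: "real \<Rightarrow> real^'d \<Rightarrow> real" where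
  "cutoff R x = max 0 (min 1 (R + 1 - norm x))"

lemma cutoff_bounds: "0 \<le> cutoff R x" "cutoff R x \<le> 1"
  by (auto simp: cutoff_def)

lemma measurable_cutoff [measurable]: "cutoff R \<in> borel_measurable borel"
  unfolding cutoff_def[abs_def] by measurable

lemma cutoff_mult_integral:
  fixes f :: "real^'d \<Rightarrow> real"
  assumes [measurable]: "f \<in> borel_measurable borel" and f: "\<And>x. \<bar>f x\<bar> \<le> 1"
  shows "integrable lborel (\<lambda>x. f x * cutoff R x)"
    and "(\<integral>x. \<bar>f x * cutoff R x\<bar> \<partial>lborel) \<le> measure lborel (cball (0 :: real^'d) (R + 1))"
proof -
  have ind: "integrable lborel (indicat_real (cball (0 :: real^'d) (R + 1)))"
    by (rule integrable_real_indicator) (simp, rule emeasure_bounded_finite[OF bounded_cball])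
  have le: "\<bar>f x * cutoff R x\<bar> \<le> indicat_real (cball 0 (R + 1)) x" for x
  proof (cases "x \<in> cball 0 (R + 1)")
    case True
    then show ?thesis using mult_mono[OF f cutoff_bounds(2)[of R x]] cutoff_bounds(1)[of R x] by (simp add: abs_mult)
  next
    case False
    then have "cutoff R x = 0" by (simp add: cutoff_def)
    then show ?thesis by simp
  qed
  show int: "integrable lborel (\<lambda>x. f x * cutoff R x)"
    by (rule Bochner_Integration.integrable_bound[OF ind]) (use le in auto)
  have "(\<integral>x. \<bar>f x * cutoff R x\<bar> \<partial>lborel) \<le> (\<integral>x. indicat_real (cball (0 :: real^'d) (R + 1)) x \<partial>lborel)"
    using int ind le by (intro integral_mono) auto
  then show "(\<integral>x. \<bar>f x * cutoff R x\<bar> \<partial>lborel) \<le> measure lborel (cball (0 :: real^'d) (R + 1))" by simp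
qed

lemma cutoff_smooth_lim:
  fixes Q :: "(real^'d) measure"
  assumes Q: "finite_measure Q" "sets Q = sets borel" "measure Q UNIV = a"
  shows "(\<lambda>R. \<integral>x. smooth \<delta> (cutoff (real R)) x \<partial>Q) \<longlonglongrightarrow> a"
proof -
  note [measurable_cong] = Q(2)
  interpret Q: finite_measure Q by (rule Q)
  have spQ: "space Q = UNIV" using sets_eq_imp_space_eq[OF Q(2)] by simp
  have lim1: "(\<lambda>R. cutoff (real R) x) \<longlonglongrightarrow> 1" for x :: "real^'d"
  proof (rule tendsto_eventually)
    obtain N :: nat where "norm x \<le> real N" using real_arch_simple by blast
    then show "\<forall>\<^sub>F R in sequentially. cutoff (real R) x = 1"
      by (intro eventually_mono[OF eventually_ge_at_top[of N]]) (auto simp: cutoff_def max_def min_def)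
  qed
  have ab: "\<bar>cutoff R x\<bar> \<le> 1" for R and x :: "real^'d" using cutoff_bounds[of R x] by (simp add: abs_le_iff)
  have lim2: "(\<lambda>R. smooth \<delta> (cutoff (real R)) x) \<longlonglongrightarrow> 1" for x :: "real^'d"
  proof -
    have "(\<lambda>R. smooth \<delta> (cutoff (real R)) x) \<longlonglongrightarrow> smooth \<delta> (\<lambda>_. 1) x"
      unfolding smooth_def
    proof (rule integral_dominated_convergence[where w = "\<lambda>_. 1"])
      show "integrable std_gaussian (\<lambda>_ :: real^'d. 1 :: real)"
        by (rule finite_measure.integrable_const[OF finite_measure_std_gaussian])
    qed (use lim1 ab in auto)
    then show ?thesis by (simp add: smooth_const)
  qed
  have "(\<lambda>R. \<integral>x. smooth \<delta> (cutoff (real R)) x \<partial>Q) \<longlonglongrightarrow> (\<integral>x. 1 \<partial>Q)"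
  proof (rule integral_dominated_convergence[where w = "\<lambda>_. 1"])
    show "smooth \<delta> (cutoff (real R)) \<in> borel_measurable Q" for R
      by (simp add: measurable_cong_sets[OF Q(2) refl] measurable_smooth)
  qed (use lim2 smooth_abs_le[OF measurable_cutoff ab] in auto)
  then show ?thesis using Q(3) spQ by simp
qed

text \<open>Dominated convergence: characteristic functions of measures of mass \<open>a\<close> are
  bounded by \<open>a\<close>.\<close>

lemma char_gap_lim:
  fixes P :: "nat \<Rightarrow> (real^'d) measure"
  assumes P: "\<And>n. finite_measure (P n)" "\<And>n. sets (P n) = sets borel" "\<And>n. measure (P n) UNIV = a"
    and Q: "finite_measure Q" "sets Q = sets borel" "measure Q UNIV = a"
    and char: "\<And>u. (\<lambda>n. CLINT x|P n. iexp (u \<bullet> x)) \<longlonglongrightarrow> (CLINT x|Q. iexp (u \<bullet> x))"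
  shows "(\<lambda>n. char_gap \<delta> (P n) Q) \<longlonglongrightarrow> 0"
proof -
  have mP[measurable]: "(\<lambda>w. CLINT x|P n. iexp ((c *\<^sub>R w) \<bullet> x)) \<in> borel_measurable borel" for n c
    by (rule measurable_char[OF P(1,2)])
  have mQ[measurable]: "(\<lambda>w. CLINT x|Q. iexp ((c *\<^sub>R w) \<bullet> x)) \<in> borel_measurable borel" for c
    by (rule measurable_char[OF Q(1,2)])
  have "(\<lambda>n. char_gap \<delta> (P n) Q) \<longlonglongrightarrow> (\<integral>w. 0 \<partial>(std_gaussian :: (real^'d) measure))"
    unfolding char_gap_def
  proof (rule integral_dominated_convergence[where w = "\<lambda>_. 2 * a"])
    show "integrable std_gaussian (\<lambda>_ :: real^'d. 2 * a)"
      by (rule finite_measure.integrable_const[OF finite_measure_std_gaussian])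
    show "AE w in (std_gaussian :: (real^'d) measure). (\<lambda>n. cmod ((CLINT x|P n. iexp ((- (1/\<delta>) *\<^sub>R w) \<bullet> x))
      - (CLINT x|Q. iexp ((- (1/\<delta>) *\<^sub>R w) \<bullet> x)))) \<longlonglongrightarrow> 0"
    proof (rule AE_I2)
      fix w :: "real^'d"
      show "(\<lambda>n. cmod ((CLINT x|P n. iexp ((- (1/\<delta>) *\<^sub>R w) \<bullet> x))
          - (CLINT x|Q. iexp ((- (1/\<delta>) *\<^sub>R w) \<bullet> x)))) \<longlonglongrightarrow> 0"
        by (intro tendsto_norm_zero LIM_zero char)
    qed
    show "AE w in (std_gaussian :: (real^'d) measure). norm (cmod ((CLINT x|P n. iexp ((- (1/\<delta>) *\<^sub>R w) \<bullet> x))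
      - (CLINT x|Q. iexp ((- (1/\<delta>) *\<^sub>R w) \<bullet> x)))) \<le> 2 * a" for n
    proof (rule AE_I2)
      fix w :: "real^'d"
      define p q where "p = (CLINT x|P n. iexp ((- (1/\<delta>) *\<^sub>R w) \<bullet> x))" and "q = (CLINT x|Q. iexp ((- (1/\<delta>) *\<^sub>R w) \<bullet> x))"
      have "cmod p \<le> a" "cmod q \<le> a" unfolding p_def q_def by (rule char_norm_le[OF P] char_norm_le[OF Q])+
      then have "norm (cmod (p - q)) \<le> 2 * a" using norm_triangle_ineq4[of p q] by simp
      then show "norm (cmod ((CLINT x|P n. iexp ((- (1/\<delta>) *\<^sub>R w) \<bullet> x))
        - (CLINT x|Q. iexp ((- (1/\<delta>) *\<^sub>R w) \<bullet> x)))) \<le> 2 * a" by (simp add: p_def q_def)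
    qed
    show "(\<lambda>w. cmod ((CLINT x|P n. iexp ((- (1/\<delta>) *\<^sub>R w) \<bullet> x))
      - (CLINT x|Q. iexp ((- (1/\<delta>) *\<^sub>R w) \<bullet> x)))) \<in> borel_measurable std_gaussian" for n
      by (simp only: measurable_cong_sets[OF sets_std_gaussian refl])
        (intro measurable_compose[OF _ borel_measurable_norm] borel_measurable_diff mP mQ)
  qed simp
  then show ?thesis by simp
qed

text \<open>It bounds the supremum and the Lipschitz constant separately, so it contains the unit
  ball of \<open>bl_norm\<close>, which bounds their sum. Like that ball it is translation
  invariant.\<close>

definition bl_ball :: "(real^'d \<Rightarrow> real) set" where
  "bl_ball = {f. (\<forall>x. \<bar>f x\<bar> \<le> 1) \<and> (\<forall>x y. \<bar>f x - f y\<bar> \<le> norm (x - y))}"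

lemma bl_ball_measurable: "f \<in> bl_ball \<Longrightarrow> f \<in> borel_measurable borel"
proof -
  assume f: "f \<in> bl_ball"
  have "1-lipschitz_on UNIV f"
    using f by (intro lipschitz_onI) (auto simp: bl_ball_def dist_norm)
  then show ?thesis
    using lipschitz_on_continuous_on borel_measurable_continuous_onI by blast
qed

text \<open>Replace \<open>f\<close> by its smoothing, then split \<open>f\<close> with a cutoff.
  The compact part is controlled by \<open>smooth_gap\<close> with a constant independent of
  \<open>f\<close>. The tail is dominated by the mass that the smoothed cutoff misses; for
  \<open>P n\<close> this mass is compared with that of \<open>Q\<close> by using the cutoff itself
  as test function, so tightness is derived along the way.\<close>

theorem char_convergence_uniform:
  fixes P :: "nat \<Rightarrow> (real^'d) measure"
  assumes P: "\<And>n. finite_measure (P n)" "\<And>n. sets (P n) = sets borel" "\<And>n. measure (P n) UNIV = a"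
    and Q: "finite_measure Q" "sets Q = sets borel" "measure Q UNIV = a"
    and char: "\<And>u. (\<lambda>n. CLINT x|P n. iexp (u \<bullet> x)) \<longlonglongrightarrow> (CLINT x|Q. iexp (u \<bullet> x))"
    and \<epsilon>: "\<epsilon> > 0"
  shows "\<forall>\<^sub>F n in sequentially. \<forall>f\<in>bl_ball. \<bar>(\<integral>x. f x \<partial>P n) - (\<integral>x. f x \<partial>Q)\<bar> \<le> \<epsilon>"
proof -
  have a0: "a \<ge> 0" using Q(3) measure_nonneg by metis
  \<comment> \<open>One third of the error goes to smoothing under both measures, one third to the
    tails, one third to two copies of the gap.\<close>
  have "(\<lambda>k. 2 * a * smoothing_error TYPE('d) (1 / real (Suc k))) \<longlonglongrightarrow> 2 * a * 0"
    by (intro tendsto_intros smoothing_error_lim)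
  then have "\<forall>\<^sub>F k in sequentially. 2 * a * smoothing_error TYPE('d) (1 / real (Suc k)) < \<epsilon> / 3"
    using \<epsilon> by (intro order_tendstoD) auto
  then obtain k where k: "2 * a * smoothing_error TYPE('d) (1 / real (Suc k)) < \<epsilon> / 3"
    by (auto simp: eventually_sequentially)
  define \<delta> where "\<delta> = 1 / real (Suc k)"
  have \<delta>: "\<delta> > 0" by (simp add: \<delta>_def)
  \<comment> \<open>The missing mass of \<open>Q\<close> is charged twice, once for \<open>Q\<close>
    and once for \<open>P n\<close> after comparison; hence the sixth.\<close>
  have "\<forall>\<^sub>F R in sequentially. a - \<epsilon> / 6 < (\<integral>x. smooth \<delta> (cutoff (real R)) x \<partial>Q)"
    using \<epsilon> by (intro order_tendstoD[OF cutoff_smooth_lim[OF Q]]) auto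
  then obtain R0 :: nat where R0: "a - \<epsilon> / 6 < (\<integral>x. smooth \<delta> (cutoff (real R0)) x \<partial>Q)"
    by (auto simp: eventually_sequentially)
  define R where "R = real R0"
  define c where "c = (1 / (\<delta> * sqrt (2 * pi))) ^ CARD('d) * measure lborel (cball (0 :: real^'d) (R + 1))"
  have c0: "c \<ge> 0" using \<delta> by (simp add: c_def)
  have gap0: "char_gap \<delta> (P n) Q \<ge> 0" for n
    unfolding char_gap_def by (intro Bochner_Integration.integral_nonneg) auto
  have "(\<lambda>n. 2 * c * char_gap \<delta> (P n) Q) \<longlonglongrightarrow> 2 * c * 0"
    by (intro tendsto_intros char_gap_lim[OF P Q char])
  then have ev: "\<forall>\<^sub>F n in sequentially. 2 * c * char_gap \<delta> (P n) Q < \<epsilon> / 3"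
    using \<epsilon> by (intro order_tendstoD) auto
  show ?thesis
  proof (rule eventually_mono[OF ev], intro ballI)
    fix n f assume n: "2 * c * char_gap \<delta> (P n) Q < \<epsilon> / 3" and f: "f \<in> (bl_ball :: (real^'d \<Rightarrow> real) set)"
    have fm[measurable]: "f \<in> borel_measurable borel" by (rule bl_ball_measurable[OF f])
    have f1: "\<bar>f x\<bar> \<le> 1" and f2: "\<bar>f x - f y\<bar> \<le> norm (x - y)" for x y using f by (auto simp: bl_ball_def)
    define h :: "real^'d \<Rightarrow> real" where "h = cutoff R"
    have hm[measurable]: "h \<in> borel_measurable borel" by (simp add: h_def)
    have h: "0 \<le> h x" "h x \<le> 1" for x using cutoff_bounds by (auto simp: h_def)
    define g where "g x = f x * h x" for x
    define g' where "g' x = f x * (1 - h x)" for x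
    have gm[measurable]: "g \<in> borel_measurable borel" "g' \<in> borel_measurable borel"
      unfolding g_def[abs_def] g'_def[abs_def] by measurable
    have g1: "\<bar>g x\<bar> \<le> 1" for x
      using mult_mono[OF f1 h(2)[of x]] h(1)[of x] by (simp add: g_def abs_mult)
    have g'le: "\<bar>g' x\<bar> \<le> 1 - h x" for x
      using mult_mono[OF f1 order_refl, of "1 - h x"] h[of x] by (simp add: g'_def abs_mult)
    have g'1: "\<bar>g' x\<bar> \<le> 1" for x using g'le[of x] h[of x] by linarith
    have h1: "\<bar>h x\<bar> \<le> 1" for x using h[of x] by (simp add: abs_le_iff)
    have int: "integrable M (smooth \<delta> w)"
      if "w \<in> borel_measurable borel" "\<And>x. \<bar>w x\<bar> \<le> 1" "finite_measure M" "sets M = sets borel" for w and M :: "(real^'d) measure"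
      using measurable_smooth[OF that(1)] smooth_abs_le[OF that(1,2)] that(3,4)
      by (intro bounded_integrable[where B = 1]) (auto simp: measurable_cong_sets[OF that(4) refl])
    have intf: "integrable M f" if "finite_measure M" "sets M = sets borel" for M :: "(real^'d) measure"
      using that f1 by (intro bounded_integrable[where B = 1]) (auto simp: measurable_cong_sets[OF that(2) refl])
    have err: "\<bar>(\<integral>x. f x \<partial>M) - (\<integral>x. smooth \<delta> f x \<partial>M)\<bar> \<le> a * smoothing_error TYPE('d) \<delta>"
      if M: "finite_measure M" "sets M = sets borel" "measure M UNIV = a" for M :: "(real^'d) measure"
    proof -
      have sp: "space M = UNIV" using sets_eq_imp_space_eq[OF M(2)] by simp
      have "\<bar>(\<integral>x. f x \<partial>M) - (\<integral>x. smooth \<delta> f x \<partial>M)\<bar> = \<bar>\<integral>x. f x - smooth \<delta> f x \<partial>M\<bar>"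
        using intf[OF M(1,2)] int[OF fm f1 M(1,2)] by simp
      also have "\<dots> \<le> (\<integral>x. \<bar>f x - smooth \<delta> f x\<bar> \<partial>M)" by (rule integral_abs_bound)
      also have "\<dots> \<le> (\<integral>x. smoothing_error TYPE('d) \<delta> \<partial>M)"
        using intf[OF M(1,2)] int[OF fm f1 M(1,2)] smooth_error[OF f1 f2 fm] \<delta> finite_measure.integrable_const[OF M(1)]
        by (intro integral_mono) auto
      finally show ?thesis using M(3) sp by simp
    qed
    have split: "(\<integral>x. smooth \<delta> f x \<partial>M) = (\<integral>x. smooth \<delta> g x \<partial>M) + (\<integral>x. smooth \<delta> g' x \<partial>M)"
      if M: "finite_measure M" "sets M = sets borel" for M :: "(real^'d) measure"
    proof -
      have "f = (\<lambda>x. g x + g' x)" by (simp add: g_def g'_def fun_eq_iff algebra_simps)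
      then have "smooth \<delta> f x = smooth \<delta> g x + smooth \<delta> g' x" for x
        using smooth_add[OF gm(1) g1 gm(2) g'1] by simp
      then show ?thesis using int[OF gm(1) g1 M] int[OF gm(2) g'1 M] by simp
    qed
    have tail: "\<bar>\<integral>x. smooth \<delta> g' x \<partial>M\<bar> \<le> a - (\<integral>x. smooth \<delta> h x \<partial>M)"
      if M: "finite_measure M" "sets M = sets borel" "measure M UNIV = a" for M :: "(real^'d) measure"
    proof -
      have sp: "space M = UNIV" using sets_eq_imp_space_eq[OF M(2)] by simp
      have sh: "smooth \<delta> (\<lambda>x. 1 - h x) x = 1 - smooth \<delta> h x" for x
        using smooth_add[of "\<lambda>x. 1 - h x" 1 h 1 \<delta> x] h h1 smooth_const[of \<delta> 1 x] by simp
      have "\<bar>smooth \<delta> g' x\<bar> \<le> 1 - smooth \<delta> h x" for x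
      proof -
        have "smooth \<delta> g' x \<le> smooth \<delta> (\<lambda>x. 1 - h x) x"
          using g'le h by (intro smooth_mono[OF gm(2) g'1, of _ 1]) (auto simp: abs_le_iff)
        moreover have "smooth \<delta> (\<lambda>x. - g' x) x \<le> smooth \<delta> (\<lambda>x. 1 - h x) x"
          using g'le h g'1 by (intro smooth_mono[of _ 1 _ 1]) (auto simp: abs_le_iff)
        moreover have "smooth \<delta> (\<lambda>x. - g' x) x = - smooth \<delta> g' x" by (simp add: smooth_def)
        ultimately show ?thesis by (simp add: sh abs_le_iff)
      qed
      then have "(\<integral>x. \<bar>smooth \<delta> g' x\<bar> \<partial>M) \<le> (\<integral>x. 1 - smooth \<delta> h x \<partial>M)"
        using int[OF gm(2) g'1 M(1,2)] int[OF hm h1 M(1,2)] finite_measure.integrable_const[OF M(1), of "1 :: real"]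
        by (intro integral_mono Bochner_Integration.integrable_abs Bochner_Integration.integrable_diff) auto
      also have "\<dots> = a - (\<integral>x. smooth \<delta> h x \<partial>M)"
        using int[OF hm h1 M(1,2)] finite_measure.integrable_const[OF M(1), of "1 :: real"] M(3) sp
        by (subst Bochner_Integration.integral_diff) auto
      finally show ?thesis using integral_abs_bound[of M "smooth \<delta> g'"] by linarith
    qed
    have gapc: "\<bar>(\<integral>x. smooth \<delta> w x \<partial>P n) - (\<integral>x. smooth \<delta> w x \<partial>Q)\<bar> \<le> c * char_gap \<delta> (P n) Q"
      if w: "w = (\<lambda>x. v x * cutoff R x)" "v \<in> borel_measurable borel" "\<And>x. \<bar>v x\<bar> \<le> 1" for w v
    proof -
      have "\<bar>(\<integral>x. smooth \<delta> w x \<partial>P n) - (\<integral>x. smooth \<delta> w x \<partial>Q)\<bar>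
          \<le> (1 / (\<delta> * sqrt (2 * pi))) ^ CARD('d) * ((\<integral>z. \<bar>w z\<bar> \<partial>lborel) * char_gap \<delta> (P n) Q)"
        unfolding w(1) by (rule smooth_gap[OF P(1,2) Q(1,2) \<delta> cutoff_mult_integral(1)[OF w(2,3)]])
      also have "\<dots> \<le> (1 / (\<delta> * sqrt (2 * pi))) ^ CARD('d)
          * (measure lborel (cball (0 :: real^'d) (R + 1)) * char_gap \<delta> (P n) Q)"
        unfolding w(1) using \<delta> gap0 by (intro mult_left_mono mult_right_mono cutoff_mult_integral(2)[OF w(2,3)]) auto
      finally show ?thesis by (simp add: c_def)
    qed
    have gg: "\<bar>(\<integral>x. smooth \<delta> g x \<partial>P n) - (\<integral>x. smooth \<delta> g x \<partial>Q)\<bar> \<le> c * char_gap \<delta> (P n) Q"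
      by (rule gapc[OF _ fm f1]) (simp add: g_def[abs_def] h_def)
    have gh: "\<bar>(\<integral>x. smooth \<delta> h x \<partial>P n) - (\<integral>x. smooth \<delta> h x \<partial>Q)\<bar> \<le> c * char_gap \<delta> (P n) Q"
      by (rule gapc[of _ "\<lambda>_. 1"]) (simp_all add: h_def)
    have R0': "a - \<epsilon> / 6 < (\<integral>x. smooth \<delta> h x \<partial>Q)" using R0 by (simp add: h_def R_def)
    show "\<bar>(\<integral>x. f x \<partial>P n) - (\<integral>x. f x \<partial>Q)\<bar> \<le> \<epsilon>"
      using err[OF P, of n] err[OF Q] split[OF P(1,2), of n] split[OF Q(1,2)] tail[OF P, of n] tail[OF Q] gg gh n R0'
        k[folded \<delta>_def] by linarith
  qed
qed

section \<open>Mixtures\<close>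

text \<open>The construction by \<open>measure_of\<close> has the given values only once countable
  additivity is verified.\<close>

lemma mixture_props:
  fixes N :: "'i \<Rightarrow> (real^'d) measure"
  assumes N: "\<And>i. i \<in> I \<Longrightarrow> sets (N i) = sets borel" and I: "finite I"
  shows "sets (mixture I a N) = sets borel"
    and "B \<in> sets borel \<Longrightarrow> emeasure (mixture I a N) B = (\<Sum>i\<in>I. ennreal (a i) * emeasure (N i) B)"
proof -
  show s: "sets (mixture I a N) = sets borel"
    unfolding mixture_def by (simp add: sets.sets_measure_of_eq[of borel, simplified])
  assume B: "B \<in> sets borel"
  show "emeasure (mixture I a N) B = (\<Sum>i\<in>I. ennreal (a i) * emeasure (N i) B)"
  proof (rule emeasure_measure_of[OF mixture_def])
    show "countably_additive (sets (mixture I a N)) (\<lambda>B. \<Sum>i\<in>I. ennreal (a i) * emeasure (N i) B)"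
      unfolding s countably_additive_def
    proof (intro allI impI)
      fix A :: "nat \<Rightarrow> (real^'d) set" assume A: "range A \<subseteq> sets borel" "disjoint_family A" "\<Union>(range A) \<in> sets borel"
      have "(\<Sum>n. \<Sum>i\<in>I. ennreal (a i) * emeasure (N i) (A n)) = (\<Sum>i\<in>I. \<Sum>n. ennreal (a i) * emeasure (N i) (A n))"
        by (rule suminf_sum) auto
      also have "\<dots> = (\<Sum>i\<in>I. ennreal (a i) * emeasure (N i) (\<Union>(range A)))"
        using A N by (intro sum.cong refl) (simp add: suminf_emeasure)
      finally show "(\<Sum>n. \<Sum>i\<in>I. ennreal (a i) * emeasure (N i) (A n))
          = (\<Sum>i\<in>I. ennreal (a i) * emeasure (N i) (\<Union>(range A)))" .
    qed
  qed (use B s in \<open>auto simp: positive_def\<close>)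
qed

lemma integral_mixture:
  fixes f :: "real^'d \<Rightarrow> real"
  assumes N: "\<And>i. i \<in> I \<Longrightarrow> sets (N i) = sets borel" "\<And>i. i \<in> I \<Longrightarrow> prob_space (N i)" and I: "finite I"
    and a: "\<And>i. i \<in> I \<Longrightarrow> a i \<ge> 0" and fm: "f \<in> borel_measurable borel" and f: "\<And>x. \<bar>f x\<bar> \<le> 1"
  shows "(\<integral>x. f x \<partial>mixture I a N) = (\<Sum>i\<in>I. a i * (\<integral>x. f x \<partial>N i))"
proof -
  define M where "M = mixture I a N"
  note e = mixture_props(2)[OF N(1) I]
  have sM: "sets M = sets borel" unfolding M_def by (rule mixture_props(1)[OF N(1) I])
  have spM: "space M = UNIV" using sets_eq_imp_space_eq[OF sM] by simp
  have nn: "(\<integral>\<^sup>+x. g x \<partial>M) = (\<Sum>i\<in>I. ennreal (a i) * (\<integral>\<^sup>+x. g x \<partial>N i))" if "g \<in> borel_measurable borel" for g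
    using that
  proof (induction rule: borel_measurable_induct)
    case (cong f g)
    then have "f = g" by (simp add: fun_eq_iff)
    with cong show ?case by simp
  next
    case (set A)
    then show ?case using sM N(1) by (simp add: M_def e)
  next
    case (mult u c)
    then show ?case
      using sM N(1) by (simp add: nn_integral_cmult measurable_cong_sets[OF sM refl]
          measurable_cong_sets[OF N(1) refl] sum_distrib_left mult_ac cong: sum.cong)
  next
    case (add u v)
    have "(\<integral>\<^sup>+x. v x + u x \<partial>N i) = (\<integral>\<^sup>+x. v x \<partial>N i) + (\<integral>\<^sup>+x. u x \<partial>N i)" if "i \<in> I" for i
      using add that by (intro nn_integral_add) (auto simp: measurable_cong_sets[OF N(1)[OF that] refl])
    then show ?case
      using add by (simp add: nn_integral_add measurable_cong_sets[OF sM refl] distrib_left sum.distrib)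
  next
    case (seq U)
    have mono: "incseq (\<lambda>n. U n)" by fact
    have "(\<integral>\<^sup>+x. (SUP n. U n) x \<partial>K) = (SUP n. \<integral>\<^sup>+x. U n x \<partial>K)" if "sets K = sets borel" for K :: "(real^'d) measure"
      using nn_integral_monotone_convergence_SUP[OF mono, of K] seq(1)
      by (simp add: measurable_cong_sets[OF that refl] image_comp)
    then have "(\<integral>\<^sup>+x. (SUP n. U n) x \<partial>M) = (SUP n. \<Sum>i\<in>I. ennreal (a i) * (\<integral>\<^sup>+x. U n x \<partial>N i))"
      using seq sM by (simp add: image_comp)
    also have "\<dots> = (\<Sum>i\<in>I. SUP n. ennreal (a i) * (\<integral>\<^sup>+x. U n x \<partial>N i))"
      using mono by (intro ennreal_SUP_sum) (auto simp: incseq_def le_fun_def intro!: mult_left_mono nn_integral_mono)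
    also have "\<dots> = (\<Sum>i\<in>I. ennreal (a i) * (\<integral>\<^sup>+x. (SUP n. U n) x \<partial>N i))"
    proof (rule sum.cong[OF refl])
      fix i assume "i \<in> I"
      have "(\<integral>\<^sup>+x. (SUP n. U n) x \<partial>N i) = (SUP n. \<integral>\<^sup>+x. U n x \<partial>N i)"
        using nn_integral_monotone_convergence_SUP[OF mono, of "N i"] seq(1)
        by (simp add: measurable_cong_sets[OF N(1)[OF \<open>i \<in> I\<close>] refl] image_comp)
      then show "(SUP n. ennreal (a i) * (\<integral>\<^sup>+x. U n x \<partial>N i)) = ennreal (a i) * (\<integral>\<^sup>+x. (SUP n. U n) x \<partial>N i)"
        by (simp add: SUP_mult_left_ennreal)
    qed
    finally show ?case by simp
  qed
  have fin: "finite_measure M"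
  proof
    have "emeasure M UNIV = (\<Sum>i\<in>I. ennreal (a i) * emeasure (N i) UNIV)" by (simp add: M_def e)
    also have "\<dots> \<noteq> \<infinity>"
      using I N by (auto simp: ennreal_mult_eq_top_iff finite_measure.emeasure_finite prob_space.finite_measure)
    finally show "emeasure M (space M) \<noteq> \<infinity>" by (simp add: spM)
  qed
  have key: "(\<integral>x. g x \<partial>M) = (\<Sum>i\<in>I. a i * (\<integral>x. g x \<partial>N i))"
    if g: "g \<in> borel_measurable borel" "\<And>x. 0 \<le> g x" "\<And>x. g x \<le> 2" for g :: "real^'d \<Rightarrow> real"
  proof -
    have gi: "integrable K g" if "finite_measure K" "sets K = sets borel" for K
      using g that by (intro bounded_integrable[where B = 2]) (auto simp: measurable_cong_sets[OF that(2) refl])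
    have giN: "integrable (N i) g" if "i \<in> I" for i using gi N that prob_space.finite_measure by blast
    have "ennreal (\<integral>x. g x \<partial>M) = (\<integral>\<^sup>+x. ennreal (g x) \<partial>M)"
      using gi[OF fin sM] g by (simp add: nn_integral_eq_integral)
    also have "\<dots> = (\<Sum>i\<in>I. ennreal (a i) * (\<integral>\<^sup>+x. ennreal (g x) \<partial>N i))"
      using g(1) by (intro nn) auto
    also have "\<dots> = (\<Sum>i\<in>I. ennreal (a i * (\<integral>x. g x \<partial>N i)))"
      using giN g a by (intro sum.cong refl) (simp add: nn_integral_eq_integral ennreal_mult)
    also have "\<dots> = ennreal (\<Sum>i\<in>I. a i * (\<integral>x. g x \<partial>N i))"
      using a g by (intro sum_ennreal) auto
    finally show ?thesis
      using a g by (subst (asm) ennreal_inj) (auto intro!: sum_nonneg Bochner_Integration.integral_nonneg)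
  qed
  have fi: "integrable K f" if "finite_measure K" "sets K = sets borel" for K
    using fm f that by (intro bounded_integrable[where B = 1]) (auto simp: measurable_cong_sets[OF that(2) refl])
  \<comment> \<open>Adding 1 makes \<open>f\<close> nonnegative and brings it into the range of
    \<open>key\<close>; the constant is then integrated separately.\<close>
  have f2: "0 \<le> f x + 1" "f x + 1 \<le> 2" for x using f[of x] by (auto simp: abs_le_iff)
  have "(\<integral>x. f x + 1 \<partial>M) = (\<Sum>i\<in>I. a i * (\<integral>x. f x + 1 \<partial>N i))"
    using fm f2 by (intro key) auto
  moreover have "(\<integral>x. (1 :: real) \<partial>M) = (\<Sum>i\<in>I. a i * (\<integral>x. 1 \<partial>N i))" by (intro key) auto
  moreover have "(\<integral>x. f x + 1 \<partial>M) = (\<integral>x. f x \<partial>M) + (\<integral>x. 1 \<partial>M)"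
    using fi[OF fin sM] finite_measure.integrable_const[OF fin] by (intro Bochner_Integration.integral_add) auto
  moreover have "(\<Sum>i\<in>I. a i * (\<integral>x. f x + 1 \<partial>N i)) = (\<Sum>i\<in>I. a i * (\<integral>x. f x \<partial>N i)) + (\<Sum>i\<in>I. a i * (\<integral>x. 1 \<partial>N i))"
  proof -
    have "(\<integral>x. f x + 1 \<partial>N i) = (\<integral>x. f x \<partial>N i) + (\<integral>x. 1 \<partial>N i)" if "i \<in> I" for i
      using fi[OF prob_space.finite_measure[OF N(2)[OF that]] N(1)[OF that]]
        finite_measure.integrable_const[OF prob_space.finite_measure[OF N(2)[OF that]]]
      by (intro Bochner_Integration.integral_add) auto
    then show ?thesis by (simp add: distrib_left sum.distrib)
  qed
  ultimately show ?thesis unfolding M_def by linarith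
qed

section \<open>Bounds for the Fortet-Mourier distance\<close>

lemma bl_norm_le_1: "bl_norm f \<le> 1 \<Longrightarrow> f \<in> bl_ball"
proof -
  assume b: "bl_norm f \<le> 1"
  have "\<bar>f x\<bar> \<le> 1" for x
  proof -
    have "ennreal \<bar>f x\<bar> \<le> (SUP x. ennreal \<bar>f x\<bar>)" by (rule SUP_upper) simp
    also have "\<dots> \<le> bl_norm f" by (simp add: bl_norm_def)
    also note b
    finally show ?thesis by simp
  qed
  moreover have "\<bar>f x - f y\<bar> \<le> norm (x - y)" for x y
  proof (cases "x = y")
    case False
    have "ennreal (\<bar>f x - f y\<bar> / norm (x - y))
        \<le> (SUP (x, y) \<in> {(x, y). x \<noteq> y}. ennreal (\<bar>f x - f y\<bar> / norm (x - y)))"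
      using False by (intro SUP_upper2[of "(x, y)"]) auto
    also have "\<dots> \<le> bl_norm f" by (simp add: bl_norm_def)
    also note b
    finally have "\<bar>f x - f y\<bar> / norm (x - y) \<le> 1" by simp
    then show ?thesis using False by (simp add: field_simps)
  qed simp
  ultimately show ?thesis by (simp add: bl_ball_def)
qed

lemma fortet_mourier_le:
  fixes P Q :: "(real^'d) measure"
  assumes "\<And>f. f \<in> bl_ball \<Longrightarrow> \<bar>(\<integral>x. f x \<partial>P) - (\<integral>x. f x \<partial>Q)\<bar> \<le> e"
  shows "0 \<le> fortet_mourier P Q" "fortet_mourier P Q \<le> e"
proof -
  have "bl_norm (\<lambda>_ :: real^'d. 0) \<le> 0 + 0"
    unfolding bl_norm_def by (intro add_mono SUP_least) auto
  then have 0: "(\<lambda>_. 0) \<in> {f :: real^'d \<Rightarrow> real. bl_norm f \<le> 1}" by (auto intro: order_trans)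
  show "fortet_mourier P Q \<le> e"
    unfolding fortet_mourier_def using 0 assms bl_norm_le_1 by (intro cSUP_least) auto
  have "bdd_above ((\<lambda>f. \<bar>(\<integral>x. f x \<partial>P) - (\<integral>x. f x \<partial>Q)\<bar>) ` {f. bl_norm f \<le> 1})"
    using assms bl_norm_le_1 by (intro bdd_aboveI2[of _ _ e]) auto
  from cSUP_upper[OF 0 this] show "0 \<le> fortet_mourier P Q" by (simp add: fortet_mourier_def)
qed

section \<open>The law of the walk\<close>

text \<open>Ionescu-Tulcea with the one-step kernels \<open>p (w @ [j]) / p w\<close>: consistency
  makes these probabilities, and telescoping the products gives back \<open>p w\<close> on
  cylinders.\<close>

lemma word_measure_exists:
  fixes p :: "'j::finite list \<Rightarrow> real"
  assumes p0: "\<And>w. 0 \<le> p w" and p1: "p [] = 1" and pS: "\<And>w. (\<Sum>j\<in>UNIV. p (w @ [j])) = p w"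
  shows "\<exists>Q. prob_space Q \<and> sets Q = sets (\<Pi>\<^sub>M n\<in>(UNIV :: nat set). count_space (UNIV :: 'j set)) \<and>
    (\<forall>w. emeasure Q {x. \<forall>i<length w. x i = w ! i} = ennreal (p w))"
proof -
  \<comment> \<open>On a word of mass 0 the kernel is a dummy; by consistency all extensions of such
    a word have mass 0 as well, so the product rule below still holds.\<close>
  define K where "K w = (if p w > 0 then embed_pmf (\<lambda>j. p (w @ [j]) / p w) else return_pmf undefined)" for w
  have K: "p w * pmf (K w) j = p (w @ [j])" for w j
  proof (cases "p w > 0")
    case True
    have "pmf (K w) j = p (w @ [j]) / p w"
      unfolding K_def if_P[OF True]
    proof (rule pmf_embed_pmf)
      have "(\<integral>\<^sup>+j. ennreal (p (w @ [j]) / p w) \<partial>count_space UNIV) = ennreal (\<Sum>j\<in>UNIV. p (w @ [j]) / p w)"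
        using p0 by (simp add: nn_integral_count_space_finite sum_ennreal)
      also have "(\<Sum>j\<in>UNIV. p (w @ [j]) / p w) = 1"
        using pS[of w] True by (simp flip: sum_divide_distrib)
      finally show "(\<integral>\<^sup>+j. ennreal (p (w @ [j]) / p w) \<partial>count_space UNIV) = 1" by simp
    qed (use p0 in simp)
    then show ?thesis using True by simp
  next
    case False
    then have 0: "p w = 0" using p0[of w] by simp
    then have "\<forall>j\<in>UNIV. p (w @ [j]) = 0"
      using sum_nonneg_eq_0_iff[of UNIV "\<lambda>j. p (w @ [j])"] pS[of w] p0 by simp
    then show ?thesis using 0 by simp
  qed
  define M :: "nat \<Rightarrow> 'j measure" where "M = (\<lambda>_. count_space UNIV)"
  have PiM_M: "PiM {0..<i} M = count_space (PiE {0..<i} (\<lambda>_. UNIV))" for i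
    unfolding M_def by (rule count_space_PiM_finite) auto
  interpret IT: Ionescu_Tulcea "\<lambda>i x. measure_pmf (K (map x [0..<i]))" M
  proof
    show "(\<lambda>x. measure_pmf (K (map x [0..<i]))) \<in> PiM {0..<i} M \<rightarrow>\<^sub>M subprob_algebra (M i)" for i
      unfolding PiM_M by (simp add: M_def measure_pmf_in_subprob_algebra)
  qed
  have "emeasure (IT.C 0 n (\<lambda>_. undefined)) {\<lambda>i\<in>{0..<n}. w ! i} = ennreal (p w)" if "length w = n" for n w
    using that
  proof (induction n arbitrary: w)
    case 0
    then show ?case using p1 by (simp add: restrict_def sets_PiM_empty)
  next
    case (Suc n)
    then obtain v j where w: "w = v @ [j]" and v: "length v = n" by (cases w rule: rev_cases) auto
    let ?g = "\<lambda>v. \<lambda>i\<in>{0..<length v}. v ! i"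
    have und: "(\<lambda>_. undefined) \<in> space (PiM {0..<0} M)" by (simp add: PiM_M)
    have spC: "space (IT.C 0 n (\<lambda>_. undefined)) = PiE {0..<n} (\<lambda>_. UNIV)"
      using IT.space_C[OF und, of n] by (simp add: PiM_M)
    have gw: "{?g w} \<in> sets (PiM {0..<Suc n} M)"
      using v by (auto simp: PiM_M w)
    have "emeasure (IT.C 0 (Suc n) (\<lambda>_. undefined)) {?g w}
        = (\<integral>\<^sup>+x. emeasure (IT.eP n x) {?g w} \<partial>IT.C 0 n (\<lambda>_. undefined))"
      using gw by (simp, intro emeasure_bind[where N = "PiM {0..<Suc n} M"])
        (auto simp: spC measurable_cong_sets[OF IT.sets_C[OF und] refl] PiE_eq_empty_iff)
    also have "\<dots> = (\<integral>\<^sup>+x. ennreal (pmf (K v) j) * indicator {?g v} x \<partial>IT.C 0 n (\<lambda>_. undefined))"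
    proof (rule nn_integral_cong)
      fix x assume "x \<in> space (IT.C 0 n (\<lambda>_. undefined))"
      then have x: "x \<in> PiE {0..<n} (\<lambda>_. UNIV)" by (simp add: spC)
      have "emeasure (IT.eP n x) {?g w} = emeasure (measure_pmf (K (map x [0..<n]))) ((\<lambda>a. x(n := a)) -` {?g w} \<inter> space (M n))"
        using x gw by (intro IT.emeasure_eP) (simp_all add: PiM_M)
      also have "(\<lambda>a. x(n := a)) -` {?g w} \<inter> space (M n) = (if x = ?g v then {j} else {})"
      proof -
        have "x(n := a) = ?g w \<longleftrightarrow> x = ?g v \<and> a = j" for a
        proof
          assume e: "x(n := a) = ?g w"
          have "x i = ?g v i" for i
            using fun_cong[OF e, of i] x v by (cases "i < n") (auto simp: w nth_append PiE_def extensional_def)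
          then show "x = ?g v \<and> a = j" using fun_cong[OF e, of n] v by (auto simp: w)
        next
          assume "x = ?g v \<and> a = j"
          then show "x(n := a) = ?g w" using v by (auto simp: w nth_append fun_eq_iff)
        qed
        then show ?thesis by (auto simp: M_def)
      qed
      finally have e: "emeasure (IT.eP n x) {?g w}
        = emeasure (measure_pmf (K (map x [0..<n]))) (if x = ?g v then {j} else {})" .
      show "emeasure (IT.eP n x) {?g w} = ennreal (pmf (K v) j) * indicator {?g v} x"
      proof (cases "x = ?g v")
        case True
        have "map x [0..<n] = v" using v True by (intro nth_equalityI) auto
        then show ?thesis unfolding e if_P[OF True] using True by (simp add: emeasure_pmf_single)
      next
        case False
        then show ?thesis unfolding e if_not_P[OF False] by simp
      qed
    qed
    also have "\<dots> = ennreal (pmf (K v) j) * emeasure (IT.C 0 n (\<lambda>_. undefined)) {?g v}"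
    proof (rule nn_integral_cmult_indicator)
      show "{?g v} \<in> sets (IT.C 0 n (\<lambda>_. undefined))"
        using v by (auto simp: IT.sets_C[OF und] PiM_M)
    qed
    also have "emeasure (IT.C 0 n (\<lambda>_. undefined)) {?g v} = ennreal (p v)" using Suc.IH[OF v] unfolding v .
    also have "ennreal (pmf (K v) j) * ennreal (p v) = ennreal (p w)"
      using K[of v j] p0[of v] by (simp add: w mult.commute flip: ennreal_mult)
    finally show ?case unfolding Suc.prems .
  qed
  moreover have "{x. \<forall>i<length w. x i = w ! i} = IT.PF.emb UNIV {0..<length w} {\<lambda>i\<in>{0..<length w}. w ! i}" for w :: "'j list"
    by (auto simp: prod_emb_def M_def fun_eq_iff restrict_def) metis
  moreover have "emeasure IT.PF.lim (IT.PF.emb UNIV {0..<n} X) = emeasure (IT.C 0 n (\<lambda>_. undefined)) X"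
    if "X \<in> sets (PiM {0..<n} M)" for n X
    using that sets.sets_into_space[OF that]
    by (simp add: IT.lim IT.emeasure_CI[OF order_refl] prod_emb_id space_PiM)
  ultimately have e: "emeasure IT.PF.lim {x. \<forall>i<length w. x i = w ! i} = ennreal (p w)" for w
    by (simp add: PiM_M)
  show ?thesis
  proof (intro exI[of _ IT.PF.lim] conjI allI e)
    show "sets IT.PF.lim = sets (\<Pi>\<^sub>M n\<in>UNIV. count_space UNIV)"
      using IT.PF.sets_lim by (simp only: M_def)
    have sp: "space IT.PF.lim = UNIV" unfolding IT.PF.space_lim by (simp add: space_PiM M_def)
    show "prob_space IT.PF.lim"
      by (rule prob_spaceI, unfold sp) (use e[of "[]"] p1 in simp)
  qed
qed

lemma has_sum_nn_integral:
  assumes "(g has_sum (G :: real)) V" "\<And>k. k \<in> V \<Longrightarrow> 0 \<le> g k"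
  shows "(\<integral>\<^sup>+k. ennreal (g k) \<partial>count_space V) = ennreal G" "(\<integral>k. g k \<partial>count_space V) = G"
proof -
  have "g summable_on V" using assms(1) by (rule has_sum_imp_summable)
  then have "Infinite_Sum.abs_summable_on g V" by (rule summable_on_iff_abs_summable_on_real[THEN iffD1])
  then have a: "Infinite_Set_Sum.abs_summable_on g V" by (rule abs_summable_equivalent[THEN iffD1])
  have s: "infsetsum g V = G" using infsetsum_infsum[OF a] infsumI[OF assms(1)] by simp
  then show "(\<integral>\<^sup>+k. ennreal (g k) \<partial>count_space V) = ennreal G"
    using nn_integral_conv_infsetsum[OF a assms(2)] by simp
  show "(\<integral>k. g k \<partial>count_space V) = G" using s by (simp add: infsetsum_def)
qed

text \<open>The lattice is the union of its finite intersections with balls. Countability is what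
  allows the path space to be generated by cylinders.\<close>

lemma lattice_countable: "generated_lattice V S \<Longrightarrow> countable V"
proof -
  assume "generated_lattice V S"
  then have "finite (V \<inter> ball 0 (real n))" for n
    by (auto simp: generated_lattice_def)
  moreover have "V = (\<Union>n. V \<inter> ball 0 (real n))"
    using reals_Archimedean2 by auto
  ultimately show ?thesis by (metis countable_UN countable_finite countableI_type)
qed

section \<open>Cylinder sets of the path space\<close>

definition cylinder :: "(real^'d) set \<Rightarrow> real^'d \<Rightarrow> 'j list \<Rightarrow> ((real^'d) \<times> (nat \<Rightarrow> 'j)) set" where
  "cylinder V k w = {\<omega> \<in> V \<times> UNIV. fst \<omega> = k \<and> (\<forall>i<length w. snd \<omega> i = w ! i)}"

lemma space_path_space [simp]: "space (path_space V) = V \<times> UNIV"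
  by (simp add: path_space_def space_pair_measure space_PiM)

lemma measurable_path_fst: "fst \<in> path_space V \<rightarrow>\<^sub>M count_space V"
  and measurable_path_snd: "(\<lambda>\<omega>. snd \<omega> n) \<in> path_space V \<rightarrow>\<^sub>M count_space UNIV"
  unfolding path_space_def by measurable

lemma cylinder_sets: "cylinder V k w \<in> sets (path_space V)"
proof -
  have a: "fst -` ({k} \<inter> V) \<inter> space (path_space V) \<in> sets (path_space V)"
    by (rule measurable_sets[OF measurable_path_fst]) simp
  have b: "{\<omega> \<in> space (path_space V). \<forall>i\<in>{..<length w}. snd \<omega> i \<in> {w ! i}} \<in> sets (path_space V)"
  proof (rule sets.sets_Collect_finite_All)
    show "{\<omega> \<in> space (path_space V). snd \<omega> i \<in> {w ! i}} \<in> sets (path_space V)" for i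
      using measurable_sets[OF measurable_path_snd, of "{w ! i}" i V] by (simp add: vimage_def Int_def conj_commute)
  qed simp
  have c: "cylinder V k w = fst -` ({k} \<inter> V) \<inter> space (path_space V)
      \<inter> {\<omega> \<in> space (path_space V). \<forall>i\<in>{..<length w}. snd \<omega> i \<in> {w ! i}}"
    by (auto simp: cylinder_def)
  show ?thesis unfolding c by (rule sets.Int[OF a b])
qed

lemma cylinder_Int:
  assumes "length w \<le> length w'"
  shows "cylinder V k w \<inter> cylinder V k' w' = (if k = k' \<and> take (length w) w' = w then cylinder V k' w' else {})"
proof (cases "k = k' \<and> take (length w) w' = w")
  case True
  then have "w' ! i = w ! i" if "i < length w" for i using that by (metis nth_take)
  then have "cylinder V k' w' \<subseteq> cylinder V k w" using True assms by (auto simp: cylinder_def)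
  then show ?thesis using True by auto
next
  case False
  have "take (length w) w' = w" if "\<omega> \<in> cylinder V k w" "\<omega> \<in> cylinder V k' w'" for \<omega>
    using that assms by (intro nth_equalityI) (auto simp: cylinder_def)
  then show ?thesis using False by (auto simp: cylinder_def)
qed

text \<open>An event on one coordinate is a countable union of cylinders, over all starting sites
  and all finite words before it; so the projections are measurable for the sigma-algebra generated
  by cylinders.\<close>

lemma sets_path_space:
  assumes V: "countable V"
  shows "sets (path_space V :: ((real^'d) \<times> (nat \<Rightarrow> 'j::finite)) measure)
    = sigma_sets (V \<times> UNIV) (insert {} (range (\<lambda>(k, w). cylinder V k w)))" (is "_ = sigma_sets ?O ?E")
proof
  have E: "?E \<subseteq> Pow ?O" by (auto simp: cylinder_def)
  show "sigma_sets ?O ?E \<subseteq> sets (path_space V)"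
    using cylinder_sets sets.top[of "path_space V"] by (intro sets.sigma_sets_subset'[of ?E]) auto
  define S where "S = sigma ?O ?E"
  have spS: "space S = ?O" and seS: "sets S = sigma_sets ?O ?E" using E by (auto simp: S_def)
  have cyl: "cylinder V k w \<in> sets S" for k w unfolding seS by (rule sigma_sets.Basic) auto
  have f: "fst \<in> S \<rightarrow>\<^sub>M count_space V"
    unfolding measurable_count_space_eq_countable[OF V]
  proof (intro conjI ballI)
    fix k assume "k \<in> V"
    have "fst -` {k} \<inter> space S = cylinder V k []" by (auto simp: spS cylinder_def)
    then show "fst -` {k} \<inter> space S \<in> sets S" using cyl by simp
  qed (auto simp: spS)
  have s: "(\<lambda>\<omega>. snd \<omega> n) \<in> S \<rightarrow>\<^sub>M count_space UNIV" for n
    unfolding measurable_count_space_eq_countable[OF countable_finite[OF finite]]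
  proof (intro conjI ballI)
    fix j :: 'j
    have "(\<lambda>\<omega>. snd \<omega> n) -` {j} \<inter> space S = (\<Union>k\<in>V. \<Union>w\<in>words n. cylinder V k (w @ [j]))" (is "?l = ?r")
    proof
      show "?l \<subseteq> ?r"
      proof
        fix \<omega> assume \<omega>: "\<omega> \<in> ?l"
        have "\<omega> \<in> cylinder V (fst \<omega>) (map (snd \<omega>) [0..<n] @ [j])"
          using \<omega> by (auto simp: cylinder_def spS nth_append less_Suc_eq)
        moreover have "fst \<omega> \<in> V" "map (snd \<omega>) [0..<n] \<in> words n" using \<omega> by (auto simp: spS words_def)
        ultimately show "\<omega> \<in> ?r" by blast
      qed
      show "?r \<subseteq> ?l" by (auto simp: cylinder_def spS words_def nth_append)
    qed
    also have "\<dots> \<in> sets S"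
      using V finite_words cyl by (intro sets.countable_UN' sets.finite_UN) auto
    finally show "(\<lambda>\<omega>. snd \<omega> n) -` {j} \<inter> space S \<in> sets S" .
  qed auto
  have "(\<lambda>\<omega>. snd \<omega>) \<in> S \<rightarrow>\<^sub>M (\<Pi>\<^sub>M n\<in>UNIV. count_space UNIV)"
    using measurable_PiM_single'[of UNIV "\<lambda>n \<omega>. snd \<omega> n" S "\<lambda>_. count_space UNIV"] s by auto
  with f have "(\<lambda>\<omega>. \<omega>) \<in> S \<rightarrow>\<^sub>M path_space V" unfolding path_space_def
    by (subst measurable_pair_iff) (auto simp: comp_def)
  then show "sets (path_space V) \<subseteq> sigma_sets ?O ?E"
  proof (intro subsetI)
    fix A assume i: "(\<lambda>\<omega>. \<omega>) \<in> S \<rightarrow>\<^sub>M path_space V" and A: "A \<in> sets (path_space V :: ((real^'d) \<times> (nat \<Rightarrow> 'j)) measure)"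
    have "A \<subseteq> ?O" using sets.sets_into_space[OF A] by simp
    then have "(\<lambda>\<omega>. \<omega>) -` A \<inter> space S = A" by (auto simp: spS)
    then show "A \<in> sigma_sets ?O ?E" using measurable_sets[OF i A] by (simp add: seS)
  qed
qed

lemma path_measure_eqI:
  fixes P Q :: "((real^'d) \<times> (nat \<Rightarrow> 'j::finite)) measure"
  assumes V: "countable V" and P: "prob_space P" "sets P = sets (path_space V)"
    and Q: "sets Q = sets (path_space V)"
    and eq: "\<And>k w. k \<in> V \<Longrightarrow> emeasure P (cylinder V k w) = emeasure Q (cylinder V k w)"
  shows "P = Q"
proof (rule measure_eqI_generator_eq_countable[where \<Omega> = "V \<times> UNIV"
      and E = "insert {} (range (\<lambda>(k, w). cylinder V k w))" and A = "(\<lambda>k. cylinder V k []) ` V"])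
  have "cylinder V k w \<inter> cylinder V k' w' \<in> insert {} (range (\<lambda>(k, w). cylinder V k w))"
    for k k' and w w' :: "'j list"
  proof (cases "length w \<le> length w'")
    case True
    then show ?thesis by (simp add: cylinder_Int) auto
  next
    case False
    then show ?thesis by (subst Int_commute) (simp add: cylinder_Int, auto)
  qed
  then show "Int_stable (insert {} (range (\<lambda>(k, w). cylinder V k w :: ((real^'d) \<times> (nat \<Rightarrow> 'j)) set)))"
    unfolding Int_stable_def by auto
  show "emeasure P X = emeasure Q X" if "X \<in> insert {} (range (\<lambda>(k, w). cylinder V k w))" for X
  proof -
    have "emeasure P (cylinder V k w) = emeasure Q (cylinder V k w)" for k w
    proof (cases "k \<in> V")
      case False
      then have "cylinder V k w = {}" by (auto simp: cylinder_def)
      then show ?thesis by simp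
    qed (rule eq)
    then show ?thesis using that by auto
  qed
  show "sets P = sigma_sets (V \<times> UNIV) (insert {} (range (\<lambda>(k, w). cylinder V k w)))"
    "sets Q = sigma_sets (V \<times> UNIV) (insert {} (range (\<lambda>(k, w). cylinder V k w)))"
    using P Q sets_path_space[OF V] by auto
  show "emeasure P a \<noteq> \<infinity>" for a
    using prob_space.finite_measure[OF P(1)] finite_measure.emeasure_finite by fastforce
  show "countable ((\<lambda>k. cylinder V k []) ` V)" using V by simp
  show "\<Union>((\<lambda>k. cylinder V k []) ` V) = V \<times> UNIV" by (auto simp: cylinder_def)
  have "cylinder V k [] \<in> range (\<lambda>(k, w :: 'j list). cylinder V k w)" for k
    using rangeI[of "\<lambda>(k, w :: 'j list). cylinder V k w" "(k, [])"] by simp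
  then show "(\<lambda>k. cylinder V k []) ` V \<subseteq> insert {} (range (\<lambda>(k, w :: 'j list). cylinder V k w))" by auto
qed (auto simp: cylinder_def)

context kraus_channel
begin

text \<open>Consistency of the word probabilities is trace preservation. The factor
  \<open>Tr \<sigma>\<close> is kept on the left so that \<sigma> = 0 is included, where any path
  law will do.\<close>

lemma block_measure_exists:
  assumes \<sigma>: "psd \<sigma>"
  shows "\<exists>Q. prob_space Q \<and> sets Q = sets (\<Pi>\<^sub>M n\<in>(UNIV :: nat set). count_space (UNIV :: 'j set)) \<and>
    (\<forall>w. ennreal (Re (trace \<sigma>)) * emeasure Q {x. \<forall>i<length w. x i = w ! i} = ennreal (Re (trace (block L \<sigma> w))))"
proof -
  have pos: "\<exists>Q. prob_space Q \<and> sets Q = sets (\<Pi>\<^sub>M n\<in>(UNIV :: nat set). count_space (UNIV :: 'j set)) \<and>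
    (\<forall>w. ennreal (Re (trace \<sigma>)) * emeasure Q {x. \<forall>i<length w. x i = w ! i} = ennreal (Re (trace (block L \<sigma> w))))"
    if \<sigma>: "psd \<sigma>" and r: "Re (trace \<sigma>) > 0" for \<sigma>
  proof -
    have tb: "(\<Sum>j\<in>UNIV. Re (trace (block L \<sigma> (w @ [j])))) = Re (trace (block L \<sigma> w))" for w
      using arg_cong[OF trace_T[of "block L \<sigma> w"], of Re] by (simp add: block_snoc channel_def tr_sum)
    define p where "p w = Re (trace (block L \<sigma> w)) / Re (trace \<sigma>)" for w
    have "\<exists>Q. prob_space Q \<and> sets Q = sets (\<Pi>\<^sub>M n\<in>(UNIV :: nat set). count_space (UNIV :: 'j set)) \<and>
        (\<forall>w. emeasure Q {x. \<forall>i<length w. x i = w ! i} = ennreal (p w))"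
    proof (rule word_measure_exists)
      show "0 \<le> p w" for w using trace_psd(2)[OF psd_block[where L = L, OF \<sigma>]] r by (simp add: p_def)
      show "p [] = 1" using r by (simp add: p_def block_Nil)
      show "(\<Sum>j\<in>UNIV. p (w @ [j])) = p w" for w using tb[of w] by (simp add: p_def flip: sum_divide_distrib)
    qed
    moreover have "ennreal (Re (trace \<sigma>)) * ennreal (p w) = ennreal (Re (trace (block L \<sigma> w)))" for w
      using r trace_psd(2)[OF psd_block[where L = L, OF \<sigma>], of w] by (simp add: p_def flip: ennreal_mult)
    ultimately show ?thesis by auto
  qed
  show ?thesis
  proof (cases "Re (trace \<sigma>) > 0")
    case False
    then have 0: "\<sigma> = 0" using psd_trace_0[OF \<sigma>] trace_psd(2)[OF \<sigma>] by simp
    \<comment> \<open>For \<sigma> = 0 the path law built from the identity serves as a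
      placeholder.\<close>
    have "Re (trace (mat 1 :: complex^'h^'h)) > 0" by (simp add: trace_def mat_def)
    from pos[OF psd_mat_1 this] show ?thesis by (auto simp: 0 block_def linear_0[OF linear_trace])
  qed (rule pos[OF \<sigma>])
qed

text \<open>Draw the starting site with law \<open>q\<close>, then the steps with the law of its
  block; the walk measure is the bind of \<open>q\<close> with this kernel.\<close>

lemma walk_measure_exists:
  assumes init: "diagonal_state V \<rho>"
  shows "\<exists>P. prob_space P \<and> sets P = sets (path_space V) \<and>
    (\<forall>k\<in>V. \<forall>w. emeasure P (cylinder V k w) = ennreal (Re (trace (block L (\<rho> k) w))))"
proof -
  have psd: "psd (\<rho> k)" if "k \<in> V" for k using init that by (simp add: diagonal_state_def)
  have "\<forall>k\<in>V. \<exists>Q. prob_space Q \<and> sets Q = sets (\<Pi>\<^sub>M n\<in>(UNIV :: nat set). count_space (UNIV :: 'j set)) \<and>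
    (\<forall>w. ennreal (Re (trace (\<rho> k))) * emeasure Q {x. \<forall>i<length w. x i = w ! i} = ennreal (Re (trace (block L (\<rho> k) w))))"
    using block_measure_exists psd by blast
  then obtain Q where Q: "\<And>k. k \<in> V \<Longrightarrow> prob_space (Q k)"
    "\<And>k. k \<in> V \<Longrightarrow> sets (Q k) = sets (\<Pi>\<^sub>M n\<in>(UNIV :: nat set). count_space (UNIV :: 'j set))"
    "\<And>k w. k \<in> V \<Longrightarrow> ennreal (Re (trace (\<rho> k))) * emeasure (Q k) {x. \<forall>i<length w. x i = w ! i}
      = ennreal (Re (trace (block L (\<rho> k) w)))"
    by (subst (asm) bchoice_iff) auto
  define q where "q = density (count_space V) (\<lambda>k. ennreal (Re (trace (\<rho> k))))"
  have spq: "space q = V" and seq: "sets q = Pow V" by (auto simp: q_def)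
  have "emeasure q V = (\<integral>\<^sup>+k. ennreal (Re (trace (\<rho> k))) \<partial>count_space V)"
    unfolding q_def by (subst emeasure_density) (auto intro!: nn_integral_cong)
  also have "\<dots> = ennreal 1"
    using init trace_psd(2)[OF psd] by (intro has_sum_nn_integral) (auto simp: diagonal_state_def)
  finally have pq: "prob_space q" by (intro prob_spaceI) (simp add: spq)
  define \<kappa> where "\<kappa> k = distr (Q k) (path_space V) (Pair k)" for k
  have Pm: "Pair k \<in> Q k \<rightarrow>\<^sub>M path_space V" if "k \<in> V" for k
    unfolding path_space_def measurable_cong_sets[OF Q(2)[OF that] refl] using that by (intro measurable_Pair1') simp
  have p\<kappa>: "prob_space (\<kappa> k)" if "k \<in> V" for k
    unfolding \<kappa>_def by (rule prob_space.prob_space_distr[OF Q(1)[OF that] Pm[OF that]])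
  have \<kappa>m: "\<kappa> \<in> q \<rightarrow>\<^sub>M subprob_algebra (path_space V)"
  proof (rule measurableI)
    show "\<kappa> k \<in> space (subprob_algebra (path_space V))" if "k \<in> space q" for k
      using p\<kappa>[of k] that by (auto simp: spq space_subprob_algebra \<kappa>_def prob_space_imp_subprob_space)
  qed (auto simp: seq spq)
  have ne: "space q \<noteq> {}" using prob_space.not_empty[OF pq] .
  show ?thesis
  proof (intro exI[of _ "q \<bind> \<kappa>"] conjI ballI allI)
    show "prob_space (q \<bind> \<kappa>)"
      using p\<kappa> by (intro prob_space.prob_space_bind[OF pq _ \<kappa>m]) (auto simp: spq)
    show "sets (q \<bind> \<kappa>) = sets (path_space V)"
      using ne by (intro sets_bind) (auto simp: \<kappa>_def)
    fix k w assume k: "k \<in> V"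
    have "emeasure (\<kappa> l) (cylinder V k w) = emeasure (Q k) {x. \<forall>i<length w. x i = w ! i} * indicator {k} l"
      if l: "l \<in> V" for l
    proof -
      have "emeasure (\<kappa> l) (cylinder V k w) = emeasure (Q l) (Pair l -` cylinder V k w \<inter> space (Q l))"
        unfolding \<kappa>_def by (rule emeasure_distr[OF Pm[OF l] cylinder_sets])
      also have "Pair l -` cylinder V k w \<inter> space (Q l) = (if l = k then {x. \<forall>i<length w. x i = w ! i} else {})"
        using l sets_eq_imp_space_eq[OF Q(2)[OF l]] by (auto simp: cylinder_def space_PiM)
      finally show ?thesis by simp
    qed
    then have "emeasure (q \<bind> \<kappa>) (cylinder V k w)
        = (\<integral>\<^sup>+l. emeasure (Q k) {x. \<forall>i<length w. x i = w ! i} * indicator {k} l \<partial>q)"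
      unfolding emeasure_bind[OF ne \<kappa>m cylinder_sets] by (intro nn_integral_cong) (simp add: spq)
    also have "\<dots> = emeasure (Q k) {x. \<forall>i<length w. x i = w ! i} * emeasure q {k}"
      using k by (intro nn_integral_cmult_indicator) (simp add: seq)
    also have "emeasure q {k} = ennreal (Re (trace (\<rho> k)))"
      using k unfolding q_def by (subst emeasure_density) (auto simp: nn_integral_cmult_indicator)
    finally show "emeasure (q \<bind> \<kappa>) (cylinder V k w) = ennreal (Re (trace (block L (\<rho> k) w)))"
      using Q(3)[OF k, of w] by (simp add: mult.commute)
  qed
qed

lemma walk_measure_props:
  assumes V: "countable V" and init: "diagonal_state V \<rho>"
  shows "prob_space (walk_measure V L \<rho>)" "sets (walk_measure V L \<rho>) = sets (path_space V)"
    "k \<in> V \<Longrightarrow> emeasure (walk_measure V L \<rho>) (cylinder V k w) = ennreal (Re (trace (block L (\<rho> k) w)))"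
proof -
  have psd: "psd (\<rho> k)" if "k \<in> V" for k using init that by (simp add: diagonal_state_def)
  let ?R = "\<lambda>P. prob_space P \<and> sets P = sets (path_space V) \<and>
     (\<forall>k\<in>V. \<forall>js. measure P (cylinder V k js) = Re (trace (block L (\<rho> k) js)))"
  have wm: "walk_measure V L \<rho> = (THE P. ?R P)"
    by (simp add: walk_measure_def cylinder_def block_def)
  have em: "emeasure P (cylinder V k w) = ennreal (Re (trace (block L (\<rho> k) w)))" if "?R P" "k \<in> V" for P k w
    using that by (simp add: finite_measure.emeasure_eq_measure prob_space.finite_measure)
  obtain P where P: "prob_space P" "sets P = sets (path_space V)"
    "\<And>k w. k \<in> V \<Longrightarrow> emeasure P (cylinder V k w) = ennreal (Re (trace (block L (\<rho> k) w)))"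
    using walk_measure_exists[OF init] by blast
  have RP: "?R P"
    using P trace_psd(2)[OF psd_block[where L = L, OF psd]] by (auto simp: measure_def)
  have "?R (walk_measure V L \<rho>)"
    unfolding wm
  proof (rule theI[of ?R, OF RP])
    fix P' assume R': "?R P'"
    show "P' = P"
      by (rule path_measure_eqI[OF V]) (use R' RP em[OF R'] em[OF RP] in auto)
  qed
  then show "prob_space (walk_measure V L \<rho>)" "sets (walk_measure V L \<rho>) = sets (path_space V)"
    "k \<in> V \<Longrightarrow> emeasure (walk_measure V L \<rho>) (cylinder V k w) = ennreal (Re (trace (block L (\<rho> k) w)))"
    using em by auto
qed


text \<open>The norms of the blocks are dominated by their traces, so the blocks are absolutely
  summable. \<open>R\<close> is the reduced state on the local space.\<close>

lemma diagonal_state_sum: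
  fixes \<rho> :: "real^'d \<Rightarrow> complex^'h^'h"
  assumes init: "diagonal_state V \<rho>"
  obtains R where "psd R" "trace R = 1" "(\<rho> has_sum R) V"
proof -
  have psd: "psd (\<rho> k)" if "k \<in> V" for k using init that by (simp add: diagonal_state_def)
  have tr: "((\<lambda>k. Re (trace (\<rho> k))) has_sum 1) V" using init by (simp add: diagonal_state_def)
  obtain K where K: "\<And>\<omega> :: complex^'h^'h. psd \<omega> \<Longrightarrow> norm \<omega> \<le> K * Re (trace \<omega>)"
    using norm_psd_le by blast
  have "(\<lambda>k. norm (\<rho> k)) summable_on V"
  proof (rule Infinite_Sum.abs_summable_on_comparison_test')
    show "(\<lambda>k. K * Re (trace (\<rho> k))) summable_on V"
      using has_sum_cmult_right[OF tr] has_sum_imp_summable by blast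
  qed (use K psd in auto)
  then have "\<rho> summable_on V" by (rule Infinite_Sum.abs_summable_summable)
  then obtain R where R: "(\<rho> has_sum R) V" by (auto simp: summable_on_def)
  have "psd R"
  proof -
    have "R \<in> {M. psd M}"
    proof (rule Lim_in_closed_set[OF closed_psd])
      show "(sum \<rho> \<longlongrightarrow> R) (finite_subsets_at_top V)" using R by (simp add: has_sum_def)
      show "\<forall>\<^sub>F F in finite_subsets_at_top V. sum \<rho> F \<in> {M. psd M}"
        by (rule eventually_finite_subsets_at_top_weakI) (use psd in \<open>auto intro!: psd_sum\<close>)
    qed simp
    then show ?thesis by simp
  qed
  moreover have "trace R = 1"
  proof -
    have bl: "bounded_linear (\<lambda>M :: complex^'h^'h. Re (trace M))"
      by (intro linear_conv_bounded_linear[THEN iffD1] linear_compose[OF linear_trace, unfolded comp_def]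
          bounded_linear.linear[OF bounded_linear_Re])
    have "Re (trace R) = 1" using has_sum_unique[OF has_sum_bounded_linear[OF bl R] tr] .
    then show ?thesis using trace_psd(3)[OF \<open>psd R\<close>] by simp
  qed
  ultimately show ?thesis using that R by blast
qed

lemma has_sum_trace:
  fixes A B :: "complex^'h^'h"
  assumes R: "(\<rho> has_sum (R :: complex^'h^'h)) V"
  shows "((\<lambda>k. Re (trace (A ** \<rho> k ** B))) has_sum Re (trace (A ** R ** B))) V"
proof -
  have "linear (\<lambda>M :: complex^'h^'h. Re (trace (A ** M ** B)))"
    by (simp add: linear_iff mm.add_left mm.add_right mm.scaleR_left mm.scaleR_right tr_add tr_scaleR)
  then have "bounded_linear (\<lambda>M :: complex^'h^'h. Re (trace (A ** M ** B)))"
    by (rule linear_conv_bounded_linear[THEN iffD1])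
  from has_sum_bounded_linear[OF this R] show ?thesis .
qed

text \<open>The increment is a function of the first \<open>n\<close> steps alone, and summing the
  probability of a word over all starting sites replaces the blocks of the initial state by their
  sum \<open>R\<close>.\<close>

lemma rescaled_law_integral:
  fixes s :: "'j \<Rightarrow> real^'d"
  assumes V: "countable V" and init: "diagonal_state V \<rho>" and R: "(\<rho> has_sum R) V"
    and f: "f \<in> borel_measurable borel"
  shows "(\<integral>x. f x \<partial>rescaled_law V s L \<rho> n)
    = (\<Sum>w\<in>words n. Re (trace (block L R w)) * (f ((1 / sqrt (real n)) *\<^sub>R sum_list (map s w)) :: real))"
proof -
  define P where "P = walk_measure V L \<rho>"
  note wp = walk_measure_props[OF V init, folded P_def]
  interpret prob_space P by (rule wp)
  have sp: "space P = V \<times> UNIV" using sets_eq_imp_space_eq[OF wp(2)] by simp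
  have psd: "psd (\<rho> k)" if "k \<in> V" for k using init that by (simp add: diagonal_state_def)
  define pre where "pre \<omega> = map (snd \<omega>) [0..<n]" for \<omega> :: "(real^'d) \<times> (nat \<Rightarrow> 'j)"
  define F where "F w = {\<omega> \<in> space P. pre \<omega> = w}" for w
  have pre: "pre \<omega> \<in> words n" for \<omega> by (simp add: pre_def words_def)
  have F: "F w = (\<Union>k\<in>V. cylinder V k w)" if "w \<in> words n" for w
    using that by (auto simp: F_def pre_def sp cylinder_def words_def list_eq_iff_nth_eq)
  have Fs: "F w \<in> sets P" if "w \<in> words n" for w
    unfolding F[OF that] wp(2) using V cylinder_sets by (intro sets.countable_UN') auto
  have Fm: "measure P (F w) = Re (trace (block L R w))" if "w \<in> words n" for w
  proof -
    have hs: "((\<lambda>k. Re (trace (block L (\<rho> k) w))) has_sum Re (trace (block L R w))) V"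
      unfolding block_def by (rule has_sum_trace[OF R])
    have nn: "0 \<le> Re (trace (block L (\<rho> k) w))" if "k \<in> V" for k
      using trace_psd(2)[OF psd_block[OF psd[OF that], where L = L]] .
    have "emeasure P (F w) = (\<integral>\<^sup>+k. emeasure P (cylinder V k w) \<partial>count_space V)"
      unfolding F[OF that] using V cylinder_sets wp(2)
      by (intro emeasure_UN_countable) (auto simp: disjoint_family_on_def cylinder_def)
    also have "\<dots> = (\<integral>\<^sup>+k. ennreal (Re (trace (block L (\<rho> k) w))) \<partial>count_space V)"
      using wp(3) by (intro nn_integral_cong) simp
    also have "\<dots> = ennreal (Re (trace (block L R w)))" by (rule has_sum_nn_integral[OF hs nn])
    finally show ?thesis using has_sum_nonneg[OF hs nn] by (simp add: measure_def)
  qed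
  define g where "g w = (1 / sqrt (real n)) *\<^sub>R sum_list (map s w)" for w
  have pos: "(1 / sqrt (real n)) *\<^sub>R (position s n \<omega> - position s 0 \<omega>) = g (pre \<omega>)" for \<omega>
  proof -
    have "position s m \<omega> - position s 0 \<omega> = sum_list (map s (map (snd \<omega>) [0..<m]))" for m
      by (induction m) (simp_all add: algebra_simps)
    then show ?thesis by (simp add: g_def pre_def)
  qed
  have ind: "h (pre \<omega>) = (\<Sum>w\<in>words n. indicator (F w) \<omega> *\<^sub>R h w)"
    if "\<omega> \<in> space P" for \<omega> and h :: "'j list \<Rightarrow> 'z::real_vector"
  proof -
    have "(\<Sum>w\<in>words n. indicator (F w) \<omega> *\<^sub>R h w) = (\<Sum>w\<in>words n. if w = pre \<omega> then h w else 0)"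
      using that by (intro sum.cong) (auto simp: F_def indicator_def)
    then show ?thesis using pre[of \<omega>] by (simp add: finite_words)
  qed
  have indg: "g (pre \<omega>) = (\<Sum>w\<in>words n. indicator (F w) \<omega> *\<^sub>R g w)"
    and indf: "f (g (pre \<omega>)) = (\<Sum>w\<in>words n. indicator (F w) \<omega> *\<^sub>R f (g w))" if "\<omega> \<in> space P" for \<omega>
    by (rule ind[OF that])+
  have gm: "(\<lambda>\<omega>. g (pre \<omega>)) \<in> borel_measurable P"
  proof -
    have "(\<lambda>\<omega>. \<Sum>w\<in>words n. indicator (F w) \<omega> *\<^sub>R g w) \<in> borel_measurable P"
      using Fs by (intro borel_measurable_sum borel_measurable_scaleR borel_measurable_indicator) auto
    then show ?thesis by (subst measurable_cong[OF indg])
  qed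
  have "(\<integral>x. f x \<partial>rescaled_law V s L \<rho> n) = (\<integral>\<omega>. f (g (pre \<omega>)) \<partial>P)"
    unfolding rescaled_law_def P_def[symmetric] pos by (rule integral_distr[OF gm f])
  also have "\<dots> = (\<integral>\<omega>. (\<Sum>w\<in>words n. indicator (F w) \<omega> *\<^sub>R f (g w)) \<partial>P)"
    by (intro Bochner_Integration.integral_cong refl indf)
  also have "\<dots> = (\<Sum>w\<in>words n. \<integral>\<omega>. indicator (F w) \<omega> *\<^sub>R f (g w) \<partial>P)"
  proof (rule Bochner_Integration.integral_sum)
    fix w :: "'j list" assume w: "w \<in> words n"
    have "integrable P (indicat_real (F w))" using Fs[OF w] by (intro integrable_real_indicator) (auto simp: emeasure_eq_measure)
    then show "integrable P (\<lambda>\<omega>. indicator (F w) \<omega> *\<^sub>R f (g w))" by simp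
  qed
  also have "\<dots> = (\<Sum>w\<in>words n. Re (trace (block L R w)) * f (g w))"
    using Fm Fs sets.sets_into_space by (intro sum.cong) (auto simp: Int_absorb2)
  finally show ?thesis by (simp add: g_def)
qed

text \<open>The normalisation of the initial local state cancels against the law of the starting
  site. Positivity makes the integral over sites agree with the unordered sum.\<close>

lemma absorption_weight_sum:
  assumes V: "countable V" and init: "diagonal_state V \<rho>" and R: "(\<rho> has_sum R) V" and X: "psd (absorption L X)"
  shows "absorption_weight V L \<rho> X = (\<Sum>\<^sub>\<infinity>k\<in>V. Re (trace (absorption L X ** \<rho> k)))"
    and "absorption_weight V L \<rho> X = Re (trace (R ** absorption L X))"
proof -
  define P where "P = walk_measure V L \<rho>"
  note wp = walk_measure_props[OF V init, folded P_def]
  have sp: "space P = V \<times> UNIV" using sets_eq_imp_space_eq[OF wp(2)] by simp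
  have psd: "psd (\<rho> k)" if "k \<in> V" for k using init that by (simp add: diagonal_state_def)
  define r where "r k = Re (trace (\<rho> k))" for k
  define h where "h k = Re (trace (absorption L X ** ((1 / r k) *\<^sub>R \<rho> k)))" for k
  have fm: "fst \<in> P \<rightarrow>\<^sub>M count_space V"
    unfolding measurable_cong_sets[OF wp(2) refl] by (rule measurable_path_fst)
  have law: "distr P (count_space V) fst = density (count_space V) (\<lambda>k. ennreal (r k))"
  proof (rule measure_eqI_countable[of _ V])
    fix k assume k: "k \<in> V"
    have "emeasure (distr P (count_space V) fst) {k} = emeasure P (fst -` {k} \<inter> space P)"
      using k by (intro emeasure_distr[OF fm]) simp
    also have "fst -` {k} \<inter> space P = cylinder V k []" by (auto simp: sp cylinder_def)
    also have "emeasure P (cylinder V k []) = ennreal (r k)" using wp(3)[OF k, of "[]"] by (simp add: block_Nil r_def)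
    also have "\<dots> = emeasure (density (count_space V) (\<lambda>k. ennreal (r k))) {k}"
      using k by (subst emeasure_density) (auto simp: nn_integral_cmult_indicator)
    finally show "emeasure (distr P (count_space V) fst) {k} = emeasure (density (count_space V) (\<lambda>k. ennreal (r k))) {k}" .
  qed (use V in auto)
  have hs: "((\<lambda>k. Re (trace (absorption L X ** \<rho> k))) has_sum Re (trace (absorption L X ** R))) V"
    using has_sum_trace[OF R, of "absorption L X" "mat 1"] by simp
  have "absorption_weight V L \<rho> X = (\<integral>\<omega>. h (fst \<omega>) \<partial>P)"
    by (simp add: absorption_weight_def initial_local_state_def h_def r_def P_def)
  also have "\<dots> = (\<integral>k. h k \<partial>distr P (count_space V) fst)" by (rule integral_distr[OF fm, symmetric]) simp
  also have "\<dots> = (\<integral>k. r k *\<^sub>R h k \<partial>count_space V)"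
    unfolding law using trace_psd(2)[OF psd] by (intro integral_density) (auto simp: r_def AE_count_space)
  also have "\<dots> = (\<integral>k. Re (trace (absorption L X ** \<rho> k)) \<partial>count_space V)"
  proof (intro Bochner_Integration.integral_cong refl)
    fix k assume "k \<in> space (count_space V)"
    then have k: "psd (\<rho> k)" using psd by simp
    show "r k *\<^sub>R h k = Re (trace (absorption L X ** \<rho> k))"
    \<comment> \<open>Where the trace vanishes the block itself is 0, so the value
      \<open>1 / 0 = 0\<close> in \<open>initial_local_state\<close> does no harm.\<close>
    proof (cases "r k = 0")
      case True
      then have "\<rho> k = 0" using psd_trace_0[OF k] by (simp add: r_def)
      then show ?thesis by (simp add: h_def mm.zero_right linear_0[OF linear_trace])
    next
      case False
      then show ?thesis by (simp add: h_def mm.scaleR_right tr_scaleR)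
    qed
  qed
  also have "\<dots> = Re (trace (absorption L X ** R))"
    by (rule has_sum_nn_integral(2)[OF hs trace_psd_mult(2)[OF X psd]])
  finally have e: "absorption_weight V L \<rho> X = Re (trace (absorption L X ** R))" .
  then show "absorption_weight V L \<rho> X = (\<Sum>\<^sub>\<infinity>k\<in>V. Re (trace (absorption L X ** \<rho> k)))"
    using infsumI[OF hs] by simp
  show "absorption_weight V L \<rho> X = Re (trace (R ** absorption L X))"
    unfolding e by (subst trace_mul_sym) rule
qed

end

section \<open>The central limit theorem\<close>

context kraus_channel
begin

text \<open>The centred, rescaled sums are weighted by the traces against the absorption operator;
  their total mass does not depend on \<open>n\<close>, because that operator is fixed by the dual.
  The centring is then undone by translating the test function.\<close>

lemma component_law_limit:
  fixes s :: "'j \<Rightarrow> real^'d"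
  assumes X: "X \<in> components" and R: "psd R" and \<epsilon>: "\<epsilon> > 0"
  shows "\<forall>\<^sub>F n in sequentially. \<forall>f\<in>bl_ball.
    \<bar>(\<Sum>w\<in>words n. Re (trace (block L R w ** absorption L X)) * f ((1 / sqrt (real n)) *\<^sub>R sum_list (map s w)))
      - Re (trace (R ** absorption L X)) * (\<integral>x. f x \<partial>gaussian (sqrt (real n) *\<^sub>R chi_mean s L X) (chi_cov s L X))\<bar> \<le> \<epsilon>"
proof -
  define A where "A = absorption L X"
  define m where "m = chi_mean s L X"
  define D where "D = chi_cov s L X"
  define a where "a = Re (trace (R ** A))"
  define q where "q w = Re (trace (block L R w ** A))" for w
  define g where "g n w = (1 / sqrt (real n)) *\<^sub>R (sum_list (map s w) - real n *\<^sub>R m)" for n w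
  have A: "psd A" and TA: "T' A = A"
    unfolding A_def by (intro psd_absorption absorption_fixed component_invsub X)+
  have q0: "0 \<le> q w" and tq: "trace (block L R w ** A) = of_real (q w)" for w
    using trace_psd_mult[OF psd_block[OF R, where L = L] A, of w] by (simp_all add: q_def complex_eq_iff)
  have a0: "0 \<le> a" and ta: "trace (R ** A) = of_real a"
    using trace_psd_mult[OF R A] by (simp_all add: a_def complex_eq_iff)
  have qsum: "(\<Sum>w\<in>words n. q w) = a" for n
  proof -
    have "(T' ^^ n) A = A" by (induction n) (simp_all add: TA)
    then have "trace ((\<Sum>w\<in>words n. block L R w) ** A) = trace (R ** A)"
      by (simp add: sum_block trace_T_pow_mult)
    then show ?thesis by (simp add: q_def a_def mm.sum_left tr_sum flip: Re_sum)
  qed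
  define P where "P n = distr (point_measure (words n) (\<lambda>w. ennreal (q w))) borel (g n)" for n
  define Q where "Q = density (gaussian 0 D) (\<lambda>_. ennreal a)"
  have intP: "(\<integral>x. F x \<partial>P n) = (\<Sum>w\<in>words n. q w *\<^sub>R F (g n w))" if "F \<in> borel_measurable borel"
    for n and F :: "real^'d \<Rightarrow> 'z::{banach, second_countable_topology}"
    unfolding P_def using that q0
    by (subst integral_distr) (auto simp: lebesgue_integral_point_measure_finite[OF finite_words])
  have intQ: "(\<integral>x. F x \<partial>Q) = a *\<^sub>R (\<integral>x. F x \<partial>gaussian 0 D)" if "F \<in> borel_measurable borel"
    for F :: "real^'d \<Rightarrow> 'z::{banach, second_countable_topology}"
    unfolding Q_def using that a0 by (subst integral_density) auto
  have eP: "emeasure (P n) UNIV = ennreal a" for n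
  proof -
    have "emeasure (P n) UNIV = emeasure (point_measure (words n) (\<lambda>w. ennreal (q w))) (words n)"
      unfolding P_def by (subst emeasure_distr) (auto simp: space_point_measure)
    then show ?thesis using q0 qsum by (simp add: emeasure_point_measure_finite[OF finite_words] sum_ennreal)
  qed
  have sP: "sets (P n) = sets borel" for n by (simp add: P_def)
  have fP: "finite_measure (P n)" for n by (rule finite_measureI) (simp add: eP P_def[symmetric] sets_eq_imp_space_eq[OF sP])
  have mP: "measure (P n) UNIV = a" for n using eP a0 by (simp add: measure_def)
  have sQ: "sets Q = sets borel" by (simp add: Q_def)
  have eQ: "emeasure Q UNIV = ennreal a"
    using prob_space.emeasure_space_1[OF prob_space_gaussian[of 0 D]]
    by (simp add: Q_def emeasure_density_const)
  have fQ: "finite_measure Q" by (rule finite_measureI) (simp add: eQ sets_eq_imp_space_eq[OF sQ])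
  have mQ: "measure Q UNIV = a" using eQ a0 by (simp add: measure_def)
  have iexp_m: "(\<lambda>x. iexp (u \<bullet> x)) \<in> borel_measurable borel" for u :: "real^'d" by measurable
  have char: "(\<lambda>n. CLINT x|P n. iexp (u \<bullet> x)) \<longlonglongrightarrow> (CLINT x|Q. iexp (u \<bullet> x))" for u
  proof -
    have lin: "sum_list (map (\<lambda>i. u \<bullet> (s i - m)) w) = u \<bullet> (sum_list (map s w) - real (length w) *\<^sub>R m)" for w
      by (induction w) (simp_all add: inner_diff_right inner_add_right algebra_simps)
    have "(CLINT x|P n. iexp (u \<bullet> x)) = phase_sum L R (\<lambda>i. u \<bullet> (s i - m)) (1 / sqrt (real n)) n A" for n
      unfolding intP[OF iexp_m] phase_sum_def
    proof (intro sum.cong refl)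
      fix w :: "'j list" assume "w \<in> words n"
      then have "u \<bullet> g n w = (1 / sqrt (real n)) * sum_list (map (\<lambda>i. u \<bullet> (s i - m)) w)"
        by (simp add: lin g_def words_def)
      then show "q w *\<^sub>R iexp (u \<bullet> g n w)
          = iexp ((1 / sqrt (real n)) * sum_list (map (\<lambda>i. u \<bullet> (s i - m)) w)) * trace (block L R w ** A)"
        by (simp only: tq scaleR_conv_of_real mult.commute)
    qed
    moreover have "(CLINT x|Q. iexp (u \<bullet> x)) = of_real (exp (- (u \<bullet> (D *v u)) / 2)) * trace (R ** A)"
      unfolding intQ[OF iexp_m] gaussian_char[OF chi_cov_form(1)[OF X, where s = s] chi_cov_nonneg[OF X], folded D_def]
      by (simp add: ta scaleR_conv_of_real)
    ultimately show ?thesis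
      using component_phase_limit[OF X R, where s = s and u = u] by (simp add: m_def A_def D_def)
  qed
  show ?thesis
  proof (rule eventually_mono[OF char_convergence_uniform[OF fP sP mP fQ sQ mQ char \<epsilon>]], intro ballI)
    fix n and f :: "real^'d \<Rightarrow> real"
    assume unif: "\<forall>f\<in>bl_ball. \<bar>(\<integral>x. f x \<partial>P n) - (\<integral>x. f x \<partial>Q)\<bar> \<le> \<epsilon>" and f: "f \<in> bl_ball"
    \<comment> \<open>The translated test function depends on \<open>n\<close>; convergence uniform
      over \<open>bl_ball\<close> is what makes this admissible.\<close>
    define f' where "f' x = f (sqrt (real n) *\<^sub>R m + x)" for x
    have "\<bar>f (c + x) - f (c + y)\<bar> \<le> norm ((c + x) - (c + y))" "\<bar>f (c + x)\<bar> \<le> 1" for c x y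
      using f unfolding bl_ball_def by blast+
    then have f': "f' \<in> bl_ball" by (simp add: bl_ball_def f'_def)
    have "sqrt (real n) *\<^sub>R m + g n w = (1 / sqrt (real n)) *\<^sub>R sum_list (map s w)" for w
      by (simp add: g_def scaleR_diff_right real_div_sqrt)
    then have "(\<integral>x. f' x \<partial>P n) = (\<Sum>w\<in>words n. q w * f ((1 / sqrt (real n)) *\<^sub>R sum_list (map s w)))"
      unfolding intP[OF bl_ball_measurable[OF f']] by (simp add: f'_def)
    moreover have "(\<integral>x. f' x \<partial>Q) = a * (\<integral>x. f x \<partial>gaussian (sqrt (real n) *\<^sub>R m) D)"
      unfolding intQ[OF bl_ball_measurable[OF f']] integral_gaussian_shift[OF bl_ball_measurable[OF f], of "sqrt (real n) *\<^sub>R m"]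
      by (simp add: f'_def[abs_def])
    ultimately show "\<bar>(\<Sum>w\<in>words n. Re (trace (block L R w ** absorption L X)) * f ((1 / sqrt (real n)) *\<^sub>R sum_list (map s w)))
      - Re (trace (R ** absorption L X)) * (\<integral>x. f x \<partial>gaussian (sqrt (real n) *\<^sub>R chi_mean s L X) (chi_cov s L X))\<bar> \<le> \<epsilon>"
      using bspec[OF unif f'] by (simp add: q_def a_def A_def m_def D_def)
  qed
qed

end

theorem theorem1p1:
  fixes V :: "(real^'d) set"
    and s :: "'j::finite \<Rightarrow> real^'d"
    and L :: "'j \<Rightarrow> complex^'h^'h"
    and \<rho> :: "real^'d \<Rightarrow> complex^'h^'h"
  assumes lattice: "generated_lattice V (range s)"
    and nontrivial: "range s \<noteq> {0}"
    and kraus: "(\<Sum>i\<in>UNIV. adj (L i) ** L i) = mat 1"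
    and init: "diagonal_state V \<rho>"
  shows "(\<forall>\<chi>\<^sub>\<alpha>\<in>canonical_decomposition L. absorption_weight V L \<rho> \<chi>\<^sub>\<alpha>
            = (\<Sum>\<^sub>\<infinity>k\<in>V. Re (trace (absorption L \<chi>\<^sub>\<alpha> ** \<rho> k)))) \<and>
    (\<lambda>n. fortet_mourier (rescaled_law V s L \<rho> n)
           (mixture (canonical_decomposition L) (absorption_weight V L \<rho>)
              (\<lambda>\<chi>\<^sub>\<alpha>. gaussian (sqrt (real n) *\<^sub>R chi_mean s L \<chi>\<^sub>\<alpha>) (chi_cov s L \<chi>\<^sub>\<alpha>))))
      \<longlonglongrightarrow> 0"
proof -
  interpret kraus_channel L by unfold_locales (rule kraus)
  note V = lattice_countable[OF lattice]
  obtain R where R: "psd R" "trace R = 1" "(\<rho> has_sum R) V" using diagonal_state_sum[OF init] .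
  note weight = absorption_weight_sum[OF V init R(3) psd_absorption[OF component_invsub]]
  define N where "N n X = gaussian (sqrt (real n) *\<^sub>R chi_mean s L X) (chi_cov s L X)" for n X
  have "(\<lambda>n. fortet_mourier (rescaled_law V s L \<rho> n) (mixture components (absorption_weight V L \<rho>) (N n))) \<longlonglongrightarrow> 0"
  proof (rule tendstoI)
    fix \<epsilon> :: real assume \<epsilon>: "\<epsilon> > 0"
    \<comment> \<open>Dividing by one more than the number of components keeps the total error
      strictly below \<epsilon>.\<close>
    define e where "e = \<epsilon> / (real (card components) + 1)"
    have e: "e > 0" using \<epsilon> by (simp add: e_def)
    have "\<forall>\<^sub>F n in sequentially. \<forall>X\<in>components. \<forall>f\<in>bl_ball.
      \<bar>(\<Sum>w\<in>words n. Re (trace (block L R w ** absorption L X)) * f ((1 / sqrt (real n)) *\<^sub>R sum_list (map s w)))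
        - Re (trace (R ** absorption L X)) * (\<integral>x. f x \<partial>N n X)\<bar> \<le> e"
      unfolding N_def by (intro eventually_ball_finite finite_components ballI component_law_limit R e)
    then show "\<forall>\<^sub>F n in sequentially.
      dist (fortet_mourier (rescaled_law V s L \<rho> n) (mixture components (absorption_weight V L \<rho>) (N n))) 0 < \<epsilon>"
    proof (rule eventually_mono)
      fix n
      assume b: "\<forall>X\<in>components. \<forall>f\<in>bl_ball.
        \<bar>(\<Sum>w\<in>words n. Re (trace (block L R w ** absorption L X)) * f ((1 / sqrt (real n)) *\<^sub>R sum_list (map s w)))
          - Re (trace (R ** absorption L X)) * (\<integral>x. f x \<partial>N n X)\<bar> \<le> e"
      have "\<bar>(\<integral>x. f x \<partial>rescaled_law V s L \<rho> n) - (\<integral>x. f x \<partial>mixture components (absorption_weight V L \<rho>) (N n))\<bar>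
          \<le> real (card components) * e" if f: "f \<in> bl_ball" for f
      proof -
        define F where "F w = f ((1 / sqrt (real n)) *\<^sub>R sum_list (map s w))" for w
        have "Re (trace (block L R w)) = (\<Sum>X\<in>components. Re (trace (block L R w ** absorption L X)))" for w
        proof -
          have "trace (block L R w) = trace (block L R w ** (\<Sum>X\<in>components. absorption L X))"
            by (simp add: sum_absorption)
          then show ?thesis by (simp add: mm.sum_right tr_sum)
        qed
        then have "(\<integral>x. f x \<partial>rescaled_law V s L \<rho> n)
            = (\<Sum>w\<in>words n. \<Sum>X\<in>components. Re (trace (block L R w ** absorption L X)) * F w)"
          unfolding rescaled_law_integral[OF V init R(3) bl_ball_measurable[OF f]] by (simp add: sum_distrib_right F_def)
        also have "\<dots> = (\<Sum>X\<in>components. \<Sum>w\<in>words n. Re (trace (block L R w ** absorption L X)) * F w)"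
          by (rule sum.swap)
        finally have 1: "(\<integral>x. f x \<partial>rescaled_law V s L \<rho> n)
          = (\<Sum>X\<in>components. \<Sum>w\<in>words n. Re (trace (block L R w ** absorption L X)) * F w)" .
        have "(\<integral>x. f x \<partial>mixture components (absorption_weight V L \<rho>) (N n))
            = (\<Sum>X\<in>components. absorption_weight V L \<rho> X * (\<integral>x. f x \<partial>N n X))"
        proof (rule integral_mixture[OF _ _ finite_components _ bl_ball_measurable[OF f]])
          show "0 \<le> absorption_weight V L \<rho> X" if "X \<in> components" for X
            unfolding weight(2)[OF that] by (rule trace_psd_mult(2)[OF R(1) psd_absorption[OF component_invsub[OF that]]])
        qed (use f in \<open>auto simp: N_def prob_space_gaussian bl_ball_def\<close>)
        also have "\<dots> = (\<Sum>X\<in>components. Re (trace (R ** absorption L X)) * (\<integral>x. f x \<partial>N n X))"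
          by (intro sum.cong refl) (simp add: weight(2))
        finally have "(\<integral>x. f x \<partial>rescaled_law V s L \<rho> n) - (\<integral>x. f x \<partial>mixture components (absorption_weight V L \<rho>) (N n))
          = (\<Sum>X\<in>components. (\<Sum>w\<in>words n. Re (trace (block L R w ** absorption L X)) * F w)
              - Re (trace (R ** absorption L X)) * (\<integral>x. f x \<partial>N n X))"
          unfolding 1 by (simp add: sum_subtractf)
        also have "\<bar>\<dots>\<bar> \<le> (\<Sum>X\<in>components. e)"
          using b f unfolding F_def by (intro order_trans[OF sum_abs] sum_mono) blast
        finally show ?thesis by simp
      qed
      from fortet_mourier_le[OF this] have "\<bar>fortet_mourier (rescaled_law V s L \<rho> n)
          (mixture components (absorption_weight V L \<rho>) (N n))\<bar> \<le> real (card components) * e" by simp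
      also have "\<dots> < \<epsilon>" using \<epsilon> by (simp add: e_def field_simps)
      finally show "dist (fortet_mourier (rescaled_law V s L \<rho> n) (mixture components (absorption_weight V L \<rho>) (N n))) 0 < \<epsilon>"
        by simp
    qed
  qed
  then show ?thesis using weight(1) by (simp add: canonical_decomposition_eq N_def[abs_def])
qed

end
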